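(* Let $\mathfrak g$ be a finite-dimensional simple Lie algebra over $\mathbb C$ and let $\mathbb F$ be an algebraically closed field (if $\mathfrak g$ is of type $G_2$, assume that the characteristic of $\mathbb F$ is either $0$ or at least $5$). Let $\ell\in\mathbb Z_{\ge0}$ and $\lambda\in P^+$. Then $D_{\mathbb F}(\ell,\lambda)$ is isomorphic to the quotient of $U_{\mathbb F}(\mathfrak g[t])$ by the left ideal $I^-_{\mathbb F}(\ell,\lambda)$ generated by $h-w_0\lambda(h)$ ($h\in U_{\mathbb F}(\mathfrak h)$), $U_{\mathbb F}(\mathfrak h[t]_+)^0$, $U_{\mathbb F}(\mathfrak n^-[t])^0$, and $$(x^+_{\alpha,s})^{(k)}\quad\text{for all}\quad\alpha\in R^+,\ s\ge0,\ k>\max\{0,-w_0\lambda(h_\alpha)-s\ell r^\vee_\alpha\}.$$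
   Context: $\mathfrak h\subset\mathfrak g$ is a Cartan subalgebra, $\{\alpha_i:i\in I\}$ simple roots, $R^+$ positive roots, $\{x_\alpha^\pm,h_i:\alpha\in R^+,i\in I\}$ a Chevalley basis with $x_\alpha^\pm\in\mathfrak g_{\pm\alpha}$, $h_\alpha=[x_\alpha^+,x_\alpha^-]$, $\mathfrak n^\pm=\bigoplus_{\alpha\in R^+}\mathfrak g_{\pm\alpha}$, $P^+$ the dominant integral weights, $w_0$ the longest element of the Weyl group. $r^\vee_\alpha=1$ if $\alpha$ is long and $r^\vee_\alpha=r^\vee$ (the lacing number) if $\alpha$ is short (all roots are long if $\mathfrak g$ is simply laced). $\mathfrak a[t]=\mathfrak a\otimes\mathbb C[t]$, $\mathfrak a[t]_+=\mathfrak a\otimes t\mathbb C[t]$ for $\mathfrak a\subseteq\mathfrak g$; $x^\pm_{\alpha,r}=x_\alpha^\pm\otimes t^r$; $x^{(k)}=x^k/k!$. $U_{\mathbb Z}(\tilde{\mathfrak g})$ is the $\mathbb Z$-subalgebra of $U(\mathfrak g\otimes\mathbb C[t,t^{-1}])$ generated by all $(x_{\alpha,r}^\pm)^{(k)}$, $\alpha\in R^+,r\in\mathbb Z,k\ge0$; for a Lie subalgebra $\mathfrak a$ of $\mathfrak g\otimes\mathbb C[t,t^{-1}]$, $U_{\mathbb Z}(\mathfrak a)=U(\mathfrak a)\cap U_{\mathbb Z}(\tilde{\mathfrak g})$, $U_{\mathbb F}(\mathfrak a)=\mathbb F\otimes_{\mathbb Z}U_{\mathbb Z}(\mathfrak a)$,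 and $U_{\mathbb F}(\mathfrak a)^0$ is the augmentation ideal. A weight $\mu$ is viewed as the algebra homomorphism $U_{\mathbb F}(\mathfrak h)\to\mathbb F$, $\binom{h_i}{k}\mapsto\binom{\mu(h_i)}{k}$. $D_{\mathbb F}(\ell,\lambda)$ is the quotient of $U_{\mathbb F}(\mathfrak g[t])$ by the left ideal generated by $U_{\mathbb F}(\mathfrak n^+[t])^0$, $U_{\mathbb F}(\mathfrak h[t]_+)^0$, $h-\lambda(h)$ ($h\in U_{\mathbb F}(\mathfrak h)$), and $(x^-_{\alpha,s})^{(k)}$ for all $\alpha\in R^+$, $s,k\in\mathbb Z_{\ge0}$, $k>\max\{0,\lambda(h_\alpha)-s\ell r_\alpha^\vee\}$. *)

theory Defs
  imports
    Complex_Main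
    "HOL-Library.Poly_Mapping"
    "HOL-Library.Function_Algebras"
    "HOL-Computational_Algebra.Computational_Algebra"
    "HOL-Algebra.QuotRing"
    "HOL-Algebra.Module"
begin

section \<open>Complex Lie algebras\<close>

class complex_lie_algebra = ab_group_add +
  fixes scaleC :: "complex \<Rightarrow> 'a \<Rightarrow> 'a" (infixr \<open>*\<^sub>C\<close> 75)
    and lie :: "'a \<Rightarrow> 'a \<Rightarrow> 'a"
  assumes scaleC_add_right: "a *\<^sub>C (x + y) = a *\<^sub>C x + a *\<^sub>C y"
    and scaleC_add_left: "(a + b) *\<^sub>C x = a *\<^sub>C x + b *\<^sub>C x"
    and scaleC_scaleC: "a *\<^sub>C b *\<^sub>C x = (a * b) *\<^sub>C x"
    and scaleC_one: "1 *\<^sub>C x = x"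
    and lie_add_left: "lie (x + y) z = lie x z + lie y z"
    and lie_add_right: "lie x (y + z) = lie x y + lie x z"
    and lie_scaleC_left: "lie (a *\<^sub>C x) y = a *\<^sub>C lie x y"
    and lie_scaleC_right: "lie x (a *\<^sub>C y) = a *\<^sub>C lie x y"
    and lie_self: "lie x x = 0"
    and jacobi: "lie x (lie y z) + lie y (lie z x) + lie z (lie x y) = 0"

global_interpretation cvs: vector_space "scaleC :: complex \<Rightarrow> 'a \<Rightarrow> 'a::complex_lie_algebra"
  by unfold_locales (simp_all add: scaleC_add_right scaleC_add_left scaleC_scaleC scaleC_one)

lemma lie_zero_left [simp]: "lie 0 (x :: 'a::complex_lie_algebra) = 0"
  using lie_add_left[of 0 0 x] by simp

lemma lie_zero_right [simp]: "lie (x :: 'a::complex_lie_algebra) 0 = 0"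
  using lie_add_right[of x 0 0] by simp

lemma lie_antisym: "lie x y = - lie y (x :: 'a::complex_lie_algebra)"
proof -
  have "lie (x + y) (x + y) = lie x y + lie y x"
    unfolding lie_add_left lie_add_right by (simp add: lie_self)
  then have "lie x y + lie y x = 0" by (simp add: lie_self)
  then show ?thesis by (simp add: eq_neg_iff_add_eq_0)
qed

definition finite_dimensional_lie :: "'g::complex_lie_algebra itself \<Rightarrow> bool" where
  "finite_dimensional_lie _ \<longleftrightarrow> (\<exists>B::'g set. finite B \<and> cvs.span B = UNIV)"

definition lie_ideal :: "'g::complex_lie_algebra set \<Rightarrow> bool" where
  "lie_ideal J \<longleftrightarrow> cvs.subspace J \<and> (\<forall>x. \<forall>y\<in>J. lie x y \<in> J)"

definition simple_lie :: "'g::complex_lie_algebra itself \<Rightarrow> bool" where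
  "simple_lie _ \<longleftrightarrow> (\<exists>x y :: 'g. lie x y \<noteq> 0) \<and>
     (\<forall>J::'g set. lie_ideal J \<longrightarrow> J = {0} \<or> J = UNIV)"

definition lie_subalgebra :: "'g::complex_lie_algebra set \<Rightarrow> bool" where
  "lie_subalgebra S \<longleftrightarrow> cvs.subspace S \<and> (\<forall>x\<in>S. \<forall>y\<in>S. lie x y \<in> S)"

fun lower_central :: "'g::complex_lie_algebra set \<Rightarrow> nat \<Rightarrow> 'g set" where
  "lower_central S 0 = S"
| "lower_central S (Suc n) = cvs.span {lie x y | x y. x \<in> S \<and> y \<in> lower_central S n}"

definition cartan_subalgebra :: "'g::complex_lie_algebra set \<Rightarrow> bool" where
  "cartan_subalgebra H \<longleftrightarrow> lie_subalgebra H \<and> (\<exists>n. lower_central H n = {0}) \<and>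
     {x. \<forall>y\<in>H. lie x y \<in> H} = H"


section \<open>Roots, Chevalley bases and the Weyl group\<close>

text \<open>A linear functional on the Cartan subalgebra \<open>H\<close> is represented by the function on the
  whole Lie algebra that extends it by \<open>0\<close> outside \<open>H\<close>, so that functionals are equal iff they
  are equal as functions, and sums and negatives are the pointwise ones.\<close>

definition dual_space :: "'g::complex_lie_algebra set \<Rightarrow> ('g \<Rightarrow> complex) set" where
  "dual_space H = {\<mu>. (\<forall>x\<in>H. \<forall>y\<in>H. \<mu> (x + y) = \<mu> x + \<mu> y) \<and>
     (\<forall>c. \<forall>x\<in>H. \<mu> (c *\<^sub>C x) = c * \<mu> x) \<and> (\<forall>x. x \<notin> H \<longrightarrow> \<mu> x = 0)}"

definition root_space :: "'g::complex_lie_algebra set \<Rightarrow> ('g \<Rightarrow> complex) \<Rightarrow> 'g set" where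
  "root_space H \<alpha> = {x. \<forall>h\<in>H. lie h x = \<alpha> h *\<^sub>C x}"

definition roots :: "'g::complex_lie_algebra set \<Rightarrow> ('g \<Rightarrow> complex) set" where
  "roots H = {\<alpha> \<in> dual_space H. \<alpha> \<noteq> 0 \<and> root_space H \<alpha> \<noteq> {0}}"

definition nat_combination :: "('g \<Rightarrow> complex) set \<Rightarrow> ('g \<Rightarrow> complex) \<Rightarrow> bool" where
  "nat_combination \<Delta> \<mu> \<longleftrightarrow> (\<exists>n :: ('g \<Rightarrow> complex) \<Rightarrow> nat. \<mu> = (\<lambda>x. \<Sum>\<beta>\<in>\<Delta>. of_nat (n \<beta>) * \<beta> x))"

definition simple_roots :: "'g::complex_lie_algebra set \<Rightarrow> ('g \<Rightarrow> complex) set \<Rightarrow> bool" where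
  "simple_roots H \<Delta> \<longleftrightarrow> finite \<Delta> \<and> \<Delta> \<subseteq> roots H \<and>
     (\<forall>c :: ('g \<Rightarrow> complex) \<Rightarrow> complex.
        (\<forall>x. (\<Sum>\<beta>\<in>\<Delta>. c \<beta> * \<beta> x) = 0) \<longrightarrow> (\<forall>\<beta>\<in>\<Delta>. c \<beta> = 0)) \<and>
     (\<forall>\<alpha>\<in>roots H. nat_combination \<Delta> \<alpha> \<or> nat_combination \<Delta> (- \<alpha>))"

definition pos_roots :: "'g::complex_lie_algebra set \<Rightarrow> ('g \<Rightarrow> complex) set \<Rightarrow> ('g \<Rightarrow> complex) set" where
  "pos_roots H \<Delta> = {\<alpha> \<in> roots H. nat_combination \<Delta> \<alpha>}"

text \<open>Root vectors are given by one function \<open>X\<close> on all roots: for a positive root \<open>\<alpha>\<close>,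
  \<open>X \<alpha>\<close> is \<open>x\<close>-plus and \<open>X (- \<alpha>)\<close> is \<open>x\<close>-minus. In particular the coroot of \<open>- \<alpha>\<close> is the negative
  of the coroot of \<open>\<alpha>\<close>.\<close>

definition coroot :: "(('g \<Rightarrow> complex) \<Rightarrow> 'g::complex_lie_algebra) \<Rightarrow> ('g \<Rightarrow> complex) \<Rightarrow> 'g" where
  "coroot X \<alpha> = lie (X \<alpha>) (X (- \<alpha>))"

definition chevalley_basis ::
    "'g::complex_lie_algebra set \<Rightarrow> ('g \<Rightarrow> complex) set \<Rightarrow> (('g \<Rightarrow> complex) \<Rightarrow> 'g) \<Rightarrow> bool" where
  "chevalley_basis H \<Delta> X \<longleftrightarrow>
     (\<forall>\<alpha>\<in>roots H. X \<alpha> \<in> root_space H \<alpha> \<and> \<alpha> (coroot X \<alpha>) = 2) \<and>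
     (\<forall>\<alpha>\<in>roots H. \<forall>\<beta>\<in>roots H. \<alpha> + \<beta> \<in> roots H \<longrightarrow>
        (let p = (GREATEST p::nat. (\<lambda>x. \<beta> x - of_nat p * \<alpha> x) \<in> roots H) in
          lie (X \<alpha>) (X \<beta>) = of_nat (p + 1) *\<^sub>C X (\<alpha> + \<beta>) \<or>
          lie (X \<alpha>) (X \<beta>) = - (of_nat (p + 1) *\<^sub>C X (\<alpha> + \<beta>)))) \<and>
     cvs.independent (X ` roots H \<union> coroot X ` \<Delta>) \<and>
     cvs.span (X ` roots H \<union> coroot X ` \<Delta>) = UNIV"

text \<open>The integer represented by an integral complex number; only applied to integral arguments.\<close>

definition to_int :: "complex \<Rightarrow> int" where
  "to_int z = \<lfloor>Re z\<rfloor>"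

definition dominant_weights ::
    "'g::complex_lie_algebra set \<Rightarrow> ('g \<Rightarrow> complex) set \<Rightarrow> (('g \<Rightarrow> complex) \<Rightarrow> 'g) \<Rightarrow>
      ('g \<Rightarrow> complex) set" where
  "dominant_weights H \<Delta> X = {\<mu> \<in> dual_space H. \<forall>\<alpha>\<in>\<Delta>. \<mu> (coroot X \<alpha>) \<in> \<nat>}"

definition simple_reflection ::
    "(('g \<Rightarrow> complex) \<Rightarrow> 'g::complex_lie_algebra) \<Rightarrow> ('g \<Rightarrow> complex) \<Rightarrow>
      ('g \<Rightarrow> complex) \<Rightarrow> ('g \<Rightarrow> complex)" where
  "simple_reflection X \<alpha> \<mu> = (\<lambda>x. \<mu> x - \<mu> (coroot X \<alpha>) * \<alpha> x)"

definition reflection_product ::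
    "(('g \<Rightarrow> complex) \<Rightarrow> 'g::complex_lie_algebra) \<Rightarrow> ('g \<Rightarrow> complex) list \<Rightarrow>
      ('g \<Rightarrow> complex) \<Rightarrow> ('g \<Rightarrow> complex)" where
  "reflection_product X as = foldr (\<lambda>\<alpha> w. simple_reflection X \<alpha> \<circ> w) as id"

definition weyl_group ::
    "('g::complex_lie_algebra \<Rightarrow> complex) set \<Rightarrow> (('g \<Rightarrow> complex) \<Rightarrow> 'g) \<Rightarrow>
      (('g \<Rightarrow> complex) \<Rightarrow> ('g \<Rightarrow> complex)) set" where
  "weyl_group \<Delta> X = {reflection_product X as | as. set as \<subseteq> \<Delta>}"

definition weyl_length ::
    "('g::complex_lie_algebra \<Rightarrow> complex) set \<Rightarrow> (('g \<Rightarrow> complex) \<Rightarrow> 'g) \<Rightarrow>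
      (('g \<Rightarrow> complex) \<Rightarrow> ('g \<Rightarrow> complex)) \<Rightarrow> nat" where
  "weyl_length \<Delta> X w = (LEAST n. \<exists>as. set as \<subseteq> \<Delta> \<and> length as = n \<and> reflection_product X as = w)"

definition longest_element ::
    "('g::complex_lie_algebra \<Rightarrow> complex) set \<Rightarrow> (('g \<Rightarrow> complex) \<Rightarrow> 'g) \<Rightarrow>
      (('g \<Rightarrow> complex) \<Rightarrow> ('g \<Rightarrow> complex)) \<Rightarrow> bool" where
  "longest_element \<Delta> X w \<longleftrightarrow> w \<in> weyl_group \<Delta> X \<and>
     (\<forall>w'\<in>weyl_group \<Delta> X. weyl_length \<Delta> X w' \<le> weyl_length \<Delta> X w)"


section \<open>Root lengths and the lacing number\<close>

definition lie_trace :: "('g::complex_lie_algebra \<Rightarrow> 'g) \<Rightarrow> complex" where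
  "lie_trace T = (let B = (SOME B. cvs.independent B \<and> cvs.span B = UNIV)
     in \<Sum>b\<in>B. cvs.representation B (T b) b)"

definition killing :: "'g::complex_lie_algebra \<Rightarrow> 'g \<Rightarrow> complex" where
  "killing x y = lie_trace (\<lambda>z. lie x (lie y z))"

text \<open>The value of the form on the dual of \<open>H\<close> induced by the Killing form at the pair consisting
  of \<open>\<alpha>\<close> and \<open>\<alpha>\<close>; this is a positive rational number when \<open>\<alpha>\<close> is a root.\<close>

definition root_norm :: "'g::complex_lie_algebra set \<Rightarrow> ('g \<Rightarrow> complex) \<Rightarrow> real" where
  "root_norm H \<alpha> = (let t = (THE t. t \<in> H \<and> (\<forall>h\<in>H. killing t h = \<alpha> h)) in Re (killing t t))"

definition long_root :: "'g::complex_lie_algebra set \<Rightarrow> ('g \<Rightarrow> complex) \<Rightarrow> bool" where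
  "long_root H \<alpha> \<longleftrightarrow> \<alpha> \<in> roots H \<and> (\<forall>\<beta>\<in>roots H. root_norm H \<beta> \<le> root_norm H \<alpha>)"

text \<open>The maximal number of edges joining two nodes of the Dynkin diagram, and \<open>1\<close> in rank one.\<close>

definition lacing_number ::
    "('g::complex_lie_algebra \<Rightarrow> complex) set \<Rightarrow> (('g \<Rightarrow> complex) \<Rightarrow> 'g) \<Rightarrow> int" where
  "lacing_number \<Delta> X = Max (insert 1
     {to_int (\<alpha> (coroot X \<beta>) * \<beta> (coroot X \<alpha>)) | \<alpha> \<beta>. \<alpha> \<in> \<Delta> \<and> \<beta> \<in> \<Delta> \<and> \<alpha> \<noteq> \<beta>})"

definition r_check ::
    "'g::complex_lie_algebra set \<Rightarrow> ('g \<Rightarrow> complex) set \<Rightarrow> (('g \<Rightarrow> complex) \<Rightarrow> 'g) \<Rightarrow>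
      ('g \<Rightarrow> complex) \<Rightarrow> int" where
  "r_check H \<Delta> X \<alpha> = (if long_root H \<alpha> then 1 else lacing_number \<Delta> X)"

definition type_G2 ::
    "('g::complex_lie_algebra \<Rightarrow> complex) set \<Rightarrow> (('g \<Rightarrow> complex) \<Rightarrow> 'g) \<Rightarrow> bool" where
  "type_G2 \<Delta> X \<longleftrightarrow> (\<exists>\<alpha> \<beta>. \<alpha> \<noteq> \<beta> \<and> \<Delta> = {\<alpha>, \<beta>} \<and>
     \<beta> (coroot X \<alpha>) = -1 \<and> \<alpha> (coroot X \<beta>) = -3)"


section \<open>Loop algebras\<close>

text \<open>The tensor product of a Lie algebra with the Laurent polynomial ring consists of the finitely
  supported functions on the integers with values in the Lie algebra; \<open>Poly_Mapping.single r x\<close>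
  stands for the tensor of \<open>x\<close> with the \<open>r\<close>-th power of \<open>t\<close>.\<close>

lemma poly_mapping_add_induct [case_names zero single add]:
  assumes "P 0" "\<And>k v. P (Poly_Mapping.single k v)" "\<And>f g. P f \<Longrightarrow> P g \<Longrightarrow> P (f + g)"
  shows "P (f :: 'a \<Rightarrow>\<^sub>0 'b::monoid_add)"
proof (induction f rule: update_induct)
  case const
  then show ?case by (rule assms(1))
next
  case (update f k v)
  have "Poly_Mapping.update k v f = Poly_Mapping.single k v + f"
    using update by (intro poly_mapping_eqI)
      (auto simp: lookup_update lookup_add lookup_single when_def in_keys_iff)
  then show ?case using assms(2,3) update by metis
qed

instantiation poly_mapping :: (comm_monoid_add, complex_lie_algebra) complex_lie_algebra
begin

definition scaleC_poly_mapping :: "complex \<Rightarrow> ('a \<Rightarrow>\<^sub>0 'b) \<Rightarrow> 'a \<Rightarrow>\<^sub>0 'b" where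
  "scaleC_poly_mapping c f = Poly_Mapping.map ((*\<^sub>C) c) f"

definition lie_poly_mapping :: "('a \<Rightarrow>\<^sub>0 'b) \<Rightarrow> ('a \<Rightarrow>\<^sub>0 'b) \<Rightarrow> 'a \<Rightarrow>\<^sub>0 'b" where
  "lie_poly_mapping f g = (\<Sum>i\<in>Poly_Mapping.keys f. \<Sum>j\<in>Poly_Mapping.keys g.
     Poly_Mapping.single (i + j) (lie (Poly_Mapping.lookup f i) (Poly_Mapping.lookup g j)))"

instance
proof
  have lk: "Poly_Mapping.lookup (c *\<^sub>C f) k = c *\<^sub>C Poly_Mapping.lookup f k" for c :: complex and f :: "'a \<Rightarrow>\<^sub>0 'b" and k
    unfolding scaleC_poly_mapping_def by (simp add: Poly_Mapping.map.rep_eq when_def)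
  fix a b :: complex and x y z :: "'a \<Rightarrow>\<^sub>0 'b"
  show "a *\<^sub>C (x + y) = a *\<^sub>C x + a *\<^sub>C y" "(a + b) *\<^sub>C x = a *\<^sub>C x + b *\<^sub>C x"
    "a *\<^sub>C b *\<^sub>C x = (a * b) *\<^sub>C x" "1 *\<^sub>C x = x"
    by (auto intro!: poly_mapping_eqI
        simp: lk lookup_add scaleC_add_right scaleC_add_left scaleC_scaleC scaleC_one)
  have ext: "lie f g = (\<Sum>i\<in>S. \<Sum>j\<in>T. Poly_Mapping.single (i + j) (lie (Poly_Mapping.lookup f i) (Poly_Mapping.lookup g j)))"
    if "finite S" "finite T" "Poly_Mapping.keys f \<subseteq> S" "Poly_Mapping.keys g \<subseteq> T" for f g :: "'a \<Rightarrow>\<^sub>0 'b" and S T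
  proof -
    have "lie f g = (\<Sum>i\<in>Poly_Mapping.keys f. \<Sum>j\<in>T. Poly_Mapping.single (i + j) (lie (Poly_Mapping.lookup f i) (Poly_Mapping.lookup g j)))"
      unfolding lie_poly_mapping_def
      by (intro sum.cong refl sum.mono_neutral_left) (use that in \<open>auto simp: in_keys_iff\<close>)
    also have "\<dots> = (\<Sum>i\<in>S. \<Sum>j\<in>T. Poly_Mapping.single (i + j) (lie (Poly_Mapping.lookup f i) (Poly_Mapping.lookup g j)))"
      by (intro sum.mono_neutral_left) (use that in \<open>auto simp: in_keys_iff\<close>)
    finally show ?thesis .
  qed
  have addl: "lie (f + g) h = lie f h + lie g h" for f g h :: "'a \<Rightarrow>\<^sub>0 'b"
  proof -
    let ?S = "Poly_Mapping.keys f \<union> Poly_Mapping.keys g"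
    have k: "Poly_Mapping.keys (f + g) \<subseteq> ?S" by (rule keys_add)
    show ?thesis
      by (subst (1 2 3) ext[where S = ?S and T = "Poly_Mapping.keys h"])
        (use k in \<open>auto simp: lookup_add lie_add_left single_add sum.distrib\<close>)
  qed
  have anti: "lie f g = - lie g f" for f g :: "'a \<Rightarrow>\<^sub>0 'b"
    unfolding lie_poly_mapping_def
    by (subst sum.swap, subst sum_negf[symmetric], rule sum.cong[OF refl],
        subst sum_negf[symmetric], rule sum.cong[OF refl])
      (metis add.commute lie_antisym single_uminus)
  have addr: "lie f (g + h) = lie f g + lie f h" for f g h :: "'a \<Rightarrow>\<^sub>0 'b"
    by (metis addl anti minus_add_distrib)
  show "lie (x + y) z = lie x z + lie y z" by (rule addl)
  show "lie x (y + z) = lie x y + lie x z" by (rule addr)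
  have sc: "c *\<^sub>C Poly_Mapping.single k v = Poly_Mapping.single k (c *\<^sub>C v)" for c k and v :: 'b
    by (rule poly_mapping_eqI) (simp add: lk lookup_single when_def)
  have scsum: "c *\<^sub>C sum F A = (\<Sum>i\<in>A. c *\<^sub>C F i)" for c and F :: "'a \<Rightarrow> 'a \<Rightarrow>\<^sub>0 'b" and A
    by (rule poly_mapping_eqI) (simp add: lk lookup_sum cvs.scale_sum_right)
  have kc: "Poly_Mapping.keys (c *\<^sub>C f) \<subseteq> Poly_Mapping.keys f" for c and f :: "'a \<Rightarrow>\<^sub>0 'b"
    by (auto simp: in_keys_iff lk)
  have scl: "lie (c *\<^sub>C f) g = c *\<^sub>C lie f g" for c and f g :: "'a \<Rightarrow>\<^sub>0 'b"
    by (subst (1 2) ext[where S = "Poly_Mapping.keys f" and T = "Poly_Mapping.keys g"])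
      (use kc in \<open>auto simp: lk lie_scaleC_left scsum sc\<close>)
  show "lie (a *\<^sub>C x) y = a *\<^sub>C lie x y" by (rule scl)
  have neg: "c *\<^sub>C (- f) = - (c *\<^sub>C f)" for c and f :: "'a \<Rightarrow>\<^sub>0 'b"
    by (rule poly_mapping_eqI) (simp add: lk)
  show "lie x (a *\<^sub>C y) = a *\<^sub>C lie x y" by (metis anti scl neg)
  have ss: "lie (Poly_Mapping.single i u) (Poly_Mapping.single j v) = Poly_Mapping.single (i + j) (lie u v)"
    for i j and u v :: 'b
    by (subst ext[where S = "{i}" and T = "{j}"]) (auto simp: in_keys_iff lookup_single)
  show "lie x x = 0"
  proof (induction x rule: poly_mapping_add_induct)
    case zero
    then show ?case by (simp add: lie_poly_mapping_def)
  next
    case (single k v)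
    then show ?case by (simp add: ss lie_self)
  next
    case (add f g)
    then show ?case by (simp add: addl addr anti[of g f])
  qed
  define J where "J u v w = lie u (lie v w) + lie v (lie w u) + lie w (lie u v)"
    for u v w :: "'a \<Rightarrow>\<^sub>0 'b"
  have J1: "J (u + u') v w = J u v w + J u' v w" for u u' v w
    by (simp add: J_def addl addr)
  have J2: "J u v w = J v w u" for u v w
    by (simp add: J_def add_ac)
  have J0: "J 0 v w = 0" for v w
    using J1[of 0 0] by simp
  have sss: "J (Poly_Mapping.single i u) (Poly_Mapping.single j v) (Poly_Mapping.single k w) = 0"
    for i j k and u v w :: 'b
  proof -
    have "j + (k + i) = i + (j + k)" "k + (i + j) = i + (j + k)" by (simp_all add: ac_simps)
    then show ?thesis by (simp add: J_def ss jacobi flip: single_add)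
  qed
  have s2: "J (Poly_Mapping.single i u) (Poly_Mapping.single j v) w = 0" for i j and u v :: 'b and w
  proof (induction w rule: poly_mapping_add_induct)
    case zero then show ?case by (metis J0 J2)
  next
    case single then show ?case by (rule sss)
  next
    case add then show ?case by (metis J1 J2 add_0)
  qed
  have s1: "J (Poly_Mapping.single i u) v w = 0" for i and u :: 'b and v w
  proof (induction v rule: poly_mapping_add_induct)
    case zero then show ?case by (metis J0 J2)
  next
    case single then show ?case by (rule s2)
  next
    case add then show ?case by (metis J1 J2 add_0)
  qed
  have "J x y z = 0"
    by (induction x rule: poly_mapping_add_induct) (simp_all add: J0 J1 s1)
  then show "lie x (lie y z) + lie y (lie z x) + lie z (lie x y) = 0"
    by (simp add: J_def)
qed

end

type_synonym 'g loop = "int \<Rightarrow>\<^sub>0 'g"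

definition current :: "'g::complex_lie_algebra set \<Rightarrow> 'g loop set" where
  "current S = {f. \<forall>r. Poly_Mapping.lookup f r \<in> S \<and> (r < 0 \<longrightarrow> Poly_Mapping.lookup f r = 0)}"

definition current_pos :: "'g::complex_lie_algebra set \<Rightarrow> 'g loop set" where
  "current_pos S = {f. \<forall>r. Poly_Mapping.lookup f r \<in> S \<and> (r \<le> 0 \<longrightarrow> Poly_Mapping.lookup f r = 0)}"

definition nilradical_plus :: "'g::complex_lie_algebra set \<Rightarrow> ('g \<Rightarrow> complex) set \<Rightarrow> 'g set" where
  "nilradical_plus H \<Delta> = cvs.span (\<Union>\<alpha>\<in>pos_roots H \<Delta>. root_space H \<alpha>)"

definition nilradical_minus :: "'g::complex_lie_algebra set \<Rightarrow> ('g \<Rightarrow> complex) set \<Rightarrow> 'g set" where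
  "nilradical_minus H \<Delta> = cvs.span (\<Union>\<alpha>\<in>pos_roots H \<Delta>. root_space H (- \<alpha>))"


section \<open>Universal enveloping algebras\<close>

text \<open>Words under concatenation, written additively so that finitely supported functions on words
  are, with the convolution product of \<open>Poly_Mapping\<close>, the free associative algebra.\<close>

datatype 'a fword = FWord (letters: "'a list")

instantiation fword :: (type) monoid_add
begin

definition zero_fword :: "'a fword" where "zero_fword = FWord []"

definition plus_fword :: "'a fword \<Rightarrow> 'a fword \<Rightarrow> 'a fword" where
  "plus_fword v w = FWord (letters v @ letters w)"

instance by standard (simp_all add: zero_fword_def plus_fword_def)

end

type_synonym 'a free_alg = "'a fword \<Rightarrow>\<^sub>0 complex"

abbreviation free_gen :: "'a \<Rightarrow> 'a free_alg" where
  "free_gen x \<equiv> Poly_Mapping.single (FWord [x]) 1"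

abbreviation free_const :: "complex \<Rightarrow> 'a free_alg" where
  "free_const c \<equiv> Poly_Mapping.single 0 c"

inductive_set uea_ideal :: "'l::complex_lie_algebra free_alg set" where
  add_rel: "free_gen (x + y) - free_gen x - free_gen y \<in> uea_ideal"
| scale_rel: "free_gen (c *\<^sub>C x) - free_const c * free_gen x \<in> uea_ideal"
| lie_rel: "free_gen x * free_gen y - free_gen y * free_gen x - free_gen (lie x y) \<in> uea_ideal"
| zero: "0 \<in> uea_ideal"
| diff: "p \<in> uea_ideal \<Longrightarrow> q \<in> uea_ideal \<Longrightarrow> p - q \<in> uea_ideal"
| mult_left: "p \<in> uea_ideal \<Longrightarrow> r * p \<in> uea_ideal"
| mult_right: "p \<in> uea_ideal \<Longrightarrow> p * r \<in> uea_ideal"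

lemma uea_ideal_add: "p \<in> uea_ideal \<Longrightarrow> q \<in> uea_ideal \<Longrightarrow> p + q \<in> uea_ideal"
  using uea_ideal.diff[OF _ uea_ideal.diff[OF uea_ideal.zero]] by fastforce

quotient_type (overloaded) 'l uea = "'l::complex_lie_algebra free_alg" / "\<lambda>p q. p - q \<in> uea_ideal"
proof (rule equivpI)
  show "reflp (\<lambda>p q :: 'l free_alg. p - q \<in> uea_ideal)"
    by (simp add: reflp_def uea_ideal.zero)
  show "symp (\<lambda>p q :: 'l free_alg. p - q \<in> uea_ideal)"
    using uea_ideal.diff[OF uea_ideal.zero] by (fastforce simp: symp_def)
  show "transp (\<lambda>p q :: 'l free_alg. p - q \<in> uea_ideal)"
    using uea_ideal_add by (fastforce simp: transp_def)
qed

lemma fword_plus_eq_0_iff: "v + w = (0 :: 'a fword) \<longleftrightarrow> v = 0 \<and> w = 0"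
  by (cases v; cases w) (simp add: zero_fword_def plus_fword_def)

lemma fword_neq_0: "FWord [x] \<noteq> 0"
  by (simp add: zero_fword_def)

lemma lookup_mult_0: "Poly_Mapping.lookup (p * q) 0 = Poly_Mapping.lookup p 0 * Poly_Mapping.lookup q (0 :: 'a fword)"
  for p q :: "'a free_alg"
proof -
  have "(\<Sum>w. Poly_Mapping.lookup q w when 0 = v + w) = (Poly_Mapping.lookup q 0 when v = 0)" for v :: "'a fword"
    using fword_plus_eq_0_iff[of v] by (cases "v = 0") (simp_all add: eq_commute[of 0])
  then show ?thesis
    by (simp add: lookup_mult mult_when)
qed

lemma uea_ideal_lookup_0: "p \<in> uea_ideal \<Longrightarrow> Poly_Mapping.lookup p 0 = 0"
  by (induction rule: uea_ideal.induct)
    (simp_all add: lookup_minus lookup_mult_0 lookup_single when_def fword_neq_0)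

instantiation uea :: (complex_lie_algebra) ring_1
begin

lift_definition zero_uea :: "'a uea" is 0 .

lift_definition one_uea :: "'a uea" is 1 .

lift_definition plus_uea :: "'a uea \<Rightarrow> 'a uea \<Rightarrow> 'a uea" is "(+)"
  using uea_ideal_add by (fastforce simp: algebra_simps)

lift_definition minus_uea :: "'a uea \<Rightarrow> 'a uea \<Rightarrow> 'a uea" is "(-)"
  using uea_ideal.diff by (fastforce simp: algebra_simps)

lift_definition uminus_uea :: "'a uea \<Rightarrow> 'a uea" is uminus
  using uea_ideal.diff[OF uea_ideal.zero] by (fastforce simp: algebra_simps)

lift_definition times_uea :: "'a uea \<Rightarrow> 'a uea \<Rightarrow> 'a uea" is "(*)"
proof -
  fix p p' q q' :: "'a free_alg"
  assume "p - p' \<in> uea_ideal" "q - q' \<in> uea_ideal"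
  then have "(p - p') * q + p' * (q - q') \<in> uea_ideal"
    by (intro uea_ideal_add uea_ideal.mult_left uea_ideal.mult_right)
  then show "p * q - p' * q' \<in> uea_ideal"
    by (simp add: algebra_simps)
qed

instance
proof
  show "(0 :: 'a uea) \<noteq> 1"
  proof (transfer, rule notI)
    assume "0 - (1 :: 'a free_alg) \<in> uea_ideal"
    from uea_ideal_lookup_0[OF this] show False by (simp add: lookup_minus)
  qed
qed (transfer, simp add: uea_ideal.zero algebra_simps)+

end

lift_definition uea_gen :: "'l::complex_lie_algebra \<Rightarrow> 'l uea" is free_gen .

lift_definition uea_const :: "complex \<Rightarrow> 'l::complex_lie_algebra uea" is free_const .

lift_definition counit :: "'l::complex_lie_algebra uea \<Rightarrow> complex" is "\<lambda>p. Poly_Mapping.lookup p 0"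
  using uea_ideal_lookup_0 by (fastforce simp: lookup_minus)

definition divided_power :: "'l::complex_lie_algebra uea \<Rightarrow> nat \<Rightarrow> 'l uea" where
  "divided_power u k = uea_const (1 / fact k) * u ^ k"

definition uea_binomial :: "'l::complex_lie_algebra uea \<Rightarrow> nat \<Rightarrow> 'l uea" where
  "uea_binomial u k = uea_const (1 / fact k) * prod_list (map (\<lambda>j. u - of_nat j) [0..<k])"

text \<open>The enveloping algebra of a Lie subalgebra, as a subalgebra of that of the whole algebra.\<close>

inductive_set uea_sub :: "'l::complex_lie_algebra set \<Rightarrow> 'l uea set" for S :: "'l set" where
  gen: "x \<in> S \<Longrightarrow> uea_gen x \<in> uea_sub S"
| const: "uea_const c \<in> uea_sub S"
| diff: "u \<in> uea_sub S \<Longrightarrow> v \<in> uea_sub S \<Longrightarrow> u - v \<in> uea_sub S"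
| mult: "u \<in> uea_sub S \<Longrightarrow> v \<in> uea_sub S \<Longrightarrow> u * v \<in> uea_sub S"

inductive_set int_form ::
    "'g::complex_lie_algebra set \<Rightarrow> (('g \<Rightarrow> complex) \<Rightarrow> 'g) \<Rightarrow> 'g loop uea set"
  for H :: "'g set" and X :: "('g \<Rightarrow> complex) \<Rightarrow> 'g" where
  gen: "\<alpha> \<in> roots H \<Longrightarrow> divided_power (uea_gen (Poly_Mapping.single r (X \<alpha>))) k \<in> int_form H X"
| one: "1 \<in> int_form H X"
| diff: "u \<in> int_form H X \<Longrightarrow> v \<in> int_form H X \<Longrightarrow> u - v \<in> int_form H X"
| mult: "u \<in> int_form H X \<Longrightarrow> v \<in> int_form H X \<Longrightarrow> u * v \<in> int_form H X"

definition int_form_sub ::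
    "'g::complex_lie_algebra set \<Rightarrow> (('g \<Rightarrow> complex) \<Rightarrow> 'g) \<Rightarrow> 'g loop set \<Rightarrow> 'g loop uea set" where
  "int_form_sub H X S = uea_sub S \<inter> int_form H X"


section \<open>Extension of scalars of a subring\<close>

text \<open>For a field \<open>'f\<close> and a subring \<open>A\<close> of \<open>'u\<close>, the tensor product of \<open>'f\<close> and \<open>A\<close> over the
  integers is the free abelian group on the pairs \<open>(c, u)\<close> with \<open>u \<in> A\<close>, modulo the subgroup
  generated by the biadditivity relations. The product of the pairs \<open>(c, u)\<close> and \<open>(d, v)\<close> is
  \<open>(c * d, u * v)\<close>.\<close>

type_synonym ('f, 'u) formal = "'f \<times> 'u \<Rightarrow>\<^sub>0 int"

definition formal_ring :: "'u::ring_1 set \<Rightarrow> ('f::field, 'u) formal ring" where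
  "formal_ring A = \<lparr>carrier = {p. Poly_Mapping.keys p \<subseteq> UNIV \<times> A},
     mult = (\<lambda>p q. \<Sum>a\<in>Poly_Mapping.keys p. \<Sum>b\<in>Poly_Mapping.keys q.
       Poly_Mapping.single (fst a * fst b, snd a * snd b) (Poly_Mapping.lookup p a * Poly_Mapping.lookup q b)),
     one = Poly_Mapping.single (1, 1) 1, zero = 0, add = (+)\<rparr>"

inductive_set tensor_rel :: "'u::ring_1 set \<Rightarrow> ('f::field, 'u) formal set" for A :: "'u set" where
  add_left: "u \<in> A \<Longrightarrow>
    Poly_Mapping.single (c + d, u) 1 - Poly_Mapping.single (c, u) 1 - Poly_Mapping.single (d, u) 1
      \<in> tensor_rel A"
| add_right: "u \<in> A \<Longrightarrow> v \<in> A \<Longrightarrow>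
    Poly_Mapping.single (c, u + v) 1 - Poly_Mapping.single (c, u) 1 - Poly_Mapping.single (c, v) 1
      \<in> tensor_rel A"
| zero: "0 \<in> tensor_rel A"
| diff: "p \<in> tensor_rel A \<Longrightarrow> q \<in> tensor_rel A \<Longrightarrow> p - q \<in> tensor_rel A"

definition tensor_ring :: "'u::ring_1 set \<Rightarrow> ('f::field, 'u) formal set ring" where
  "tensor_ring A = formal_ring A Quot tensor_rel A"

definition tensor_class :: "'u::ring_1 set \<Rightarrow> ('f::field, 'u) formal \<Rightarrow> ('f, 'u) formal set" where
  "tensor_class A p = tensor_rel A +>\<^bsub>formal_ring A\<^esub> p"

definition tensor :: "'u::ring_1 set \<Rightarrow> 'f::field \<Rightarrow> 'u \<Rightarrow> ('f, 'u) formal set" where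
  "tensor A c u = tensor_class A (Poly_Mapping.single (c, u) 1)"

text \<open>The map induced by an inclusion of a subring in the subring \<open>B\<close>.\<close>

definition tensor_incl :: "'u::ring_1 set \<Rightarrow> ('f::field, 'u) formal set \<Rightarrow> ('f, 'u) formal set" where
  "tensor_incl B C = (\<Union>p\<in>C. tensor_class B p)"


section \<open>Left ideals and cyclic left modules\<close>

definition left_ideal :: "'r set \<Rightarrow> 'r ring \<Rightarrow> bool" where
  "left_ideal I R \<longleftrightarrow> additive_subgroup I R \<and> (\<forall>r\<in>carrier R. \<forall>x\<in>I. r \<otimes>\<^bsub>R\<^esub> x \<in> I)"

definition left_ideal_gen :: "'r ring \<Rightarrow> 'r set \<Rightarrow> 'r set" where
  "left_ideal_gen R S = \<Inter> {I. left_ideal I R \<and> S \<subseteq> I}"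

text \<open>As usual for modules over the record type of the library, the fields \<open>mult\<close> and \<open>one\<close> carry
  no information.\<close>

definition quotient_lmodule :: "'r ring \<Rightarrow> 'r set \<Rightarrow> ('r, 'r set) module" where
  "quotient_lmodule R I = \<lparr>carrier = a_rcosets\<^bsub>R\<^esub> I, mult = undefined, one = undefined,
     zero = I, add = set_add R, smult = (\<lambda>r C. \<Union>x\<in>C. I +>\<^bsub>R\<^esub> (r \<otimes>\<^bsub>R\<^esub> x))\<rparr>"

definition lmodule_iso :: "'r ring \<Rightarrow> ('r, 'm) module \<Rightarrow> ('r, 'n) module \<Rightarrow> ('m \<Rightarrow> 'n) \<Rightarrow> bool" where
  "lmodule_iso R M N \<phi> \<longleftrightarrow> bij_betw \<phi> (carrier M) (carrier N) \<and>
     (\<forall>x\<in>carrier M. \<forall>y\<in>carrier M. \<phi> (x \<oplus>\<^bsub>M\<^esub> y) = \<phi> x \<oplus>\<^bsub>N\<^esub> \<phi> y) \<and>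
     (\<forall>r\<in>carrier R. \<forall>x\<in>carrier M. \<phi> (r \<odot>\<^bsub>M\<^esub> x) = r \<odot>\<^bsub>N\<^esub> \<phi> x)"

definition lmodule_isomorphic :: "'r ring \<Rightarrow> ('r, 'm) module \<Rightarrow> ('r, 'n) module \<Rightarrow> bool" where
  "lmodule_isomorphic R M N \<longleftrightarrow> (\<exists>\<phi>. lmodule_iso R M N \<phi>)"


section \<open>Hyperalgebras and Demazure modules\<close>

type_synonym ('f, 'g) hyp = "('f, 'g loop uea) formal set"

definition hyperalgebra ::
    "'g::complex_lie_algebra set \<Rightarrow> (('g \<Rightarrow> complex) \<Rightarrow> 'g) \<Rightarrow> 'g loop set \<Rightarrow>
      ('f::field, 'g) hyp ring" where
  "hyperalgebra H X S = tensor_ring (int_form_sub H X S)"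

text \<open>The counit takes integral values on the integral form.\<close>

definition formal_counit :: "('f::field, 'l::complex_lie_algebra uea) formal \<Rightarrow> 'f" where
  "formal_counit p = (\<Sum>a\<in>Poly_Mapping.keys p. of_int (Poly_Mapping.lookup p a) * fst a * of_int (to_int (counit (snd a))))"

definition augmentation_ideal ::
    "'g::complex_lie_algebra set \<Rightarrow> (('g \<Rightarrow> complex) \<Rightarrow> 'g) \<Rightarrow> 'g loop set \<Rightarrow>
      ('f::field, 'g) hyp set" where
  "augmentation_ideal H X S = {tensor_class (int_form_sub H X S) p | p.
     Poly_Mapping.keys p \<subseteq> UNIV \<times> int_form_sub H X S \<and> formal_counit p = 0}"

text \<open>The Cartan subalgebra inside the loop algebra, in degree \<open>0\<close>.\<close>

definition constants :: "'g::complex_lie_algebra set \<Rightarrow> 'g loop set" where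
  "constants S = Poly_Mapping.single 0 ` S"

definition weight_hom ::
    "'g::complex_lie_algebra set \<Rightarrow> ('g \<Rightarrow> complex) set \<Rightarrow> (('g \<Rightarrow> complex) \<Rightarrow> 'g) \<Rightarrow>
      ('g \<Rightarrow> complex) \<Rightarrow> (('f::field, 'g) hyp \<Rightarrow> 'f) \<Rightarrow> bool" where
  "weight_hom H \<Delta> X \<mu> \<chi> \<longleftrightarrow>
     (let A = int_form_sub H X (constants H); U = hyperalgebra H X (constants H) in
       (\<forall>x\<in>carrier U. \<forall>y\<in>carrier U. \<chi> (x \<oplus>\<^bsub>U\<^esub> y) = \<chi> x + \<chi> y \<and> \<chi> (x \<otimes>\<^bsub>U\<^esub> y) = \<chi> x * \<chi> y) \<and>
       (\<forall>c. \<chi> (tensor A c 1) = c) \<and>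
       (\<forall>\<alpha>\<in>\<Delta>. \<forall>k.
          \<chi> (tensor A 1 (uea_binomial (uea_gen (Poly_Mapping.single 0 (coroot X \<alpha>))) k)) =
            of_int (to_int (\<mu> (coroot X \<alpha>) gchoose k))))"

text \<open>Elements \<open>h - \<mu>(h)\<close>, where \<open>h\<close> is in the hyperalgebra of \<open>H\<close> and \<open>\<mu>(h)\<close> is the value at \<open>h\<close> of
  the algebra homomorphism determined by the integral weight \<open>\<mu>\<close>. There is exactly one \<open>\<chi>\<close> with
  \<open>weight_hom H \<Delta> X \<mu> \<chi>\<close> on the carrier, because the integral form of the enveloping algebra of \<open>H\<close>
  has the products of the binomials of the simple coroots as a basis.\<close>

definition weight_relations ::
    "'g::complex_lie_algebra set \<Rightarrow> ('g \<Rightarrow> complex) set \<Rightarrow> (('g \<Rightarrow> complex) \<Rightarrow> 'g) \<Rightarrow>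
      ('g \<Rightarrow> complex) \<Rightarrow> ('f::field, 'g) hyp set" where
  "weight_relations H \<Delta> X \<mu> =
     (let B = int_form_sub H X (current UNIV) in
       {tensor_incl B h \<ominus>\<^bsub>hyperalgebra H X (current UNIV)\<^esub> tensor B (\<chi> h) 1 | h \<chi>.
          h \<in> carrier (hyperalgebra H X (constants H)) \<and> weight_hom H \<Delta> X \<mu> \<chi>})"

definition root_power ::
    "'g::complex_lie_algebra set \<Rightarrow> (('g \<Rightarrow> complex) \<Rightarrow> 'g) \<Rightarrow> ('g \<Rightarrow> complex) \<Rightarrow> nat \<Rightarrow> nat \<Rightarrow>
      ('f::field, 'g) hyp" where
  "root_power H X \<alpha> s k = tensor (int_form_sub H X (current UNIV)) 1
     (divided_power (uea_gen (Poly_Mapping.single (int s) (X \<alpha>))) k)"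

definition demazure_ideal ::
    "'g::complex_lie_algebra set \<Rightarrow> ('g \<Rightarrow> complex) set \<Rightarrow> (('g \<Rightarrow> complex) \<Rightarrow> 'g) \<Rightarrow> nat \<Rightarrow>
      ('g \<Rightarrow> complex) \<Rightarrow> ('f::field, 'g) hyp set" where
  "demazure_ideal H \<Delta> X l \<mu> = (let B = int_form_sub H X (current UNIV) in
     left_ideal_gen (hyperalgebra H X (current UNIV))
      (tensor_incl B ` augmentation_ideal H X (current (nilradical_plus H \<Delta>)) \<union>
       tensor_incl B ` augmentation_ideal H X (current_pos H) \<union>
       weight_relations H \<Delta> X \<mu> \<union>
       {root_power H X (- \<alpha>) s k | \<alpha> s k. \<alpha> \<in> pos_roots H \<Delta> \<and>
          int k > max 0 (to_int (\<mu> (coroot X \<alpha>)) - int s * int l * r_check H \<Delta> X \<alpha>)}))"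

definition demazure_module ::
    "'g::complex_lie_algebra set \<Rightarrow> ('g \<Rightarrow> complex) set \<Rightarrow> (('g \<Rightarrow> complex) \<Rightarrow> 'g) \<Rightarrow> nat \<Rightarrow>
      ('g \<Rightarrow> complex) \<Rightarrow> (('f::field, 'g) hyp, ('f, 'g) hyp set) module" where
  "demazure_module H \<Delta> X l \<mu> =
     quotient_lmodule (hyperalgebra H X (current UNIV)) (demazure_ideal H \<Delta> X l \<mu>)"

definition demazure_ideal_minus ::
    "'g::complex_lie_algebra set \<Rightarrow> ('g \<Rightarrow> complex) set \<Rightarrow> (('g \<Rightarrow> complex) \<Rightarrow> 'g) \<Rightarrow>
      (('g \<Rightarrow> complex) \<Rightarrow> ('g \<Rightarrow> complex)) \<Rightarrow> nat \<Rightarrow> ('g \<Rightarrow> complex) \<Rightarrow> ('f::field, 'g) hyp set" where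
  "demazure_ideal_minus H \<Delta> X w0 l \<mu> = (let B = int_form_sub H X (current UNIV) in
     left_ideal_gen (hyperalgebra H X (current UNIV))
      (weight_relations H \<Delta> X (w0 \<mu>) \<union>
       tensor_incl B ` augmentation_ideal H X (current_pos H) \<union>
       tensor_incl B ` augmentation_ideal H X (current (nilradical_minus H \<Delta>)) \<union>
       {root_power H X \<alpha> s k | \<alpha> s k. \<alpha> \<in> pos_roots H \<Delta> \<and>
          int k > max 0 (- to_int (w0 \<mu> (coroot X \<alpha>)) - int s * int l * r_check H \<Delta> X \<alpha>)}))"

end

theory Submission
  imports Defs
begin

text \<open>For \<open>x\<close> a root vector of a simple root or of its negative, conjugation by \<open>exp x\<close>
  is an automorphism \<open>\<Phi>\<close> of the enveloping algebra of the loop algebra that preserves the integral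
  form, since \<open>\<Phi> u\<close> is a sum of products of divided powers of \<open>x\<close>, \<open>u\<close>, and divided powers of
  \<open>- x\<close>. If almost all divided powers of \<open>x\<close> lie in a left ideal \<open>I\<close>, then \<open>exp x\<close> acts on the
  cyclic module \<open>U / I\<close> and identifies it with \<open>U / \<Phi> I\<close>. The product of these automorphisms
  along a word for \<open>w\<^sub>0\<close> maps each root space to the one of the root translated by \<open>w\<^sub>0\<close>, and
  Chevalley basis vectors to Chevalley basis vectors up to sign. As \<open>w\<^sub>0\<close> sends positive roots to
  negative ones, it maps the generators of one ideal to those of the other one, up to sign.\<close>

section \<open>Exponentials of locally nilpotent operators\<close>

text \<open>Strings of weights are finite, so \<open>lie x\<close> is locally nilpotent and every
  exponential is a finite sum. The exponential of x itself is no element of the hyperalgebra: it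
  acts on U / I only through truncations whose tails lie in I. Each letter of the word replaces the
  ideal, so nilpotency modulo the current ideal has to be carried along the word, for all simple
  roots and their negatives at once. For the Demazure ideal it comes from the augmentation ideal of
  the positive part and from the relations with s = 0.

  Three points need more than transport of structure. A lift of w0 multiplies root vectors by
  scalars, and that these are signs rests on Chevalley's integrality along root strings. The bounds
  in the two families of relations match because pairings with coroots and root lengths are
  invariant. The weight relations match because simple coroots go to negatives of simple coroots,
  and binomials of -h are integral combinations of binomials of h.\<close>

locale complex_space = vector_space scale
  for scale :: "complex \<Rightarrow> 'b::ab_group_add \<Rightarrow> 'b"
begin

definition lin :: "('b \<Rightarrow> 'b) \<Rightarrow> bool" where
  "lin D \<longleftrightarrow> (\<forall>x y. D (x + y) = D x + D y) \<and> (\<forall>c x. D (scale c x) = scale c (D x))"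

text \<open>The exponent may depend on the vector: \<open>ad_gen x\<close> has no uniform bound on
  an enveloping algebra, since products need larger exponents than their factors.\<close>

definition loc_nilpotent :: "('b \<Rightarrow> 'b) \<Rightarrow> bool" where
  "loc_nilpotent D \<longleftrightarrow> lin D \<and> (\<forall>u. \<exists>n. (D ^^ n) u = 0)"

definition dpow :: "('b \<Rightarrow> 'b) \<Rightarrow> nat \<Rightarrow> 'b \<Rightarrow> 'b" where
  "dpow D k u = scale (1 / fact k) ((D ^^ k) u)"

text \<open>The sum stops at the first power of D that vanishes on u; all later terms are zero too,
  so this is the whole exponential series.\<close>

definition dexp :: "('b \<Rightarrow> 'b) \<Rightarrow> 'b \<Rightarrow> 'b" where
  "dexp D u = (\<Sum>k<(LEAST n. (D ^^ n) u = 0). dpow D k u)"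

lemma lin_add: "lin D \<Longrightarrow> D (x + y) = D x + D y"
  and lin_scale: "lin D \<Longrightarrow> D (scale c x) = scale c (D x)"
  by (simp_all add: lin_def)

lemma lin_0: "lin D \<Longrightarrow> D 0 = 0"
  using lin_add[of D 0 0] by simp

lemma lin_uminus: "lin D \<Longrightarrow> D (- x) = - D x"
  using lin_add[of D x "- x"] by (simp add: lin_0 eq_neg_iff_add_eq_0 add.commute)

lemma lin_diff: "lin D \<Longrightarrow> D (x - y) = D x - D y"
  using lin_add[of D x "- y"] by (simp add: lin_uminus)

lemma lin_sum: "lin D \<Longrightarrow> D (sum f A) = (\<Sum>i\<in>A. D (f i))"
  by (induction A rule: infinite_finite_induct) (simp_all add: lin_0 lin_add)

lemma lin_funpow: "lin D \<Longrightarrow> lin (D ^^ n)"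
  by (induction n) (auto simp: lin_def)

lemma lin_dpow: "lin D \<Longrightarrow> lin (dpow D k)"
  using lin_funpow[of D k] by (auto simp: lin_def dpow_def scale_right_distrib mult.commute)

lemma lin_neg: "lin D \<Longrightarrow> lin (\<lambda>u. - D u)"
  by (simp add: lin_def)

lemma loc_nilpotent_lin: "loc_nilpotent D \<Longrightarrow> lin D"
  by (simp add: loc_nilpotent_def)

lemma funpow_neg: "lin D \<Longrightarrow> ((\<lambda>u. - D u) ^^ n) u = scale ((-1) ^ n) ((D ^^ n) u)"
  by (induction n) (simp_all add: lin_scale)

lemma dpow_neg: "lin D \<Longrightarrow> dpow (\<lambda>u. - D u) n u = scale ((-1) ^ n) (dpow D n u)"
  by (simp add: dpow_def funpow_neg mult.commute)

lemma loc_nilpotent_neg: "loc_nilpotent D \<Longrightarrow> loc_nilpotent (\<lambda>u. - D u)"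
  by (auto simp: loc_nilpotent_def lin_neg funpow_neg)

lemma funpow_0_mono: "lin D \<Longrightarrow> (D ^^ n) u = 0 \<Longrightarrow> n \<le> m \<Longrightarrow> (D ^^ m) u = 0"
  by (metis add_diff_inverse_nat comp_apply funpow_add lin_0 lin_funpow add.commute not_less)

lemma dpow_0_iff: "dpow D k u = 0 \<longleftrightarrow> (D ^^ k) u = 0"
  by (simp add: dpow_def)

lemma dpow_zero [simp]: "dpow D 0 u = u"
  by (simp add: dpow_def)

lemma dpow_Suc: "lin D \<Longrightarrow> D (dpow D k u) = scale (of_nat (Suc k)) (dpow D (Suc k) u)"
  by (simp add: dpow_def lin_scale del: of_nat_Suc)

lemma dexp_eq:
  assumes "lin D" "(D ^^ n) u = 0"
  shows "dexp D u = (\<Sum>k<n. dpow D k u)"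
proof -
  let ?m = "LEAST n. (D ^^ n) u = 0"
  have "(D ^^ ?m) u = 0" using assms(2) by (rule LeastI)
  moreover have "?m \<le> n" using assms(2) by (rule Least_le)
  ultimately show ?thesis
    unfolding dexp_def using assms(1)
    by (intro sum.mono_neutral_left) (auto simp: dpow_0_iff not_less intro: funpow_0_mono)
qed

lemma loc_nilpotentE:
  assumes "loc_nilpotent D"
  obtains n where "\<And>m. m \<ge> n \<Longrightarrow> (D ^^ m) u = 0"
  using assms funpow_0_mono unfolding loc_nilpotent_def by metis

lemma lin_dexp:
  assumes D: "loc_nilpotent D"
  shows "lin (dexp D)"
  unfolding lin_def
proof (intro conjI allI)
  note l = loc_nilpotent_lin[OF D]
  fix x y c
  obtain n where n: "\<And>m. m \<ge> n \<Longrightarrow> (D ^^ m) x = 0" using loc_nilpotentE[OF D] by metis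
  obtain n' where n': "\<And>m. m \<ge> n' \<Longrightarrow> (D ^^ m) y = 0" using loc_nilpotentE[OF D] by metis
  have z: "(D ^^ max n n') x = 0" "(D ^^ max n n') y = 0" using n n' by auto
  moreover have "(D ^^ max n n') (x + y) = 0" "(D ^^ max n n') (scale c x) = 0"
    using z lin_funpow[OF l] by (simp_all add: lin_def)
  ultimately show "dexp D (x + y) = dexp D x + dexp D y" "dexp D (scale c x) = scale c (dexp D x)"
    using lin_dpow[OF l]
    by (simp_all add: dexp_eq[OF l, of "max n n'"] lin_def sum.distrib scale_sum_right)
qed

text \<open>The product b is any bilinear map and the three operators may differ. With D = S = T
  this is the Leibniz rule for a derivation; with left and right multiplications it yields the
  formulas for conjugation and for moving a divided power past an element. The induction step proves
  n + 1 times the claim: the coefficients i and n + 1 - i of a term add up to n + 1.\<close>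

lemma dpow_leibniz:
  assumes l: "lin D" "lin S" "lin T"
    and b: "\<And>u. lin (b u)" "\<And>v. lin (\<lambda>u. b u v)"
    and der: "\<And>u v. D (b u v) = b (S u) v + b u (T v)"
  shows "dpow D n (b u v) = (\<Sum>i\<le>n. b (dpow S i u) (dpow T (n - i) v))"
proof (induction n)
  case 0
  then show ?case by simp
next
  case (Suc n)
  let ?f = "\<lambda>i. b (dpow S i u) (dpow T (Suc n - i) v)"
  have "scale (of_nat (Suc n)) (dpow D (Suc n) (b u v)) = D (dpow D n (b u v))"
    by (simp only: dpow_Suc[OF l(1)])
  also have "\<dots> = (\<Sum>i\<le>n. scale (of_nat (Suc i)) (?f (Suc i)) + scale (of_nat (Suc (n - i))) (?f i))"
    unfolding Suc.IH lin_sum[OF l(1)] der dpow_Suc[OF l(2)] dpow_Suc[OF l(3)]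
    by (intro sum.cong refl) (simp add: lin_scale[OF b(1)] lin_scale[OF b(2)] Suc_diff_le del: of_nat_Suc)
  also have "\<dots> = (\<Sum>i\<le>n. scale (of_nat (Suc i)) (?f (Suc i))) + (\<Sum>i\<le>n. scale (of_nat (Suc n - i)) (?f i))"
    by (simp add: sum.distrib Suc_diff_le)
  also have "(\<Sum>i\<le>n. scale (of_nat (Suc i)) (?f (Suc i))) = (\<Sum>i\<le>Suc n. scale (of_nat i) (?f i))"
    by (subst sum.atMost_Suc_shift) simp
  also have "(\<Sum>i\<le>n. scale (of_nat (Suc n - i)) (?f i)) = (\<Sum>i\<le>Suc n. scale (of_nat (Suc n - i)) (?f i))"
    by simp
  also have "(\<Sum>i\<le>Suc n. scale (of_nat i) (?f i)) + (\<Sum>i\<le>Suc n. scale (of_nat (Suc n - i)) (?f i))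
      = (\<Sum>i\<le>Suc n. scale (of_nat (Suc n)) (?f i))"
    unfolding sum.distrib[symmetric] scale_left_distrib[symmetric] of_nat_add[symmetric]
    by (intro sum.cong refl) (simp del: of_nat_Suc of_nat_diff)
  also have "\<dots> = scale (of_nat (Suc n)) (\<Sum>i\<le>Suc n. ?f i)"
    by (simp only: scale_sum_right)
  finally show ?case
    by (metis nat.distinct(1) of_nat_eq_0_iff scale_cancel_left)
qed

lemma dexp_product:
  assumes D: "loc_nilpotent D" and b: "\<And>u. lin (b u)" "\<And>v. lin (\<lambda>u. b u v)"
    and der: "\<And>u v. D (b u v) = b (D u) v + b u (D v)"
  shows "dexp D (b u v) = b (dexp D u) (dexp D v)"
proof -
  note l = loc_nilpotent_lin[OF D]
  note L = dpow_leibniz[where b = b, OF l l l b der]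
  obtain n where n: "\<And>m. m \<ge> n \<Longrightarrow> (D ^^ m) u = 0" using loc_nilpotentE[OF D] by metis
  obtain n' where n': "\<And>m. m \<ge> n' \<Longrightarrow> (D ^^ m) v = 0" using loc_nilpotentE[OF D] by metis
  have z: "b (dpow D i u) (dpow D j v) = 0" if "i \<ge> n \<or> j \<ge> n'" for i j
    using that n n' dpow_0_iff lin_0[OF b(1)] lin_0[OF b(2)] by metis
  have "dpow D m (b u v) = 0" if "m \<ge> n + n'" for m
    unfolding L by (intro sum.neutral ballI z) (use that in auto)
  then have "dexp D (b u v) = (\<Sum>m<n + n'. \<Sum>i\<le>m. b (dpow D i u) (dpow D (m - i) v))"
    using dexp_eq[OF l, of "n + n'" "b u v"] by (simp add: L flip: dpow_0_iff)
  also have "\<dots> = (\<Sum>(i, j)\<in>{(i, j). i + j < n + n'}. b (dpow D i u) (dpow D j v))"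
    by (rule sum.triangle_reindex[symmetric])
  \<comment> \<open>The rectangle lies inside the triangle, and a term outside it has i \<ge> n or j
    \<ge> n', so it vanishes.\<close>
  also have "\<dots> = (\<Sum>(i, j)\<in>{..<n} \<times> {..<n'}. b (dpow D i u) (dpow D j v))"
  proof (rule sum.mono_neutral_right)
    show "finite {(i, j). i + j < n + n'}"
      by (rule finite_subset[of _ "{..n + n'} \<times> {..n + n'}"]) auto
    show "\<forall>i\<in>{(i, j). i + j < n + n'} - {..<n} \<times> {..<n'}. (case i of (i, j) \<Rightarrow> b (dpow D i u) (dpow D j v)) = 0"
      using z by auto (meson leI)+
  qed auto
  also have "\<dots> = b (\<Sum>i<n. dpow D i u) (\<Sum>j<n'. dpow D j v)"
    by (simp add: sum.cartesian_product[symmetric] lin_sum[OF b(1)] lin_sum[OF b(2)])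
      (rule sum.swap)
  also have "\<dots> = b (dexp D u) (dexp D v)"
    using dexp_eq[OF l] n n' by (metis order_refl)
  finally show ?thesis .
qed

lemma funpow_dpow: "lin D \<Longrightarrow> (D ^^ m) (dpow D k u) = dpow D k ((D ^^ m) u)"
  unfolding dpow_def lin_scale[OF lin_funpow] by (metis add.commute comp_apply funpow_add)

text \<open>Sorted by total degree m, the double sum has as its coefficient in degree m the
  alternating sum of the binomials of m, which is zero unless m = 0.\<close>

lemma dexp_neg:
  assumes D: "loc_nilpotent D"
  shows "dexp (\<lambda>u. - D u) (dexp D u) = u"
proof -
  note l = loc_nilpotent_lin[OF D]
  obtain n where n: "\<And>m. m \<ge> n \<Longrightarrow> (D ^^ m) u = 0" using loc_nilpotentE[OF D] by metis
  have 1: "dexp D u = (\<Sum>k<n. dpow D k u)"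
    using dexp_eq[OF l] n by simp
  have z: "dpow D i (dpow D j u) = 0" if "i \<ge> n \<or> j \<ge> n" for i j
    using that n funpow_dpow[OF l, of i j u] lin_0[OF lin_dpow[OF l]] dpow_0_iff by metis
  have 2: "((\<lambda>u. - D u) ^^ n) (dexp D u) = 0"
    unfolding 1 funpow_neg[OF l] lin_sum[OF lin_funpow[OF l]]
    by (simp add: funpow_dpow[OF l] n lin_0[OF lin_dpow[OF l]])
  have "dexp (\<lambda>u. - D u) (dexp D u) = (\<Sum>i<n. \<Sum>k<n. scale ((-1) ^ i) (dpow D i (dpow D k u)))"
    unfolding dexp_eq[OF lin_neg[OF l] 2] unfolding 1
    by (simp add: dpow_neg[OF l] lin_sum[OF lin_dpow[OF l]] scale_sum_right)
  also have "\<dots> = (\<Sum>(i, k)\<in>{..<n} \<times> {..<n}. scale ((-1) ^ i) (dpow D i (dpow D k u)))"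
    by (simp add: sum.cartesian_product)
  also have "\<dots> = (\<Sum>(i, k)\<in>{(i, k). i + k < n + n}. scale ((-1) ^ i) (dpow D i (dpow D k u)))"
  proof (rule sum.mono_neutral_left)
    show "finite {(i, j). i + j < n + n}"
      by (rule finite_subset[of _ "{..n + n} \<times> {..n + n}"]) auto
    show "\<forall>i\<in>{(i, j). i + j < n + n} - {..<n} \<times> {..<n}. (case i of (i, k) \<Rightarrow> scale ((-1) ^ i) (dpow D i (dpow D k u))) = 0"
      using z by auto (meson leI)+
  qed auto
  also have "\<dots> = (\<Sum>m<n + n. \<Sum>i\<le>m. scale ((-1) ^ i) (dpow D i (dpow D (m - i) u)))"
    by (rule sum.triangle_reindex)
  also have "\<dots> = (\<Sum>m<n + n. if m = 0 then u else 0)"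
  proof (intro sum.cong refl)
    fix m
    have "(\<Sum>i\<le>m. scale ((-1) ^ i) (dpow D i (dpow D (m - i) u)))
        = (\<Sum>i\<le>m. scale ((-1) ^ i * of_nat (m choose i)) (dpow D m u))"
    proof (intro sum.cong refl)
      fix i assume "i \<in> {..m}"
      then have "(D ^^ i) ((D ^^ (m - i)) u) = (D ^^ m) u"
        by (metis atMost_iff comp_apply funpow_add le_add_diff_inverse)
      then show "scale ((-1) ^ i) (dpow D i (dpow D (m - i) u)) = scale ((-1) ^ i * of_nat (m choose i)) (dpow D m u)"
        using \<open>i \<in> {..m}\<close> by (simp add: dpow_def lin_scale[OF lin_funpow[OF l]] binomial_fact field_simps)
    qed
    also have "\<dots> = scale (\<Sum>i\<le>m. (-1) ^ i * of_nat (m choose i)) (dpow D m u)"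
      by (simp add: scale_sum_left)
    also have "\<dots> = (if m = 0 then u else 0)"
      using choose_alternating_sum[of m, where 'a = complex] by simp
    finally show "(\<Sum>i\<le>m. scale ((-1) ^ i) (dpow D i (dpow D (m - i) u))) = (if m = 0 then u else 0)" .
  qed
  also have "\<dots> = u"
  \<comment> \<open>For n = 0 the outer sum is empty, but then u itself is zero.\<close>
  proof (cases "n = 0")
    case True
    then have "u = 0" using n[of 0] by simp
    then show ?thesis by simp
  qed (simp add: sum.delta)
  finally show ?thesis .
qed

lemma dexp_neg':
  assumes D: "loc_nilpotent D"
  shows "dexp D (dexp (\<lambda>u. - D u) u) = u"
  using dexp_neg[OF loc_nilpotent_neg[OF D]] by simp

end

text \<open>Only D has to be locally nilpotent: if D kills u in n steps, D' kills f u in n steps.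
  This carries exponentials from a Lie algebra to its enveloping algebra, and from loops to their
  coefficients.\<close>

lemma dexp_intertwine:
  assumes "complex_space s1" "complex_space s2"
    and D: "complex_space.loc_nilpotent s1 D" and D': "complex_space.lin s2 D'"
    and f: "\<And>x y. f (x + y) = f x + f y" "\<And>c x. f (s1 c x) = s2 c (f x)"
    and eq: "\<And>x. f (D x) = D' (f x)"
  shows "f (complex_space.dexp s1 D u) = complex_space.dexp s2 D' (f u)"
proof -
  interpret v1: complex_space s1 by fact
  interpret v2: complex_space s2 by fact
  have f0: "f 0 = 0" using f(1)[of 0 0] by simp
  have fs: "f (sum g A) = (\<Sum>i\<in>A. f (g i))" for g and A :: "nat set"
    by (induction A rule: infinite_finite_induct) (simp_all add: f0 f)
  obtain n where n: "(D ^^ n) u = 0" using D by (auto simp: v1.loc_nilpotent_def)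
  have p: "f ((D ^^ k) u) = (D' ^^ k) (f u)" for k
    by (induction k) (simp_all add: eq)
  have "(D' ^^ n) (f u) = 0" using p[of n] n f0 by simp
  then show ?thesis
    using v1.dexp_eq[OF v1.loc_nilpotent_lin[OF D] n] v2.dexp_eq[OF D'] p
    by (simp add: fs v1.dpow_def v2.dpow_def f(2))
qed


section \<open>Enveloping algebras\<close>

lemma uea_const_add: "uea_const (c + d) = uea_const c + uea_const d"
  by transfer (simp add: single_add uea_ideal.zero)

lemma uea_const_mult: "uea_const (c * d) = uea_const c * uea_const d"
  by transfer (simp add: mult_single uea_ideal.zero)

lemma uea_const_1 [simp]: "uea_const 1 = 1"
  by transfer (simp add: uea_ideal.zero)

lemma uea_const_0 [simp]: "uea_const 0 = 0"
  using uea_const_add[of 0 0] by simp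

lemma uea_const_commute: "u * uea_const c = uea_const c * u"
proof transfer
  fix p :: "'a free_alg" and c
  have "p * free_const c = free_const c * p"
    by (induction p rule: poly_mapping_add_induct)
      (simp_all add: mult_single distrib_left distrib_right mult.commute)
  then show "p * free_const c - free_const c * p \<in> uea_ideal"
    by (simp add: uea_ideal.zero)
qed

lemma uea_const_left_commute: "u * (uea_const c * v) = uea_const c * (u * v)"
  by (metis mult.assoc uea_const_commute)

lemma uea_const_uminus: "uea_const (- c) = - uea_const c"
  using uea_const_add[of c "- c"] by (simp add: eq_neg_iff_add_eq_0 add.commute)

lemma uea_const_of_nat: "uea_const (of_nat n) = of_nat n"
  by (induction n) (simp_all add: uea_const_add)

lemma uea_const_of_int: "uea_const (of_int n) = of_int n"
  by (cases n) (simp_all add: uea_const_of_nat uea_const_uminus flip: of_nat_Suc)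

lemma uea_const_neg_1_power: "uea_const ((-1) ^ n) = (-1) ^ n"
  by (induction n) (simp_all add: uea_const_uminus)

lemma uea_gen_add: "uea_gen (x + y) = uea_gen x + uea_gen y"
  by transfer (metis uea_ideal.add_rel diff_diff_eq)

lemma uea_gen_scaleC: "uea_gen (c *\<^sub>C x) = uea_const c * uea_gen x"
  by transfer (rule uea_ideal.scale_rel)

lemma uea_gen_lie: "uea_gen x * uea_gen y - uea_gen y * uea_gen x = uea_gen (lie x y)"
  by transfer (rule uea_ideal.lie_rel)

lemma uea_gen_0 [simp]: "uea_gen 0 = 0"
  using uea_gen_add[of 0 0] by simp

lemma uea_gen_uminus: "uea_gen (- x) = - uea_gen x"
  using uea_gen_add[of x "- x"] by (simp add: eq_neg_iff_add_eq_0 add.commute)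

global_interpretation uvs: complex_space "\<lambda>c u. uea_const c * (u :: 'l::complex_lie_algebra uea)"
  by unfold_locales
    (simp_all add: distrib_left distrib_right uea_const_add uea_const_mult mult.assoc)

global_interpretation lvs: complex_space "scaleC :: complex \<Rightarrow> 'l::complex_lie_algebra \<Rightarrow> 'l"
  by unfold_locales

lemma uea_induct [case_names gen const add mult]:
  assumes gen: "\<And>x. P (uea_gen x)" and const: "\<And>c. P (uea_const c)"
    and add: "\<And>u v. P u \<Longrightarrow> P v \<Longrightarrow> P (u + v)" and mult: "\<And>u v. P u \<Longrightarrow> P v \<Longrightarrow> P (u * v)"
  shows "P (u :: 'l::complex_lie_algebra uea)"
proof -
  have word: "P (abs_uea (Poly_Mapping.single (FWord ws) c))" for ws :: "'l list" and c
  proof (induction ws)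
    case Nil
    have "abs_uea (Poly_Mapping.single (FWord []) c) = (uea_const c :: 'l uea)"
      by (simp add: uea_const.abs_eq zero_fword_def)
    then show ?case using const by simp
  next
    case (Cons w ws)
    have "abs_uea (Poly_Mapping.single (FWord (w # ws)) c) = uea_gen w * abs_uea (Poly_Mapping.single (FWord ws) c)"
      by (simp add: uea_gen.abs_eq times_uea.abs_eq mult_single plus_fword_def)
    then show ?case using Cons gen mult by simp
  qed
  have "P (abs_uea p)" for p
  proof (induction p rule: poly_mapping_add_induct)
    case zero
    show ?case using const[of 0, unfolded uea_const_0] unfolding zero_uea_def by simp
  next
    case (single k v)
    show ?case by (cases k) (simp add: word)
  next
    case (add f g)
    then show ?case using assms(3) by (metis plus_uea.abs_eq)
  qed
  then have "P (abs_uea (rep_uea u))" .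
  then show ?thesis by (simp only: Quotient_abs_rep[OF Quotient_uea])
qed

section \<open>The adjoint action on the enveloping algebra and its exponential\<close>

definition ad_gen :: "'l::complex_lie_algebra \<Rightarrow> 'l uea \<Rightarrow> 'l uea" where
  "ad_gen x u = uea_gen x * u - u * uea_gen x"

lemma ad_gen_mult: "ad_gen x (u * v) = ad_gen x u * v + u * ad_gen x v"
  by (simp add: ad_gen_def algebra_simps)

lemma ad_gen_gen: "ad_gen x (uea_gen y) = uea_gen (lie x y)"
  by (simp add: ad_gen_def uea_gen_lie)

lemma ad_gen_const: "ad_gen x (uea_const c) = 0"
  by (simp add: ad_gen_def uea_const_commute)

lemma lin_mult_right: "uvs.lin (\<lambda>v. u * v)"
  by (simp add: uvs.lin_def distrib_left uea_const_left_commute)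

lemma lin_mult_left: "uvs.lin (\<lambda>u. u * v)"
  by (simp add: uvs.lin_def distrib_right mult.assoc)

lemma lin_ad_gen: "uvs.lin (ad_gen x)"
  by (simp add: uvs.lin_def ad_gen_def distrib_left distrib_right right_diff_distrib uea_const_left_commute mult.assoc)

lemmas ad_gen_leibniz = uvs.dpow_leibniz[where b = "(*)", OF lin_ad_gen lin_ad_gen lin_ad_gen lin_mult_right lin_mult_left ad_gen_mult]

lemma lin_lie: "lvs.lin (lie x)"
  by (simp add: lvs.lin_def lie_add_right lie_scaleC_right)

lemma lie_uminus_left: "lie (- x) y = - lie x (y :: 'l::complex_lie_algebra)"
  using lie_add_left[of x "- x" y] by (simp add: eq_neg_iff_add_eq_0 add.commute)

lemma ad_gen_funpow_gen: "(ad_gen x ^^ n) (uea_gen y) = uea_gen ((lie x ^^ n) y)"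
  by (induction n) (simp_all add: ad_gen_gen)

text \<open>By the Leibniz rule the elements killed by some power of a derivation form a subalgebra,
  and this one contains the generators. For a product, every summand of degree n + m applies at
  least n derivations to u or at least m to v.\<close>

lemma loc_nilpotent_ad_gen:
  assumes "lvs.loc_nilpotent (lie x)"
  shows "uvs.loc_nilpotent (ad_gen x)"
  unfolding uvs.loc_nilpotent_def
proof (intro conjI allI)
  fix u
  show "\<exists>n. (ad_gen x ^^ n) u = 0"
  proof (induction u rule: uea_induct)
    case (gen y)
    then show ?case
      using assms by (metis ad_gen_funpow_gen lvs.loc_nilpotent_def uea_gen_0)
  next
    case (const c)
    then show ?case by (auto intro!: exI[of _ 1] simp: ad_gen_const)
  next
    case (add u v)
    then obtain n m where "(ad_gen x ^^ n) u = 0" "(ad_gen x ^^ m) v = 0" by blast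
    then have "(ad_gen x ^^ max n m) u = 0" "(ad_gen x ^^ max n m) v = 0"
      by (auto intro: uvs.funpow_0_mono[OF lin_ad_gen])
    then have "(ad_gen x ^^ max n m) (u + v) = 0"
      by (simp add: uvs.lin_add[OF uvs.lin_funpow[OF lin_ad_gen]])
    then show ?case by blast
  next
    case (mult u v)
    then obtain n m where nm: "(ad_gen x ^^ n) u = 0" "(ad_gen x ^^ m) v = 0" by blast
    have "uvs.dpow (ad_gen x) (n + m) (u * v) = 0"
      unfolding ad_gen_leibniz
    proof (intro sum.neutral ballI)
      fix i assume "i \<in> {..n + m}"
      then have "i \<ge> n \<or> n + m - i \<ge> m" by auto
      then have "uvs.dpow (ad_gen x) i u = 0 \<or> uvs.dpow (ad_gen x) (n + m - i) v = 0"
        unfolding uvs.dpow_0_iff using uvs.funpow_0_mono[OF lin_ad_gen] nm by blast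
      then show "uvs.dpow (ad_gen x) i u * uvs.dpow (ad_gen x) (n + m - i) v = 0" by auto
    qed
    then show ?case using uvs.dpow_0_iff by blast
  qed
qed (rule lin_ad_gen)

text \<open>A relation between two given maps, so that no universal property has to be constructed:
  only exponentials and their composites occur, and these exist on both levels.\<close>

definition uea_ext :: "('l::complex_lie_algebra \<Rightarrow> 'l) \<Rightarrow> ('l uea \<Rightarrow> 'l uea) \<Rightarrow> bool" where
  "uea_ext \<theta> \<Phi> \<longleftrightarrow> (\<forall>u v. \<Phi> (u + v) = \<Phi> u + \<Phi> v) \<and> (\<forall>u v. \<Phi> (u * v) = \<Phi> u * \<Phi> v) \<and>
     (\<forall>c. \<Phi> (uea_const c) = uea_const c) \<and> (\<forall>y. \<Phi> (uea_gen y) = uea_gen (\<theta> y))"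

lemma uea_extD:
  assumes "uea_ext \<theta> \<Phi>"
  shows "\<Phi> (u + v) = \<Phi> u + \<Phi> v" "\<Phi> (u * v) = \<Phi> u * \<Phi> v" "\<Phi> (uea_const c) = uea_const c"
    "\<Phi> (uea_gen y) = uea_gen (\<theta> y)" "\<Phi> 0 = 0" "\<Phi> 1 = 1" "\<Phi> (- u) = - \<Phi> u" "\<Phi> (u - v) = \<Phi> u - \<Phi> v"
proof -
  note a = assms[unfolded uea_ext_def]
  show "\<Phi> (u + v) = \<Phi> u + \<Phi> v" "\<Phi> (u * v) = \<Phi> u * \<Phi> v" "\<Phi> (uea_const c) = uea_const c"
    "\<Phi> (uea_gen y) = uea_gen (\<theta> y)" using a by auto
  show "\<Phi> 1 = 1" using a by (metis uea_const_1)
  show 0: "\<Phi> 0 = 0" using a by (metis uea_const_0)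
  have neg: "\<Phi> (- u) = - \<Phi> u" for u
    using a 0 by (metis add.right_inverse add_eq_0_iff)
  then show "\<Phi> (- u) = - \<Phi> u" .
  show "\<Phi> (u - v) = \<Phi> u - \<Phi> v" using a neg by (metis uminus_add_conv_diff add.commute)
qed

lemma uea_ext_id: "uea_ext id id"
  by (simp add: uea_ext_def)

lemma uea_ext_comp: "uea_ext \<theta> \<Phi> \<Longrightarrow> uea_ext \<theta>' \<Phi>' \<Longrightarrow> uea_ext (\<theta> \<circ> \<theta>') (\<Phi> \<circ> \<Phi>')"
  by (simp add: uea_ext_def)

lemma uea_ext_divided_power: "uea_ext \<theta> \<Phi> \<Longrightarrow> \<Phi> (divided_power u k) = divided_power (\<Phi> u) k"
proof -
  assume a: "uea_ext \<theta> \<Phi>"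
  have "\<Phi> (u ^ k) = \<Phi> u ^ k" by (induction k) (simp_all add: uea_extD[OF a])
  then show ?thesis by (simp add: divided_power_def uea_extD[OF a])
qed

lemma uea_ext_binomial: "uea_ext \<theta> \<Phi> \<Longrightarrow> \<Phi> (uea_binomial u k) = uea_binomial (\<Phi> u) k"
proof -
  assume a: "uea_ext \<theta> \<Phi>"
  have "\<Phi> (of_nat n) = of_nat n" for n
    by (induction n) (simp_all add: uea_extD[OF a])
  then have "\<Phi> (prod_list (map (\<lambda>j. u - of_nat j) ns)) = prod_list (map (\<lambda>j. \<Phi> u - of_nat j) ns)" for ns
    by (induction ns) (simp_all add: uea_extD[OF a])
  then show ?thesis by (simp add: uea_binomial_def uea_extD[OF a])
qed

lemma uea_ext_uea_sub:
  assumes "uea_ext \<theta> \<Phi>" "u \<in> uea_sub S"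
  shows "\<Phi> u \<in> uea_sub (\<theta> ` S)"
  using assms(2)
  by induction (auto simp: uea_extD[OF assms(1)] intro: uea_sub.intros)

lemma counit_const [simp]: "counit (uea_const c) = c"
  by transfer simp

lemma counit_gen [simp]: "counit (uea_gen x) = 0"
  by transfer (simp add: lookup_single fword_neq_0 when_def)

lemma counit_add: "counit (u + v) = counit u + counit v"
  by transfer (simp add: lookup_add)

lemma counit_mult: "counit (u * v) = counit u * counit v"
  by transfer (rule lookup_mult_0)

lemma counit_1 [simp]: "counit 1 = 1"
  using counit_const[of 1] by simp

lemma counit_divided_power: "counit (divided_power (uea_gen x) k) = (if k = 0 then 1 else 0)"
proof -
  have "counit (uea_gen x ^ k) = 0 ^ k"
    by (induction k) (simp_all add: counit_mult)
  then show ?thesis by (simp add: divided_power_def counit_mult)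
qed

lemma uea_ext_counit: "uea_ext \<theta> \<Phi> \<Longrightarrow> counit (\<Phi> u) = counit u"
  by (induction u rule: uea_induct) (simp_all add: uea_extD counit_add counit_mult)

lemma uea_ext_dexp:
  assumes "lvs.loc_nilpotent (lie x)"
  shows "uea_ext (lvs.dexp (lie x)) (uvs.dexp (ad_gen x))"
  unfolding uea_ext_def
proof (intro conjI allI)
  note n = loc_nilpotent_ad_gen[OF assms]
  show "uvs.dexp (ad_gen x) (u + v) = uvs.dexp (ad_gen x) u + uvs.dexp (ad_gen x) v" for u v
    by (rule uvs.lin_add[OF uvs.lin_dexp[OF n]])
  show "uvs.dexp (ad_gen x) (u * v) = uvs.dexp (ad_gen x) u * uvs.dexp (ad_gen x) v" for u v
    by (rule uvs.dexp_product[where b = "(*)", OF n lin_mult_right lin_mult_left ad_gen_mult])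
  show "uvs.dexp (ad_gen x) (uea_const c) = uea_const c" for c
    using uvs.dexp_eq[OF lin_ad_gen, of 1 x "uea_const c"] by (simp add: ad_gen_const)
  show "uvs.dexp (ad_gen x) (uea_gen y) = uea_gen (lvs.dexp (lie x) y)" for y
    by (rule dexp_intertwine[symmetric])
      (simp_all add: lvs.complex_space_axioms uvs.complex_space_axioms assms lin_ad_gen uea_gen_add uea_gen_scaleC ad_gen_gen)
qed

lemma dexp_ad_gen_inverse:
  assumes "lvs.loc_nilpotent (lie x)"
  shows "uvs.dexp (ad_gen (- x)) (uvs.dexp (ad_gen x) u) = u" "uvs.dexp (ad_gen x) (uvs.dexp (ad_gen (- x)) u) = u"
proof -
  have "ad_gen (- x) = (\<lambda>u. - ad_gen x u)"
    by (simp add: ad_gen_def uea_gen_uminus fun_eq_iff)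
  then show "uvs.dexp (ad_gen (- x)) (uvs.dexp (ad_gen x) u) = u" "uvs.dexp (ad_gen x) (uvs.dexp (ad_gen (- x)) u) = u"
    using uvs.dexp_neg uvs.dexp_neg' loc_nilpotent_ad_gen[OF assms] by auto
qed

subsection \<open>Divided powers\<close>

lemma divided_power_0 [simp]: "divided_power u 0 = 1"
  by (simp add: divided_power_def)

lemma divided_power_1 [simp]: "divided_power u (Suc 0) = u"
  by (simp add: divided_power_def)

lemma divided_power_uminus: "divided_power (- u) k = (-1) ^ k * divided_power u k"
  unfolding divided_power_def
  by (subst power_minus) (metis uea_const_left_commute)

lemma divided_power_mult: "divided_power u i * divided_power u j = of_nat ((i + j) choose i) * divided_power u (i + j)"
proof -
  have "divided_power u i * divided_power u j = uea_const (1 / fact i * (1 / fact j)) * u ^ (i + j)"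
    by (simp add: divided_power_def power_add uea_const_mult mult.assoc uea_const_left_commute[of "u ^ i"])
  also have "1 / fact i * (1 / fact j) = of_nat ((i + j) choose i) * (1 / fact (i + j) :: complex)"
    by (simp add: binomial_fact)
  finally show ?thesis
    by (simp only: divided_power_def uea_const_mult uea_const_of_nat mult.assoc)
qed

lemma dpow_mult_right: "uvs.dpow (\<lambda>v. u * v) k v = divided_power u k * v"
proof -
  have "((\<lambda>v. u * v) ^^ k) v = u ^ k * v"
    by (induction k) (simp_all add: mult.assoc)
  then show ?thesis by (simp add: uvs.dpow_def divided_power_def mult.assoc)
qed

lemma dpow_mult_left: "uvs.dpow (\<lambda>v. v * u) k v = v * divided_power u k"
proof -
  have "((\<lambda>v. v * u) ^^ k) v = v * u ^ k"
    by (induction k) (simp_all add: mult.assoc flip: power_Suc2)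
  then show ?thesis by (simp add: uvs.dpow_def divided_power_def uea_const_left_commute)
qed

text \<open>\<open>ad_gen x\<close> is the sum of left multiplication by x and right multiplication
  by -x; this is the Leibniz formula for these two at v = 1.\<close>

lemma dpow_ad_gen:
  "uvs.dpow (ad_gen x) n u = (\<Sum>i\<le>n. divided_power (uea_gen x) i * u * divided_power (- uea_gen x) (n - i))"
  using uvs.dpow_leibniz[where b = "(*)" and D = "ad_gen x" and S = "\<lambda>v. uea_gen x * v" and T = "\<lambda>v. v * (- uea_gen x)"
      and u = u and v = 1 and n = n, OF lin_ad_gen lin_mult_right lin_mult_left lin_mult_right lin_mult_left]
  by (simp add: ad_gen_def dpow_mult_left[of "- uea_gen x", simplified] dpow_mult_right mult.assoc)

text \<open>Left multiplication by x on u * v is \<open>ad_gen x\<close> on u plus left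
  multiplication by x on v; the Leibniz formula is applied at v = 1.\<close>

lemma divided_power_commutation:
  "divided_power (uea_gen x) n * u = (\<Sum>i\<le>n. uvs.dpow (ad_gen x) i u * divided_power (uea_gen x) (n - i))"
  using uvs.dpow_leibniz[where b = "(*)" and D = "\<lambda>v. uea_gen x * v" and S = "ad_gen x" and T = "\<lambda>v. uea_gen x * v"
      and u = u and v = 1 and n = n, OF lin_mult_right lin_ad_gen lin_mult_right lin_mult_right lin_mult_left]
  by (simp add: ad_gen_def dpow_mult_right algebra_simps)

text \<open>With \<open>N\<close> so large that the divided powers of \<open>x\<close> from \<open>N\<close> on lie in a left ideal, this
  says that multiplication by the exponential of \<open>x\<close> intertwines modulo that ideal.\<close>

lemma divided_power_sum_commutation:
  assumes J: "\<And>i. i \<ge> J \<Longrightarrow> uvs.dpow (ad_gen x) i u = 0" and M: "J + N \<le> M"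
  shows "(\<Sum>k<M. divided_power (uea_gen x) k) * u =
    uvs.dexp (ad_gen x) u * (\<Sum>k<N. divided_power (uea_gen x) k) +
    (\<Sum>i<J. uvs.dpow (ad_gen x) i u * (\<Sum>j\<in>{N..<M - i}. divided_power (uea_gen x) j))"
proof -
  let ?d = "\<lambda>i. uvs.dpow (ad_gen x) i u" and ?p = "divided_power (uea_gen x)"
  have "(\<Sum>k<M. ?p k) * u = (\<Sum>k<M. \<Sum>i\<le>k. ?d i * ?p (k - i))"
    by (simp only: sum_distrib_right divided_power_commutation)
  also have "\<dots> = (\<Sum>(i, j)\<in>{(i, j). i + j < M}. ?d i * ?p j)"
    by (rule sum.triangle_reindex[symmetric])
  also have "{(i, j). i + j < M} = Sigma {..<M} (\<lambda>i. {..<M - i})"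
    by auto
  also have "(\<Sum>(i, j)\<in>Sigma {..<M} (\<lambda>i. {..<M - i}). ?d i * ?p j) = (\<Sum>i<M. \<Sum>j<M - i. ?d i * ?p j)"
    by (rule sum.Sigma[symmetric]) auto
  also have "\<dots> = (\<Sum>i<J. \<Sum>j<M - i. ?d i * ?p j)"
    by (rule sum.mono_neutral_right) (use J M in auto)
  also have "\<dots> = (\<Sum>i<J. ?d i * (\<Sum>k<N. ?p k) + ?d i * (\<Sum>j\<in>{N..<M - i}. ?p j))"
  proof (intro sum.cong refl)
    fix i assume "i \<in> {..<J}"
    \<comment> \<open>As i < J and J + N \<le> M, the truncation at M - i contains the one at
      N.\<close>
    then have "{..<M - i} = {..<N} \<union> {N..<M - i}" using M by auto
    then have "(\<Sum>j<M - i. ?p j) = (\<Sum>k<N. ?p k) + (\<Sum>j\<in>{N..<M - i}. ?p j)"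
      by (simp add: sum.union_disjoint ivl_disj_int)
    then show "(\<Sum>j<M - i. ?d i * ?p j) = ?d i * (\<Sum>k<N. ?p k) + ?d i * (\<Sum>j\<in>{N..<M - i}. ?p j)"
      by (simp add: sum_distrib_left[symmetric] distrib_left)
  qed
  also have "\<dots> = (\<Sum>i<J. ?d i) * (\<Sum>k<N. ?p k) + (\<Sum>i<J. ?d i * (\<Sum>j\<in>{N..<M - i}. ?p j))"
    by (simp add: sum.distrib sum_distrib_right)
  also have "(\<Sum>i<J. ?d i) = uvs.dexp (ad_gen x) u"
    using uvs.dexp_eq[OF lin_ad_gen, of J x u] J[of J] by (simp add: uvs.dpow_0_iff)
  finally show ?thesis .
qed

text \<open>Below degree N the product agrees with that of the full series of exp (-u) and exp u,
  hence is 1. The rest has degrees from N on and integral coefficients, so after extension of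
  scalars it lies in every left ideal that contains the divided powers from N on.\<close>

lemma divided_power_sum_inverse:
  assumes "N > 0"
  shows "\<exists>c :: nat \<Rightarrow> int. (\<Sum>k<N. divided_power (- u) k) * (\<Sum>k<N. divided_power u k) =
    1 + (\<Sum>k\<in>{N..<2 * N}. of_int (c k) * divided_power u k)"
proof -
  let ?p = "divided_power u"
  let ?f = "\<lambda>i j. of_int ((-1) ^ i * int ((i + j) choose i)) * ?p (i + j)"
  have "(\<Sum>k<N. divided_power (- u) k) * (\<Sum>k<N. ?p k) = (\<Sum>i<N. \<Sum>j<N. ?f i j)"
    unfolding sum_distrib_right sum_distrib_left
    by (subst sum.swap, intro sum.cong refl) (simp add: divided_power_uminus mult.assoc divided_power_mult)
  also have "\<dots> = (\<Sum>(i, j)\<in>{..<N} \<times> {..<N}. ?f i j)"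
    by (simp add: sum.cartesian_product)
  \<comment> \<open>The square of indices splits into the triangle of total degree below N and the
    opposite corner, whose degrees lie in {N..<2 * N}.\<close>
  also have "{..<N} \<times> {..<N} = {(i, j). i + j < N} \<union> (SIGMA i:{..<N}. {N - i..<N})"
    by auto
  also have "(\<Sum>(i, j)\<in>\<dots>. ?f i j) = (\<Sum>(i, j)\<in>{(i, j). i + j < N}. ?f i j) + (\<Sum>(i, j)\<in>(SIGMA i:{..<N}. {N - i..<N}). ?f i j)"
  proof (rule sum.union_disjoint)
    show "finite {(i, j). i + j < N}"
      by (rule finite_subset[of _ "{..N} \<times> {..N}"]) auto
  qed auto
  also have "(\<Sum>(i, j)\<in>{(i, j). i + j < N}. ?f i j) = (\<Sum>n<N. \<Sum>i\<le>n. ?f i (n - i))"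
    by (rule sum.triangle_reindex)
  also have "\<dots> = (\<Sum>n<N. if n = 0 then 1 else 0)"
  proof (intro sum.cong refl)
    fix n
    have "(\<Sum>i\<le>n. ?f i (n - i)) = (\<Sum>i\<le>n. of_int ((-1) ^ i * int (n choose i)) * ?p n)"
      by (intro sum.cong refl) simp
    also have "\<dots> = of_int (\<Sum>i\<le>n. (-1) ^ i * int (n choose i)) * ?p n"
      by (simp only: of_int_sum sum_distrib_right)
    also have "\<dots> = (if n = 0 then 1 else 0)"
    proof -
      have "(\<Sum>i\<le>n. (-1) ^ i * int (n choose i)) = (if n = 0 then 1 else 0)"
        using choose_alternating_sum[of n, where 'a = int] by simp
      then show ?thesis by (simp only:) simp
    qed
    finally show "(\<Sum>i\<le>n. ?f i (n - i)) = (if n = 0 then 1 else 0)" .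
  qed
  also have "\<dots> = 1" using assms by (simp add: sum.delta)
  also have "(\<Sum>(i, j)\<in>(SIGMA i:{..<N}. {N - i..<N}). ?f i j) =
      (\<Sum>k\<in>{N..<2 * N}. \<Sum>(i, j)\<in>{p \<in> (SIGMA i:{..<N}. {N - i..<N}). fst p + snd p = k}. ?f i j)"
    by (rule sum.group[symmetric]) auto
  also have "\<dots> = (\<Sum>k\<in>{N..<2 * N}. of_int (\<Sum>(i, j)\<in>{p \<in> (SIGMA i:{..<N}. {N - i..<N}). fst p + snd p = k}. (-1) ^ i * int (k choose i)) * ?p k)"
    by (intro sum.cong refl) (auto simp only: of_int_sum sum_distrib_right split_def intro!: sum.cong)
  finally show ?thesis
    by (intro exI[of _ "\<lambda>k. \<Sum>(i, j)\<in>{p \<in> (SIGMA i:{..<N}. {N - i..<N}). fst p + snd p = k}. (-1) ^ i * int (k choose i)"])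
qed

subsection \<open>Integral forms\<close>

lemma int_form_0: "0 \<in> int_form H X"
  using int_form.diff[OF int_form.one int_form.one] by simp

lemma int_form_uminus: "u \<in> int_form H X \<Longrightarrow> - u \<in> int_form H X"
  using int_form.diff[OF int_form_0] by fastforce

lemma int_form_add: "u \<in> int_form H X \<Longrightarrow> v \<in> int_form H X \<Longrightarrow> u + v \<in> int_form H X"
  using int_form.diff[OF _ int_form_uminus] by fastforce

lemma int_form_sum: "(\<And>i. i \<in> A \<Longrightarrow> f i \<in> int_form H X) \<Longrightarrow> sum f A \<in> int_form H X"
  by (induction A rule: infinite_finite_induct) (auto intro: int_form_0 int_form_add)

lemma int_form_neg_1_power: "(-1) ^ k \<in> int_form H X"
  by (induction k) (auto intro: int_form.one int_form_uminus)

lemma uea_sub_0: "0 \<in> uea_sub S"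
  using uea_sub.const[of 0] by simp

lemma uea_sub_1: "1 \<in> uea_sub S"
  using uea_sub.const[of 1] by simp

lemma uea_sub_uminus: "u \<in> uea_sub S \<Longrightarrow> - u \<in> uea_sub S"
  using uea_sub.diff[OF uea_sub_0] by fastforce

lemma uea_sub_add: "u \<in> uea_sub S \<Longrightarrow> v \<in> uea_sub S \<Longrightarrow> u + v \<in> uea_sub S"
  using uea_sub.diff[OF _ uea_sub_uminus] by fastforce

lemma uea_sub_sum: "(\<And>i. i \<in> A \<Longrightarrow> f i \<in> uea_sub S) \<Longrightarrow> sum f A \<in> uea_sub S"
  by (induction A rule: infinite_finite_induct) (auto intro: uea_sub_0 uea_sub_add)

lemma uea_sub_power: "u \<in> uea_sub S \<Longrightarrow> u ^ k \<in> uea_sub S"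
  by (induction k) (auto intro: uea_sub_1 uea_sub.mult)

lemma uea_sub_divided_power: "u \<in> uea_sub S \<Longrightarrow> divided_power u k \<in> uea_sub S"
  by (auto simp: divided_power_def intro: uea_sub.mult uea_sub.const uea_sub_power)

lemma uea_sub_mono: "S \<subseteq> T \<Longrightarrow> uea_sub S \<subseteq> uea_sub T"
proof
  fix u assume "S \<subseteq> T" "u \<in> uea_sub S"
  from this(2,1) show "u \<in> uea_sub T"
    by induction (auto intro: uea_sub.intros)
qed

definition subring_set :: "'u::ring_1 set \<Rightarrow> bool" where
  "subring_set A \<longleftrightarrow> 1 \<in> A \<and> (\<forall>u\<in>A. \<forall>v\<in>A. u - v \<in> A \<and> u * v \<in> A)"

lemma subring_setD:
  assumes "subring_set A"
  shows "1 \<in> A" "0 \<in> A" "u \<in> A \<Longrightarrow> - u \<in> A" "u \<in> A \<Longrightarrow> v \<in> A \<Longrightarrow> u - v \<in> A"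
    "u \<in> A \<Longrightarrow> v \<in> A \<Longrightarrow> u * v \<in> A" "u \<in> A \<Longrightarrow> v \<in> A \<Longrightarrow> u + v \<in> A" "of_int n \<in> A"
    "(\<And>i. i \<in> B \<Longrightarrow> f i \<in> A) \<Longrightarrow> sum f B \<in> A"
proof -
  note a = assms[unfolded subring_set_def]
  show 1: "1 \<in> A" using a by blast
  show 0: "0 \<in> A" using a by (metis diff_self)
  have neg: "u \<in> A \<Longrightarrow> - u \<in> A" for u using a 0 by (metis diff_0)
  then show "u \<in> A \<Longrightarrow> - u \<in> A" .
  show "u \<in> A \<Longrightarrow> v \<in> A \<Longrightarrow> u - v \<in> A" "u \<in> A \<Longrightarrow> v \<in> A \<Longrightarrow> u * v \<in> A" using a by blast+
  have add: "u \<in> A \<Longrightarrow> v \<in> A \<Longrightarrow> u + v \<in> A" for u v using a neg by (metis diff_minus_eq_add)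
  then show "u \<in> A \<Longrightarrow> v \<in> A \<Longrightarrow> u + v \<in> A" .
  have nat: "of_nat n \<in> A" for n by (induction n) (auto intro: 0 1 add)
  then show "of_int n \<in> A" using neg by (cases n) (auto simp del: of_nat_Suc)
  show "(\<And>i. i \<in> B \<Longrightarrow> f i \<in> A) \<Longrightarrow> sum f B \<in> A"
    by (induction B rule: infinite_finite_induct) (auto intro: 0 add)
qed

lemma subring_set_int_form: "subring_set (int_form_sub H X S)"
  by (auto simp: subring_set_def int_form_sub_def intro: int_form.intros uea_sub_1 uea_sub.intros)

lemma dpow_ad_gen_int_form:
  assumes "\<And>k. divided_power (uea_gen x) k \<in> int_form H X" "u \<in> int_form H X"
  shows "uvs.dpow (ad_gen x) n u \<in> int_form H X"
  unfolding dpow_ad_gen divided_power_uminus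
  by (intro int_form_sum int_form.mult assms int_form_neg_1_power)

lemma dpow_ad_gen_uea_sub:
  assumes "x \<in> S" "u \<in> uea_sub S"
  shows "uvs.dpow (ad_gen x) n u \<in> uea_sub S"
  unfolding dpow_ad_gen
  by (intro uea_sub_sum uea_sub.mult uea_sub_divided_power assms uea_sub.gen uea_sub_uminus)

lemma dexp_ad_gen_int_form:
  assumes "\<And>k. divided_power (uea_gen x) k \<in> int_form H X" "u \<in> int_form H X"
  shows "uvs.dexp (ad_gen x) u \<in> int_form H X"
  unfolding uvs.dexp_def by (intro int_form_sum dpow_ad_gen_int_form assms)

subsection \<open>Loop algebras\<close>

lemma lie_single:
  "lie (Poly_Mapping.single i u) (Poly_Mapping.single j v) = Poly_Mapping.single (i + j) (lie u v)"
  by (cases "u = 0"; cases "v = 0") (simp_all add: lie_poly_mapping_def)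

lemma scaleC_single: "c *\<^sub>C Poly_Mapping.single k v = Poly_Mapping.single k (c *\<^sub>C v)"
  by (rule poly_mapping_eqI) (simp add: scaleC_poly_mapping_def Poly_Mapping.map.rep_eq lookup_single when_def)

lemma lookup_scaleC: "Poly_Mapping.lookup (c *\<^sub>C f) k = c *\<^sub>C Poly_Mapping.lookup f k"
  by (simp add: scaleC_poly_mapping_def Poly_Mapping.map.rep_eq when_def)

text \<open>An element of degree zero does not mix powers of t; therefore its exponential acts on
  each coefficient separately.\<close>

lemma lookup_lie_single_0:
  "Poly_Mapping.lookup (lie (Poly_Mapping.single 0 x) f) r = lie x (Poly_Mapping.lookup f r)"
  by (induction f rule: poly_mapping_add_induct)
    (simp_all add: lie_single lookup_single when_def lie_add_right lookup_add)

lemma loc_nilpotent_lie_single: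
  fixes x :: "'g::complex_lie_algebra"
  assumes "lvs.loc_nilpotent (lie x)"
  shows "lvs.loc_nilpotent (lie (Poly_Mapping.single 0 x :: 'g loop))"
  unfolding lvs.loc_nilpotent_def
proof (intro conjI allI)
  fix f :: "'g loop"
  show "\<exists>n. (lie (Poly_Mapping.single 0 x) ^^ n) f = 0"
  proof (induction f rule: poly_mapping_add_induct)
    case zero
    show ?case by (rule exI[of _ 0]) simp
  next
    case (single k v)
    have "(lie (Poly_Mapping.single 0 x) ^^ n) (Poly_Mapping.single k v) = Poly_Mapping.single k ((lie x ^^ n) v)" for n
      by (induction n) (simp_all add: lie_single)
    moreover obtain n where "(lie x ^^ n) v = 0" using assms unfolding lvs.loc_nilpotent_def by blast
    ultimately have "(lie (Poly_Mapping.single 0 x) ^^ n) (Poly_Mapping.single k v) = 0" by simp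
    then show ?case by blast
  next
    case (add f g)
    then obtain n m where "(lie (Poly_Mapping.single 0 x) ^^ n) f = 0" "(lie (Poly_Mapping.single 0 x) ^^ m) g = 0" by blast
    then have "(lie (Poly_Mapping.single 0 x) ^^ max n m) f = 0" "(lie (Poly_Mapping.single 0 x) ^^ max n m) g = 0"
      by (auto intro: lvs.funpow_0_mono[OF lin_lie])
    then have "(lie (Poly_Mapping.single 0 x) ^^ max n m) (f + g) = 0"
      by (simp add: lvs.lin_add[OF lvs.lin_funpow[OF lin_lie]])
    then show ?case by blast
  qed
qed (rule lin_lie)

lemma lookup_dexp_lie_single:
  fixes x :: "'g::complex_lie_algebra" and f :: "'g loop"
  assumes "lvs.loc_nilpotent (lie x)"
  shows "Poly_Mapping.lookup (lvs.dexp (lie (Poly_Mapping.single 0 x)) f) r = lvs.dexp (lie x) (Poly_Mapping.lookup f r)"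
  by (rule dexp_intertwine[where f = "\<lambda>f. Poly_Mapping.lookup f r"])
    (simp_all add: lvs.complex_space_axioms loc_nilpotent_lie_single[OF assms] lin_lie lookup_add lookup_scaleC lookup_lie_single_0)

lemma lie_leibniz: "lie x (lie u v) = lie (lie x u) v + lie u (lie x (v :: 'l::complex_lie_algebra))"
  using jacobi[of x u v] lie_antisym[of v "lie x u"] lie_antisym[of v x] lvs.lin_uminus[OF lin_lie, of u "lie x v"]
  by (simp add: algebra_simps eq_neg_iff_add_eq_0)

lemma dexp_lie_product:
  assumes "lvs.loc_nilpotent (lie x)"
  shows "lvs.dexp (lie x) (lie u v) = lie (lvs.dexp (lie x) u) (lvs.dexp (lie x) v)"
proof (rule lvs.dexp_product[OF assms lin_lie])
  show "lvs.lin (\<lambda>u. lie u v)" for v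
    by (simp add: lvs.lin_def lie_add_left lie_scaleC_left)
qed (rule lie_leibniz)

lemma dexp_lie_inverse:
  assumes "lvs.loc_nilpotent (lie x)"
  shows "lvs.dexp (lie (- x)) (lvs.dexp (lie x) u) = u" "lvs.dexp (lie x) (lvs.dexp (lie (- x)) u) = u"
  using lvs.dexp_neg[OF assms] lvs.dexp_neg'[OF assms] by (simp_all add: lie_uminus_left[abs_def])

section \<open>Root space decomposition\<close>

lemma lie_uminus_right: "lie x (- y) = - lie x (y :: 'l::complex_lie_algebra)"
  by (rule lvs.lin_uminus[OF lin_lie])

lemma lie_sum_right: "lie x (sum f A) = (\<Sum>i\<in>A. lie x (f i :: 'l::complex_lie_algebra))"
  by (rule lvs.lin_sum[OF lin_lie])

section \<open>Lie algebra automorphisms, functionals on H and weight spaces\<close>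

definition lie_aut :: "('l::complex_lie_algebra \<Rightarrow> 'l) \<Rightarrow> bool" where
  "lie_aut \<theta> \<longleftrightarrow> lvs.lin \<theta> \<and> (\<forall>u v. \<theta> (lie u v) = lie (\<theta> u) (\<theta> v)) \<and> bij \<theta>"

lemma lie_aut_id: "lie_aut id"
  by (simp add: lie_aut_def lvs.lin_def)

lemma lie_aut_comp: "lie_aut \<theta> \<Longrightarrow> lie_aut \<eta> \<Longrightarrow> lie_aut (\<theta> \<circ> \<eta>)"
  by (auto simp: lie_aut_def lvs.lin_def intro: bij_comp)

lemma lie_autD:
  assumes "lie_aut \<theta>"
  shows "\<theta> (x + y) = \<theta> x + \<theta> y" "\<theta> (c *\<^sub>C x) = c *\<^sub>C \<theta> x" "\<theta> (lie x y) = lie (\<theta> x) (\<theta> y)"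
    "\<theta> 0 = 0" "\<theta> (- x) = - \<theta> x" "\<theta> x = 0 \<longleftrightarrow> x = 0" "\<theta> (x - y) = \<theta> x - \<theta> y" "\<theta> (sum f A) = (\<Sum>i\<in>A. \<theta> (f i))" "bij \<theta>"
proof -
  have l: "lvs.lin \<theta>" and b: "bij \<theta>" using assms by (auto simp: lie_aut_def)
  show "\<theta> (x + y) = \<theta> x + \<theta> y" "\<theta> (c *\<^sub>C x) = c *\<^sub>C \<theta> x" "\<theta> (lie x y) = lie (\<theta> x) (\<theta> y)" "bij \<theta>"
    using assms by (auto simp: lie_aut_def lvs.lin_def)
  show 0: "\<theta> 0 = 0" and "\<theta> (- x) = - \<theta> x" and "\<theta> (x - y) = \<theta> x - \<theta> y" and "\<theta> (sum f A) = (\<Sum>i\<in>A. \<theta> (f i))"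
    using lvs.lin_0[OF l] lvs.lin_uminus[OF l] lvs.lin_diff[OF l] lvs.lin_sum[OF l] by auto
  show "\<theta> x = 0 \<longleftrightarrow> x = 0" using b 0 by (metis bij_pointE)
qed

lemma lie_aut_dexp:
  assumes n: "lvs.loc_nilpotent (lie x)"
  shows "lie_aut (lvs.dexp (lie x))"
  unfolding lie_aut_def
proof (intro conjI allI)
  have "(\<lambda>u. - lie x u) = lie (- x)" by (simp add: lie_uminus_left fun_eq_iff)
  then have "lvs.dexp (lie (- x)) (lvs.dexp (lie x) u) = u" "lvs.dexp (lie x) (lvs.dexp (lie (- x)) u) = u" for u
    using lvs.dexp_neg[OF n] lvs.dexp_neg'[OF n] by auto
  then show "bij (lvs.dexp (lie x))" by (metis bijI')
qed (use n in \<open>auto intro: lvs.lin_dexp dexp_lie_product\<close>)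

lemma dual_spaceD:
  assumes "\<alpha> \<in> dual_space H"
  shows "x \<in> H \<Longrightarrow> y \<in> H \<Longrightarrow> \<alpha> (x + y) = \<alpha> x + \<alpha> y" "x \<in> H \<Longrightarrow> \<alpha> (c *\<^sub>C x) = c * \<alpha> x" "x \<notin> H \<Longrightarrow> \<alpha> x = 0"
  using assms by (auto simp: dual_space_def)

lemma dual_space_add: "\<alpha> \<in> dual_space H \<Longrightarrow> \<beta> \<in> dual_space H \<Longrightarrow> \<alpha> + \<beta> \<in> dual_space H"
  and dual_space_0: "0 \<in> dual_space H"
  and dual_space_shift: "\<alpha> \<in> dual_space H \<Longrightarrow> \<beta> \<in> dual_space H \<Longrightarrow> (\<lambda>x. \<beta> x + b * \<alpha> x) \<in> dual_space H"
  by (auto simp: dual_space_def algebra_simps)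

lemma root_space_lie:
  "x \<in> root_space H \<alpha> \<Longrightarrow> y \<in> root_space H \<beta> \<Longrightarrow> lie x y \<in> root_space H (\<alpha> + \<beta>)"
  by (simp add: root_space_def lie_leibniz[where u = x] lie_scaleC_left lie_scaleC_right scaleC_add_left)

lemma subspace_root_space: "cvs.subspace (root_space H \<alpha>)"
  by (auto simp: cvs.subspace_def root_space_def lie_add_right lie_scaleC_right scaleC_add_right scaleC_scaleC mult.commute)

lemma funpow_lie_root_space:
  assumes "z \<in> root_space H \<gamma>" "h \<in> H"
  shows "(lie h ^^ n) z = (\<gamma> h ^ n) *\<^sub>C z"
  using assms by (induction n) (simp_all add: root_space_def lie_scaleC_right scaleC_scaleC mult.commute)

text \<open>The axioms do not say that H is commutative or spanned by the simple coroots, that root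
  spaces are lines, or that the negative of a root is a root. These facts are derived first, in an
  order dictated by what each proof may already use.\<close>

locale chevalley =
  fixes H :: "'g::complex_lie_algebra set"
    and \<Delta> :: "('g \<Rightarrow> complex) set"
    and X :: "('g \<Rightarrow> complex) \<Rightarrow> 'g"
  assumes fin_dim: "finite_dimensional_lie TYPE('g)"
    and simple: "simple_lie TYPE('g)"
    and cartan: "cartan_subalgebra H"
    and simple_roots: "simple_roots H \<Delta>"
    and chevalley: "chevalley_basis H \<Delta> X"
begin

abbreviation "R \<equiv> roots H"
abbreviation "hh \<equiv> coroot X"
abbreviation "srefl \<equiv> simple_reflection X"

lemma subspace_H: "cvs.subspace H"
  using cartan by (simp add: cartan_subalgebra_def lie_subalgebra_def)

lemma lie_H: "x \<in> H \<Longrightarrow> y \<in> H \<Longrightarrow> lie x y \<in> H"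
  using cartan by (simp add: cartan_subalgebra_def lie_subalgebra_def)

lemma root_dual: "\<alpha> \<in> R \<Longrightarrow> \<alpha> \<in> dual_space H"
  and root_nonzero: "\<alpha> \<in> R \<Longrightarrow> \<alpha> \<noteq> 0"
  by (simp_all add: roots_def)

lemma root_witness:
  assumes "\<gamma> \<in> dual_space H" "\<gamma> \<noteq> 0"
  obtains h where "h \<in> H" "\<gamma> h \<noteq> 0"
proof -
  obtain h where "\<gamma> h \<noteq> 0" using assms(2) by (auto simp: fun_eq_iff)
  then show ?thesis using that dual_spaceD(3)[OF assms(1)] by blast
qed

lemma dual_eqI:
  assumes "\<alpha> \<in> dual_space H" "\<beta> \<in> dual_space H" "\<And>h. h \<in> H \<Longrightarrow> \<alpha> h = \<beta> h"
  shows "\<alpha> = \<beta>"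
  using assms by (auto simp: dual_space_def fun_eq_iff) metis

lemma simple_root: "\<alpha> \<in> \<Delta> \<Longrightarrow> \<alpha> \<in> R"
  and finite_simple: "finite \<Delta>"
  using simple_roots by (auto simp: simple_roots_def)

lemma X_root_space: "\<alpha> \<in> R \<Longrightarrow> X \<alpha> \<in> root_space H \<alpha>"
  and root_hh: "\<alpha> \<in> R \<Longrightarrow> \<alpha> (hh \<alpha>) = 2"
  using chevalley by (auto simp: chevalley_basis_def)

lemma lie_H_X: "\<alpha> \<in> R \<Longrightarrow> h \<in> H \<Longrightarrow> lie h (X \<alpha>) = \<alpha> h *\<^sub>C X \<alpha>"
  using X_root_space by (simp add: root_space_def)

lemma X_bracket:
  assumes "\<alpha> \<in> R" "\<beta> \<in> R" "\<alpha> + \<beta> \<in> R"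
  defines "p \<equiv> (GREATEST p::nat. (\<lambda>x. \<beta> x - of_nat p * \<alpha> x) \<in> R)"
  shows "lie (X \<alpha>) (X \<beta>) = of_nat (p + 1) *\<^sub>C X (\<alpha> + \<beta>) \<or> lie (X \<alpha>) (X \<beta>) = - (of_nat (p + 1) *\<^sub>C X (\<alpha> + \<beta>))"
  using chevalley assms by (simp add: chevalley_basis_def Let_def)

lemma basis_independent: "cvs.independent (X ` R \<union> hh ` \<Delta>)"
  and basis_span: "cvs.span (X ` R \<union> hh ` \<Delta>) = UNIV"
  using chevalley by (auto simp: chevalley_basis_def)

lemma X_nonzero: "\<alpha> \<in> R \<Longrightarrow> X \<alpha> \<noteq> 0"
  using basis_independent cvs.dependent_zero[of "X ` R \<union> hh ` \<Delta>"] by (metis UnI1 imageI)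

lemma hh_in_H: "\<alpha> \<in> R \<Longrightarrow> hh \<alpha> \<in> H"
  using root_hh[of \<alpha>] dual_spaceD(3)[OF root_dual, of \<alpha> "hh \<alpha>"] by force

lemma lie_H_nilpotent:
  assumes "h \<in> H" "y \<in> H"
  obtains n where "(lie h ^^ n) y = 0"
proof -
  have "(lie h ^^ n) y \<in> lower_central H n" for n
    by (induction n) (use assms in \<open>auto intro!: cvs.span_base\<close>)
  then show ?thesis
    using that cartan by (metis cartan_subalgebra_def singletonD)
qed

text \<open>A nonzero eigenvalue of \<open>lie h\<close> contradicts its nilpotency on H.\<close>

lemma root_space_H_0:
  assumes "z \<in> root_space H \<gamma>" "z \<in> H" "\<gamma> \<in> dual_space H" "\<gamma> \<noteq> 0"
  shows "z = 0"
proof -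
  obtain h where h: "h \<in> H" "\<gamma> h \<noteq> 0" using root_witness assms by blast
  obtain n where "(lie h ^^ n) z = 0" using lie_H_nilpotent[OF h(1) assms(2)] .
  then show ?thesis using funpow_lie_root_space[OF assms(1) h(1), of n] h(2) by simp
qed

lemma inj_on_X: "inj_on X R"
proof (rule inj_onI)
  fix \<alpha> \<beta> assume a: "\<alpha> \<in> R" "\<beta> \<in> R" "X \<alpha> = X \<beta>"
  show "\<alpha> = \<beta>"
  proof (rule dual_eqI[OF root_dual root_dual])
    fix h assume "h \<in> H"
    then have "\<alpha> h *\<^sub>C X \<alpha> = \<beta> h *\<^sub>C X \<alpha>" using a lie_H_X by metis
    then show "\<alpha> h = \<beta> h" using X_nonzero[OF a(1)] by simp
  qed (use a in auto)
qed

lemma finite_basis: "finite (X ` R \<union> hh ` \<Delta>)"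
proof -
  obtain B :: "'g set" where "finite B" "cvs.span B = UNIV"
    using fin_dim by (auto simp: finite_dimensional_lie_def)
  then show ?thesis
    using cvs.independent_span_bound[OF _ basis_independent] by (metis subset_UNIV)
qed

lemma finite_R: "finite R"
  using finite_basis inj_on_X by (simp add: finite_image_iff)

lemma X_independent:
  assumes "(\<Sum>\<beta>\<in>R. c \<beta> *\<^sub>C X \<beta>) = 0" "\<beta> \<in> R"
  shows "c \<beta> = 0"
proof -
  have "(\<Sum>v\<in>X ` R. c (the_inv_into R X v) *\<^sub>C v) = (\<Sum>\<beta>\<in>R. c \<beta> *\<^sub>C X \<beta>)"
    by (subst sum.reindex[OF inj_on_X]) (auto intro!: sum.cong simp: the_inv_into_f_f[OF inj_on_X])
  then have "(\<Sum>v\<in>X ` R. c (the_inv_into R X v) *\<^sub>C v) = 0" using assms by simp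
  then have "c (the_inv_into R X (X \<beta>)) = 0"
    using cvs.independentD[OF cvs.independent_mono[OF basis_independent, of "X ` R"], of "X ` R" "\<lambda>v. c (the_inv_into R X v)" "X \<beta>"]
      finite_R assms(2) by blast
  then show ?thesis by (simp add: the_inv_into_f_f[OF inj_on_X] assms(2))
qed

text \<open>On H the map \<open>lie h\<close> is nilpotent, but it multiplies X \<beta> by \<beta>
  h. After n applications the sum is zero with coefficients c \<beta> * \<beta> h ^ n, and h is
  chosen with \<beta> h \<noteq> 0.\<close>

lemma X_sum_in_H:
  assumes "(\<Sum>\<beta>\<in>R. c \<beta> *\<^sub>C X \<beta>) \<in> H" "\<beta> \<in> R"
  shows "c \<beta> = 0"
proof -
  obtain h where h: "h \<in> H" "\<beta> h \<noteq> 0" using root_witness[OF root_dual root_nonzero] assms(2) by metis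
  obtain n where n: "(lie h ^^ n) (\<Sum>\<beta>\<in>R. c \<beta> *\<^sub>C X \<beta>) = 0" using lie_H_nilpotent[OF h(1) assms(1)] .
  have "(lie h ^^ n) (\<Sum>\<beta>\<in>R. c \<beta> *\<^sub>C X \<beta>) = (\<Sum>\<beta>\<in>R. (c \<beta> * \<beta> h ^ n) *\<^sub>C X \<beta>)"
    unfolding lvs.lin_sum[OF lvs.lin_funpow[OF lin_lie]]
    by (intro sum.cong refl)
      (simp add: lvs.lin_scale[OF lvs.lin_funpow[OF lin_lie]] funpow_lie_root_space[OF X_root_space h(1)] scaleC_scaleC)
  then have "c \<beta> * \<beta> h ^ n = 0" using n X_independent[OF _ assms(2)] by metis
  then show ?thesis using h by simp
qed

lemma span_hh_subset: "cvs.span (hh ` \<Delta>) \<subseteq> H"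
  by (intro cvs.span_minimal subspace_H) (auto intro: hh_in_H simple_root)

lemma decompose':
  obtains c h where "x = (\<Sum>\<beta>\<in>R. c \<beta> *\<^sub>C X \<beta>) + h" "h \<in> cvs.span (hh ` \<Delta>)"
proof -
  have "x \<in> cvs.span (X ` R \<union> hh ` \<Delta>)" by (simp add: basis_span)
  then obtain y h where xy: "x = y + h" "y \<in> cvs.span (X ` R)" "h \<in> cvs.span (hh ` \<Delta>)"
    unfolding cvs.span_Un by blast
  from xy(2) obtain u where "y = (\<Sum>v\<in>X ` R. u v *\<^sub>C v)"
    unfolding cvs.span_finite[OF finite_imageI[OF finite_R]] by blast
  then have "y = (\<Sum>\<beta>\<in>R. u (X \<beta>) *\<^sub>C X \<beta>)"
    by (simp add: sum.reindex[OF inj_on_X])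
  then show ?thesis using that[of "\<lambda>\<beta>. u (X \<beta>)" h] xy by blast
qed

lemma H_eq_span: "H = cvs.span (hh ` \<Delta>)"
proof
  show "H \<subseteq> cvs.span (hh ` \<Delta>)"
  proof
    fix x assume x: "x \<in> H"
    obtain c h where ch: "x = (\<Sum>\<beta>\<in>R. c \<beta> *\<^sub>C X \<beta>) + h" "h \<in> cvs.span (hh ` \<Delta>)" using decompose' .
    then have "(\<Sum>\<beta>\<in>R. c \<beta> *\<^sub>C X \<beta>) = x - h" by simp
    then have "(\<Sum>\<beta>\<in>R. c \<beta> *\<^sub>C X \<beta>) \<in> H" using x ch span_hh_subset cvs.subspace_diff[OF subspace_H] by force
    then have "\<forall>\<beta>\<in>R. c \<beta> = 0" using X_sum_in_H by blast
    then show "x \<in> cvs.span (hh ` \<Delta>)" using ch by simp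
  qed
qed (rule span_hh_subset)

lemma decompose:
  obtains c h where "x = (\<Sum>\<beta>\<in>R. c \<beta> *\<^sub>C X \<beta>) + h" "h \<in> H"
  using decompose' H_eq_span by metis

text \<open>For h0 separating \<beta> from \<gamma>, the bracket lie h0 z is computed from the
  decomposition of z and from its weight. Brackets inside H are not yet known to vanish, so the root
  parts are compared modulo H only, which suffices by \<open>X_sum_in_H\<close>. The remaining
  component of z lies in H and in a space of nonzero weight, hence is zero.\<close>

lemma root_space_1dim:
  assumes z: "z \<in> root_space H \<gamma>" and \<gamma>: "\<gamma> \<in> dual_space H" "\<gamma> \<noteq> 0"
  shows "z = 0 \<or> (\<gamma> \<in> R \<and> (\<exists>c. z = c *\<^sub>C X \<gamma>))"
proof (cases "z = 0")
  case False
  then have R: "\<gamma> \<in> R" using z \<gamma> by (auto simp: roots_def)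
  obtain c h where ch: "z = (\<Sum>\<beta>\<in>R. c \<beta> *\<^sub>C X \<beta>) + h" "h \<in> H" using decompose .
  have c0: "c \<beta> = 0" if b: "\<beta> \<in> R" "\<beta> \<noteq> \<gamma>" for \<beta>
  proof -
    obtain h0 where h0: "h0 \<in> H" "\<beta> h0 \<noteq> \<gamma> h0"
      using dual_eqI[OF root_dual[OF b(1)] \<gamma>(1)] b(2) by blast
    have "lie h0 z = (\<Sum>\<beta>\<in>R. (c \<beta> * \<beta> h0) *\<^sub>C X \<beta>) + lie h0 h"
      by (simp add: ch(1) lie_add_right lie_sum_right lie_scaleC_right lie_H_X h0(1) scaleC_scaleC cong: sum.cong)
    moreover have "lie h0 z = (\<Sum>\<beta>\<in>R. (c \<beta> * \<gamma> h0) *\<^sub>C X \<beta>) + \<gamma> h0 *\<^sub>C h"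
      using z h0(1) ch(1) by (simp add: root_space_def scaleC_add_right cvs.scale_sum_right scaleC_scaleC mult.commute)
    ultimately have "(\<Sum>\<beta>\<in>R. (c \<beta> * \<beta> h0) *\<^sub>C X \<beta>) + lie h0 h = (\<Sum>\<beta>\<in>R. (c \<beta> * \<gamma> h0) *\<^sub>C X \<beta>) + \<gamma> h0 *\<^sub>C h"
      by simp
    then have "(\<Sum>\<beta>\<in>R. (c \<beta> * \<beta> h0) *\<^sub>C X \<beta>) - (\<Sum>\<beta>\<in>R. (c \<beta> * \<gamma> h0) *\<^sub>C X \<beta>) = \<gamma> h0 *\<^sub>C h - lie h0 h"
      by (simp add: algebra_simps)
    then have "(\<Sum>\<beta>\<in>R. (c \<beta> * \<beta> h0 - c \<beta> * \<gamma> h0) *\<^sub>C X \<beta>) = \<gamma> h0 *\<^sub>C h - lie h0 h"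
      by (simp add: cvs.scale_left_diff_distrib sum_subtractf)
    also have "\<dots> \<in> H"
      using ch(2) h0(1) by (intro cvs.subspace_diff[OF subspace_H] cvs.subspace_scale[OF subspace_H] lie_H)
    finally have "c \<beta> * \<beta> h0 - c \<beta> * \<gamma> h0 = 0" by (rule X_sum_in_H[OF _ b(1)])
    then show "c \<beta> = 0" using h0(2) by (simp flip: right_diff_distrib)
  qed
  have "(\<Sum>\<beta>\<in>R. c \<beta> *\<^sub>C X \<beta>) = (\<Sum>\<beta>\<in>{\<gamma>}. c \<beta> *\<^sub>C X \<beta>)"
    by (rule sum.mono_neutral_right) (use R finite_R c0 in auto)
  then have zc: "z = c \<gamma> *\<^sub>C X \<gamma> + h" using ch(1) by simp
  then have "h = z - c \<gamma> *\<^sub>C X \<gamma>" by simp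
  then have "h \<in> root_space H \<gamma>"
    using z X_root_space[OF R] by (auto intro: cvs.subspace_diff[OF subspace_root_space] cvs.subspace_scale[OF subspace_root_space])
  then have "h = 0" using root_space_H_0 ch(2) \<gamma> by blast
  then show ?thesis using R zc by auto
qed simp

text \<open>The line spanned by a central element is an ideal, and if it were everything, all
  brackets would vanish.\<close>

lemma central_0:
  assumes "\<And>y. lie z y = (0 :: 'g)"
  shows "z = 0"
proof -
  have "lie y z = 0" for y using assms[of y] lie_antisym[of y z] by simp
  then have "lie_ideal (cvs.span {z})"
    using cvs.subspace_span[of "{z}"] cvs.span_zero[of "{z}"]
    by (auto simp: lie_ideal_def cvs.span_singleton lie_scaleC_right)
  then have "cvs.span {z} = {0} \<or> cvs.span {z} = UNIV"
    using simple unfolding simple_lie_def by blast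
  then show ?thesis
  proof
    assume "cvs.span {z} = UNIV"
    then have "\<exists>c. x = c *\<^sub>C z" for x
      unfolding cvs.span_singleton using UNIV_I[of x] by (auto simp only: image_iff)
    then have "lie x y = 0" for x y :: 'g
      using lie_scaleC_left[of _ z y] assms[of y] by (metis cvs.scale_zero_right)
    then show ?thesis using simple by (simp add: simple_lie_def)
  next
    assume "cvs.span {z} = {0}"
    then show ?thesis using cvs.span_base[of z "{z}"] by simp
  qed
qed

lemma root_lie_H:
  assumes "\<alpha> \<in> R" "h \<in> H" "h' \<in> H"
  shows "\<alpha> (lie h h') = 0"
proof -
  have "lie (lie h h') (X \<alpha>) = lie h (lie h' (X \<alpha>)) - lie h' (lie h (X \<alpha>))"
    using lie_leibniz[of h h' "X \<alpha>"] by simp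
  also have "\<dots> = 0" by (simp add: lie_H_X assms lie_scaleC_right scaleC_scaleC mult.commute)
  finally have "\<alpha> (lie h h') *\<^sub>C X \<alpha> = 0" using lie_H_X[OF assms(1) lie_H[OF assms(2,3)]] by simp
  then show ?thesis using X_nonzero[OF assms(1)] by simp
qed

text \<open>The element z = lie h h' acts on each X \<beta> by a commutator of scalars, that is, by
  zero. Once it is seen to kill the coroots that span H, it is central in a simple algebra.\<close>

lemma lie_H_abelian:
  assumes "h \<in> H" "h' \<in> H"
  shows "lie h h' = 0"
proof (rule central_0)
  let ?z = "lie h h'"
  have zH: "?z \<in> H" using assms by (rule lie_H)
  have zX: "lie ?z (X \<beta>) = 0" if "\<beta> \<in> R" for \<beta>
    using lie_H_X[OF that zH] root_lie_H[OF that assms] by simp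
  have zdec: "\<exists>k\<in>H. lie ?z y = lie ?z k" for y
  proof -
    obtain c k where ck: "y = (\<Sum>\<beta>\<in>R. c \<beta> *\<^sub>C X \<beta>) + k" "k \<in> H" using decompose .
    then have "lie ?z y = lie ?z k" by (simp add: lie_add_right lie_sum_right lie_scaleC_right zX cong: sum.cong)
    then show ?thesis using ck by blast
  qed
  have zhh: "lie ?z (hh \<alpha>) = 0" if "\<alpha> \<in> \<Delta>" for \<alpha>
  proof -
    have a: "\<alpha> \<in> R" using that by (rule simple_root)
    \<comment> \<open>At this point -\<alpha> need not be a root, so X (- \<alpha>) is an unknown
      vector. But z kills its root part; only its component k in H contributes, and \<alpha>
      vanishes on lie z k.\<close>
    obtain k where k: "k \<in> H" "lie ?z (X (- \<alpha>)) = lie ?z k" using zdec by blast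
    have "lie ?z (hh \<alpha>) = lie (X \<alpha>) (lie ?z k)"
      unfolding coroot_def lie_leibniz[where x = ?z and u = "X \<alpha>"] by (simp add: zX a k)
    also have "\<dots> = - (\<alpha> (lie ?z k) *\<^sub>C X \<alpha>)"
      using lie_antisym[of "X \<alpha>"] lie_H_X[OF a lie_H[OF zH k(1)]] by simp
    finally show ?thesis using root_lie_H[OF a zH k(1)] by simp
  qed
  have zH0: "lie ?z k = 0" if "k \<in> H" for k
    using that unfolding H_eq_span
  proof (induction rule: cvs.span_induct_alt)
    case (step c x y)
    then show ?case using zhh by (auto simp: lie_add_right lie_scaleC_right)
  qed simp
  show "lie ?z y = 0" for y using zdec zH0 by metis
qed

lemma H_root_space_0: "h \<in> H \<Longrightarrow> h \<in> root_space H 0"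
  by (simp add: root_space_def lie_H_abelian)

text \<open>If -\<alpha> were not a root, the bracket of X \<alpha> with any root vector or any
  element of H would be a combination of root vectors. Then so would hh \<alpha>; lying in H, it
  would be zero, against \<alpha> (hh \<alpha>) = 2.\<close>

lemma uminus_root:
  assumes a: "\<alpha> \<in> R"
  shows "- \<alpha> \<in> R"
proof (rule ccontr)
  assume n: "- \<alpha> \<notin> R"
  obtain c h where ch: "X (- \<alpha>) = (\<Sum>\<beta>\<in>R. c \<beta> *\<^sub>C X \<beta>) + h" "h \<in> H" using decompose .
  have "lie (X \<alpha>) (X \<beta>) \<in> cvs.span (X ` R)" if b: "\<beta> \<in> R" for \<beta>
  proof -
    have "\<alpha> + \<beta> \<noteq> 0" using n b by (metis add_eq_0_iff)
    then have "lie (X \<alpha>) (X \<beta>) = 0 \<or> \<alpha> + \<beta> \<in> R \<and> (\<exists>c. lie (X \<alpha>) (X \<beta>) = c *\<^sub>C X (\<alpha> + \<beta>))"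
      using root_space_1dim[OF root_space_lie[OF X_root_space[OF a] X_root_space[OF b]] dual_space_add[OF root_dual[OF a] root_dual[OF b]]]
      by simp
    then show ?thesis using cvs.span_zero cvs.span_scale[OF cvs.span_base[OF imageI]] by (elim disjE conjE exE) (simp_all only:)
  qed
  moreover have "lie (X \<alpha>) h \<in> cvs.span (X ` R)"
    using lie_antisym[of "X \<alpha>" h] lie_H_X[OF a ch(2)] a by (simp add: cvs.span_neg cvs.span_scale cvs.span_base)
  ultimately have "hh \<alpha> \<in> cvs.span (X ` R)"
    unfolding coroot_def ch(1) lie_add_right lie_sum_right lie_scaleC_right
    by (intro cvs.span_add cvs.span_sum cvs.span_scale) auto
  then obtain u where "hh \<alpha> = (\<Sum>v\<in>X ` R. u v *\<^sub>C v)"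
    unfolding cvs.span_finite[OF finite_imageI[OF finite_R]] by blast
  then have e: "hh \<alpha> = (\<Sum>\<beta>\<in>R. u (X \<beta>) *\<^sub>C X \<beta>)"
    by (simp add: sum.reindex[OF inj_on_X])
  then have "\<forall>\<beta>\<in>R. u (X \<beta>) = 0" using X_sum_in_H[of "\<lambda>\<beta>. u (X \<beta>)"] hh_in_H[OF a] by simp
  then have "hh \<alpha> = 0" using e by simp
  then show False using root_hh[OF a] dual_spaceD(2)[OF root_dual[OF a] hh_in_H[OF a], of 0] by simp
qed

lemma hh_uminus: "hh (- \<alpha>) = - hh \<alpha>"
  by (simp add: coroot_def lie_antisym[of "X (- \<alpha>)"])

lemma dual_uminus: "\<mu> \<in> dual_space H \<Longrightarrow> x \<in> H \<Longrightarrow> \<mu> (- x) = - \<mu> x"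
  using dual_spaceD(2)[of \<mu> H x "-1"] by (simp add: cvs.scale_minus_left)

lemma funpow_lie_X_root_space:
  assumes "\<alpha> \<in> R" "z \<in> root_space H \<gamma>"
  shows "(lie (X \<alpha>) ^^ k) z \<in> root_space H (\<lambda>x. \<gamma> x + of_nat k * \<alpha> x)"
proof (induction k)
  case 0
  then show ?case using assms(2) by simp
next
  case (Suc k)
  have "(\<lambda>x. \<gamma> x + of_nat (Suc k) * \<alpha> x) = \<alpha> + (\<lambda>x. \<gamma> x + of_nat k * \<alpha> x)"
    by (auto simp: algebra_simps)
  then show ?case using root_space_lie[OF X_root_space[OF assms(1)] Suc] by simp
qed

lemma string_leaves:
  assumes "\<alpha> \<in> R"
  obtains k where "(\<lambda>x. \<gamma> x + of_nat k * \<alpha> x) \<notin> R \<union> {0}"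
proof -
  obtain h where h: "h \<in> H" "\<alpha> h \<noteq> 0" using root_witness[OF root_dual root_nonzero] assms by metis
  have "inj (\<lambda>k::nat. (\<lambda>x. \<gamma> x + of_nat k * \<alpha> x))"
    by (rule injI) (use h in \<open>auto dest: fun_cong[of _ _ h]\<close>)
  then have "infinite (range (\<lambda>k::nat. (\<lambda>x. \<gamma> x + of_nat k * \<alpha> x)))"
    by (simp add: finite_image_iff)
  then have "\<not> range (\<lambda>k::nat. (\<lambda>x. \<gamma> x + of_nat k * \<alpha> x)) \<subseteq> R \<union> {0}"
    using finite_R by (meson finite.emptyI finite_Un finite_insert finite_subset)
  then show ?thesis using that by blast
qed

text \<open>Each application of X \<alpha> adds \<alpha> to the weight, and the string of weights
  leaves the finite set R \<union> {0}. Weight 0 has to be avoided as well, since its space is not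
  zero.\<close>

lemma loc_nilpotent_X:
  assumes a: "\<alpha> \<in> R"
  shows "lvs.loc_nilpotent (lie (X \<alpha>))"
  unfolding lvs.loc_nilpotent_def
proof (intro conjI allI)
  have w: "\<exists>n. (lie (X \<alpha>) ^^ n) z = 0" if z: "z \<in> root_space H \<gamma>" and g: "\<gamma> \<in> dual_space H" for z \<gamma>
  proof -
    obtain k where k: "(\<lambda>x. \<gamma> x + of_nat k * \<alpha> x) \<notin> R \<union> {0}" using string_leaves[OF a] .
    have "(lie (X \<alpha>) ^^ k) z = 0"
      using root_space_1dim[OF funpow_lie_X_root_space[OF a z] dual_space_shift[OF root_dual[OF a] g], of k] k by auto
    then show ?thesis by blast
  qed
  fix u
  have "u \<in> cvs.span (X ` R \<union> hh ` \<Delta>)" by (simp add: basis_span)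
  then show "\<exists>n. (lie (X \<alpha>) ^^ n) u = 0"
  proof (induction rule: cvs.span_induct_alt)
    case base
    show ?case by (rule exI[of _ 0]) simp
  next
    case (step c x y)
    then obtain n m where "(lie (X \<alpha>) ^^ n) x = 0" "(lie (X \<alpha>) ^^ m) y = 0"
      using w X_root_space root_dual H_root_space_0[OF hh_in_H[OF simple_root]] dual_space_0 by blast
    then have "(lie (X \<alpha>) ^^ max n m) x = 0" "(lie (X \<alpha>) ^^ max n m) y = 0"
      by (auto intro: lvs.funpow_0_mono[OF lin_lie])
    then have "(lie (X \<alpha>) ^^ max n m) (c *\<^sub>C x + y) = 0"
      by (simp add: lvs.lin_add[OF lvs.lin_funpow[OF lin_lie]] lvs.lin_scale[OF lvs.lin_funpow[OF lin_lie]])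
    then show ?case by blast
  qed
qed (rule lin_lie)

lemma loc_nilpotent_uminus_X: "\<alpha> \<in> R \<Longrightarrow> lvs.loc_nilpotent (lie (- X \<alpha>))"
  using lvs.loc_nilpotent_neg[OF loc_nilpotent_X] by (simp add: lie_uminus_left[abs_def])

subsection \<open>Reflections\<close>

text \<open>The usual lift of the reflection in \<alpha>: in SL2 the product of the three
  exponentials is the matrix with rows (0, 1) and (-1, 0).\<close>

definition weyl_aut :: "('g \<Rightarrow> complex) \<Rightarrow> 'g \<Rightarrow> 'g" where
  "weyl_aut \<alpha> = lvs.dexp (lie (X \<alpha>)) \<circ> lvs.dexp (lie (- X (- \<alpha>))) \<circ> lvs.dexp (lie (X \<alpha>))"

lemma lie_aut_weyl_aut: "\<alpha> \<in> R \<Longrightarrow> lie_aut (weyl_aut \<alpha>)"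
  unfolding weyl_aut_def
  by (intro lie_aut_comp lie_aut_dexp loc_nilpotent_X loc_nilpotent_uminus_X uminus_root)

lemma dual_diff_scale: "\<beta> \<in> dual_space H \<Longrightarrow> x \<in> H \<Longrightarrow> y \<in> H \<Longrightarrow> \<beta> (x - c *\<^sub>C y) = \<beta> x - c * \<beta> y"
  using dual_spaceD(1)[of \<beta> H x "(- c) *\<^sub>C y"] dual_spaceD(2)[of \<beta> H y "- c"] cvs.subspace_scale[OF subspace_H, of y "- c"]
  by simp

text \<open>A computation in the span of H, X \<alpha> and X (- \<alpha>): the series end after
  degree 1 on H and after degree 2 on the opposite root vector.\<close>

lemma weyl_aut_H:
  assumes a: "\<alpha> \<in> R" and h: "h \<in> H"
  shows "weyl_aut \<alpha> h = h - \<alpha> h *\<^sub>C hh \<alpha>"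
proof -
  let ?x = "X \<alpha>" and ?y = "X (- \<alpha>)" and ?h = "hh \<alpha>"
  have hx: "lie k ?x = \<alpha> k *\<^sub>C ?x" and hy: "lie k ?y = - (\<alpha> k *\<^sub>C ?y)" if "k \<in> H" for k
    using lie_H_X[OF a that] lie_H_X[OF uminus_root[OF a] that] by (simp_all add: cvs.scale_minus_left)
  have xh: "lie ?x k = - (\<alpha> k *\<^sub>C ?x)" and yh: "lie ?y k = \<alpha> k *\<^sub>C ?y" if "k \<in> H" for k
    using lie_antisym[of ?x k] lie_antisym[of ?y k] hx hy that by simp_all
  have yx: "lie ?y ?x = - ?h" by (simp add: coroot_def lie_antisym[of ?y ?x])
  have hH: "?h \<in> H" using a by (rule hh_in_H)
  have x1: "lvs.dexp (lie ?x) k = k - \<alpha> k *\<^sub>C ?x" if "k \<in> H" for k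
    using lvs.dexp_eq[OF lin_lie, of 2 ?x k]
    by (simp add: numeral_2_eq_2 lvs.dpow_def xh that lie_uminus_right lie_scaleC_right lie_self)
  have x2: "lvs.dexp (lie ?x) ?x = ?x"
    using lvs.dexp_eq[OF lin_lie, of 1 ?x ?x] by (simp add: lie_self)
  have y1: "lvs.dexp (lie (- ?y)) k = k - \<alpha> k *\<^sub>C ?y" if "k \<in> H" for k
    using lvs.dexp_eq[OF lin_lie, of 2 "- ?y" k]
    by (simp add: numeral_2_eq_2 lvs.dpow_def yh that lie_uminus_left lie_uminus_right lie_scaleC_right lie_self)
  have d: "lie (- ?y) ?x = ?h" "lie (- ?y) ?h = - (2 *\<^sub>C ?y)" "lie (- ?y) (- (2 *\<^sub>C ?y)) = 0"
    by (simp_all add: yx yh hH root_hh[OF a] lie_uminus_left lie_uminus_right lie_scaleC_right lie_self)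
  have "lvs.dexp (lie (- ?y)) ?x = (\<Sum>k<Suc (Suc (Suc 0)). lvs.dpow (lie (- ?y)) k ?x)"
    by (rule lvs.dexp_eq[OF lin_lie]) (simp add: d)
  also have "\<dots> = ?x + ?h + (1 / 2) *\<^sub>C (- (2 *\<^sub>C ?y))"
    by (simp add: lvs.dpow_def d)
  also have "(1 / 2) *\<^sub>C (- (2 *\<^sub>C ?y)) = - ?y"
    by (simp add: cvs.scale_minus_right scaleC_scaleC scaleC_one)
  finally have y2: "lvs.dexp (lie (- ?y)) ?x = ?x + ?h - ?y" by (simp only: add_uminus_conv_diff)
  note l = lvs.lin_dexp[OF loc_nilpotent_X[OF a]] lvs.lin_dexp[OF loc_nilpotent_uminus_X[OF uminus_root[OF a]]]
  have "lvs.dexp (lie (- ?y)) (lvs.dexp (lie ?x) h) = (h - \<alpha> h *\<^sub>C ?h) - \<alpha> h *\<^sub>C ?x"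
    by (simp add: x1 h y1 y2 lvs.lin_diff[OF l(2)] lvs.lin_scale[OF l(2)] scaleC_add_right cvs.scale_right_diff_distrib)
  moreover have "h - \<alpha> h *\<^sub>C ?h \<in> H"
    using h hH by (intro cvs.subspace_diff[OF subspace_H] cvs.subspace_scale[OF subspace_H])
  \<comment> \<open>Since \<alpha> takes the opposite value on the reflected element, the last
    exponential adds back the multiple of X \<alpha> that the first one subtracted.\<close>
  moreover have "\<alpha> (h - \<alpha> h *\<^sub>C ?h) = - \<alpha> h"
    by (simp add: dual_diff_scale[OF root_dual[OF a] h hH] root_hh[OF a])
  ultimately show ?thesis
    using lvs.lin_diff[OF l(1), of "h - \<alpha> h *\<^sub>C ?h" "\<alpha> h *\<^sub>C ?x"] x1[of "h - \<alpha> h *\<^sub>C ?h"]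
    by (simp add: weyl_aut_def lvs.lin_scale[OF l(1)] x2 cvs.scale_minus_left)
qed

lemma weyl_aut_H_in: "\<alpha> \<in> R \<Longrightarrow> h \<in> H \<Longrightarrow> weyl_aut \<alpha> h \<in> H"
  by (simp add: weyl_aut_H cvs.subspace_diff[OF subspace_H] cvs.subspace_scale[OF subspace_H] hh_in_H)

text \<open>The restriction to H matters: on root vectors the square of the lift may be a
  sign.\<close>

lemma weyl_aut_weyl_aut_H: "\<alpha> \<in> R \<Longrightarrow> h \<in> H \<Longrightarrow> weyl_aut \<alpha> (weyl_aut \<alpha> h) = h"
  using weyl_aut_H[of \<alpha> "weyl_aut \<alpha> h"] weyl_aut_H_in[of \<alpha> h]
  by (simp add: weyl_aut_H dual_diff_scale root_dual root_hh hh_in_H cvs.scale_minus_left algebra_simps)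

lemma refl_refl: "\<alpha> \<in> R \<Longrightarrow> srefl \<alpha> (srefl \<alpha> \<mu>) = \<mu>"
  by (auto simp: simple_reflection_def root_hh)

lemma refl_dual: "\<alpha> \<in> R \<Longrightarrow> \<mu> \<in> dual_space H \<Longrightarrow> srefl \<alpha> \<mu> \<in> dual_space H"
  using dual_space_shift[OF root_dual, of \<alpha> \<mu> "- \<mu> (hh \<alpha>)"] by (simp add: simple_reflection_def)

lemma refl_apply: "\<alpha> \<in> R \<Longrightarrow> \<mu> \<in> dual_space H \<Longrightarrow> h \<in> H \<Longrightarrow> srefl \<alpha> \<mu> h = \<mu> (weyl_aut \<alpha> h)"
  by (simp add: simple_reflection_def weyl_aut_H dual_diff_scale hh_in_H mult.commute)

lemma weyl_aut_root_space:
  assumes a: "\<alpha> \<in> R" and g: "\<gamma> \<in> dual_space H" and z: "z \<in> root_space H \<gamma>"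
  shows "weyl_aut \<alpha> z \<in> root_space H (srefl \<alpha> \<gamma>)"
  unfolding root_space_def
proof (intro CollectI ballI)
  fix h assume h: "h \<in> H"
  note \<theta> = lie_autD[OF lie_aut_weyl_aut[OF a]]
  have "lie h (weyl_aut \<alpha> z) = weyl_aut \<alpha> (lie (weyl_aut \<alpha> h) z)"
    by (simp add: \<theta>(3) weyl_aut_weyl_aut_H a h)
  also have "lie (weyl_aut \<alpha> h) z = \<gamma> (weyl_aut \<alpha> h) *\<^sub>C z"
    using z weyl_aut_H_in[OF a h] by (simp add: root_space_def)
  finally show "lie h (weyl_aut \<alpha> z) = srefl \<alpha> \<gamma> h *\<^sub>C weyl_aut \<alpha> z"
    by (simp add: \<theta>(2) refl_apply a g h)
qed

lemma refl_root:
  assumes a: "\<alpha> \<in> R" and b: "\<beta> \<in> R"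
  shows "srefl \<alpha> \<beta> \<in> R"
proof -
  have "weyl_aut \<alpha> (X \<beta>) \<in> root_space H (srefl \<alpha> \<beta>)"
    using weyl_aut_root_space[OF a root_dual[OF b] X_root_space[OF b]] .
  moreover have "weyl_aut \<alpha> (X \<beta>) \<noteq> 0"
    using lie_autD(6)[OF lie_aut_weyl_aut[OF a]] X_nonzero[OF b] by blast
  moreover have "srefl \<alpha> \<beta> \<noteq> 0"
  proof
    assume "srefl \<alpha> \<beta> = 0"
    then have "srefl \<alpha> 0 = \<beta>" using refl_refl[OF a, of \<beta>] by simp
    then show False using root_nonzero[OF b] by (simp add: simple_reflection_def zero_fun_def)
  qed
  ultimately show ?thesis using refl_dual[OF a root_dual[OF b]] by (auto simp: roots_def)
qed

lemma refl_uminus: "srefl \<alpha> (- \<beta>) = - srefl \<alpha> \<beta>"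
  by (auto simp: simple_reflection_def)

subsection \<open>Coefficients with respect to the simple roots\<close>

lemma simple_independent:
  assumes "\<And>x. (\<Sum>\<beta>\<in>\<Delta>. c \<beta> * \<beta> x) = 0" "\<beta> \<in> \<Delta>"
  shows "c \<beta> = 0"
  using simple_roots assms unfolding simple_roots_def by blast

text \<open>The coordinates of a root in the simple roots, integral and of one sign. Linear
  independence makes them unique on \<Delta>; all other values are left open.\<close>

definition cf :: "('g \<Rightarrow> complex) \<Rightarrow> ('g \<Rightarrow> complex) \<Rightarrow> int" where
  "cf \<beta> = (SOME n. (\<forall>x. \<beta> x = (\<Sum>\<gamma>\<in>\<Delta>. of_int (n \<gamma>) * \<gamma> x)) \<and> ((\<forall>\<gamma>\<in>\<Delta>. n \<gamma> \<ge> 0) \<or> (\<forall>\<gamma>\<in>\<Delta>. n \<gamma> \<le> 0)))"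

lemma cf:
  assumes "\<beta> \<in> R"
  shows cf_eq: "\<beta> x = (\<Sum>\<gamma>\<in>\<Delta>. of_int (cf \<beta> \<gamma>) * \<gamma> x)"
    and cf_sign: "(\<forall>\<gamma>\<in>\<Delta>. cf \<beta> \<gamma> \<ge> 0) \<or> (\<forall>\<gamma>\<in>\<Delta>. cf \<beta> \<gamma> \<le> 0)"
proof -
  have "nat_combination \<Delta> \<beta> \<or> nat_combination \<Delta> (- \<beta>)"
    using simple_roots assms by (auto simp: simple_roots_def)
  then have "\<exists>n. (\<forall>x. \<beta> x = (\<Sum>\<gamma>\<in>\<Delta>. of_int (n \<gamma>) * \<gamma> x)) \<and> ((\<forall>\<gamma>\<in>\<Delta>. n \<gamma> \<ge> 0) \<or> (\<forall>\<gamma>\<in>\<Delta>. n \<gamma> \<le> 0))"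
  proof
    assume "nat_combination \<Delta> \<beta>"
    then obtain n :: "('g \<Rightarrow> complex) \<Rightarrow> nat" where "\<beta> = (\<lambda>x. \<Sum>\<beta>\<in>\<Delta>. of_nat (n \<beta>) * \<beta> x)"
      by (auto simp: nat_combination_def)
    then show ?thesis by (intro exI[of _ "\<lambda>\<gamma>. int (n \<gamma>)"]) auto
  next
    assume "nat_combination \<Delta> (- \<beta>)"
    then obtain n :: "('g \<Rightarrow> complex) \<Rightarrow> nat" where n: "- \<beta> = (\<lambda>x. \<Sum>\<beta>\<in>\<Delta>. of_nat (n \<beta>) * \<beta> x)"
      by (auto simp: nat_combination_def)
    have "\<beta> x = - (\<Sum>\<beta>\<in>\<Delta>. of_nat (n \<beta>) * \<beta> x)" for x
      using fun_cong[OF n, of x] by (metis add.inverse_inverse uminus_apply)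
    then show ?thesis by (intro exI[of _ "\<lambda>\<gamma>. - int (n \<gamma>)"]) (auto simp: sum_negf)
  qed
  from someI_ex[OF this] show "\<beta> x = (\<Sum>\<gamma>\<in>\<Delta>. of_int (cf \<beta> \<gamma>) * \<gamma> x)"
    "(\<forall>\<gamma>\<in>\<Delta>. cf \<beta> \<gamma> \<ge> 0) \<or> (\<forall>\<gamma>\<in>\<Delta>. cf \<beta> \<gamma> \<le> 0)"
    unfolding cf_def by blast+
qed

lemma cf_unique:
  assumes "\<beta> \<in> R" "\<And>x. \<beta> x = (\<Sum>\<gamma>\<in>\<Delta>. c \<gamma> * \<gamma> x)" "\<gamma> \<in> \<Delta>"
  shows "of_int (cf \<beta> \<gamma>) = c \<gamma>"
proof -
  have "(\<Sum>\<gamma>\<in>\<Delta>. (of_int (cf \<beta> \<gamma>) - c \<gamma>) * \<gamma> x) = 0" for x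
    using cf_eq[OF assms(1), of x] assms(2)[of x] by (simp add: left_diff_distrib sum_subtractf)
  then show ?thesis using simple_independent[OF _ assms(3)] by fastforce
qed

lemma cf_unique_int:
  assumes "\<beta> \<in> R" "\<And>x. \<beta> x = (\<Sum>\<gamma>\<in>\<Delta>. of_int (c \<gamma>) * \<gamma> x)" "\<gamma> \<in> \<Delta>"
  shows "cf \<beta> \<gamma> = c \<gamma>"
  using cf_unique[OF assms] by simp

lemma cf_simple: "\<alpha> \<in> \<Delta> \<Longrightarrow> \<gamma> \<in> \<Delta> \<Longrightarrow> cf \<alpha> \<gamma> = (if \<gamma> = \<alpha> then 1 else 0)"
  by (rule cf_unique_int[OF simple_root]) (auto simp: finite_simple if_distrib[of of_int] if_distrib[of "\<lambda>c. c * _"] sum.delta cong: if_cong)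

lemma cf_uminus: "\<beta> \<in> R \<Longrightarrow> \<gamma> \<in> \<Delta> \<Longrightarrow> cf (- \<beta>) \<gamma> = - cf \<beta> \<gamma>"
  by (rule cf_unique_int[OF uminus_root]) (simp_all add: sum_negf cf_eq[of \<beta> for x, symmetric])

lemma cf_nonzero:
  assumes "\<beta> \<in> R"
  obtains \<gamma> where "\<gamma> \<in> \<Delta>" "cf \<beta> \<gamma> \<noteq> 0"
proof -
  have "\<exists>\<gamma>\<in>\<Delta>. cf \<beta> \<gamma> \<noteq> 0"
  proof (rule ccontr)
    assume "\<not> ?thesis"
    then have "\<beta> x = 0" for x using cf_eq[OF assms, of x] by simp
    then show False using root_nonzero[OF assms] by (auto simp: fun_eq_iff)
  qed
  then show ?thesis using that by blast
qed

lemma pos_roots_iff: "\<beta> \<in> pos_roots H \<Delta> \<longleftrightarrow> \<beta> \<in> R \<and> (\<forall>\<gamma>\<in>\<Delta>. cf \<beta> \<gamma> \<ge> 0)"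
proof
  assume a: "\<beta> \<in> pos_roots H \<Delta>"
  then obtain n :: "('g \<Rightarrow> complex) \<Rightarrow> nat" where b: "\<beta> \<in> R" "\<beta> = (\<lambda>x. \<Sum>\<beta>\<in>\<Delta>. of_nat (n \<beta>) * \<beta> x)"
    by (auto simp: pos_roots_def nat_combination_def)
  have "cf \<beta> \<gamma> = int (n \<gamma>)" if "\<gamma> \<in> \<Delta>" for \<gamma>
    by (rule cf_unique_int[OF b(1) _ that]) (use fun_cong[OF b(2)] in simp)
  then show "\<beta> \<in> R \<and> (\<forall>\<gamma>\<in>\<Delta>. cf \<beta> \<gamma> \<ge> 0)" using b by simp
next
  assume a: "\<beta> \<in> R \<and> (\<forall>\<gamma>\<in>\<Delta>. cf \<beta> \<gamma> \<ge> 0)"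
  then have "\<beta> = (\<lambda>x. \<Sum>\<beta>'\<in>\<Delta>. of_nat (nat (cf \<beta> \<beta>')) * \<beta>' x)"
    using cf_eq[of \<beta>] by (auto simp: fun_eq_iff intro!: sum.cong)
  then have "\<exists>n :: _ \<Rightarrow> nat. \<beta> = (\<lambda>x. \<Sum>\<beta>'\<in>\<Delta>. of_nat (n \<beta>') * \<beta>' x)" by (rule exI[of _ "\<lambda>\<beta>'. nat (cf \<beta> \<beta>')"])
  then show "\<beta> \<in> pos_roots H \<Delta>" using a unfolding pos_roots_def nat_combination_def by simp
qed

lemma neg_root_iff: "\<beta> \<in> R \<Longrightarrow> \<beta> \<notin> pos_roots H \<Delta> \<longleftrightarrow> - \<beta> \<in> pos_roots H \<Delta>"
proof -
  assume b: "\<beta> \<in> R"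
  obtain \<gamma> where "\<gamma> \<in> \<Delta>" "cf \<beta> \<gamma> \<noteq> 0" using cf_nonzero[OF b] .
  then show ?thesis
    using cf_sign[OF b] b uminus_root[OF b] by (auto simp: pos_roots_iff cf_uminus intro!: bexI[of _ \<gamma>])
qed

lemma simple_pos: "\<alpha> \<in> \<Delta> \<Longrightarrow> \<alpha> \<in> pos_roots H \<Delta>"
  by (simp add: pos_roots_iff simple_root cf_simple)

lemma cf_refl:
  assumes a: "\<alpha> \<in> \<Delta>" and b: "\<beta> \<in> R" and g: "\<gamma> \<in> \<Delta>"
  shows "of_int (cf (srefl \<alpha> \<beta>) \<gamma>) = of_int (cf \<beta> \<gamma>) - (if \<gamma> = \<alpha> then \<beta> (hh \<alpha>) else 0)"
proof (rule cf_unique[OF refl_root[OF simple_root[OF a] b] _ g])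
  fix x
  have "(\<Sum>\<gamma>\<in>\<Delta>. (of_int (cf \<beta> \<gamma>) - (if \<gamma> = \<alpha> then \<beta> (hh \<alpha>) else 0)) * \<gamma> x)
    = (\<Sum>\<gamma>\<in>\<Delta>. of_int (cf \<beta> \<gamma>) * \<gamma> x - (if \<gamma> = \<alpha> then \<beta> (hh \<alpha>) * \<gamma> x else 0))"
    by (intro sum.cong) (auto simp: left_diff_distrib)
  also have "\<dots> = \<beta> x - \<beta> (hh \<alpha>) * \<alpha> x"
    using a finite_simple cf_eq[OF b, of x] by (simp add: sum_subtractf)
  finally show "srefl \<alpha> \<beta> x = (\<Sum>\<gamma>\<in>\<Delta>. (of_int (cf \<beta> \<gamma>) - (if \<gamma> = \<alpha> then \<beta> (hh \<alpha>) else 0)) * \<gamma> x)"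
    by (simp add: simple_reflection_def)
qed

text \<open>A reflection changes only the coordinate at \<alpha>, by \<beta> (hh \<alpha>), and
  roots have integral coordinates.\<close>

lemma root_hh_int:
  assumes "\<alpha> \<in> \<Delta>" "\<beta> \<in> R"
  shows "\<beta> (hh \<alpha>) = of_int (cf \<beta> \<alpha> - cf (srefl \<alpha> \<beta>) \<alpha>)"
  using cf_refl[OF assms assms(1)] by simp

lemma cf_refl_other: "\<alpha> \<in> \<Delta> \<Longrightarrow> \<beta> \<in> R \<Longrightarrow> \<gamma> \<in> \<Delta> \<Longrightarrow> \<gamma> \<noteq> \<alpha> \<Longrightarrow> cf (srefl \<alpha> \<beta>) \<gamma> = cf \<beta> \<gamma>"
  using cf_refl[of \<alpha> \<beta> \<gamma>] by simp

text \<open>Independence of the set of simple coroots does not by itself exclude that two simple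
  roots share a coroot. If they did, \<beta> - 2\<alpha> would be a root with coordinates of both
  signs.\<close>

lemma inj_on_hh: "inj_on hh \<Delta>"
proof (rule inj_onI, rule ccontr)
  fix \<alpha> \<beta> assume a: "\<alpha> \<in> \<Delta>" "\<beta> \<in> \<Delta>" "hh \<alpha> = hh \<beta>" "\<alpha> \<noteq> \<beta>"
  have b: "\<beta> (hh \<alpha>) = 2" using root_hh[OF simple_root[OF a(2)]] a(3) by simp
  have "cf (srefl \<alpha> \<beta>) \<beta> = 1" using cf_refl_other[of \<alpha> \<beta> \<beta>] a simple_root by (simp add: cf_simple)
  moreover have "of_int (cf (srefl \<alpha> \<beta>) \<alpha>) = (of_int (- 2) :: complex)"
    using cf_refl[of \<alpha> \<beta> \<alpha>] a simple_root b by (simp add: cf_simple)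
  then have "cf (srefl \<alpha> \<beta>) \<alpha> = - 2" by (simp only: of_int_eq_iff)
  ultimately show False
    using cf_sign[OF refl_root[OF simple_root[OF a(1)] simple_root[OF a(2)]]] a(1,2) by force
qed

section \<open>Strings for sl2 and multiples of simple roots\<close>

lemma sl2_lowering:
  assumes a: "\<alpha> \<in> R" and y: "lie (X (- \<alpha>)) z = 0" and h: "lie (hh \<alpha>) z = c *\<^sub>C z"
  shows "lie (hh \<alpha>) ((lie (X \<alpha>) ^^ k) z) = (c + 2 * of_nat k) *\<^sub>C (lie (X \<alpha>) ^^ k) z"
    and "lie (X (- \<alpha>)) ((lie (X \<alpha>) ^^ Suc k) z) = (- (of_nat (Suc k) * (c + of_nat k))) *\<^sub>C (lie (X \<alpha>) ^^ k) z"
proof -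
  let ?x = "X \<alpha>" and ?y = "X (- \<alpha>)" and ?h = "hh \<alpha>"
  show H: "lie ?h ((lie ?x ^^ k) z) = (c + 2 * of_nat k) *\<^sub>C (lie ?x ^^ k) z" for k
  proof (induction k)
    case (Suc k)
    have "lie ?h (lie ?x ((lie ?x ^^ k) z)) = 2 *\<^sub>C lie ?x ((lie ?x ^^ k) z) + lie ?x ((c + 2 * of_nat k) *\<^sub>C (lie ?x ^^ k) z)"
      by (simp only: lie_leibniz[of ?h ?x] Suc lie_H_X[OF a hh_in_H[OF a]] root_hh[OF a] lie_scaleC_left)
    also have "\<dots> = (2 + (c + 2 * of_nat k)) *\<^sub>C lie ?x ((lie ?x ^^ k) z)"
      by (simp only: scaleC_add_left lie_scaleC_right lie_add_right)
    also have "2 + (c + 2 * of_nat k) = c + 2 * of_nat (Suc k)" by simp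
    finally show ?case by (simp only: funpow.simps comp_apply)
  qed (simp add: h)
  have yx: "lie ?y ?x = - ?h" by (simp add: coroot_def lie_antisym[of ?y ?x])
  have S: "lie ?y (lie ?x w) = lie ?x (lie ?y w) - lie ?h w" for w
    by (simp add: lie_leibniz[of ?y ?x w] yx lie_uminus_left)
  show "lie ?y ((lie ?x ^^ Suc k) z) = (- (of_nat (Suc k) * (c + of_nat k))) *\<^sub>C (lie ?x ^^ k) z"
  proof (induction k)
    case 0
    have "- (of_nat (Suc 0) * (c + of_nat 0)) = - c" by simp
    then show ?case
      using S[of z] by (simp only: y h cvs.scale_minus_left funpow.simps comp_apply id_apply lie_zero_right diff_0)
  next
    case (Suc k)
    have "lie ?y ((lie ?x ^^ Suc (Suc k)) z) = lie ?x (lie ?y ((lie ?x ^^ Suc k) z)) - lie ?h ((lie ?x ^^ Suc k) z)"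
      using S by simp
    also have "\<dots> = (- (of_nat (Suc k) * (c + of_nat k))) *\<^sub>C (lie ?x ^^ Suc k) z - (c + 2 * of_nat (Suc k)) *\<^sub>C (lie ?x ^^ Suc k) z"
      by (simp only: Suc.IH[unfolded funpow.simps comp_apply] H[of "Suc k", unfolded funpow.simps comp_apply] lie_scaleC_right funpow.simps comp_apply)
    also have "\<dots> = (- (of_nat (Suc k) * (c + of_nat k)) - (c + 2 * of_nat (Suc k))) *\<^sub>C (lie ?x ^^ Suc k) z"
      by (simp only: cvs.scale_left_diff_distrib)
    also have "- (of_nat (Suc k) * (c + of_nat k)) - (c + 2 * of_nat (Suc k)) = - (of_nat (Suc (Suc k)) * (c + of_nat (Suc k)))"
      by (simp add: algebra_simps)
    finally show ?case .
  qed
qed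

text \<open>By \<open>sl2_lowering\<close>, X (- \<alpha>) takes the power k + 1 of X \<alpha> on z
  to -(k + 1)(m + k) times the power k. The factor is nonzero for m > 0, so on a nonzero z no power
  would vanish, against local nilpotency.\<close>

lemma no_positive_lowest_weight:
  assumes a: "\<alpha> \<in> R" and y: "lie (X (- \<alpha>)) z = 0" and h: "lie (hh \<alpha>) z = of_nat m *\<^sub>C z" and m: "m > 0"
  shows "z = 0"
proof (rule ccontr)
  assume z: "z \<noteq> 0"
  have "(lie (X \<alpha>) ^^ k) z \<noteq> 0" for k
  proof (induction k)
    case (Suc k)
    have "of_nat (Suc k) * (of_nat m + of_nat k :: complex) = of_nat (Suc k * (m + k))"
      by (simp only: of_nat_mult of_nat_add)
    also have "\<dots> \<noteq> 0" unfolding of_nat_eq_0_iff using m by simp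
    finally have "lie (X (- \<alpha>)) ((lie (X \<alpha>) ^^ Suc k) z) \<noteq> 0"
      unfolding sl2_lowering(2)[OF a y h] using Suc by simp
    then show ?case by force
  qed (simp add: z)
  then show False using loc_nilpotent_X[OF a] by (auto simp: lvs.loc_nilpotent_def)
qed

text \<open>For m = 2 the Chevalley relation would make lie (X \<alpha>) (X \<alpha>) = 0 a nonzero
  multiple of a root vector. For m > 2 the multiple m - 1 is excluded by induction, so the root
  vector would be killed by X (- \<alpha>) although its weight under hh \<alpha> is 2 m > 0.\<close>

lemma no_root_multiple:
  assumes a: "\<alpha> \<in> \<Delta>" and m: "m \<ge> 2"
  shows "(\<lambda>x. of_nat m * \<alpha> x) \<notin> R"
  using m
proof (induction m rule: less_induct)
  case (less m)
  have aR: "\<alpha> \<in> R" using a by (rule simple_root)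
  show ?case
  proof
    assume r: "(\<lambda>x. of_nat m * \<alpha> x) \<in> R"
    show False
    proof (cases "m = 2")
      case True
      have e: "\<alpha> + \<alpha> = (\<lambda>x. of_nat m * \<alpha> x)" by (auto simp: True)
      then have "\<alpha> + \<alpha> \<in> R" using r by simp
      from X_bracket[OF aR aR this] obtain p :: nat where "of_nat (p + 1) *\<^sub>C X (\<alpha> + \<alpha>) = 0"
        by (auto simp: lie_self)
      moreover have "of_nat (p + 1) \<noteq> (0 :: complex)" by (metis add_is_0 of_nat_eq_0_iff zero_neq_one)
      ultimately have "X (\<alpha> + \<alpha>) = 0" by (simp only: cvs.scale_eq_0_iff) simp
      then show False using X_nonzero r e by metis
    next
      case False
      let ?z = "X (\<lambda>x. of_nat m * \<alpha> x)"
      let ?g = "\<lambda>x. of_nat (m - 1) * \<alpha> x"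
      have e: "- \<alpha> + (\<lambda>x. of_nat m * \<alpha> x) = ?g"
        using less.prems by (auto simp: of_nat_diff algebra_simps)
      have nR: "?g \<notin> R" by (rule less.IH) (use less.prems False in auto)
      obtain h where h: "h \<in> H" "\<alpha> h \<noteq> 0" using root_witness[OF root_dual root_nonzero] aR by metis
      have "?g h \<noteq> 0" using h less.prems by simp
      then have "?g \<noteq> 0" by (auto simp: fun_eq_iff)
      then have "lie (X (- \<alpha>)) ?z = 0"
        using root_space_1dim[OF root_space_lie[OF X_root_space[OF uminus_root[OF aR]] X_root_space[OF r]]
            dual_space_add[OF root_dual[OF uminus_root[OF aR]] root_dual[OF r]]] nR
        unfolding e by blast
      moreover have "lie (hh \<alpha>) ?z = of_nat (2 * m) *\<^sub>C ?z"
        using lie_H_X[OF r hh_in_H[OF aR]] root_hh[OF aR] by (simp add: mult.commute)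
      ultimately have "?z = 0" using no_positive_lowest_weight[OF aR, of ?z "2 * m"] less.prems by simp
      then show False using X_nonzero[OF r] by simp
    qed
  qed
qed

lemma simple_multiple:
  assumes a: "\<alpha> \<in> \<Delta>" and r: "(\<lambda>x. of_int m * \<alpha> x) \<in> R"
  shows "m = 1 \<or> m = -1"
proof -
  have "m \<noteq> 0" using root_nonzero[OF r] by (auto simp: fun_eq_iff)
  moreover have "\<not> m \<ge> 2"
  proof
    assume "m \<ge> 2"
    then have "2 \<le> nat m" "(of_nat (nat m) :: complex) = of_int m" by simp_all
    then show False using no_root_multiple[OF a, of "nat m"] r by simp
  qed
  moreover have "\<not> m \<le> -2"
  proof
    assume m: "m \<le> -2"
    have "- (\<lambda>x. of_int m * \<alpha> x) = (\<lambda>x. of_nat (nat (- m)) * \<alpha> x)"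
      using m by (auto simp: fun_eq_iff)
    moreover have "2 \<le> nat (- m)" using m by linarith
    ultimately show False using no_root_multiple[OF a, of "nat (- m)"] uminus_root[OF r] by simp
  qed
  ultimately show ?thesis by linarith
qed

text \<open>No positive root other than \<alpha> is a multiple of \<alpha>, so \<beta> has a
  positive coordinate away from \<alpha>. The reflection does not touch it, and one positive
  coordinate decides the sign of a root.\<close>

lemma refl_pos:
  assumes a: "\<alpha> \<in> \<Delta>" and b: "\<beta> \<in> pos_roots H \<Delta>" and n: "\<beta> \<noteq> \<alpha>"
  shows "srefl \<alpha> \<beta> \<in> pos_roots H \<Delta>"
proof -
  have bR: "\<beta> \<in> R" and b0: "\<And>\<gamma>. \<gamma> \<in> \<Delta> \<Longrightarrow> cf \<beta> \<gamma> \<ge> 0" using b by (auto simp: pos_roots_iff)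
  have sR: "srefl \<alpha> \<beta> \<in> R" using refl_root simple_root a bR by blast
  have "\<exists>\<gamma>\<in>\<Delta>. \<gamma> \<noteq> \<alpha> \<and> cf \<beta> \<gamma> \<noteq> 0"
  proof (rule ccontr)
    assume c: "\<not> ?thesis"
    have "\<beta> x = of_int (cf \<beta> \<alpha>) * \<alpha> x" for x
    proof -
      have "\<beta> x = (\<Sum>\<gamma>\<in>{\<alpha>}. of_int (cf \<beta> \<gamma>) * \<gamma> x)"
        unfolding cf_eq[OF bR, of x] by (rule sum.mono_neutral_right) (use c a finite_simple in auto)
      then show ?thesis by simp
    qed
    then have e: "\<beta> = (\<lambda>x. of_int (cf \<beta> \<alpha>) * \<alpha> x)" by auto
    then have "cf \<beta> \<alpha> = 1 \<or> cf \<beta> \<alpha> = -1" using simple_multiple[OF a] bR by metis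
    then have "cf \<beta> \<alpha> = 1" using b0[OF a] by auto
    then have "\<beta> = \<alpha>" using \<open>\<And>x. \<beta> x = of_int (cf \<beta> \<alpha>) * \<alpha> x\<close> by (auto simp: fun_eq_iff)
    then show False using n by simp
  qed
  then obtain \<gamma> where g: "\<gamma> \<in> \<Delta>" "\<gamma> \<noteq> \<alpha>" "cf \<beta> \<gamma> \<noteq> 0" by blast
  then have "cf (srefl \<alpha> \<beta>) \<gamma> > 0" using cf_refl_other[OF a bR g(1,2)] b0[OF g(1)] by simp
  then show ?thesis using cf_sign[OF sR] sR g(1) unfolding pos_roots_iff by force
qed

subsection \<open>The integral lattice spanned by the Chevalley basis\<close>

abbreviation "basis \<equiv> X ` R \<union> hh ` \<Delta>"

text \<open>The integral span of the Chevalley basis, described by coordinates so that integrality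
  of a scalar can be read off from its product with a basis vector.\<close>

definition chev_lattice :: "'g set" where
  "chev_lattice = {y. \<forall>b\<in>basis. cvs.representation basis y b \<in> \<int>}"

lemma lattice_add: "x \<in> chev_lattice \<Longrightarrow> y \<in> chev_lattice \<Longrightarrow> x + y \<in> chev_lattice"
  by (simp add: chev_lattice_def cvs.representation_add[OF basis_independent] basis_span)

lemma lattice_scale: "x \<in> chev_lattice \<Longrightarrow> c \<in> \<int> \<Longrightarrow> c *\<^sub>C x \<in> chev_lattice"
  by (simp add: chev_lattice_def cvs.representation_scale[OF basis_independent] basis_span)

lemma lattice_0: "0 \<in> chev_lattice"
  by (simp add: chev_lattice_def cvs.representation_zero)

lemma lattice_uminus: "x \<in> chev_lattice \<Longrightarrow> - x \<in> chev_lattice"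
  using lattice_scale[of x "-1"] by (simp add: cvs.scale_minus_left scaleC_one)

lemma lattice_sum: "(\<And>i. i \<in> A \<Longrightarrow> f i \<in> chev_lattice) \<Longrightarrow> sum f A \<in> chev_lattice"
  by (induction A rule: infinite_finite_induct) (auto intro: lattice_0 lattice_add)

lemma lattice_basis: "b \<in> basis \<Longrightarrow> b \<in> chev_lattice"
  by (simp add: chev_lattice_def cvs.representation_basis[OF basis_independent])

lemma lattice_multiple:
  assumes "b \<in> basis" "c *\<^sub>C b \<in> chev_lattice"
  shows "c \<in> \<int>"
proof -
  have "cvs.representation basis (c *\<^sub>C b) b = c"
    using assms(1) by (simp add: cvs.representation_scale[OF basis_independent] basis_span cvs.representation_basis[OF basis_independent])
  then show ?thesis using assms by (force simp: chev_lattice_def)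
qed

lemma lattice_closed:
  assumes l: "lvs.lin \<theta>" and b: "\<And>b. b \<in> basis \<Longrightarrow> \<theta> b \<in> chev_lattice" and y: "y \<in> chev_lattice"
  shows "\<theta> y \<in> chev_lattice"
proof -
  have "y = (\<Sum>b\<in>basis. cvs.representation basis y b *\<^sub>C b)"
    by (rule cvs.sum_representation_eq[OF basis_independent _ finite_basis, symmetric]) (simp_all add: basis_span)
  then have e: "\<theta> y = (\<Sum>b\<in>basis. cvs.representation basis y b *\<^sub>C \<theta> b)"
    by (subst lvs.lin_scale[OF l, symmetric], subst lvs.lin_sum[OF l, symmetric]) (rule arg_cong)
  have "cvs.representation basis y b \<in> \<int>" if "b \<in> basis" for b
    using y that unfolding chev_lattice_def by blast
  then show ?thesis unfolding e by (intro lattice_sum lattice_scale b)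
qed

text \<open>These are the roots whose vectors enter \<open>weyl_aut\<close> for simple \<alpha>. For
  them the coroot lies in the lattice and no proper multiple is a root.\<close>

abbreviation "signed_simple \<equiv> \<Delta> \<union> uminus ` \<Delta>"

lemma signed_simple_root: "\<gamma> \<in> signed_simple \<Longrightarrow> \<gamma> \<in> R"
  using simple_root uminus_root by auto

lemma signed_simple_multiple:
  assumes "\<gamma> \<in> signed_simple" "(\<lambda>x. of_int m * \<gamma> x) \<in> R"
  shows "m = 1 \<or> m = -1"
proof (cases "\<gamma> \<in> \<Delta>")
  case False
  then obtain \<alpha> where "\<alpha> \<in> \<Delta>" "\<gamma> = - \<alpha>" using assms by auto
  then show ?thesis using simple_multiple[of \<alpha> "- m"] assms(2) by auto
qed (use simple_multiple assms in blast)

lemma hh_signed_simple: "\<gamma> \<in> signed_simple \<Longrightarrow> hh \<gamma> \<in> chev_lattice"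
  using lattice_basis lattice_uminus by (auto simp: hh_uminus)

lemma signed_simple_hh_int: "\<gamma> \<in> signed_simple \<Longrightarrow> \<delta> \<in> \<Delta> \<Longrightarrow> \<gamma> (hh \<delta>) \<in> \<int>"
  using root_hh_int[of \<delta> \<gamma>] signed_simple_root by simp

definition string_length :: "('g \<Rightarrow> complex) \<Rightarrow> ('g \<Rightarrow> complex) \<Rightarrow> nat" where
  "string_length \<gamma> \<beta> = (GREATEST p. (\<lambda>x. \<beta> x - of_nat p * \<gamma> x) \<in> R)"

lemma string_bounded:
  assumes g: "\<gamma> \<in> R"
  obtains b where "\<And>p. (\<lambda>x. \<beta> x - of_nat p * \<gamma> x) \<in> R \<Longrightarrow> p \<le> b"
proof -
  obtain h where h: "h \<in> H" "\<gamma> h \<noteq> 0" using root_witness[OF root_dual root_nonzero] g by metis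
  have "inj (\<lambda>p::nat. (\<lambda>x. \<beta> x - of_nat p * \<gamma> x))"
    by (rule injI) (use h in \<open>auto dest: fun_cong[of _ _ h]\<close>)
  then have "finite ((\<lambda>p::nat. (\<lambda>x. \<beta> x - of_nat p * \<gamma> x)) -` R)"
    using finite_vimageI[OF finite_R] by blast
  then obtain b where "\<forall>p\<in>(\<lambda>p::nat. (\<lambda>x. \<beta> x - of_nat p * \<gamma> x)) -` R. p \<le> b"
    using finite_nat_set_iff_bounded_le by blast
  then show ?thesis using that by (auto simp: vimage_def)
qed

lemma string_length_Suc:
  assumes g: "\<gamma> \<in> R" and b: "\<beta> \<in> R" and s: "\<gamma> + \<beta> \<in> R"
  shows "string_length \<gamma> (\<gamma> + \<beta>) = Suc (string_length \<gamma> \<beta>)"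
  unfolding string_length_def[of \<gamma> "\<gamma> + \<beta>"]
proof (rule Greatest_equality)
  obtain B where B: "\<And>p. (\<lambda>x. \<beta> x - of_nat p * \<gamma> x) \<in> R \<Longrightarrow> p \<le> B" using string_bounded[OF g] by metis
  have "(\<lambda>x. \<beta> x - of_nat (string_length \<gamma> \<beta>) * \<gamma> x) \<in> R"
    unfolding string_length_def by (rule GreatestI_nat[of "\<lambda>p. (\<lambda>x. \<beta> x - of_nat p * \<gamma> x) \<in> R" 0 B]) (use B b in auto)
  then show "(\<lambda>x. (\<gamma> + \<beta>) x - of_nat (Suc (string_length \<gamma> \<beta>)) * \<gamma> x) \<in> R"
    by (simp add: algebra_simps)
  fix p assume p: "(\<lambda>x. (\<gamma> + \<beta>) x - of_nat p * \<gamma> x) \<in> R"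
  show "p \<le> Suc (string_length \<gamma> \<beta>)"
  proof (cases p)
    case (Suc q)
    then have "(\<lambda>x. \<beta> x - of_nat q * \<gamma> x) \<in> R" using p by (simp add: algebra_simps)
    then have "q \<le> string_length \<gamma> \<beta>"
      unfolding string_length_def using Greatest_le_nat[of "\<lambda>p. (\<lambda>x. \<beta> x - of_nat p * \<gamma> x) \<in> R" q B] B by blast
    then show ?thesis using Suc by simp
  qed simp
qed

text \<open>The Chevalley relations contribute the constants p + 1, ..., p + k up to sign, whence
  the rising factorial. The start -\<gamma> is excluded because its string runs through 0, which has
  no root vector.\<close>

lemma funpow_lie_X_X:
  assumes g: "\<gamma> \<in> signed_simple" and b: "\<beta> \<in> R" and n: "\<beta> \<noteq> - \<gamma>"
  defines "p \<equiv> string_length \<gamma> \<beta>"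
  shows "(lie (X \<gamma>) ^^ k) (X \<beta>) = 0 \<or>
    ((\<lambda>x. \<beta> x + of_nat k * \<gamma> x) \<in> R \<and> string_length \<gamma> (\<lambda>x. \<beta> x + of_nat k * \<gamma> x) = p + k \<and>
     (\<exists>s\<in>{1, -1}. (lie (X \<gamma>) ^^ k) (X \<beta>) = (s * pochhammer (of_nat p + 1) k) *\<^sub>C X (\<lambda>x. \<beta> x + of_nat k * \<gamma> x)))"
proof (induction k)
  case 0
  then show ?case using b by (simp add: p_def scaleC_one)
next
  case (Suc k)
  have gR: "\<gamma> \<in> R" using g by (rule signed_simple_root)
  define \<delta> where "\<delta> = (\<lambda>x. \<beta> x + of_nat k * \<gamma> x)"
  have e: "(\<lambda>x. \<beta> x + of_nat (Suc k) * \<gamma> x) = \<gamma> + \<delta>" by (auto simp: \<delta>_def algebra_simps)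
  show ?case
  proof (cases "(lie (X \<gamma>) ^^ k) (X \<beta>) = 0")
    case False
    then obtain s where s: "s \<in> {1, -1}" "(lie (X \<gamma>) ^^ k) (X \<beta>) = (s * pochhammer (of_nat p + 1) k) *\<^sub>C X \<delta>"
      and d: "\<delta> \<in> R" "string_length \<gamma> \<delta> = p + k" using Suc False unfolding \<delta>_def by blast
    show ?thesis
    proof (cases "\<gamma> + \<delta> \<in> R")
      case True
      have sl: "string_length \<gamma> (\<gamma> + \<delta>) = p + Suc k" using string_length_Suc[OF gR d(1) True] d(2) by simp
      obtain s' :: complex where s': "s' \<in> {1, -1}" "lie (X \<gamma>) (X \<delta>) = (s' * of_nat (p + k + 1)) *\<^sub>C X (\<gamma> + \<delta>)"
        using X_bracket[OF gR d(1) True] d(2) unfolding string_length_def[symmetric]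
        by (elim disjE) (metis (no_types) insertCI mult_1 mult_minus1 cvs.scale_minus_left)+
      have "(lie (X \<gamma>) ^^ Suc k) (X \<beta>) = ((s * s') * pochhammer (of_nat p + 1) (Suc k)) *\<^sub>C X (\<gamma> + \<delta>)"
        by (simp add: s(2) lie_scaleC_right s'(2) scaleC_scaleC pochhammer_Suc algebra_simps)
      moreover have "s * s' \<in> {1, -1}" using s(1) s'(1) by auto
      ultimately show ?thesis using True sl unfolding e by blast
    next
      case False
      \<comment> \<open>Otherwise \<beta> = -(k + 1)\<gamma>, which is a root only for k = 0, and
        then \<beta> is the excluded -\<gamma>.\<close>
      have "\<gamma> + \<delta> \<noteq> 0"
      proof
        assume "\<gamma> + \<delta> = 0"
        then have "\<beta> = (\<lambda>x. of_int (- int (Suc k)) * \<gamma> x)"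
          by (auto simp: \<delta>_def fun_eq_iff algebra_simps eq_neg_iff_add_eq_0)
        then have "- int (Suc k) = 1 \<or> - int (Suc k) = - 1" using signed_simple_multiple[OF g] b by metis
        then have "k = 0" by simp
        then show False using \<open>\<beta> = _\<close> n by (auto simp: fun_eq_iff)
      qed
      then have "lie (X \<gamma>) (X \<delta>) = 0"
        using root_space_1dim[OF root_space_lie[OF X_root_space[OF gR] X_root_space[OF d(1)]] dual_space_add[OF root_dual[OF gR] root_dual[OF d(1)]]] False
        by blast
      then show ?thesis by (simp add: s(2) lie_scaleC_right)
    qed
  qed simp
qed

text \<open>The denominator k! disappears in each case. Along a string, the rising factorial over k!
  is the binomial coefficient of p + k over k. From X (- \<gamma>) one passes to hh \<gamma> and
  then to -2 X \<gamma>, halved in degree 2. On a simple coroot nothing happens beyond degree 1,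
  where an integral value of \<gamma> appears.\<close>

lemma dpow_lie_X_lattice:
  assumes g: "\<gamma> \<in> signed_simple" and b: "b \<in> basis"
  shows "lvs.dpow (lie (X \<gamma>)) k b \<in> chev_lattice"
proof -
  have gR: "\<gamma> \<in> R" using g by (rule signed_simple_root)
  have xh: "lie (X \<gamma>) h = - (\<gamma> h *\<^sub>C X \<gamma>)" if "h \<in> H" for h
    using lie_antisym[of "X \<gamma>" h] lie_H_X[OF gR that] by simp
  have Xg: "X \<gamma> \<in> chev_lattice" using gR by (intro lattice_basis) auto
  consider (X) \<beta> where "\<beta> \<in> R" "\<beta> \<noteq> - \<gamma>" "b = X \<beta>" | (neg) "b = X (- \<gamma>)" | (hh) \<delta> where "\<delta> \<in> \<Delta>" "b = hh \<delta>"
    using b by auto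
  then show ?thesis
  proof cases
    case X
    let ?p = "string_length \<gamma> \<beta>"
    have "1 / fact k * pochhammer (of_nat ?p + 1) k = (of_nat ((?p + k) choose k) :: complex)"
      by (simp add: binomial_gbinomial gbinomial_pochhammer')
    then have "1 / fact k * (s * pochhammer (of_nat ?p + 1) k) \<in> \<int>" if "s \<in> {1, -1}" for s :: complex
      using that by (auto simp: divide_simps)
    then have "(1 / fact k) *\<^sub>C (s * pochhammer (of_nat ?p + 1) k) *\<^sub>C X \<delta> \<in> chev_lattice" if "s \<in> {1, -1}" "\<delta> \<in> R" for s \<delta>
      unfolding scaleC_scaleC using that by (blast intro: lattice_scale lattice_basis)
    moreover have "(1 / fact k) *\<^sub>C 0 \<in> chev_lattice" using lattice_0 by simp
    ultimately show ?thesis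
      using funpow_lie_X_X[OF g X(1,2), of k] unfolding X(3) lvs.dpow_def by (elim disjE conjE bexE) (simp_all only:)
  next
    case neg
    have 1: "lie (X \<gamma>) (X (- \<gamma>)) = hh \<gamma>" by (simp add: coroot_def)
    have 2: "lie (X \<gamma>) (hh \<gamma>) = - (2 *\<^sub>C X \<gamma>)" by (simp add: xh hh_in_H gR root_hh)
    have 3: "lie (X \<gamma>) (- (2 *\<^sub>C X \<gamma>)) = 0" by (simp add: lie_uminus_right lie_scaleC_right lie_self)
    consider "k = 0" | "k = 1" | "k = 2" | "k \<ge> 3" by linarith
    then show ?thesis
    proof cases
      case 4
      have "(lie (X \<gamma>) ^^ 3) b = 0" by (simp add: neg 1 2 3 numeral_3_eq_3)
      then have "(lie (X \<gamma>) ^^ k) b = 0" by (rule lvs.funpow_0_mono[OF lin_lie]) (rule 4)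
      then show ?thesis by (simp add: lvs.dpow_def lattice_0)
    next
      case 3
      then have "lvs.dpow (lie (X \<gamma>)) k b = - X \<gamma>"
        by (simp add: lvs.dpow_def neg 1 2 numeral_2_eq_2 cvs.scale_minus_right scaleC_scaleC scaleC_one)
      then show ?thesis using Xg by (simp add: lattice_uminus)
    qed (use b hh_signed_simple[OF g] in \<open>simp_all add: lattice_basis lvs.dpow_def neg 1 scaleC_one\<close>)
  next
    case hh
    have 1: "lie (X \<gamma>) b = (- \<gamma> (hh \<delta>)) *\<^sub>C X \<gamma>" using xh[OF hh_in_H[OF simple_root[OF hh(1)]]] hh by (simp add: cvs.scale_minus_left)
    consider "k = 0" | "k = 1" | "k \<ge> 2" by linarith
    then show ?thesis
    proof cases
      case 3
      have "(lie (X \<gamma>) ^^ 2) b = 0" by (simp add: 1 numeral_2_eq_2 lie_uminus_right lie_scaleC_right lie_self)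
      then have "(lie (X \<gamma>) ^^ k) b = 0" by (rule lvs.funpow_0_mono[OF lin_lie]) (rule 3)
      then show ?thesis by (simp add: lvs.dpow_def lattice_0)
    next
      case 2
      then show ?thesis using signed_simple_hh_int[OF g hh(1)] Xg
        by (simp add: lvs.dpow_def 1 scaleC_one) (metis Ints_minus cvs.scale_minus_left lattice_scale)
    qed (use b in \<open>simp add: lattice_basis\<close>)
  qed
qed

lemma dexp_lattice:
  assumes g: "\<gamma> \<in> signed_simple" and y: "y \<in> chev_lattice"
  shows "lvs.dexp (lie (X \<gamma>)) y \<in> chev_lattice" "lvs.dexp (lie (- X \<gamma>)) y \<in> chev_lattice"
proof -
  have gR: "\<gamma> \<in> R" using g by (rule signed_simple_root)
  show "lvs.dexp (lie (X \<gamma>)) y \<in> chev_lattice"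
    by (rule lattice_closed[OF lvs.lin_dexp[OF loc_nilpotent_X[OF gR]] _ y])
      (auto simp: lvs.dexp_def intro!: lattice_sum dpow_lie_X_lattice g)
  have "lvs.dpow (lie (- X \<gamma>)) k b = (-1) ^ k *\<^sub>C lvs.dpow (lie (X \<gamma>)) k b" for k b
    using lvs.dpow_neg[OF lin_lie, of "X \<gamma>" k b] by (simp add: lie_uminus_left[abs_def])
  then show "lvs.dexp (lie (- X \<gamma>)) y \<in> chev_lattice"
    by (intro lattice_closed[OF lvs.lin_dexp[OF loc_nilpotent_uminus_X[OF gR]] _ y])
      (auto simp: lvs.dexp_def intro!: lattice_sum lattice_scale dpow_lie_X_lattice g)
qed

text \<open>The scalar is a unit of the integers because both \<open>weyl_aut \<alpha>\<close> and its inverse preserve the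
  lattice.\<close>

lemma weyl_aut_X:
  assumes a: "\<alpha> \<in> \<Delta>" and b: "\<beta> \<in> R"
  obtains s where "s \<in> {1, -1}" "weyl_aut \<alpha> (X \<beta>) = s *\<^sub>C X (srefl \<alpha> \<beta>)"
proof -
  have aR: "\<alpha> \<in> R" using a by (rule simple_root)
  have sR: "srefl \<alpha> \<beta> \<in> R" using refl_root aR b by blast
  define \<theta>' where "\<theta>' = lvs.dexp (lie (- X \<alpha>)) \<circ> lvs.dexp (lie (X (- \<alpha>))) \<circ> lvs.dexp (lie (- X \<alpha>))"
  have inv: "\<theta>' (weyl_aut \<alpha> u) = u" for u
    using dexp_lie_inverse[OF loc_nilpotent_X[OF aR]] dexp_lie_inverse[OF loc_nilpotent_X[OF uminus_root[OF aR]]]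
    by (simp add: \<theta>'_def weyl_aut_def)
  have lin': "\<theta>' (c *\<^sub>C u) = c *\<^sub>C \<theta>' u" for c u
    unfolding \<theta>'_def comp_apply
    by (simp only: lvs.lin_scale[OF lvs.lin_dexp[OF loc_nilpotent_uminus_X[OF aR]]]
        lvs.lin_scale[OF lvs.lin_dexp[OF loc_nilpotent_X[OF uminus_root[OF aR]]]])
  have g: "\<alpha> \<in> signed_simple" "- \<alpha> \<in> signed_simple" using a by auto
  have L: "weyl_aut \<alpha> y \<in> chev_lattice" "\<theta>' y \<in> chev_lattice" if "y \<in> chev_lattice" for y
    using that by (auto simp: weyl_aut_def \<theta>'_def intro!: dexp_lattice g)
  obtain s where s: "weyl_aut \<alpha> (X \<beta>) = s *\<^sub>C X (srefl \<alpha> \<beta>)"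
    using root_space_1dim[OF weyl_aut_root_space[OF aR root_dual[OF b] X_root_space[OF b]] root_dual[OF sR] root_nonzero[OF sR]]
    by (metis cvs.scale_zero_left)
  have e: "X \<beta> = s *\<^sub>C \<theta>' (X (srefl \<alpha> \<beta>))" using inv[of "X \<beta>"] s lin' by simp
  have s0: "s \<noteq> 0" using e X_nonzero[OF b] by auto
  have "s *\<^sub>C X (srefl \<alpha> \<beta>) \<in> chev_lattice" using L(1)[of "X \<beta>"] s b by (auto intro: lattice_basis)
  then have "s \<in> \<int>" using lattice_multiple sR by blast
  moreover have "(1 / s) *\<^sub>C X \<beta> \<in> chev_lattice"
    using L(2)[of "X (srefl \<alpha> \<beta>)"] sR s0 by (subst e) (auto simp: scaleC_scaleC scaleC_one intro: lattice_basis)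
  then have "1 / s \<in> \<int>" using lattice_multiple b by blast
  ultimately obtain m n where mn: "s = of_int m" "1 / s = of_int n" by (auto elim!: Ints_cases)
  then have "of_int (m * n) = (of_int 1 :: complex)" using s0 by (metis nonzero_mult_div_cancel_left of_int_1 of_int_mult times_divide_eq_right mult.right_neutral)
  then have "m * n = 1" by (simp only: of_int_eq_iff)
  then have "s \<in> {1, -1}" using mn zmult_eq_1_iff by auto
  then show ?thesis using that s by blast
qed

text \<open>The signs picked up by X \<beta> and X (- \<beta>) cancel, because the reflected root
  takes the value 2 both on its coroot and on the image of hh \<beta>.\<close>

lemma weyl_aut_hh:
  assumes a: "\<alpha> \<in> \<Delta>" and b: "\<beta> \<in> R"
  shows "weyl_aut \<alpha> (hh \<beta>) = hh (srefl \<alpha> \<beta>)"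
proof -
  have aR: "\<alpha> \<in> R" using a by (rule simple_root)
  have sR: "srefl \<alpha> \<beta> \<in> R" using refl_root aR b by blast
  note \<theta> = lie_autD[OF lie_aut_weyl_aut[OF aR]]
  obtain s where s: "weyl_aut \<alpha> (X \<beta>) = s *\<^sub>C X (srefl \<alpha> \<beta>)" using weyl_aut_X[OF a b] .
  obtain s' where s': "weyl_aut \<alpha> (X (- \<beta>)) = s' *\<^sub>C X (- srefl \<alpha> \<beta>)"
    using weyl_aut_X[OF a uminus_root[OF b]] unfolding refl_uminus .
  have e: "weyl_aut \<alpha> (hh \<beta>) = (s * s') *\<^sub>C hh (srefl \<alpha> \<beta>)"
    by (simp add: coroot_def \<theta>(3) s s' lie_scaleC_left lie_scaleC_right scaleC_scaleC mult.commute)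
  have "srefl \<alpha> \<beta> (weyl_aut \<alpha> (hh \<beta>)) = 2"
    using refl_apply[OF aR root_dual[OF b] weyl_aut_H_in[OF aR hh_in_H[OF b]]] weyl_aut_weyl_aut_H[OF aR hh_in_H[OF b]] root_hh[OF b]
    by simp
  moreover have "srefl \<alpha> \<beta> ((s * s') *\<^sub>C hh (srefl \<alpha> \<beta>)) = (s * s') * 2"
    using dual_spaceD(2)[OF root_dual[OF sR] hh_in_H[OF sR]] root_hh[OF sR] by simp
  ultimately have "s * s' = 1" using e by simp
  then show ?thesis using e by (simp add: scaleC_one)
qed

subsection \<open>The Weyl group and its longest element\<close>

abbreviation "rp \<equiv> reflection_product X"

definition word_aut :: "('g \<Rightarrow> complex) list \<Rightarrow> 'g \<Rightarrow> 'g" where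
  "word_aut as = foldr (\<lambda>\<alpha> \<theta>. weyl_aut \<alpha> \<circ> \<theta>) as id"

lemma word_aut_simps [simp]:
  "word_aut [] = id" "word_aut (a # as) = weyl_aut a \<circ> word_aut as"
  by (simp_all add: word_aut_def)

lemma rp_simps [simp]:
  "rp [] = id" "rp (a # as) = srefl a \<circ> rp as"
  by (simp_all add: reflection_product_def)

lemma rp_append: "rp (as @ bs) = rp as \<circ> rp bs"
  by (induction as) (simp_all add: comp_assoc)

lemma rp_root: "set as \<subseteq> \<Delta> \<Longrightarrow> \<beta> \<in> R \<Longrightarrow> rp as \<beta> \<in> R"
  by (induction as) (auto intro: refl_root simple_root)

lemma rp_dual: "set as \<subseteq> \<Delta> \<Longrightarrow> \<mu> \<in> dual_space H \<Longrightarrow> rp as \<mu> \<in> dual_space H"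
  by (induction as) (auto intro: refl_dual simple_root)

lemma word_aut_H_in: "set as \<subseteq> \<Delta> \<Longrightarrow> h \<in> H \<Longrightarrow> word_aut as h \<in> H"
  by (induction as) (auto intro: weyl_aut_H_in simple_root)

lemma word_aut_hh: "set as \<subseteq> \<Delta> \<Longrightarrow> \<beta> \<in> R \<Longrightarrow> word_aut as (hh \<beta>) = hh (rp as \<beta>)"
  by (induction as) (simp_all add: weyl_aut_hh rp_root)

lemma word_aut_root_space:
  "set as \<subseteq> \<Delta> \<Longrightarrow> \<gamma> \<in> dual_space H \<Longrightarrow> z \<in> root_space H \<gamma> \<Longrightarrow> word_aut as z \<in> root_space H (rp as \<gamma>)"
  by (induction as) (auto intro!: weyl_aut_root_space rp_dual simple_root)

lemma word_aut_X:
  assumes "set as \<subseteq> \<Delta>" "\<beta> \<in> R"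
  shows "\<exists>s\<in>{1, -1}. word_aut as (X \<beta>) = s *\<^sub>C X (rp as \<beta>)"
  using assms(1)
proof (induction as)
  case Nil
  then show ?case by (simp add: scaleC_one)
next
  case (Cons a as)
  then obtain s where s: "s \<in> {1, -1}" "word_aut as (X \<beta>) = s *\<^sub>C X (rp as \<beta>)" by force
  have a: "a \<in> \<Delta>" and as: "set as \<subseteq> \<Delta>" using Cons.prems by auto
  obtain s' where s': "s' \<in> {1, -1}" "weyl_aut a (X (rp as \<beta>)) = s' *\<^sub>C X (srefl a (rp as \<beta>))"
    by (rule weyl_aut_X[OF a rp_root[OF as assms(2)]])
  have "word_aut (a # as) (X \<beta>) = (s * s') *\<^sub>C X (rp (a # as) \<beta>)"
    using s s' by (simp add: lie_autD(2)[OF lie_aut_weyl_aut[OF simple_root[OF a]]] scaleC_scaleC)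
  moreover have "s * s' \<in> {1, -1}" using s s' by auto
  ultimately show ?case by blast
qed

lemma rp_apply: "set as \<subseteq> \<Delta> \<Longrightarrow> \<mu> \<in> dual_space H \<Longrightarrow> h \<in> H \<Longrightarrow> rp as \<mu> (word_aut as h) = \<mu> h"
  by (induction as) (simp_all add: refl_apply simple_root rp_dual weyl_aut_H_in word_aut_H_in weyl_aut_weyl_aut_H)

lemma rp_diff_scale: "rp as (\<lambda>x. \<mu> x - c * \<nu> x) = (\<lambda>x. rp as \<mu> x - c * rp as \<nu> x)"
  by (induction as) (auto simp: simple_reflection_def algebra_simps)

lemma rp_sum: "rp as (\<lambda>x. \<Sum>i\<in>I. c i * f i x) = (\<lambda>x. \<Sum>i\<in>I. c i * rp as (f i) x)"
  by (induction as)
    (auto simp: simple_reflection_def fun_eq_iff right_diff_distrib sum_subtractf sum_distrib_right mult.assoc)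

lemma rp_uminus: "rp as (- \<mu>) = - rp as \<mu>"
proof -
  have "- \<mu> = (\<lambda>x. 0 - 1 * \<mu> x)" by auto
  then have "rp as (- \<mu>) = (\<lambda>x. rp as (\<lambda>x. 0) x - 1 * rp as \<mu> x)" by (simp only: rp_diff_scale)
  then show ?thesis
    using rp_diff_scale[of as "\<lambda>x. 0" 1 "\<lambda>x. 0"] by (auto simp: fun_eq_iff)
qed

lemma rp_rev: "set as \<subseteq> \<Delta> \<Longrightarrow> rp (rev as) (rp as \<mu>) = \<mu>"
  by (induction as arbitrary: \<mu>) (simp_all add: rp_append refl_refl simple_root)

text \<open>The coefficients are independent of \<mu>, so they can be determined on linear
  functionals and then used for arbitrary functions.\<close>

lemma rp_hh_combination:
  assumes "set as \<subseteq> \<Delta>" "\<delta> \<in> \<Delta>"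
  shows "\<exists>n. \<forall>\<mu>. rp as \<mu> (hh \<delta>) = (\<Sum>\<gamma>\<in>\<Delta>. n \<gamma> * \<mu> (hh \<gamma>))"
  using assms
proof (induction as arbitrary: \<delta>)
  case Nil
  then show ?case
    using finite_simple by (intro exI[of _ "\<lambda>\<gamma>. if \<gamma> = \<delta> then 1 else 0"]) (auto simp: if_distrib[of "\<lambda>c. c * _"] cong: if_cong)
next
  case (Cons a as)
  then obtain n m where n: "\<And>\<mu>. rp as \<mu> (hh \<delta>) = (\<Sum>\<gamma>\<in>\<Delta>. n \<gamma> * \<mu> (hh \<gamma>))"
    and m: "\<And>\<mu>. rp as \<mu> (hh a) = (\<Sum>\<gamma>\<in>\<Delta>. m \<gamma> * \<mu> (hh \<gamma>))"
    by (metis list.set_intros(1) set_subset_Cons subset_iff)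
  show ?case
    by (intro exI[of _ "\<lambda>\<gamma>. n \<gamma> - m \<gamma> * a (hh \<delta>)"])
      (simp add: simple_reflection_def n m algebra_simps sum_subtractf sum_distrib_left)
qed

text \<open>The Weyl group acts on all functions on the Lie algebra, not only on the dual of \<open>H\<close>, so
  the evaluation at a simple coroot has to be expanded in evaluations at simple coroots first.\<close>

lemma rp_hh:
  assumes as: "set as \<subseteq> \<Delta>" and g: "\<gamma> \<in> \<Delta>" and d: "rp as \<gamma> \<in> \<Delta>"
  shows "rp as \<mu> (hh (rp as \<gamma>)) = \<mu> (hh \<gamma>)"
proof -
  obtain n where n: "\<And>\<mu>. rp as \<mu> (hh (rp as \<gamma>)) = (\<Sum>\<gamma>\<in>\<Delta>. n \<gamma> * \<mu> (hh \<gamma>))"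
    using rp_hh_combination[OF as d] by blast
  have ind: "cvs.independent (hh ` \<Delta>)"
    by (rule cvs.independent_mono[OF basis_independent]) auto
  \<comment> \<open>The functionals dual to the simple coroots. Being linear on H, they are
    evaluated by \<open>rp_apply\<close>, which gives the coefficients n.\<close>
  define e where "e j x = (if x \<in> H then cvs.representation (hh ` \<Delta>) x (hh j) else 0)" for j x
  have e: "e j (hh i) = (if i = j then 1 else 0)" if "i \<in> \<Delta>" "j \<in> \<Delta>" for i j
    using that hh_in_H[OF simple_root[OF that(1)]] inj_onD[OF inj_on_hh]
    by (auto simp: e_def cvs.representation_basis[OF ind])
  have dual: "e j \<in> dual_space H" for j
    by (auto simp: e_def dual_space_def H_eq_span cvs.representation_add[OF ind] cvs.representation_scale[OF ind]
        cvs.span_add cvs.span_scale)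
  have "n j = (if j = \<gamma> then 1 else 0)" if j: "j \<in> \<Delta>" for j
  proof -
    have "(\<Sum>\<gamma>\<in>\<Delta>. n \<gamma> * e j (hh \<gamma>)) = (\<Sum>\<gamma>\<in>\<Delta>. if \<gamma> = j then n \<gamma> else 0)"
      by (intro sum.cong refl) (simp add: e j)
    then have "n j = rp as (e j) (hh (rp as \<gamma>))" using n[of "e j"] j finite_simple by simp
    also have "\<dots> = rp as (e j) (word_aut as (hh \<gamma>))" using word_aut_hh[OF as simple_root[OF g]] by simp
    also have "\<dots> = e j (hh \<gamma>)" by (rule rp_apply[OF as dual hh_in_H[OF simple_root[OF g]]])
    finally show ?thesis using e[OF g j] by auto
  qed
  then have "(\<Sum>\<gamma>'\<in>\<Delta>. n \<gamma>' * \<mu> (hh \<gamma>')) = (\<Sum>\<gamma>'\<in>\<Delta>. if \<gamma>' = \<gamma> then \<mu> (hh \<gamma>') else 0)"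
    by (intro sum.cong refl) simp
  then show ?thesis using n[of \<mu>] g finite_simple by simp
qed

text \<open>Lengths are measured on maps of all functions, so conjugation of reflections is needed
  as an equality of such maps and not only on the dual of H. This is what \<open>rp_hh\<close>
  provides.\<close>

lemma rp_conj:
  assumes "set as \<subseteq> \<Delta>" "\<gamma> \<in> \<Delta>" "rp as \<gamma> \<in> \<Delta>"
  shows "srefl (rp as \<gamma>) \<circ> rp as = rp as \<circ> srefl \<gamma>"
proof
  fix \<mu>
  have "rp as (srefl \<gamma> \<mu>) = (\<lambda>x. rp as \<mu> x - \<mu> (hh \<gamma>) * rp as \<gamma> x)"
    unfolding simple_reflection_def[of X \<gamma>] by (rule rp_diff_scale)
  then show "(srefl (rp as \<gamma>) \<circ> rp as) \<mu> = (rp as \<circ> srefl \<gamma>) \<mu>"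
    using rp_hh[OF assms, of \<mu>] by (simp add: simple_reflection_def[of X "rp as \<gamma>"])
qed

text \<open>Read from the right, the word makes the root negative for the first time at some letter
  b, and by \<open>refl_pos\<close> the only positive root that b makes negative is b.\<close>

lemma negative_passes_simple:
  assumes "set bs \<subseteq> \<Delta>" "\<beta> \<in> pos_roots H \<Delta>" "rp bs \<beta> \<notin> pos_roots H \<Delta>"
  obtains as b cs where "bs = as @ b # cs" "rp cs \<beta> = b"
proof -
  have "\<exists>as b cs. bs = as @ b # cs \<and> rp cs \<beta> = b"
    using assms(1,3)
  proof (induction bs)
    case (Cons b bs)
    show ?case
    proof (cases "rp bs \<beta> \<in> pos_roots H \<Delta>")
      case True
      then have "rp bs \<beta> = b" using refl_pos[of b "rp bs \<beta>"] Cons.prems by auto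
      then show ?thesis by blast
    next
      case False
      then obtain as b' cs where "bs = as @ b' # cs" "rp cs \<beta> = b'" using Cons by auto
      then show ?thesis by (metis append_Cons)
    qed
  qed (use assms in simp)
  then show ?thesis using that by blast
qed

text \<open>With b = rp cs \<gamma>, moving the reflection in \<gamma> to the left across cs turns
  it into the reflection in b, which cancels the letter b.\<close>

lemma exchange:
  assumes bs: "set bs \<subseteq> \<Delta>" and g: "\<gamma> \<in> \<Delta>" and n: "rp bs \<gamma> \<notin> pos_roots H \<Delta>"
  obtains cs where "set cs \<subseteq> \<Delta>" "Suc (length cs) = length bs" "rp bs \<circ> srefl \<gamma> = rp cs"
proof -
  obtain as b cs where e: "bs = as @ b # cs" "rp cs \<gamma> = b"
    using negative_passes_simple[OF bs simple_pos[OF g] n] .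
  have cs: "set cs \<subseteq> \<Delta>" "rp cs \<gamma> \<in> \<Delta>" using e bs by auto
  have "rp cs \<circ> srefl \<gamma> = srefl b \<circ> rp cs" using rp_conj[OF cs(1) g cs(2)] unfolding e(2) by (rule sym)
  then have "rp bs \<circ> srefl \<gamma> = rp as \<circ> (srefl b \<circ> (srefl b \<circ> rp cs))"
    using e by (simp only: rp_append rp_simps comp_assoc)
  also have "srefl b \<circ> (srefl b \<circ> rp cs) = rp cs"
    using refl_refl[OF simple_root[OF cs(2)]] e by (auto simp: fun_eq_iff)
  finally have "rp bs \<circ> srefl \<gamma> = rp (as @ cs)" by (simp only: rp_append)
  then show ?thesis using that[of "as @ cs"] e bs by auto
qed

text \<open>If w \<gamma> were positive, w followed on the right by the reflection in \<gamma> would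
  send \<gamma> to a negative root. Exchange would shorten a shortest word for this product to a
  word for w, so the product would be longer than w, against maximality.\<close>

lemma longest_element_word:
  assumes "longest_element \<Delta> X w"
  obtains ws where "set ws \<subseteq> \<Delta>" "rp ws = w" "\<And>\<gamma>. \<gamma> \<in> \<Delta> \<Longrightarrow> w \<gamma> \<notin> pos_roots H \<Delta>"
proof -
  have len: "\<exists>as. set as \<subseteq> \<Delta> \<and> length as = weyl_length \<Delta> X v \<and> rp as = v" if "v \<in> weyl_group \<Delta> X" for v
  proof -
    have "\<exists>n as. set as \<subseteq> \<Delta> \<and> length as = n \<and> rp as = v"
      using that by (auto simp: weyl_group_def)
    then show ?thesis unfolding weyl_length_def by (rule LeastI_ex)
  qed
  have le: "weyl_length \<Delta> X (rp as) \<le> length as" if "set as \<subseteq> \<Delta>" for as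
    unfolding weyl_length_def by (rule Least_le) (use that in blast)
  have w: "w \<in> weyl_group \<Delta> X" and max: "\<And>v. v \<in> weyl_group \<Delta> X \<Longrightarrow> weyl_length \<Delta> X v \<le> weyl_length \<Delta> X w"
    using assms by (auto simp: longest_element_def)
  obtain ws where ws: "set ws \<subseteq> \<Delta>" "rp ws = w" using len[OF w] by blast
  have "w \<gamma> \<notin> pos_roots H \<Delta>" if g: "\<gamma> \<in> \<Delta>" for \<gamma>
  proof
    assume p: "w \<gamma> \<in> pos_roots H \<Delta>"
    have v: "w \<circ> srefl \<gamma> = rp (ws @ [\<gamma>])" using ws by (simp add: rp_append)
    then have vW: "w \<circ> srefl \<gamma> \<in> weyl_group \<Delta> X" using ws g by (force simp: weyl_group_def)
    obtain bs where bs: "set bs \<subseteq> \<Delta>" "length bs = weyl_length \<Delta> X (w \<circ> srefl \<gamma>)" "rp bs = w \<circ> srefl \<gamma>"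
      using len[OF vW] by blast
    have "srefl \<gamma> \<gamma> = - \<gamma>" by (auto simp: simple_reflection_def root_hh simple_root g)
    then have "rp bs \<gamma> = - w \<gamma>" using rp_uminus[of ws \<gamma>] bs ws by simp
    moreover have "w \<gamma> \<in> R" using p by (simp add: pos_roots_iff)
    ultimately have "rp bs \<gamma> \<notin> pos_roots H \<Delta>"
      using neg_root_iff[OF uminus_root, of "w \<gamma>"] p by simp
    then obtain cs where cs: "set cs \<subseteq> \<Delta>" "Suc (length cs) = length bs" "rp bs \<circ> srefl \<gamma> = rp cs"
      using exchange[OF bs(1) g] by metis
    have "rp cs = w" using cs(3)[symmetric] bs(3) refl_refl[OF simple_root[OF g]] by (auto simp: fun_eq_iff)
    then have "weyl_length \<Delta> X w < weyl_length \<Delta> X (w \<circ> srefl \<gamma>)" using le[OF cs(1)] cs(2) bs(2) by simp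
    then show False using max[OF vW] by simp
  qed
  then show ?thesis using that ws by blast
qed

lemma cf_rp:
  assumes as: "set as \<subseteq> \<Delta>" and b: "\<beta> \<in> R" and d: "\<delta> \<in> \<Delta>"
  shows "cf (rp as \<beta>) \<delta> = (\<Sum>\<gamma>\<in>\<Delta>. cf \<beta> \<gamma> * cf (rp as \<gamma>) \<delta>)"
proof (rule cf_unique_int[OF rp_root[OF as b] _ d])
  fix x
  have "rp as \<beta> = rp as (\<lambda>x. \<Sum>\<gamma>\<in>\<Delta>. of_int (cf \<beta> \<gamma>) * \<gamma> x)"
    by (rule arg_cong[where f = "rp as"]) (use cf_eq[OF b] in auto)
  then have "rp as \<beta> x = (\<Sum>\<gamma>\<in>\<Delta>. of_int (cf \<beta> \<gamma>) * rp as \<gamma> x)"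
    by (simp add: rp_sum)
  also have "\<dots> = (\<Sum>\<gamma>\<in>\<Delta>. of_int (cf \<beta> \<gamma>) * (\<Sum>\<delta>\<in>\<Delta>. of_int (cf (rp as \<gamma>) \<delta>) * \<delta> x))"
    by (intro sum.cong refl) (metis cf_eq[OF rp_root[OF as simple_root]])
  also have "\<dots> = (\<Sum>\<delta>\<in>\<Delta>. of_int (\<Sum>\<gamma>\<in>\<Delta>. cf \<beta> \<gamma> * cf (rp as \<gamma>) \<delta>) * \<delta> x)"
    by (simp add: sum_distrib_left sum_distrib_right mult.assoc) (rule sum.swap)
  finally show "rp as \<beta> x = (\<Sum>\<delta>\<in>\<Delta>. of_int (\<Sum>\<gamma>\<in>\<Delta>. cf \<beta> \<gamma> * cf (rp as \<gamma>) \<delta>) * \<delta> x)" .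
qed

lemma simple_hh_int_root:
  assumes "\<mu> \<in> dual_space H" "\<And>\<delta>. \<delta> \<in> \<Delta> \<Longrightarrow> \<mu> (hh \<delta>) \<in> \<int>" "set as \<subseteq> \<Delta>" "\<delta> \<in> \<Delta>"
  shows "rp as \<mu> (hh \<delta>) \<in> \<int>"
  using assms(3,4)
proof (induction as arbitrary: \<delta>)
  case (Cons a as)
  then have "rp as \<mu> (hh \<delta>) \<in> \<int>" "rp as \<mu> (hh a) \<in> \<int>" "a (hh \<delta>) \<in> \<int>"
    using root_hh_int[of \<delta> a] simple_root by auto
  then show ?case by (simp add: simple_reflection_def)
qed (use assms in simp)

end

section \<open>The action of w0 on roots, simple roots and coroots\<close>

locale chevalley_longest = chevalley H \<Delta> X
  for H :: "'g::complex_lie_algebra set" and \<Delta> X +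
  fixes w0 ws
  assumes ws: "set ws \<subseteq> \<Delta>" "rp ws = w0" and simple_neg: "\<And>\<gamma>. \<gamma> \<in> \<Delta> \<Longrightarrow> w0 \<gamma> \<notin> pos_roots H \<Delta>"
begin

lemma w0_root: "\<beta> \<in> R \<Longrightarrow> w0 \<beta> \<in> R"
  using rp_root ws by metis

lemma w0_uminus: "w0 (- \<beta>) = - w0 \<beta>"
  using rp_uminus ws by metis

lemma inj_w0: "w0 \<alpha> = w0 \<beta> \<Longrightarrow> \<alpha> = \<beta>"
  using rp_rev ws by metis

lemma w0_pos:
  assumes b: "\<beta> \<in> pos_roots H \<Delta>"
  shows "- w0 \<beta> \<in> pos_roots H \<Delta>"
proof -
  have bR: "\<beta> \<in> R" using b by (simp add: pos_roots_iff)
  have "cf (- w0 \<beta>) \<delta> \<ge> 0" if d: "\<delta> \<in> \<Delta>" for \<delta>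
  proof -
    have "cf (w0 \<beta>) \<delta> = (\<Sum>\<gamma>\<in>\<Delta>. cf \<beta> \<gamma> * cf (w0 \<gamma>) \<delta>)" using cf_rp[OF ws(1) bR d] ws(2) by simp
    also have "\<dots> \<le> 0"
    proof (rule sum_nonpos)
      fix \<gamma> assume g: "\<gamma> \<in> \<Delta>"
      have "- w0 \<gamma> \<in> pos_roots H \<Delta>" using neg_root_iff[OF w0_root[OF simple_root[OF g]]] simple_neg[OF g] by simp
      then have "cf (w0 \<gamma>) \<delta> \<le> 0"
        using d cf_uminus[OF w0_root[OF simple_root[OF g]] d] by (auto simp: pos_roots_iff)
      then show "cf \<beta> \<gamma> * cf (w0 \<gamma>) \<delta> \<le> 0" using b g by (auto simp: pos_roots_iff intro: mult_nonneg_nonpos)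
    qed
    finally show ?thesis using cf_uminus[OF w0_root[OF bR] d] by simp
  qed
  then show ?thesis using uminus_root[OF w0_root[OF bR]] by (simp add: pos_roots_iff)
qed

lemma finite_pos_roots: "finite (pos_roots H \<Delta>)"
  by (rule finite_subset[OF _ finite_R]) (auto simp: pos_roots_def)

lemma w0_pos_image: "(\<lambda>\<beta>. - w0 \<beta>) ` pos_roots H \<Delta> = pos_roots H \<Delta>"
  by (rule endo_inj_surj[OF finite_pos_roots]) (auto intro!: w0_pos inj_onI intro: inj_w0 dest!: iffD1[OF neg_equal_iff_equal])

text \<open>Let -w0 \<alpha> be a simple root i. Its height is 1, and it is also the sum of the
  coordinates of \<alpha> weighted by the heights of the roots -w0 \<gamma>, each at least 1. So the
  coordinates of \<alpha> add up to at most 1 and \<alpha> is simple. The other inclusion is by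
  counting.\<close>

lemma w0_simple_image: "(\<lambda>\<beta>. - w0 \<beta>) ` \<Delta> = \<Delta>"
proof -
  have "\<Delta> \<subseteq> (\<lambda>\<beta>. - w0 \<beta>) ` \<Delta>"
  proof
    fix i assume i: "i \<in> \<Delta>"
    have "i \<in> (\<lambda>\<beta>. - w0 \<beta>) ` pos_roots H \<Delta>" unfolding w0_pos_image by (rule simple_pos[OF i])
    then obtain \<alpha> where a: "\<alpha> \<in> pos_roots H \<Delta>" "i = - w0 \<alpha>" by blast
    have aR: "\<alpha> \<in> R" and a0: "\<And>\<gamma>. \<gamma> \<in> \<Delta> \<Longrightarrow> cf \<alpha> \<gamma> \<ge> 0" using a by (auto simp: pos_roots_iff)
    define ht where "ht \<gamma> = (\<Sum>\<delta>\<in>\<Delta>. cf (- w0 \<gamma>) \<delta>)" for \<gamma>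
    have ht: "ht \<gamma> \<ge> 1" if g: "\<gamma> \<in> \<Delta>" for \<gamma>
    proof -
      have p: "- w0 \<gamma> \<in> pos_roots H \<Delta>" using w0_pos simple_pos g by blast
      then have R: "- w0 \<gamma> \<in> R" by (simp add: pos_roots_iff)
      obtain \<delta> where d: "\<delta> \<in> \<Delta>" "cf (- w0 \<gamma>) \<delta> \<noteq> 0" using cf_nonzero[OF R] .
      then have "1 \<le> cf (- w0 \<gamma>) \<delta>" using p by (force simp: pos_roots_iff)
      also have "\<dots> \<le> ht \<gamma>"
        unfolding ht_def by (rule member_le_sum) (use d p finite_simple in \<open>auto simp: pos_roots_iff\<close>)
      finally show ?thesis .
    qed
    have ci: "cf i \<delta> = (\<Sum>\<gamma>\<in>\<Delta>. cf \<alpha> \<gamma> * cf (- w0 \<gamma>) \<delta>)" if d: "\<delta> \<in> \<Delta>" for \<delta>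
    proof -
      have "cf i \<delta> = - (\<Sum>\<gamma>\<in>\<Delta>. cf \<alpha> \<gamma> * cf (w0 \<gamma>) \<delta>)"
        using cf_rp[OF ws(1) aR d] ws(2) cf_uminus[OF w0_root[OF aR] d] a(2) by simp
      then show ?thesis by (simp add: sum_negf[symmetric] cf_uminus w0_root simple_root d)
    qed
    have "(\<Sum>\<delta>\<in>\<Delta>. cf i \<delta>) = 1" using i finite_simple by (simp add: cf_simple)
    moreover have "(\<Sum>\<delta>\<in>\<Delta>. cf i \<delta>) = (\<Sum>\<gamma>\<in>\<Delta>. cf \<alpha> \<gamma> * ht \<gamma>)"
      by (simp add: ci ht_def sum_distrib_left) (rule sum.swap)
    moreover have "(\<Sum>\<gamma>\<in>\<Delta>. cf \<alpha> \<gamma>) \<le> (\<Sum>\<gamma>\<in>\<Delta>. cf \<alpha> \<gamma> * ht \<gamma>)"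
      by (rule sum_mono) (use ht a0 mult_left_mono[of 1] in force)
    ultimately have le1: "(\<Sum>\<gamma>\<in>\<Delta>. cf \<alpha> \<gamma>) \<le> 1" by simp
    obtain \<gamma> where g: "\<gamma> \<in> \<Delta>" "cf \<alpha> \<gamma> \<noteq> 0" using cf_nonzero[OF aR] .
    have "(\<Sum>\<gamma>\<in>\<Delta>. cf \<alpha> \<gamma>) = cf \<alpha> \<gamma> + (\<Sum>\<gamma>'\<in>\<Delta> - {\<gamma>}. cf \<alpha> \<gamma>')"
      using g finite_simple by (simp add: sum.remove)
    moreover have nn: "\<And>\<gamma>'. \<gamma>' \<in> \<Delta> - {\<gamma>} \<Longrightarrow> cf \<alpha> \<gamma>' \<ge> 0" using a0 by blast
    moreover have "cf \<alpha> \<gamma> \<ge> 1" using a0[OF g(1)] g(2) by simp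
    ultimately have "cf \<alpha> \<gamma> = 1" "(\<Sum>\<gamma>'\<in>\<Delta> - {\<gamma>}. cf \<alpha> \<gamma>') = 0"
      using le1 sum_nonneg[of "\<Delta> - {\<gamma>}" "cf \<alpha>", OF nn] by linarith+
    then have z: "cf \<alpha> \<gamma> = 1" "\<And>\<gamma>'. \<gamma>' \<in> \<Delta> - {\<gamma>} \<Longrightarrow> cf \<alpha> \<gamma>' = 0"
      using sum_nonneg_eq_0_iff[of "\<Delta> - {\<gamma>}" "cf \<alpha>"] nn finite_simple by auto
    have "\<alpha> x = \<gamma> x" for x
    proof -
      have "\<alpha> x = (\<Sum>\<gamma>'\<in>{\<gamma>}. of_int (cf \<alpha> \<gamma>') * \<gamma>' x)"
        unfolding cf_eq[OF aR, of x] by (rule sum.mono_neutral_right) (use z(2) g(1) finite_simple in auto)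
      then show ?thesis using z(1) by simp
    qed
    then have "\<alpha> = \<gamma>" by auto
    then show "i \<in> (\<lambda>\<beta>. - w0 \<beta>) ` \<Delta>" using a(2) g(1) by blast
  qed
  moreover have "card ((\<lambda>\<beta>. - w0 \<beta>) ` \<Delta>) \<le> card \<Delta>" by (rule card_image_le[OF finite_simple])
  ultimately show ?thesis using card_seteq[of "(\<lambda>\<beta>. - w0 \<beta>) ` \<Delta>" \<Delta>] finite_simple by auto
qed

text \<open>Since w0 makes \<beta> negative, some final part of its word carries \<beta> to a simple
  root. The corresponding automorphism carries the coroot along, which reduces the claim to simple
  coroots.\<close>

lemma hh_int:
  assumes mu: "\<mu> \<in> dual_space H" "\<And>\<delta>. \<delta> \<in> \<Delta> \<Longrightarrow> \<mu> (hh \<delta>) \<in> \<int>" and b: "\<beta> \<in> pos_roots H \<Delta>"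
  shows "\<mu> (hh \<beta>) \<in> \<int>"
proof -
  have bR: "\<beta> \<in> R" using b by (simp add: pos_roots_iff)
  have "rp ws \<beta> \<notin> pos_roots H \<Delta>"
    using w0_pos[OF b] neg_root_iff[OF w0_root[OF bR]] ws(2) by simp
  then obtain as \<gamma> cs where e: "ws = as @ \<gamma> # cs" "rp cs \<beta> = \<gamma>"
    using negative_passes_simple[OF ws(1) b] by metis
  then have cs: "set cs \<subseteq> \<Delta>" "\<gamma> \<in> \<Delta>" using ws(1) by auto
  have "\<mu> (hh \<beta>) = rp cs \<mu> (word_aut cs (hh \<beta>))" by (rule rp_apply[OF cs(1) mu(1) hh_in_H[OF bR], symmetric])
  also have "word_aut cs (hh \<beta>) = hh \<gamma>" using word_aut_hh[OF cs(1) bR] e by simp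
  finally show ?thesis using simple_hh_int_root[OF mu cs] by simp
qed

end

subsection \<open>Root lengths\<close>

text \<open>\<open>lie_trace\<close> refers to a chosen basis. Expanding two bases in each other
  shows that the choice does not matter, so the Chevalley basis can be used, in which the maps from
  H are diagonal.\<close>

lemma lie_trace_eq:
  fixes T :: "'g::complex_lie_algebra \<Rightarrow> 'g"
  assumes fd: "finite_dimensional_lie TYPE('g)" and l: "lvs.lin T"
    and B: "cvs.independent B" "cvs.span B = UNIV"
  shows "lie_trace T = (\<Sum>b\<in>B. cvs.representation B (T b) b)"
proof -
  obtain S :: "'g set" where S: "finite S" "cvs.span S = UNIV"
    using fd by (auto simp: finite_dimensional_lie_def)
  have fin: "finite C" if "cvs.independent C" for C :: "'g set"
    using cvs.independent_span_bound[OF S(1) that] S(2) by auto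
  have eq: "(\<Sum>b\<in>B. cvs.representation B (T b) b) = (\<Sum>c\<in>C. cvs.representation C (T c) c)"
    if B: "cvs.independent B" "cvs.span B = UNIV" and C: "cvs.independent C" "cvs.span C = UNIV" for B C :: "'g set"
  proof -
    have exp: "(\<Sum>c\<in>C. cvs.representation C v c *\<^sub>C c) = v" if "cvs.independent C" "cvs.span C = UNIV" for v and C :: "'g set"
      by (rule cvs.sum_representation_eq[OF that(1) _ fin[OF that(1)]]) (simp_all add: that)
    have "cvs.representation B (T b) b = (\<Sum>c\<in>C. cvs.representation C b c * cvs.representation B (T c) b)" for b
    proof -
      have "T b = (\<Sum>c\<in>C. cvs.representation C b c *\<^sub>C T c)"
        using lvs.lin_sum[OF l, of "\<lambda>c. cvs.representation C b c *\<^sub>C c" C] exp[OF C, of b] by (simp add: lvs.lin_scale[OF l])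
      then show ?thesis
        by (simp add: cvs.representation_sum[OF B(1)] cvs.representation_scale[OF B(1)] B(2))
    qed
    then have "(\<Sum>b\<in>B. cvs.representation B (T b) b) = (\<Sum>c\<in>C. \<Sum>b\<in>B. cvs.representation B (T c) b * cvs.representation C b c)"
      by (simp add: mult.commute) (rule sum.swap)
    also have "\<dots> = (\<Sum>c\<in>C. cvs.representation C (T c) c)"
    proof (intro sum.cong refl)
      fix c
      have "cvs.representation C (T c) c = cvs.representation C (\<Sum>b\<in>B. cvs.representation B (T c) b *\<^sub>C b) c"
        by (simp add: exp[OF B])
      also have "\<dots> = (\<Sum>b\<in>B. cvs.representation B (T c) b * cvs.representation C b c)"
        by (simp add: cvs.representation_sum[OF C(1)] cvs.representation_scale[OF C(1)] C(2))
      finally show "(\<Sum>b\<in>B. cvs.representation B (T c) b * cvs.representation C b c) = cvs.representation C (T c) c" by simp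
    qed
    finally show ?thesis .
  qed
  define C where "C = (SOME B :: 'g set. cvs.independent B \<and> cvs.span B = UNIV)"
  have "cvs.independent C \<and> cvs.span C = UNIV"
    unfolding C_def by (rule someI[of _ B]) (use B in auto)
  then show ?thesis
    using eq[OF B, of C] unfolding lie_trace_def Let_def C_def[symmetric] by simp
qed

context chevalley
begin

lemma killing_H:
  assumes h: "h \<in> H" and k: "k \<in> H"
  shows "killing h k = (\<Sum>\<beta>\<in>R. \<beta> h * \<beta> k)"
proof -
  have "killing h k = (\<Sum>b\<in>basis. cvs.representation basis (lie h (lie k b)) b)"
    unfolding killing_def
    by (rule lie_trace_eq[OF fin_dim _ basis_independent basis_span])
      (simp add: lvs.lin_def lie_add_right lie_scaleC_right)
  also have "\<dots> = (\<Sum>b\<in>X ` R. cvs.representation basis (lie h (lie k b)) b)"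
  proof (rule sum.mono_neutral_right[OF finite_basis])
    show "\<forall>b\<in>basis - X ` R. cvs.representation basis (lie h (lie k b)) b = 0"
      using hh_in_H[OF simple_root] by (auto simp: lie_H_abelian[OF k] cvs.representation_zero)
  qed auto
  also have "\<dots> = (\<Sum>\<beta>\<in>R. cvs.representation basis (lie h (lie k (X \<beta>))) (X \<beta>))"
    by (simp add: sum.reindex[OF inj_on_X])
  also have "\<dots> = (\<Sum>\<beta>\<in>R. \<beta> h * \<beta> k)"
    by (intro sum.cong refl)
      (simp add: lie_H_X h k lie_scaleC_right scaleC_scaleC cvs.representation_scale[OF basis_independent] basis_span
        cvs.representation_basis[OF basis_independent] mult.commute)
  finally show ?thesis .
qed

text \<open>Complex conjugation of H with respect to the real span of the simple coroots, on which
  roots are real. It turns the Killing form into a sum of absolute squares, which gives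
  nondegeneracy on H.\<close>

lemma conjugate_in_H:
  assumes "t \<in> H"
  obtains t' where "t' \<in> H" "\<And>\<beta>. \<beta> \<in> R \<Longrightarrow> \<beta> t' = cnj (\<beta> t)"
proof -
  \<comment> \<open>Membership in H is carried through the induction because roots are additive on H
    only.\<close>
  have "t \<in> H \<and> (\<exists>t'\<in>H. \<forall>\<beta>\<in>R. \<beta> t' = cnj (\<beta> t))"
    using assms[unfolded H_eq_span]
  proof (induction rule: cvs.span_induct_alt)
    case base
    have "\<beta> 0 = 0" if "\<beta> \<in> R" for \<beta>
      using dual_spaceD(2)[OF root_dual[OF that], of 0 0] cvs.subspace_0[OF subspace_H] by simp
    then have "\<forall>\<beta>\<in>R. \<beta> 0 = cnj (\<beta> 0)" by (metis complex_cnj_zero)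
    then show ?case using cvs.subspace_0[OF subspace_H] by blast
  next
    case (step c x y)
    then obtain \<delta> where d: "\<delta> \<in> \<Delta>" "x = hh \<delta>" by auto
    from step obtain y' where y': "y' \<in> H" "\<forall>\<beta>\<in>R. \<beta> y' = cnj (\<beta> y)" by blast
    have yH: "y \<in> H" using step by blast
    have xH: "x \<in> H" using hh_in_H[OF simple_root] d by blast
    have "\<beta> (cnj c *\<^sub>C x + y') = cnj (\<beta> (c *\<^sub>C x + y))" if b: "\<beta> \<in> R" for \<beta>
    proof -
      note D = dual_spaceD[OF root_dual[OF b]]
      have "cnj (\<beta> x) = \<beta> x" using root_hh_int[OF d(1) b] d(2) by simp
      then show ?thesis
        using D(1)[of "cnj c *\<^sub>C x" y'] D(1)[of "c *\<^sub>C x" y] D(2)[OF xH] y' yH xH b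
        by (simp add: cvs.subspace_scale[OF subspace_H])
    qed
    moreover have "cnj c *\<^sub>C x + y' \<in> H" using xH y' by (intro cvs.subspace_add[OF subspace_H] cvs.subspace_scale[OF subspace_H])
    moreover have "c *\<^sub>C x + y \<in> H" using xH yH by (intro cvs.subspace_add[OF subspace_H] cvs.subspace_scale[OF subspace_H])
    ultimately show ?case by blast
  qed
  then show ?thesis using that by blast
qed

lemma H_roots_0:
  assumes t: "t \<in> H" "\<And>\<beta>. \<beta> \<in> R \<Longrightarrow> \<beta> t = 0"
  shows "t = 0"
proof (rule central_0)
  fix y
  obtain c k where "y = (\<Sum>\<beta>\<in>R. c \<beta> *\<^sub>C X \<beta>) + k" "k \<in> H" using decompose .
  then show "lie t y = 0"
    by (simp add: lie_add_right lie_sum_right lie_scaleC_right lie_H_X t lie_H_abelian)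
qed

lemma killing_nondegenerate:
  assumes t: "t \<in> H" "\<And>h. h \<in> H \<Longrightarrow> killing t h = 0"
  shows "t = 0"
proof (rule H_roots_0[OF t(1)])
  fix \<beta> assume b: "\<beta> \<in> R"
  obtain t' where t': "t' \<in> H" "\<And>\<beta>. \<beta> \<in> R \<Longrightarrow> \<beta> t' = cnj (\<beta> t)" using conjugate_in_H[OF t(1)] by blast
  have "of_real (\<Sum>\<beta>\<in>R. (cmod (\<beta> t))\<^sup>2) = (\<Sum>\<beta>\<in>R. \<beta> t * \<beta> t')"
    by (simp add: t' complex_norm_square del: of_real_power cong: sum.cong)
  also have "\<dots> = 0" using killing_H[OF t(1) t'(1)] t(2)[OF t'(1)] by simp
  finally have "(\<Sum>\<beta>\<in>R. (cmod (\<beta> t))\<^sup>2) = 0" by (simp only: of_real_eq_0_iff)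
  then show "\<beta> t = 0" using b finite_R by (simp add: sum_nonneg_eq_0_iff)
qed

lemma killing_weyl_aut:
  assumes a: "\<alpha> \<in> R" and h: "h \<in> H" and k: "k \<in> H"
  shows "killing (weyl_aut \<alpha> h) (weyl_aut \<alpha> k) = killing h k"
proof -
  have "bij_betw (srefl \<alpha>) R R"
    by (rule bij_betwI[where g = "srefl \<alpha>"]) (auto simp: refl_root[OF a] refl_refl[OF a])
  then have "(\<Sum>\<beta>\<in>R. \<beta> h * \<beta> k) = (\<Sum>\<beta>\<in>R. srefl \<alpha> \<beta> h * srefl \<alpha> \<beta> k)"
    by (rule sum.reindex_bij_betw[symmetric])
  then show ?thesis
    by (simp add: killing_H h k weyl_aut_H_in a refl_apply root_dual)
qed

text \<open>\<open>weyl_aut \<alpha>\<close> preserves the Killing form on H and carries the vector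
  that represents \<beta> to the one that represents the reflected root.\<close>

lemma root_norm_refl:
  assumes a: "\<alpha> \<in> R" and b: "\<beta> \<in> R"
  shows "root_norm H (srefl \<alpha> \<beta>) = root_norm H \<beta>"
proof -
  define P where "P \<beta> t \<longleftrightarrow> t \<in> H \<and> (\<forall>h\<in>H. killing t h = \<beta> h)" for \<beta> t
  have uniq: "t = t'" if "P \<beta> t" "P \<beta> t'" for t t' \<beta>
  proof -
    have tH: "t \<in> H" "t' \<in> H" using that by (auto simp: P_def)
    have "t - t' = 0"
    proof (rule killing_nondegenerate)
      show d: "t - t' \<in> H" using tH by (rule cvs.subspace_diff[OF subspace_H])
      fix h assume h: "h \<in> H"
      have "killing (t - t') h = killing t h - killing t' h"
      proof -
        have "(\<Sum>\<beta>\<in>R. \<beta> (t - t') * \<beta> h) = (\<Sum>\<beta>\<in>R. \<beta> t * \<beta> h - \<beta> t' * \<beta> h)"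
        proof (intro sum.cong refl)
          fix \<beta> assume "\<beta> \<in> R"
          then have "\<beta> (t - t') = \<beta> t - \<beta> t'"
            using dual_diff_scale[OF root_dual tH, of \<beta> 1] by (simp add: scaleC_one)
          then show "\<beta> (t - t') * \<beta> h = \<beta> t * \<beta> h - \<beta> t' * \<beta> h" by (simp only: left_diff_distrib)
        qed
        then show ?thesis by (simp add: killing_H h tH d sum_subtractf)
      qed
      then show "killing (t - t') h = 0" using that h by (simp add: P_def)
    qed
    then show ?thesis by simp
  qed
  have tr: "P (srefl \<alpha> \<beta>) (weyl_aut \<alpha> t)" if "P \<beta> t" "\<beta> \<in> R" for \<beta> t
  proof -
    have t: "t \<in> H" using that by (simp add: P_def)
    have "killing (weyl_aut \<alpha> t) h = srefl \<alpha> \<beta> h" if h: "h \<in> H" for h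
      using killing_weyl_aut[OF a t weyl_aut_H_in[OF a h]] weyl_aut_weyl_aut_H[OF a h] \<open>P \<beta> t\<close> weyl_aut_H_in[OF a h]
        refl_apply[OF a root_dual[OF \<open>\<beta> \<in> R\<close>] h] by (simp add: P_def)
    then show ?thesis using weyl_aut_H_in[OF a t] by (simp add: P_def)
  qed
  show ?thesis
  proof (cases "\<exists>t. P \<beta> t")
    case True
    then obtain t where t: "P \<beta> t" by blast
    have 1: "(THE t. P \<beta> t) = t" using t uniq by blast
    have 2: "(THE t. P (srefl \<alpha> \<beta>) t) = weyl_aut \<alpha> t" using tr[OF t b] uniq by blast
    have "t \<in> H" using t by (simp add: P_def)
    then show ?thesis
      using killing_weyl_aut[OF a] unfolding root_norm_def P_def[symmetric] Let_def 1 2 by simp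
  next
    case False
    then have "\<not> (\<exists>t. P (srefl \<alpha> \<beta>) t)" using tr[OF _ refl_root[OF a b]] refl_refl[OF a, of \<beta>] by metis
    \<comment> \<open>Existence of a representing vector is not established. Without one for \<beta>
      there is none for the reflected root, and both definite descriptions denote the same
      unspecified element.\<close>
    with False have "P \<beta> = P (srefl \<alpha> \<beta>)" by (auto simp: fun_eq_iff)
    then show ?thesis unfolding root_norm_def P_def[symmetric] Let_def by simp
  qed
qed

lemma r_check_eq:
  assumes "\<alpha> \<in> R" "\<beta> \<in> R" "root_norm H \<alpha> = root_norm H \<beta>"
  shows "r_check H \<Delta> X \<alpha> = r_check H \<Delta> X \<beta>"
  using assms by (simp add: r_check_def long_root_def)

lemma root_norm_rp: "set as \<subseteq> \<Delta> \<Longrightarrow> \<beta> \<in> R \<Longrightarrow> root_norm H (rp as \<beta>) = root_norm H \<beta>"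
  by (induction as) (simp_all add: root_norm_refl simple_root rp_root)

lemma root_norm_uminus:
  assumes "\<beta> \<in> R"
  shows "root_norm H (- \<beta>) = root_norm H \<beta>"
proof -
  have "srefl \<beta> \<beta> = - \<beta>" by (auto simp: simple_reflection_def root_hh assms)
  then show ?thesis using root_norm_refl[OF assms assms] by simp
qed

end

context chevalley_longest
begin

lemma r_check_w0: "\<beta> \<in> R \<Longrightarrow> r_check H \<Delta> X (- w0 \<beta>) = r_check H \<Delta> X \<beta>"
  using root_norm_rp[OF ws(1)] root_norm_uminus w0_root uminus_root ws(2) by (intro r_check_eq) auto

end


section \<open>Binomials of coroots in the integral form\<close>

text \<open>Identities between binomials of one element u are proved as polynomial identities, that
  is, for complex numbers, and then evaluated at u.\<close>

definition ueval :: "'l::complex_lie_algebra uea \<Rightarrow> complex poly \<Rightarrow> 'l uea" where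
  "ueval u p = fold_coeffs (\<lambda>a r. uea_const a + u * r) p 0"

lemma ueval_0 [simp]: "ueval u 0 = 0"
  by (simp add: ueval_def)

lemma ueval_pCons [simp]: "ueval u (pCons a p) = uea_const a + u * ueval u p"
  by (cases "p = 0 \<and> a = 0") (auto simp: ueval_def)

lemma ueval_add: "ueval u (p + q) = ueval u p + ueval u q"
proof (induction p arbitrary: q)
  case (pCons a p)
  then show ?case by (cases q) (simp add: uea_const_add distrib_left algebra_simps)
qed simp

lemma ueval_smult: "ueval u (Polynomial.smult c p) = uea_const c * ueval u p"
  by (induction p) (simp_all add: uea_const_mult distrib_left uea_const_left_commute)

lemma ueval_mult: "ueval u (p * q) = ueval u p * ueval u q"
  by (induction p) (simp_all add: ueval_add ueval_smult distrib_right mult.assoc)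

lemma ueval_1 [simp]: "ueval u 1 = 1"
  by (simp add: one_pCons)

lemma ueval_sum: "ueval u (sum f A) = (\<Sum>i\<in>A. ueval u (f i))"
  by (induction A rule: infinite_finite_induct) (simp_all add: ueval_add)

lemma ueval_pcompose: "ueval u (pcompose p q) = ueval (ueval u q) p"
  by (induction p) (simp_all add: pcompose_pCons ueval_add ueval_mult)

definition binomial_poly :: "nat \<Rightarrow> complex poly" where
  "binomial_poly k = Polynomial.smult (1 / fact k) (\<Prod>j<k. [:- of_nat j, 1:])"

lemma poly_binomial_poly: "poly (binomial_poly k) z = z gchoose k"
  by (simp add: binomial_poly_def poly_prod gbinomial_prod_rev atLeast0LessThan)

lemma ueval_binomial_poly: "ueval u (binomial_poly k) = uea_binomial u k"
proof -
  have "ueval u (\<Prod>j<k. [:- of_nat j, 1:]) = prod_list (map (\<lambda>j. u - of_nat j) [0..<k])"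
  proof (induction k)
    case (Suc k)
    have "ueval u [:- of_nat k, 1:] = u - of_nat k"
      by (simp add: uea_const_uminus uea_const_of_nat)
    then show ?case using Suc by (simp add: ueval_mult del: ueval_pCons mult_pCons_right)
  qed simp
  then show ?thesis by (simp add: binomial_poly_def uea_binomial_def ueval_smult)
qed

text \<open>The binomial of u + c over k.\<close>

definition shifted_binomial :: "'l::complex_lie_algebra uea \<Rightarrow> int \<Rightarrow> nat \<Rightarrow> 'l uea" where
  "shifted_binomial u c k = ueval u (pcompose (binomial_poly k) [:of_int c, 1:])"

lemma shifted_binomial_0: "shifted_binomial u 0 k = uea_binomial u k"
  by (simp add: shifted_binomial_def ueval_pcompose ueval_binomial_poly)

text \<open>Complex binomial coefficients with an integral upper entry, because the sort constraint of
  \<open>gbinomial\<close> excludes the type of integers here.\<close>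

definition zchoose :: "int \<Rightarrow> nat \<Rightarrow> int" where
  "zchoose c k = (SOME n. of_int n = (of_int c gchoose k :: complex))"

lemma of_int_zchoose: "of_int (zchoose c k) = (of_int c gchoose k :: complex)"
  unfolding zchoose_def by (rule someI_ex, rule exI, rule of_int_gbinomial)

text \<open>Vandermonde's identity. Its integer coefficients keep a shifted binomial in the integral
  span of the unshifted ones of degree at most k.\<close>

lemma shifted_binomial_expand:
  "shifted_binomial u c k = (\<Sum>i\<le>k. of_int (zchoose c (k - i)) * uea_binomial u i)"
proof -
  have "pcompose (binomial_poly k) [:of_int c, 1:] = (\<Sum>i\<le>k. Polynomial.smult (of_int (zchoose c (k - i))) (binomial_poly i))"
    by (rule poly_eq_poly_eq_iff[THEN iffD1], rule ext)
      (simp add: poly_pcompose poly_sum poly_binomial_poly gbinomial_Vandermonde[symmetric] of_int_zchoose atLeast0AtMost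
        add.commute[of "of_int c"] mult.commute)
  then show ?thesis
    by (simp add: shifted_binomial_def ueval_sum ueval_smult ueval_binomial_poly uea_const_of_int)
qed

text \<open>Obtained from (-z choose k) = (-1)^k (z + k - 1 choose k) by Vandermonde's
  identity.\<close>

definition neg_binomial_coeff :: "nat \<Rightarrow> nat \<Rightarrow> int" where
  "neg_binomial_coeff k i = (-1) ^ k * zchoose (int k - 1) (k - i)"

lemma gchoose_uminus:
  fixes z :: complex
  shows "(- z) gchoose k = (\<Sum>i\<le>k. of_int (neg_binomial_coeff k i) * (z gchoose i))"
proof -
  have "(- z) gchoose k = (-1) ^ k * ((z + of_int (int k - 1)) gchoose k)"
    by (subst gbinomial_negated_upper) (simp add: algebra_simps)
  also have "(z + of_int (int k - 1)) gchoose k = (\<Sum>i\<le>k. (z gchoose i) * (of_int (int k - 1) gchoose (k - i)))"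
    by (simp only: gbinomial_Vandermonde[symmetric] atLeast0AtMost)
  finally show ?thesis
    by (simp only: neg_binomial_coeff_def of_int_mult of_int_power of_int_minus of_int_1 of_int_zchoose sum_distrib_left ac_simps)
qed

text \<open>This serves the weight relations, where w0 takes a simple coroot to the negative of a
  simple coroot.\<close>

lemma uea_binomial_uminus:
  "uea_binomial (- u) k = (\<Sum>i\<le>k. of_int (neg_binomial_coeff k i) * uea_binomial u i)"
proof -
  have "pcompose (binomial_poly k) [:0, -1:] = (\<Sum>i\<le>k. Polynomial.smult (of_int (neg_binomial_coeff k i)) (binomial_poly i))"
    by (rule poly_eq_poly_eq_iff[THEN iffD1], rule ext)
      (simp add: poly_pcompose poly_sum poly_binomial_poly gchoose_uminus)
  then have "ueval u (pcompose (binomial_poly k) [:0, -1:]) = (\<Sum>i\<le>k. of_int (neg_binomial_coeff k i) * uea_binomial u i)"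
    by (simp add: ueval_sum ueval_smult ueval_binomial_poly uea_const_of_int)
  then show ?thesis by (simp add: ueval_pcompose ueval_binomial_poly uea_const_uminus)
qed

text \<open>Divided powers with integral exponents, which vanish for negative exponents, spare the
  case distinctions at the ends of the sums below.\<close>

definition idp :: "'l::complex_lie_algebra uea \<Rightarrow> int \<Rightarrow> 'l uea" where
  "idp u n = (if n < 0 then 0 else divided_power u (nat n))"

lemma divided_power_Suc: "u * divided_power u k = of_nat (Suc k) * divided_power u (Suc k)"
  using divided_power_mult[of u 1 k] by simp

lemma mult_idp: "u * idp u n = of_int (n + 1) * idp u (n + 1)"
proof (cases "n < 0")
  case False
  then have "nat (n + 1) = Suc (nat n)" by simp
  then show ?thesis using divided_power_Suc[of u "nat n"] False by (simp add: idp_def add.commute)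
next
  case True
  then show ?thesis by (cases "n = -1") (auto simp: idp_def)
qed

lemma of_nat_mult_left_imp_eq:
  fixes u v :: "'l::complex_lie_algebra uea"
  assumes "of_nat (Suc n) * u = of_nat (Suc n) * v"
  shows "u = v"
proof -
  have "uea_const (1 / of_nat (Suc n)) * (of_nat (Suc n) * w) = w" for w :: "'l uea"
  proof -
    have "uea_const (1 / of_nat (Suc n)) * (of_nat (Suc n) * w) = uea_const (1 / of_nat (Suc n) * of_nat (Suc n)) * w"
      by (simp only: uea_const_mult uea_const_of_nat mult.assoc)
    then show ?thesis by (simp del: of_nat_Suc)
  qed
  then show ?thesis using assms by metis
qed

section \<open>The commutation formula for divided powers in sl2\<close>

locale sl2_triple =
  fixes e f h :: "'l::complex_lie_algebra uea"
  assumes ef: "e * f - f * e = h" and he: "h * e - e * h = 2 * e" and hf: "h * f - f * h = - 2 * f"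
begin

lemma e_ueval: "e * ueval h p = ueval h (pcompose p [:-2, 1:]) * e"
proof (induction p)
  case (pCons a p)
  have eh: "e * h = (h - 2) * e" using he by (simp add: algebra_simps)
  have "e * ueval h (pCons a p) = uea_const a * e + (h - 2) * (e * ueval h p)"
    by (simp add: distrib_left uea_const_commute mult.assoc[symmetric] eh)
  also have "\<dots> = (uea_const a + (h - 2) * ueval h (pcompose p [:-2, 1:])) * e"
    by (simp add: pCons distrib_right mult.assoc)
  also have "h - 2 = ueval h [:-2, 1:]"
    using uea_const_of_nat[of 2] by (simp add: uea_const_uminus)
  finally show ?case by (simp only: pcompose_pCons ueval_add ueval_mult) simp
qed simp

text \<open>The induction step multiplies both sides by n + 2, the factor by which the next divided
  power differs from a product with f, and cancels it at the end.\<close>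

lemma e_divided_power: "e * divided_power f (Suc n) = divided_power f (Suc n) * e + divided_power f n * (h - of_nat n)"
proof (induction n)
  case 0
  then show ?case using ef by (simp add: algebra_simps)
next
  case (Suc n)
  let ?F = "divided_power f"
  have comm: "f * ?F k = ?F k * f" for k
    using divided_power_mult[of f 1 k] divided_power_mult[of f k 1] by simp
  have hF: "h * f = f * (h - 2)" using hf by (simp add: algebra_simps mult_2 mult_2_right)
  have cn: "of_nat k * w = w * of_nat k" for k and w :: "'l uea"
    by (simp add: mult_of_nat_commute)
  have cn2: "of_nat k * (w * v) = w * (of_nat k * v)" for k and w v :: "'l uea"
    by (simp only: mult.assoc[symmetric] cn[of k w])
  have F: "?F n * f = of_nat (Suc n) * ?F (Suc n)" using divided_power_Suc[of f n] comm by simp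
  have "of_nat (Suc (Suc n)) * (e * ?F (Suc (Suc n))) = e * (?F (Suc n) * f)"
    using divided_power_Suc[of f "Suc n"] comm[of "Suc n"] cn by (metis mult.assoc)
  also have "\<dots> = (?F (Suc n) * e + ?F n * (h - of_nat n)) * f"
    by (simp only: mult.assoc[symmetric] Suc)
  also have "\<dots> = ?F (Suc n) * (e * f) + ?F n * (h * f - of_nat n * f)"
    by (simp only: distrib_right mult.assoc left_diff_distrib)
  also have "h * f - of_nat n * f = f * (h - 2 - of_nat n)"
    by (simp add: hF right_diff_distrib cn)
  also have "e * f = f * e + h" using ef by (simp add: algebra_simps)
  also have "?F (Suc n) * (f * e + h) + ?F n * (f * (h - 2 - of_nat n)) =
      ?F (Suc n) * f * e + ?F (Suc n) * h + ?F n * f * (h - 2 - of_nat n)"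
    by (simp only: distrib_left mult.assoc)
  also have "?F (Suc n) * f = of_nat (Suc (Suc n)) * ?F (Suc (Suc n))"
    using divided_power_Suc[of f "Suc n"] comm by simp
  also have "of_nat (Suc (Suc n)) * ?F (Suc (Suc n)) * e + ?F (Suc n) * h + ?F n * f * (h - 2 - of_nat n)
      = of_nat (Suc (Suc n)) * (?F (Suc (Suc n)) * e) + (?F (Suc n) * h + of_nat (Suc n) * (?F (Suc n) * (h - 2 - of_nat n)))"
    by (simp only: F mult.assoc add.assoc)
  also have "?F (Suc n) * h + of_nat (Suc n) * (?F (Suc n) * (h - 2 - of_nat n)) = of_nat (Suc (Suc n)) * (?F (Suc n) * (h - of_nat (Suc n)))"
  proof -
    have "?F (Suc n) * h + of_nat (Suc n) * (?F (Suc n) * (h - 2 - of_nat n)) = ?F (Suc n) * (h + of_nat (Suc n) * (h - 2 - of_nat n))"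
      by (simp only: distrib_left cn2)
    also have "h + of_nat (Suc n) * (h - 2 - of_nat n) = of_nat (Suc (Suc n)) * (h - of_nat (Suc n))"
      by (simp add: algebra_simps mult_2 mult_2_right)
    finally show ?thesis by (simp only: cn2)
  qed
  finally show ?case
    by (intro of_nat_mult_left_imp_eq[of "Suc n" "e * divided_power f (Suc (Suc n))"]) (simp only: distrib_left)
qed

lemma e_idp: "e * idp f n = idp f n * e + idp f (n - 1) * (h - of_int (n - 1))"
proof (cases "n \<le> 0")
  case True
  then show ?thesis by (cases "n = 0") (simp_all add: idp_def)
next
  case False
  define m where "m = nat (n - 1)"
  have m: "n = int (Suc m)" using False by (simp add: m_def)
  have "idp f n = divided_power f (Suc m)" "idp f (n - 1) = divided_power f m"
    by (simp_all add: idp_def m nat_add_distrib)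
  then show ?thesis using e_divided_power[of m] by (simp add: m)
qed

text \<open>Kostant's formula, by induction on a. A further factor e on the left of a summand gives
  two terms: either e passes f and the polynomial in h, shifting the latter by -2, and raises the
  power of e, or it is used up and lowers the power of f by one.\<close>

lemma divided_power_product:
  "divided_power e a * idp f b = (\<Sum>j\<le>a. idp f (b - int j) * shifted_binomial h (2 * int j - int a - b) j * idp e (int a - int j))"
proof (induction a)
  case 0
  then show ?case by (simp add: idp_def shifted_binomial_def binomial_poly_def pcompose_smult pcompose_1)
next
  case (Suc a)
  define P where "P c k = pcompose (binomial_poly k) [:of_int c, 1:]" for c :: int and k
  define w where "w j = 2 * int j - int a - b - 2" for j
  have sb: "shifted_binomial h c k = ueval h (P c k)" for c k
    by (simp add: shifted_binomial_def P_def)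
  have PP: "pcompose (P c k) [:-2, 1:] = P (c - 2) k" for c k
    unfolding P_def by (simp add: pcompose_assoc[symmetric] pcompose_pCons)
  \<comment> \<open>What the summand j - 1 contributes at j when e is used up; nothing arrives at j
    = 0.\<close>
  define Q where "Q j = (if j = 0 then 0 else [:of_int (int j - b), 1:] * P (w j) (j - 1))" for j
  \<comment> \<open>For j > 0 and y = z + w j this reads (a + 1 - j) (y choose j) + (y + a + 2 - j)
    (y choose j - 1) = (a + 1) (y + 1 choose j). It follows from Pascal's rule and y (y choose i) =
    i (y choose i) + (i + 1) (y choose i + 1).\<close>
  have key: "Polynomial.smult (of_int (int (Suc a) - int j)) (P (w j) j) + Q j = Polynomial.smult (of_nat (Suc a)) (P (w j + 1) j)" for j
  proof (rule poly_eq_poly_eq_iff[THEN iffD1], rule ext)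
    fix z :: complex
    let ?w = "z + of_int (w j)"
    have e1: "poly (P c k) z = (z + of_int c) gchoose k" for c k
      by (simp add: P_def poly_pcompose poly_binomial_poly add.commute)
    show "poly (Polynomial.smult (of_int (int (Suc a) - int j)) (P (w j) j) + Q j) z = poly (Polynomial.smult (of_nat (Suc a)) (P (w j + 1) j)) z"
    proof (cases j)
      case 0
      then show ?thesis by (simp add: e1 Q_def)
    next
      case (Suc i)
      have 1: "(?w + 1) gchoose Suc i = (?w gchoose i) + (?w gchoose Suc i)" by (rule gbinomial_Suc_Suc)
      have 2: "?w * (?w gchoose i) = of_nat i * (?w gchoose i) + of_nat (Suc i) * (?w gchoose Suc i)" by (rule gbinomial_mult_1)
      have 3: "of_int (int j - b) + z = ?w + of_nat a + 1 - of_nat i"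
        by (simp add: w_def Suc algebra_simps)
      have Qj: "poly (Q j) z = (of_int (int j - b) + z) * (?w gchoose i)"
        by (simp only: Q_def Suc nat.distinct if_False diff_Suc_1 poly_mult e1) (simp add: algebra_simps)
      have "poly (Polynomial.smult (of_int (int (Suc a) - int j)) (P (w j) j) + Q j) z
          = (of_nat a - of_nat i) * (?w gchoose Suc i) + (?w + of_nat a + 1 - of_nat i) * (?w gchoose i)"
        unfolding poly_add Qj 3 by (simp add: e1 Suc algebra_simps)
      also have "\<dots> = (of_nat a - of_nat i) * (?w gchoose Suc i) + (?w * (?w gchoose i) + (of_nat a + 1 - of_nat i) * (?w gchoose i))"
        by (simp add: algebra_simps)
      also have "\<dots> = of_nat (Suc a) * ((?w gchoose i) + (?w gchoose Suc i))"
        unfolding 2 by (simp add: algebra_simps)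
      also have "\<dots> = poly (Polynomial.smult (of_nat (Suc a)) (P (w j + 1) j)) z"
        by (simp only: 1[symmetric]) (simp add: e1 Suc add.assoc)
      finally show ?thesis .
    qed
  qed
  let ?E = "\<lambda>n. idp e n" and ?F = "\<lambda>n. idp f n"
  have mid: "e * (?F (b - int j) * ueval h (P (2 * int j - int a - b) j) * ?E (int a - int j)) =
      ?F (b - int j) * ueval h (Polynomial.smult (of_int (int (Suc a) - int j)) (P (w j) j)) * ?E (int (Suc a) - int j) +
      ?F (b - int (Suc j)) * ueval h (Q (Suc j)) * ?E (int (Suc a) - int (Suc j))" for j
  proof -
    let ?B = "ueval h (P (2 * int j - int a - b) j)"
    have "e * (?F (b - int j) * ?B * ?E (int a - int j)) =
        ?F (b - int j) * (e * ?B * ?E (int a - int j)) + ?F (b - int j - 1) * ((h - of_int (b - int j - 1)) * ?B) * ?E (int a - int j)"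
      by (simp add: mult.assoc[symmetric] e_idp) (simp add: distrib_right mult.assoc)
    also have "e * ?B * ?E (int a - int j) = ueval h (P (w j) j) * (e * ?E (int a - int j))"
      by (simp add: e_ueval PP w_def mult.assoc)
    also have "e * ?E (int a - int j) = of_int (int (Suc a) - int j) * ?E (int (Suc a) - int j)"
      using mult_idp[of e "int a - int j"] by (simp add: algebra_simps)
    also have "ueval h (P (w j) j) * (of_int (int (Suc a) - int j) * ?E (int (Suc a) - int j)) =
        ueval h (Polynomial.smult (of_int (int (Suc a) - int j)) (P (w j) j)) * ?E (int (Suc a) - int j)"
      by (simp only: ueval_smult uea_const_of_int[symmetric] uea_const_commute mult.assoc[symmetric])
    also have "(h - of_int (b - int j - 1)) * ?B = ueval h (Q (Suc j))"
    proof -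
      have "ueval h [:of_int (int (Suc j) - b), 1:] = h - of_int (b - int j - 1)"
      proof -
        have "ueval h [:of_int (int (Suc j) - b), 1:] = of_int (int (Suc j) - b) + h"
          by (simp only: ueval_pCons ueval_0 uea_const_of_int uea_const_1) simp
        then show ?thesis by simp
      qed
      moreover have "w (Suc j) = 2 * int j - int a - b" by (simp add: w_def)
      ultimately show ?thesis by (simp only: Q_def nat.distinct if_False diff_Suc_1 ueval_mult)
    qed
    finally show ?thesis by (simp add: mult.assoc algebra_simps)
  qed
  have "of_nat (Suc a) * (divided_power e (Suc a) * ?F b) = e * (divided_power e a * ?F b)"
    by (simp only: mult.assoc[symmetric] divided_power_Suc)
  also have "\<dots> = (\<Sum>j\<le>a. e * (?F (b - int j) * ueval h (P (2 * int j - int a - b) j) * ?E (int a - int j)))"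
    by (simp only: Suc sb sum_distrib_left)
  also have "\<dots> = (\<Sum>j\<le>a. ?F (b - int j) * ueval h (Polynomial.smult (of_int (int (Suc a) - int j)) (P (w j) j)) * ?E (int (Suc a) - int j)) +
      (\<Sum>j\<le>a. ?F (b - int (Suc j)) * ueval h (Q (Suc j)) * ?E (int (Suc a) - int (Suc j)))"
    by (simp only: mid sum.distrib)
  also have "(\<Sum>j\<le>a. ?F (b - int j) * ueval h (Polynomial.smult (of_int (int (Suc a) - int j)) (P (w j) j)) * ?E (int (Suc a) - int j)) =
      (\<Sum>j\<le>Suc a. ?F (b - int j) * ueval h (Polynomial.smult (of_int (int (Suc a) - int j)) (P (w j) j)) * ?E (int (Suc a) - int j))"
    by simp
  also have "(\<Sum>j\<le>a. ?F (b - int (Suc j)) * ueval h (Q (Suc j)) * ?E (int (Suc a) - int (Suc j))) =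
      (\<Sum>j\<le>Suc a. ?F (b - int j) * ueval h (Q j) * ?E (int (Suc a) - int j))"
    by (subst sum.atMost_Suc_shift[of _ a]) (simp add: Q_def)
  also have "(\<Sum>j\<le>Suc a. ?F (b - int j) * ueval h (Polynomial.smult (of_int (int (Suc a) - int j)) (P (w j) j)) * ?E (int (Suc a) - int j)) +
      (\<Sum>j\<le>Suc a. ?F (b - int j) * ueval h (Q j) * ?E (int (Suc a) - int j)) =
      (\<Sum>j\<le>Suc a. ?F (b - int j) * ueval h (Polynomial.smult (of_nat (Suc a)) (P (w j + 1) j)) * ?E (int (Suc a) - int j))"
    unfolding sum.distrib[symmetric] key[symmetric] ueval_add by (simp only: distrib_left distrib_right)
  also have "\<dots> = of_nat (Suc a) * (\<Sum>j\<le>Suc a. ?F (b - int j) * ueval h (P (w j + 1) j) * ?E (int (Suc a) - int j))"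
    unfolding sum_distrib_left ueval_smult uea_const_of_nat
    by (intro sum.cong refl) (metis mult.assoc mult_of_nat_commute)
  finally have "divided_power e (Suc a) * ?F b = (\<Sum>j\<le>Suc a. ?F (b - int j) * ueval h (P (w j + 1) j) * ?E (int (Suc a) - int j))"
    by (rule of_nat_mult_left_imp_eq)
  moreover have "w j + 1 = 2 * int j - int (Suc a) - b" for j by (simp add: w_def)
  ultimately show ?case by (simp only: sb)
qed

text \<open>For a = b = k the term j = k of the formula is the binomial of h over k, its shift being
  2k - k - k = 0. All other terms contain binomials with smaller lower entry, known by
  induction.\<close>

lemma binomial_in_subring:
  assumes A: "subring_set A" and e: "\<And>k. divided_power e k \<in> A" and f: "\<And>k. divided_power f k \<in> A"
  shows "uea_binomial h k \<in> A"
proof (induction k rule: less_induct)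
  case (less k)
  note A = subring_setD[OF A]
  have idp: "idp e n \<in> A" "idp f n \<in> A" for n using e f A(2) by (auto simp: idp_def)
  have sb: "shifted_binomial h c j \<in> A" if "j < k" for c j
    unfolding shifted_binomial_expand using less that by (auto intro!: A(8) A(5) A(7))
  define g where "g j = idp f (int k - int j) * shifted_binomial h (2 * int j - int k - int k) j * idp e (int k - int j)" for j
  have "divided_power e k * idp f (int k) = (\<Sum>j\<le>k. g j)"
    unfolding g_def by (rule divided_power_product)
  also have "\<dots> = (\<Sum>j<k. g j) + g k"
    using sum.lessThan_Suc[of g k] by (simp only: lessThan_Suc_atMost)
  also have "g k = uea_binomial h k" by (simp add: g_def idp_def shifted_binomial_0)
  finally have "uea_binomial h k = divided_power e k * idp f (int k) - (\<Sum>j<k. g j)" by simp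
  also have "\<dots> \<in> A"
    unfolding g_def by (intro A(4) A(5) A(8) e idp sb) simp
  finally show ?case .
qed

end

context chevalley
begin

text \<open>A weight is prescribed on these binomials; evaluating it on sums of them requires that
  they lie in the integral form of the Cartan subalgebra.\<close>

lemma int_form_sub_binomial:
  assumes a: "\<alpha> \<in> R"
  shows "uea_binomial (uea_gen (Poly_Mapping.single 0 (hh \<alpha>))) k \<in> int_form_sub H X (constants H)"
proof -
  let ?g = "\<lambda>x. uea_gen (Poly_Mapping.single (0::int) x)"
  have b: "?g x * ?g y - ?g y * ?g x = ?g (lie x y)" for x y :: 'g
    by (simp add: uea_gen_lie lie_single)
  have s: "?g (c *\<^sub>C x) = uea_const c * ?g x" for c and x :: 'g
    by (simp add: uea_gen_scaleC flip: scaleC_single)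
  have c2: "uea_const 2 = (2 :: 'g loop uea)" by (metis uea_const_of_int of_int_numeral)
  interpret sl2_triple "?g (X \<alpha>)" "?g (X (- \<alpha>))" "?g (hh \<alpha>)"
  proof
    show "?g (X \<alpha>) * ?g (X (- \<alpha>)) - ?g (X (- \<alpha>)) * ?g (X \<alpha>) = ?g (hh \<alpha>)"
      by (simp add: b coroot_def)
    show "?g (hh \<alpha>) * ?g (X \<alpha>) - ?g (X \<alpha>) * ?g (hh \<alpha>) = 2 * ?g (X \<alpha>)"
      by (simp only: b lie_H_X[OF a hh_in_H[OF a]] root_hh[OF a] s c2)
    show "?g (hh \<alpha>) * ?g (X (- \<alpha>)) - ?g (X (- \<alpha>)) * ?g (hh \<alpha>) = - 2 * ?g (X (- \<alpha>))"
      using lie_H_X[OF uminus_root[OF a] hh_in_H[OF a]] by (simp only: b root_hh[OF a] s uminus_apply uea_const_uminus c2)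
  qed
  have "subring_set (int_form H X)"
    by (auto simp: subring_set_def intro: int_form.intros)
  then have "uea_binomial (?g (hh \<alpha>)) k \<in> int_form H X"
    by (rule binomial_in_subring) (auto intro!: int_form.gen a uminus_root)
  moreover have "uea_binomial (?g (hh \<alpha>)) k \<in> uea_sub (constants H)"
  proof -
    have hh: "?g (hh \<alpha>) \<in> uea_sub (constants H)"
      by (rule uea_sub.gen) (simp add: constants_def hh_in_H a)
    have of_nat: "of_nat n \<in> uea_sub (constants H)" for n
      by (metis uea_const_of_nat uea_sub.const)
    have "prod_list (map (\<lambda>j. ?g (hh \<alpha>) - of_nat j) ns) \<in> uea_sub (constants H)" for ns
      by (induction ns) (auto intro!: uea_sub_1 uea_sub.mult uea_sub.diff hh of_nat)
    then show ?thesis unfolding uea_binomial_def by (intro uea_sub.mult uea_sub.const)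
  qed
  ultimately show ?thesis by (simp add: int_form_sub_def)
qed

end


section \<open>Extension of scalars\<close>

lemma formal_induct [consumes 1, case_names zero single diff]:
  assumes "Poly_Mapping.keys p \<subseteq> K" and zero: "P 0"
    and single: "\<And>k. k \<in> K \<Longrightarrow> P (Poly_Mapping.single k 1)"
    and diff: "\<And>p q. P p \<Longrightarrow> P q \<Longrightarrow> P (p - q)"
  shows "P (p :: 'a \<Rightarrow>\<^sub>0 int)"
proof -
  have neg: "P (- q)" if "P q" for q using diff[OF zero that] by simp
  have add: "P (q + r)" if "P q" "P r" for q r using diff[OF that(1) neg[OF that(2)]] by simp
  have nat: "P (Poly_Mapping.single k (int n))" if "k \<in> K" for k n
    by (induction n) (auto simp: zero single_add intro!: add single that)
  have int: "P (Poly_Mapping.single k n)" if "k \<in> K" for k n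
  proof (cases n)
    case (nonneg m)
    then show ?thesis using nat that by simp
  next
    case (neg m)
    have "P (- Poly_Mapping.single k (int (Suc m)))" using diff[OF zero nat[OF that]] by (simp only: diff_0)
    then show ?thesis unfolding neg single_uminus .
  qed
  from assms(1) show ?thesis
  proof (induction p rule: update_induct)
    case const
    then show ?case by (simp add: zero)
  next
    case (update f k v)
    have "Poly_Mapping.update k v f = Poly_Mapping.single k v + f"
      using update by (intro poly_mapping_eqI) (auto simp: lookup_update lookup_add lookup_single when_def in_keys_iff)
    moreover have "Poly_Mapping.keys f \<subseteq> K" "k \<in> K"
      using update by (auto simp: in_keys_iff lookup_update split: if_splits)
    ultimately show ?case using update int add by simp
  qed
qed

definition formal_mult :: "('f::field, 'u::ring_1) formal \<Rightarrow> ('f, 'u) formal \<Rightarrow> ('f, 'u) formal" where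
  "formal_mult p q = (\<Sum>a\<in>Poly_Mapping.keys p. \<Sum>b\<in>Poly_Mapping.keys q.
     Poly_Mapping.single (fst a * fst b, snd a * snd b) (Poly_Mapping.lookup p a * Poly_Mapping.lookup q b))"

lemma formal_mult_superset:
  assumes "finite S" "finite T" "Poly_Mapping.keys p \<subseteq> S" "Poly_Mapping.keys q \<subseteq> T"
  shows "formal_mult p q = (\<Sum>a\<in>S. \<Sum>b\<in>T.
     Poly_Mapping.single (fst a * fst b, snd a * snd b) (Poly_Mapping.lookup p a * Poly_Mapping.lookup q b))"
proof -
  have "formal_mult p q = (\<Sum>a\<in>Poly_Mapping.keys p. \<Sum>b\<in>T.
     Poly_Mapping.single (fst a * fst b, snd a * snd b) (Poly_Mapping.lookup p a * Poly_Mapping.lookup q b))"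
    unfolding formal_mult_def
    by (intro sum.cong refl sum.mono_neutral_left) (use assms in \<open>auto simp: in_keys_iff\<close>)
  also have "\<dots> = (\<Sum>a\<in>S. \<Sum>b\<in>T.
     Poly_Mapping.single (fst a * fst b, snd a * snd b) (Poly_Mapping.lookup p a * Poly_Mapping.lookup q b))"
    by (intro sum.mono_neutral_left) (use assms in \<open>auto simp: in_keys_iff\<close>)
  finally show ?thesis .
qed

lemma formal_mult_add_left: "formal_mult (p + q) r = formal_mult p r + formal_mult q r"
proof -
  let ?S = "Poly_Mapping.keys p \<union> Poly_Mapping.keys q"
  have "Poly_Mapping.keys (p + q) \<subseteq> ?S" by (rule keys_add)
  then show ?thesis
    by (subst (1 2 3) formal_mult_superset[where S = ?S and T = "Poly_Mapping.keys r"])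
      (auto simp: lookup_add distrib_right single_add sum.distrib)
qed

lemma formal_mult_add_right: "formal_mult r (p + q) = formal_mult r p + formal_mult r q"
proof -
  let ?S = "Poly_Mapping.keys p \<union> Poly_Mapping.keys q"
  have "Poly_Mapping.keys (p + q) \<subseteq> ?S" by (rule keys_add)
  then show ?thesis
    by (subst (1 2 3) formal_mult_superset[where T = ?S and S = "Poly_Mapping.keys r"])
      (auto simp: lookup_add distrib_left single_add sum.distrib)
qed

lemma formal_mult_0 [simp]: "formal_mult 0 p = 0" "formal_mult p 0 = 0"
  by (simp_all add: formal_mult_def)

lemma formal_mult_diff_left: "formal_mult (p - q) r = formal_mult p r - formal_mult q r"
  using formal_mult_add_left[of "p - q" q r] by simp

lemma formal_mult_diff_right: "formal_mult r (p - q) = formal_mult r p - formal_mult r q"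
  using formal_mult_add_right[of r "p - q" q] by simp

lemma formal_mult_single:
  "formal_mult (Poly_Mapping.single a m) (Poly_Mapping.single b n) = Poly_Mapping.single (fst a * fst b, snd a * snd b) (m * n)"
  by (subst formal_mult_superset[where S = "{a}" and T = "{b}"]) auto

lemma formal_mult_assoc: "formal_mult (formal_mult p q) r = formal_mult p (formal_mult q r)"
proof (induction p rule: poly_mapping_add_induct)
  case (single k v)
  show ?case
  proof (induction q rule: poly_mapping_add_induct)
    case (single k' v')
    show ?case
      by (induction r rule: poly_mapping_add_induct) (simp_all add: formal_mult_single formal_mult_add_right mult.assoc)
  qed (simp_all add: formal_mult_add_left formal_mult_add_right)
qed (simp_all add: formal_mult_add_left)

lemma formal_mult_1_left: "formal_mult (Poly_Mapping.single (1, 1) 1) p = p"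
  by (induction p rule: poly_mapping_add_induct) (simp_all add: formal_mult_single formal_mult_add_right)

lemma formal_mult_1_right: "formal_mult p (Poly_Mapping.single (1, 1) 1) = p"
  by (induction p rule: poly_mapping_add_induct) (simp_all add: formal_mult_single formal_mult_add_left)

abbreviation formals :: "'u::ring_1 set \<Rightarrow> ('f::field, 'u) formal set" where
  "formals A \<equiv> {p. Poly_Mapping.keys p \<subseteq> UNIV \<times> A}"

lemma formal_ring_simps:
  "carrier (formal_ring A) = formals A" "mult (formal_ring A) = formal_mult"
  "one (formal_ring A) = Poly_Mapping.single (1, 1) 1" "zero (formal_ring A) = 0" "add (formal_ring A) = (+)"
  by (auto simp: formal_ring_def formal_mult_def fun_eq_iff)

lemma formals_closed:
  "0 \<in> formals A" "p \<in> formals A \<Longrightarrow> q \<in> formals A \<Longrightarrow> p + q \<in> formals A"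
  "p \<in> formals A \<Longrightarrow> - p \<in> formals A" "p \<in> formals A \<Longrightarrow> q \<in> formals A \<Longrightarrow> p - q \<in> formals A"
  "u \<in> A \<Longrightarrow> Poly_Mapping.single (c, u) n \<in> formals A"
  using keys_add[of p q] keys_diff[of p q] by auto

lemma formals_mult:
  assumes "subring_set A" "p \<in> formals A" "q \<in> formals A"
  shows "formal_mult p q \<in> formals A"
proof -
  have c: "sum f S \<in> formals A" if "\<And>i. i \<in> S \<Longrightarrow> f i \<in> formals A" for f and S :: "'i set"
    using that by (induction S rule: infinite_finite_induct) (auto simp: formals_closed simp del: mem_Collect_eq)
  show ?thesis
    unfolding formal_mult_def using assms
    by (intro c formals_closed(5) subring_setD(5)[OF assms(1)]) auto
qed

lemma ring_formal_ring:
  assumes A: "subring_set A"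
  shows "ring (formal_ring A :: ('f::field, 'u::ring_1) formal ring)"
proof (rule ringI)
  show "abelian_group (formal_ring A :: ('f, 'u) formal ring)"
  proof (rule abelian_groupI)
    fix x :: "('f, 'u) formal"
    assume "x \<in> carrier (formal_ring A)"
    then show "\<exists>y\<in>carrier (formal_ring A). y \<oplus>\<^bsub>formal_ring A\<^esub> x = \<zero>\<^bsub>formal_ring A\<^esub>"
      by (intro bexI[of _ "- x"]) (simp_all add: formal_ring_simps)
  qed (auto simp: formal_ring_simps formals_closed add_ac simp del: mem_Collect_eq)
  show "Group.monoid (formal_ring A :: ('f, 'u) formal ring)"
    by (rule Group.monoidI)
      (auto simp: formal_ring_simps formals_mult[OF A] formals_closed subring_setD[OF A] formal_mult_assoc formal_mult_1_left
        formal_mult_1_right simp del: mem_Collect_eq)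
qed (auto simp: formal_ring_simps formal_mult_add_left formal_mult_add_right)

lemma tensor_rel_uminus: "p \<in> tensor_rel A \<Longrightarrow> - p \<in> tensor_rel A"
  using tensor_rel.diff[OF tensor_rel.zero] by fastforce

lemma tensor_rel_add: "p \<in> tensor_rel A \<Longrightarrow> q \<in> tensor_rel A \<Longrightarrow> p + q \<in> tensor_rel A"
  using tensor_rel.diff[OF _ tensor_rel_uminus] by fastforce

lemma tensor_rel_formals:
  assumes "subring_set A" "p \<in> tensor_rel A"
  shows "p \<in> formals A"
  using assms(2)
  by induction (auto simp: formals_closed subring_setD[OF assms(1)] simp del: mem_Collect_eq)

lemma tensor_rel_mult_left:
  assumes A: "subring_set A" and q: "q \<in> formals A" and p: "p \<in> tensor_rel A"
  shows "formal_mult q p \<in> tensor_rel A"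
proof -
  from q have "Poly_Mapping.keys q \<subseteq> UNIV \<times> A" by simp
  then show ?thesis
  proof (induction q rule: formal_induct)
    case (single k)
    obtain c u where k: "k = (c, u)" "u \<in> A" using single by auto
    from p show ?case
      by induction
        (auto simp: k formal_mult_diff_right formal_mult_single distrib_left subring_setD[OF A] intro: tensor_rel.intros)
  qed (auto simp: formal_mult_diff_left intro: tensor_rel.intros)
qed

lemma tensor_rel_mult_right:
  assumes A: "subring_set A" and q: "q \<in> formals A" and p: "p \<in> tensor_rel A"
  shows "formal_mult p q \<in> tensor_rel A"
proof -
  from q have "Poly_Mapping.keys q \<subseteq> UNIV \<times> A" by simp
  then show ?thesis
  proof (induction q rule: formal_induct)
    case (single k)
    obtain c u where k: "k = (c, u)" "u \<in> A" using single by auto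
    from p show ?case
      by induction
        (auto simp: k formal_mult_diff_left formal_mult_single distrib_right subring_setD[OF A] intro: tensor_rel.intros)
  qed (auto simp: formal_mult_diff_right intro: tensor_rel.intros)
qed

lemma ideal_tensor_rel:
  assumes A: "subring_set A"
  shows "ideal (tensor_rel A) (formal_ring A :: ('f::field, 'u::ring_1) formal ring)"
proof -
  interpret ring "formal_ring A :: ('f, 'u) formal ring" using A by (rule ring_formal_ring)
  have inv: "\<ominus>\<^bsub>formal_ring A\<^esub> p = - p" if "p \<in> formals A" for p :: "('f, 'u) formal"
    using that formals_closed(3)[OF that] by (intro minus_equality) (auto simp: formal_ring_simps)
  show ?thesis
  proof (rule idealI[OF ring_axioms])
    show "subgroup (tensor_rel A) (add_monoid (formal_ring A :: ('f, 'u) formal ring))"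
    proof (rule subgroup.intro)
      fix p :: "('f, 'u) formal" assume p: "p \<in> tensor_rel A"
      have "inv\<^bsub>add_monoid (formal_ring A)\<^esub> p = - p"
        using inv[OF tensor_rel_formals[OF A p]] by (simp only: a_inv_def)
      then show "inv\<^bsub>add_monoid (formal_ring A)\<^esub> p \<in> tensor_rel A" using tensor_rel_uminus[OF p] by simp
    qed (use tensor_rel_formals[OF A] in \<open>auto simp: formal_ring_simps tensor_rel_add tensor_rel.zero\<close>)
  qed (auto simp: formal_ring_simps tensor_rel_mult_left[OF A] tensor_rel_mult_right[OF A])
qed

text \<open>The field does not occur in A, so an \<open>itself\<close> argument fixes it.\<close>

locale scalar_extension =
  fixes A :: "'u::ring_1 set" and field_type :: "'f::field itself"
  assumes A: "subring_set A"
begin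

abbreviation F :: "('f, 'u) formal ring" where "F \<equiv> formal_ring A"
abbreviation R :: "('f, 'u) formal set ring" where "R \<equiv> tensor_ring A"
abbreviation cls :: "('f, 'u) formal \<Rightarrow> ('f, 'u) formal set" where "cls \<equiv> tensor_class A"
abbreviation t :: "'f \<Rightarrow> 'u \<Rightarrow> ('f, 'u) formal set" where "t \<equiv> tensor A"

sublocale rel: ideal "tensor_rel A" F
  using A by (rule ideal_tensor_rel)

sublocale ring R
  unfolding tensor_ring_def by (rule rel.quotient_is_ring)

lemma carrier_R: "carrier R = cls ` formals A"
  by (auto simp: tensor_ring_def FactRing_def A_RCOSETS_def RCOSETS_def tensor_class_def a_r_coset_def formal_ring_simps)

lemma cls_closed: "p \<in> formals A \<Longrightarrow> cls p \<in> carrier R"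
  by (simp add: carrier_R)

lemma cls_add: "p \<in> formals A \<Longrightarrow> q \<in> formals A \<Longrightarrow> cls p \<oplus>\<^bsub>R\<^esub> cls q = cls (p + q)"
  using rel.a_rcos_sum[of p q] by (simp add: tensor_ring_def FactRing_def tensor_class_def formal_ring_simps)

lemma cls_mult: "p \<in> formals A \<Longrightarrow> q \<in> formals A \<Longrightarrow> cls p \<otimes>\<^bsub>R\<^esub> cls q = cls (formal_mult p q)"
  using rel.rcoset_mult_add[of p q] by (simp add: tensor_ring_def FactRing_def tensor_class_def formal_ring_simps)

lemma cls_member: "q \<in> cls p \<longleftrightarrow> q - p \<in> tensor_rel A"
proof
  assume "q \<in> cls p"
  then show "q - p \<in> tensor_rel A" by (auto simp: tensor_class_def a_r_coset_def' formal_ring_simps)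
next
  assume a: "q - p \<in> tensor_rel A"
  show "q \<in> cls p"
    unfolding tensor_class_def a_r_coset_def' formal_ring_simps by (rule UN_I[OF a]) simp
qed

lemma cls_eq_iff: "cls p = cls q \<longleftrightarrow> p - q \<in> tensor_rel A"
proof
  assume "cls p = cls q"
  then show "p - q \<in> tensor_rel A" using cls_member[of p p] cls_member[of p q] tensor_rel.zero by simp
next
  assume pq: "p - q \<in> tensor_rel A"
  show "cls p = cls q"
  proof (rule Set.set_eqI)
    fix r
    have "r - p \<in> tensor_rel A \<longleftrightarrow> r - q \<in> tensor_rel A"
      using tensor_rel_add[OF _ pq, of "r - p"] tensor_rel.diff[OF _ pq, of "r - q"] by (auto simp: algebra_simps)
    then show "r \<in> cls p \<longleftrightarrow> r \<in> cls q" by (simp add: cls_member)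
  qed
qed

lemma zero_R: "\<zero>\<^bsub>R\<^esub> = cls 0"
  by (auto simp: tensor_ring_def FactRing_def cls_member)

lemma one_R: "\<one>\<^bsub>R\<^esub> = t 1 1"
  by (simp add: tensor_ring_def FactRing_def tensor_def tensor_class_def formal_ring_simps)

lemma cls_uminus: "p \<in> formals A \<Longrightarrow> \<ominus>\<^bsub>R\<^esub> cls p = cls (- p)"
  using formals_closed(3)[of p A]
  by (intro minus_equality) (auto simp: cls_add cls_closed zero_R simp del: mem_Collect_eq)

lemma t_closed [simp]: "u \<in> A \<Longrightarrow> t c u \<in> carrier R"
  unfolding tensor_def by (intro cls_closed formals_closed)

lemma t_add_right: "u \<in> A \<Longrightarrow> v \<in> A \<Longrightarrow> t c (u + v) = t c u \<oplus>\<^bsub>R\<^esub> t c v"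
  unfolding tensor_def
  by (subst cls_add) (auto simp: cls_eq_iff diff_diff_eq[symmetric] intro: tensor_rel.intros)

lemma t_add_left: "u \<in> A \<Longrightarrow> t (c + d) u = t c u \<oplus>\<^bsub>R\<^esub> t d u"
  unfolding tensor_def
  by (subst cls_add) (auto simp: cls_eq_iff diff_diff_eq[symmetric] intro: tensor_rel.intros)

lemma t_mult: "u \<in> A \<Longrightarrow> v \<in> A \<Longrightarrow> t c u \<otimes>\<^bsub>R\<^esub> t d v = t (c * d) (u * v)"
  unfolding tensor_def by (subst cls_mult) (auto simp: formal_mult_single)

lemma t_zero: "t c 0 = \<zero>\<^bsub>R\<^esub>"
proof -
  have "t c 0 \<oplus>\<^bsub>R\<^esub> t c 0 = t c 0" using t_add_right[of 0 0 c] subring_setD(2)[OF A] by simp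
  then show ?thesis using subring_setD(2)[OF A] by (simp add: add.l_cancel_one)
qed

lemma t_uminus: "u \<in> A \<Longrightarrow> t c (- u) = \<ominus>\<^bsub>R\<^esub> t c u"
  using t_add_right[of "- u" u c] subring_setD(3)[OF A, of u] by (intro minus_equality[symmetric]) (auto simp: t_zero)

lemma t_uminus_left: "u \<in> A \<Longrightarrow> t (- c) u = \<ominus>\<^bsub>R\<^esub> t c u"
proof -
  assume u: "u \<in> A"
  have "t 0 u \<oplus>\<^bsub>R\<^esub> t 0 u = t 0 u" using t_add_left[OF u, of 0 0] by simp
  then have "t 0 u = \<zero>\<^bsub>R\<^esub>" using u by (simp add: add.l_cancel_one)
  then show ?thesis using t_add_left[OF u, of "- c" c] u by (intro minus_equality[symmetric]) auto
qed

lemma t_diff: "u \<in> A \<Longrightarrow> v \<in> A \<Longrightarrow> t c (u - v) = t c u \<ominus>\<^bsub>R\<^esub> t c v"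
  using t_add_right[of u "- v" c] subring_setD(3)[OF A, of v] by (simp add: t_uminus a_minus_def)

lemma t_sum_mem:
  assumes I: "additive_subgroup I R" and f: "\<And>i. i \<in> B \<Longrightarrow> f i \<in> A \<and> t c (f i) \<in> I"
  shows "t c (sum f B) \<in> I"
  using f
proof (induction B rule: infinite_finite_induct)
  case (insert x B)
  then show ?case
    by (simp add: t_add_right subring_setD[OF A] additive_subgroup.a_closed[OF I])
qed (simp_all add: t_zero additive_subgroup.zero_closed[OF I])

lemma t_of_int: "t 1 (of_int n) = t (of_int n) 1"
proof -
  note A' = subring_setD[OF A]
  have nat: "t 1 (of_nat n) = t (of_nat n) 1" for n
  proof (induction n)
    case 0
    have "t 0 1 \<oplus>\<^bsub>R\<^esub> t 0 1 = t 0 1" using t_add_left[of 1 0 0] A'(1) by simp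
    then show ?case using A'(1) by (simp add: t_zero add.l_cancel_one)
  next
    case (Suc n)
    have "of_nat n \<in> A" using A'(7)[of "int n"] by simp
    then show ?case using Suc A'(1) by (simp add: t_add_right t_add_left)
  qed
  show ?thesis
  proof (cases n)
    case (nonneg m)
    then show ?thesis using nat by simp
  next
    case (neg m)
    have "of_nat (Suc m) \<in> A" using A'(7)[of "int (Suc m)"] by simp
    then have "t 1 (- of_nat (Suc m)) = t (- of_nat (Suc m)) 1"
      using nat[of "Suc m"] A'(1) by (simp only: t_uminus t_uminus_left)
    then show ?thesis unfolding neg by simp
  qed
qed

lemma tensor_induct [consumes 1, case_names tensor add]:
  assumes "r \<in> carrier R" and t: "\<And>c u. u \<in> A \<Longrightarrow> P (t c u)"
    and add: "\<And>x y. x \<in> carrier R \<Longrightarrow> y \<in> carrier R \<Longrightarrow> P x \<Longrightarrow> P y \<Longrightarrow> P (x \<oplus>\<^bsub>R\<^esub> y)"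
  shows "P r"
proof -
  obtain p where p: "r = cls p" "p \<in> formals A" using assms(1) by (auto simp: carrier_R)
  from p(2) have "Poly_Mapping.keys p \<subseteq> UNIV \<times> A" by simp
  \<comment> \<open>P is closed under sums only, whereas the induction builds differences; the claim
    for - p makes up for this.\<close>
  then have "p \<in> formals A \<and> P (cls p) \<and> P (cls (- p))"
  proof (induction p rule: formal_induct)
    case zero
    have "P (t 0 0)" using t subring_setD(2)[OF A] by blast
    then show ?case by (simp add: t_zero zero_R)
  next
    case (single k)
    then obtain c u where k: "k = (c, u)" "u \<in> A" by auto
    have "cls (- Poly_Mapping.single k 1) = t (- c) u"
      unfolding t_uminus_left[OF k(2)] unfolding tensor_def k(1)
      by (rule cls_uminus[symmetric]) (rule formals_closed(5)[OF k(2)])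
    moreover have "cls (Poly_Mapping.single k 1) = t c u" by (simp add: tensor_def k(1))
    moreover have "Poly_Mapping.single k 1 \<in> formals A" unfolding k(1) by (rule formals_closed(5)[OF k(2)])
    ultimately show ?case using t[OF k(2)] by simp
  next
    case (diff p q)
    then have "cls (p - q) = cls p \<oplus>\<^bsub>R\<^esub> cls (- q)" "cls (- (p - q)) = cls (- p) \<oplus>\<^bsub>R\<^esub> cls q"
      by (simp_all add: cls_add del: mem_Collect_eq add: formals_closed)
    then show ?case using diff by (simp add: add cls_closed formals_closed del: mem_Collect_eq)
  qed
  then show ?thesis using p by blast
qed

end

lemma tensor_rel_mono: "A \<subseteq> B \<Longrightarrow> tensor_rel A \<subseteq> tensor_rel B"
proof
  fix p assume "A \<subseteq> B" "p \<in> tensor_rel A"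
  from this(2,1) show "p \<in> tensor_rel B" by induction (auto intro: tensor_rel.intros)
qed

text \<open>All representatives of a class over A lie in one class over B, so the union in
  \<open>tensor_incl\<close> is that class.\<close>

lemma tensor_incl_class:
  fixes p :: "('f::field, 'u::ring_1) formal"
  assumes "subring_set A" "subring_set B" "A \<subseteq> B"
  shows "tensor_incl B (tensor_class A p) = tensor_class B p"
proof -
  interpret a: scalar_extension A "TYPE('f)" by unfold_locales fact
  interpret b: scalar_extension B "TYPE('f)" by unfold_locales fact
  have "tensor_class B q = tensor_class B p" if "q \<in> tensor_class A p" for q
    using that tensor_rel_mono[OF assms(3)] unfolding b.cls_eq_iff a.cls_member by blast
  moreover have "p \<in> tensor_class A p" by (simp add: a.cls_member tensor_rel.zero)
  ultimately show ?thesis unfolding tensor_incl_def by blast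
qed

subsection \<open>Functoriality\<close>

definition push :: "('u \<Rightarrow> 'u) \<Rightarrow> ('f::field, 'u::ring_1) formal \<Rightarrow> ('f, 'u) formal" where
  "push f p = (\<Sum>k\<in>Poly_Mapping.keys p. Poly_Mapping.single (fst k, f (snd k)) (Poly_Mapping.lookup p k))"

lemma push_superset:
  assumes "finite S" "Poly_Mapping.keys p \<subseteq> S"
  shows "push f p = (\<Sum>k\<in>S. Poly_Mapping.single (fst k, f (snd k)) (Poly_Mapping.lookup p k))"
  unfolding push_def by (intro sum.mono_neutral_left) (use assms in \<open>auto simp: in_keys_iff\<close>)

lemma push_0 [simp]: "push f 0 = 0"
  by (simp add: push_def)

lemma push_single: "push f (Poly_Mapping.single k n) = Poly_Mapping.single (fst k, f (snd k)) n"
  by (subst push_superset[where S = "{k}"]) auto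

lemma push_add: "push f (p + q) = push f p + push f q"
proof -
  let ?S = "Poly_Mapping.keys p \<union> Poly_Mapping.keys q"
  have "Poly_Mapping.keys (p + q) \<subseteq> ?S" by (rule keys_add)
  then show ?thesis
    by (subst (1 2 3) push_superset[where S = ?S]) (auto simp: lookup_add single_add sum.distrib)
qed

lemma push_diff: "push f (p - q) = push f p - push f q"
  using push_add[of f "p - q" q] by simp

lemma push_comp: "push f (push g p) = push (\<lambda>u. f (g u)) p"
  by (induction p rule: poly_mapping_add_induct) (simp_all add: push_single push_add)

lemma push_cong:
  assumes "p \<in> formals A" "\<And>u. u \<in> A \<Longrightarrow> f u = g u"
  shows "push f p = push g p"
  unfolding push_def using assms by (intro sum.cong refl) auto

lemma push_ident: "push (\<lambda>u. u) p = p"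
  by (induction p rule: poly_mapping_add_induct) (simp_all add: push_single push_add)

definition tmap :: "'u::ring_1 set \<Rightarrow> ('u \<Rightarrow> 'u) \<Rightarrow> ('f::field, 'u) formal set \<Rightarrow> ('f, 'u) formal set" where
  "tmap B f C = (\<Union>p\<in>C. tensor_class B (push f p))"

text \<open>The maps f and g are inverse to each other on A only. The inverse is part of the data
  because surjectivity is what makes images of left ideals left ideals; that g is a homomorphism
  follows.\<close>

locale scalar_extension_aut = scalar_extension +
  fixes f g
  assumes f_mem: "\<And>u. u \<in> A \<Longrightarrow> f u \<in> A" and f_add: "\<And>u v. u \<in> A \<Longrightarrow> v \<in> A \<Longrightarrow> f (u + v) = f u + f v"
    and f_mult: "\<And>u v. u \<in> A \<Longrightarrow> v \<in> A \<Longrightarrow> f (u * v) = f u * f v" and f_1: "f 1 = 1"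
    and g_mem: "\<And>u. u \<in> A \<Longrightarrow> g u \<in> A" and gf: "\<And>u. u \<in> A \<Longrightarrow> g (f u) = u" and fg: "\<And>u. u \<in> A \<Longrightarrow> f (g u) = u"
begin

lemma inverse: "scalar_extension_aut A g f"
proof
  fix u v assume u: "u \<in> A" "v \<in> A"
  have m: "g u \<in> A" "g v \<in> A" using u g_mem by auto
  have "g (u + v) = g (f (g u + g v))" using f_add[OF m] fg u by simp
  then show "g (u + v) = g u + g v" using gf subring_setD(6)[OF A m] by simp
  have "g (u * v) = g (f (g u * g v))" using f_mult[OF m] fg u by simp
  then show "g (u * v) = g u * g v" using gf subring_setD(5)[OF A m] by simp
next
  show "g 1 = 1" using gf[of 1] f_1 subring_setD(1)[OF A] by simp
qed (auto simp: f_mem g_mem fg gf)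

lemma push_formals:
  assumes "p \<in> formals A"
  shows "push f p \<in> formals A"
proof -
  from assms have "Poly_Mapping.keys p \<subseteq> UNIV \<times> A" by simp
  then show ?thesis
    by (induction p rule: formal_induct)
      (auto simp: push_diff push_single formals_closed f_mem simp del: mem_Collect_eq)
qed

lemma push_rel: "p \<in> tensor_rel A \<Longrightarrow> push f p \<in> tensor_rel A"
  by (induction rule: tensor_rel.induct)
    (auto simp: push_diff push_single f_add f_mem intro: tensor_rel.intros)

lemma tmap_cls: "tmap A f (cls p) = cls (push f p)"
proof -
  have "cls (push f q) = cls (push f p)" if "q \<in> cls p" for q
    using push_rel[of "q - p"] that by (simp add: cls_member cls_eq_iff push_diff)
  moreover have "p \<in> cls p" by (simp add: cls_member tensor_rel.zero)
  ultimately show ?thesis unfolding tmap_def by blast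
qed

lemma tmap_closed: "x \<in> carrier R \<Longrightarrow> tmap A f x \<in> carrier R"
  by (auto simp: carrier_R tmap_cls simp del: mem_Collect_eq intro!: imageI push_formals)

lemma tmap_tensor: "tmap A f (t c u) = t c (f u)"
  by (simp add: tensor_def tmap_cls push_single)

lemma tmap_add: "x \<in> carrier R \<Longrightarrow> y \<in> carrier R \<Longrightarrow> tmap A f (x \<oplus>\<^bsub>R\<^esub> y) = tmap A f x \<oplus>\<^bsub>R\<^esub> tmap A f y"
proof -
  assume "x \<in> carrier R" "y \<in> carrier R"
  then obtain p q where "x = cls p" "p \<in> formals A" "y = cls q" "q \<in> formals A" unfolding carrier_R by blast
  then show ?thesis by (simp add: tmap_cls cls_add push_add push_formals del: mem_Collect_eq)
qed

lemma push_mult: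
  assumes "p \<in> formals A" "q \<in> formals A"
  shows "push f (formal_mult p q) = formal_mult (push f p) (push f q)"
proof -
  from assms have "Poly_Mapping.keys p \<subseteq> UNIV \<times> A" "Poly_Mapping.keys q \<subseteq> UNIV \<times> A" by simp_all
  then show ?thesis
  proof (induction p rule: formal_induct)
    case (single k)
    from single(2) show ?case
      by (induction q rule: formal_induct)
        (use single(1) in \<open>auto simp: push_single formal_mult_single formal_mult_diff_right push_diff f_mult\<close>)
  qed (auto simp: formal_mult_diff_left push_diff)
qed

lemma tmap_mult: "x \<in> carrier R \<Longrightarrow> y \<in> carrier R \<Longrightarrow> tmap A f (x \<otimes>\<^bsub>R\<^esub> y) = tmap A f x \<otimes>\<^bsub>R\<^esub> tmap A f y"
proof -
  assume "x \<in> carrier R" "y \<in> carrier R"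
  then obtain p q where "x = cls p" "p \<in> formals A" "y = cls q" "q \<in> formals A" unfolding carrier_R by blast
  then show ?thesis by (simp add: tmap_cls cls_mult push_mult push_formals del: mem_Collect_eq)
qed

lemma tmap_inverse: "x \<in> carrier R \<Longrightarrow> tmap A g (tmap A f x) = x"
proof -
  interpret i: scalar_extension_aut A field_type g f by (rule inverse)
  assume "x \<in> carrier R"
  then obtain p where p: "x = cls p" "p \<in> formals A" by (auto simp: carrier_R)
  have "push g (push f p) = p"
    using push_cong[OF p(2), of "\<lambda>u. g (f u)" "\<lambda>u. u"] gf by (simp add: push_comp push_ident)
  then show ?thesis using p by (simp add: tmap_cls i.tmap_cls)
qed

lemma tmap_uminus: "x \<in> carrier R \<Longrightarrow> tmap A f (\<ominus>\<^bsub>R\<^esub> x) = \<ominus>\<^bsub>R\<^esub> tmap A f x"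
proof -
  assume x: "x \<in> carrier R"
  have "tmap A f (\<ominus>\<^bsub>R\<^esub> x) \<oplus>\<^bsub>R\<^esub> tmap A f x = tmap A f \<zero>\<^bsub>R\<^esub>" using x by (simp add: tmap_add[symmetric] l_neg)
  also have "\<dots> = \<zero>\<^bsub>R\<^esub>" by (simp add: zero_R tmap_cls)
  finally show ?thesis using x by (intro minus_equality[symmetric]) (auto simp: tmap_closed)
qed

lemma tmap_diff: "x \<in> carrier R \<Longrightarrow> y \<in> carrier R \<Longrightarrow> tmap A f (x \<ominus>\<^bsub>R\<^esub> y) = tmap A f x \<ominus>\<^bsub>R\<^esub> tmap A f y"
  by (simp add: a_minus_def tmap_add tmap_uminus)

end

section \<open>Left ideals and cyclic modules\<close>

locale basic_ring = ring R for R :: "'r ring" (structure)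
begin

lemma left_idealD:
  assumes "left_ideal I R"
  shows "additive_subgroup I R" "r \<in> carrier R \<Longrightarrow> x \<in> I \<Longrightarrow> r \<otimes> x \<in> I" "I \<subseteq> carrier R" "\<zero> \<in> I"
    "x \<in> I \<Longrightarrow> y \<in> I \<Longrightarrow> x \<oplus> y \<in> I" "x \<in> I \<Longrightarrow> \<ominus> x \<in> I" "x \<in> I \<Longrightarrow> y \<in> I \<Longrightarrow> x \<ominus> y \<in> I" "abelian_subgroup I R"
proof -
  show a: "additive_subgroup I R" using assms by (simp add: left_ideal_def)
  then interpret additive_subgroup I R .
  show "r \<in> carrier R \<Longrightarrow> x \<in> I \<Longrightarrow> r \<otimes> x \<in> I" using assms by (simp add: left_ideal_def)
  show "I \<subseteq> carrier R" "\<zero> \<in> I" "x \<in> I \<Longrightarrow> y \<in> I \<Longrightarrow> x \<oplus> y \<in> I" "abelian_subgroup I R"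
    using a_subset abelian_subgroupI3[OF a is_abelian_group] by auto
  show inv: "x \<in> I \<Longrightarrow> \<ominus> x \<in> I" for x by (rule a_inv_closed)
  show "x \<in> I \<Longrightarrow> y \<in> I \<Longrightarrow> x \<ominus> y \<in> I" using inv[of y] by (simp add: a_minus_def)
qed

lemma left_idealI:
  assumes "I \<subseteq> carrier R" "\<zero> \<in> I" "\<And>x y. x \<in> I \<Longrightarrow> y \<in> I \<Longrightarrow> x \<oplus> y \<in> I"
    "\<And>r x. r \<in> carrier R \<Longrightarrow> x \<in> I \<Longrightarrow> r \<otimes> x \<in> I"
  shows "left_ideal I R"
  unfolding left_ideal_def
proof (intro conjI ballI assms(4) additive_subgroup.intro subgroup.intro)
  fix x assume x: "x \<in> I"
  then have "\<ominus> x = (\<ominus> \<one>) \<otimes> x" using assms(1) by (auto simp: l_minus)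
  then have "\<ominus> x \<in> I" using assms(4)[OF _ x] by simp
  then show "inv\<^bsub>add_monoid R\<^esub> x \<in> I" by (simp add: a_inv_def)
qed (use assms in auto)

lemma left_ideal_gen:
  assumes "S \<subseteq> carrier R"
  shows "left_ideal (left_ideal_gen R S) R"
proof (rule left_idealI)
  have "left_ideal (carrier R) R" by (rule left_idealI) auto
  then show "left_ideal_gen R S \<subseteq> carrier R" using assms by (auto simp: left_ideal_gen_def)
qed (auto simp: left_ideal_gen_def intro: left_idealD)

lemma left_ideal_gen_subset: "S \<subseteq> left_ideal_gen R S"
  by (auto simp: left_ideal_gen_def)

lemma left_ideal_gen_minimal: "left_ideal I R \<Longrightarrow> S \<subseteq> I \<Longrightarrow> left_ideal_gen R S \<subseteq> I"
  by (auto simp: left_ideal_gen_def)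

lemma quotient_rcosets: "carrier (quotient_lmodule R I) = (\<lambda>x. I +> x) ` carrier R"
  by (auto simp: quotient_lmodule_def A_RCOSETS_def RCOSETS_def a_r_coset_def)

lemma rcos_eq_iff:
  assumes I: "left_ideal I R" and "x \<in> carrier R" "y \<in> carrier R"
  shows "I +> x = I +> y \<longleftrightarrow> x \<ominus> y \<in> I"
proof -
  interpret abelian_subgroup I R using left_idealD(8)[OF I] .
  show ?thesis
    using a_rcos_module_minus[OF ring_axioms assms(3,2)] a_repr_independence'[of x y] a_repr_independenceD[of x y]
      a_rcos_self[of x] assms by metis
qed

lemma rcos_member:
  assumes I: "left_ideal I R" and "x \<in> carrier R" "z \<in> I +> x"
  shows "z \<in> carrier R" "z \<ominus> x \<in> I"
proof -
  interpret abelian_subgroup I R using left_idealD(8)[OF I] .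
  show z: "z \<in> carrier R" using a_elemrcos_carrier[OF assms(2,3)] .
  show "z \<ominus> x \<in> I" using a_rcos_module_minus[OF ring_axioms assms(2) z] assms(3) by simp
qed

lemma rcos_mult_right:
  assumes I: "left_ideal I R" and J: "left_ideal J R" and e: "e \<in> carrier R" "\<And>z. z \<in> I \<Longrightarrow> z \<otimes> e \<in> J"
    and x: "x \<in> carrier R"
  shows "(\<Union>z\<in>I +> x. J +> (z \<otimes> e)) = J +> (x \<otimes> e)"
proof -
  interpret abelian_subgroup I R using left_idealD(8)[OF I] .
  have "J +> (z \<otimes> e) = J +> (x \<otimes> e)" if "z \<in> I +> x" for z
  proof -
    note z = rcos_member[OF I x that]
    have "(z \<ominus> x) \<otimes> e = (z \<otimes> e) \<ominus> (x \<otimes> e)" using z x e by (simp add: a_minus_def l_distr l_minus)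
    then show ?thesis using e(2)[OF z(2)] rcos_eq_iff[OF J] z x e by simp
  qed
  then show ?thesis using a_rcos_self[OF x] by blast
qed

lemma rcos_mult_left:
  assumes I: "left_ideal I R" and r: "r \<in> carrier R" and x: "x \<in> carrier R"
  shows "(\<Union>z\<in>I +> x. I +> (r \<otimes> z)) = I +> (r \<otimes> x)"
proof -
  interpret abelian_subgroup I R using left_idealD(8)[OF I] .
  have "I +> (r \<otimes> z) = I +> (r \<otimes> x)" if "z \<in> I +> x" for z
  proof -
    note z = rcos_member[OF I x that]
    have "r \<otimes> (z \<ominus> x) = (r \<otimes> z) \<ominus> (r \<otimes> x)" using z x r by (simp add: a_minus_def r_distr r_minus)
    then show ?thesis using left_idealD(2)[OF I r z(2)] rcos_eq_iff[OF I] z x r by simp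
  qed
  then show ?thesis using a_rcos_self[OF x] by blast
qed

text \<open>Maps between cyclic left modules are right multiplications, and d and e have to be
  inverse to each other only modulo the two ideals.\<close>

lemma lmodule_isomorphic_mult_right:
  assumes I: "left_ideal I R" and J: "left_ideal J R"
    and d: "d \<in> carrier R" "\<And>z. z \<in> I \<Longrightarrow> z \<otimes> d \<in> J" and e: "e \<in> carrier R" "\<And>z. z \<in> J \<Longrightarrow> z \<otimes> e \<in> I"
    and de: "d \<otimes> e \<ominus> \<one> \<in> I" and ed: "e \<otimes> d \<ominus> \<one> \<in> J"
  shows "lmodule_isomorphic R (quotient_lmodule R I) (quotient_lmodule R J)"
proof -
  define \<phi> where "\<phi> C = (\<Union>z\<in>C. J +> (z \<otimes> d))" for C
  define \<psi> where "\<psi> C = (\<Union>z\<in>C. I +> (z \<otimes> e))" for C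
  have \<phi>: "\<phi> (I +> x) = J +> (x \<otimes> d)" if "x \<in> carrier R" for x
    unfolding \<phi>_def by (rule rcos_mult_right[OF I J d that])
  have \<psi>: "\<psi> (J +> x) = I +> (x \<otimes> e)" if "x \<in> carrier R" for x
    unfolding \<psi>_def by (rule rcos_mult_right[OF J I e that])
  have inv: "K +> (x \<otimes> a \<otimes> b) = K +> x" if K: "left_ideal K R" and x: "x \<in> carrier R" and a: "a \<in> carrier R" and b: "b \<in> carrier R"
    and ab: "a \<otimes> b \<ominus> \<one> \<in> K" for K x a b
  proof -
    have "x \<otimes> (a \<otimes> b \<ominus> \<one>) = x \<otimes> a \<otimes> b \<ominus> x" using x a b by (simp add: a_minus_def r_distr r_minus m_assoc)
    then show ?thesis using left_idealD(2)[OF K x ab] rcos_eq_iff[OF K] x a b by simp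
  qed
  have "bij_betw \<phi> (carrier (quotient_lmodule R I)) (carrier (quotient_lmodule R J))"
  proof (rule bij_betwI[where g = \<psi>])
    show "\<phi> \<in> carrier (quotient_lmodule R I) \<rightarrow> carrier (quotient_lmodule R J)"
      using d(1) by (auto simp: quotient_rcosets \<phi>)
    show "\<psi> \<in> carrier (quotient_lmodule R J) \<rightarrow> carrier (quotient_lmodule R I)"
      using e(1) by (auto simp: quotient_rcosets \<psi>)
    show "\<psi> (\<phi> C) = C" if "C \<in> carrier (quotient_lmodule R I)" for C
      using that d(1) e(1) de by (auto simp: quotient_rcosets \<phi> \<psi> inv[OF I])
    show "\<phi> (\<psi> C) = C" if "C \<in> carrier (quotient_lmodule R J)" for C
      using that d(1) e(1) ed by (auto simp: quotient_rcosets \<phi> \<psi> inv[OF J])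
  qed
  moreover have "\<phi> (C \<oplus>\<^bsub>quotient_lmodule R I\<^esub> C') = \<phi> C \<oplus>\<^bsub>quotient_lmodule R J\<^esub> \<phi> C'"
    if C: "C \<in> carrier (quotient_lmodule R I)" "C' \<in> carrier (quotient_lmodule R I)" for C C'
  proof -
    obtain x y where xy: "x \<in> carrier R" "C = I +> x" "y \<in> carrier R" "C' = I +> y" using C by (auto simp: quotient_rcosets)
    have "(I +> x) <+> (I +> y) = I +> (x \<oplus> y)"
      using abelian_subgroup.a_rcos_sum[OF left_idealD(8)[OF I] xy(1,3)] .
    moreover have "(J +> (x \<otimes> d)) <+> (J +> (y \<otimes> d)) = J +> (x \<otimes> d \<oplus> y \<otimes> d)"
      using abelian_subgroup.a_rcos_sum[OF left_idealD(8)[OF J], of "x \<otimes> d" "y \<otimes> d"] xy d by simp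
    ultimately show ?thesis using xy d by (simp add: quotient_lmodule_def \<phi> l_distr)
  qed
  moreover have "\<phi> (r \<odot>\<^bsub>quotient_lmodule R I\<^esub> C) = r \<odot>\<^bsub>quotient_lmodule R J\<^esub> \<phi> C"
    if r: "r \<in> carrier R" and C: "C \<in> carrier (quotient_lmodule R I)" for r C
  proof -
    obtain x where x: "x \<in> carrier R" "C = I +> x" using C by (auto simp: quotient_rcosets)
    show ?thesis using r x d
      by (simp add: quotient_lmodule_def rcos_mult_left[OF I] rcos_mult_left[OF J] \<phi> m_assoc)
  qed
  ultimately show ?thesis unfolding lmodule_isomorphic_def lmodule_iso_def by blast
qed

end

lemma lmodule_isomorphic_refl: "lmodule_isomorphic R M M"
  unfolding lmodule_isomorphic_def lmodule_iso_def by (rule exI[of _ id]) auto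

lemma lmodule_isomorphic_trans:
  assumes "lmodule_isomorphic R M N" "lmodule_isomorphic R N P"
  shows "lmodule_isomorphic R M P"
proof -
  obtain \<phi> \<psi> where f: "lmodule_iso R M N \<phi>" "lmodule_iso R N P \<psi>" using assms by (auto simp: lmodule_isomorphic_def)
  have "\<phi> x \<in> carrier N" if "x \<in> carrier M" for x
    using f(1) that by (auto simp: lmodule_iso_def bij_betw_def)
  then have "lmodule_iso R M P (\<psi> \<circ> \<phi>)"
    using f by (auto simp: lmodule_iso_def intro: bij_betw_trans)
  then show ?thesis by (auto simp: lmodule_isomorphic_def)
qed


section \<open>Twisting cyclic modules by exponentials\<close>

lemma (in ring) add_minus_minus:
  assumes "a \<in> carrier R" "b \<in> carrier R" "c \<in> carrier R"
  shows "(a \<oplus> b \<ominus> c) \<ominus> (b \<ominus> c) = a"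
proof -
  have "a \<oplus> b \<ominus> c = a \<oplus> (b \<ominus> c)" using assms by (simp add: a_minus_def a_assoc)
  then show ?thesis using assms by (simp add: a_minus_def a_assoc r_neg)
qed

lemma (in ring) minus_minus_cancel:
  assumes "a \<in> carrier R" "b \<in> carrier R"
  shows "a \<ominus> (a \<ominus> b) = b"
  using assms by (simp add: a_minus_def minus_add r_neg1 r_neg2 a_assoc[symmetric] r_neg)

sublocale scalar_extension \<subseteq> basic_ring R
  by unfold_locales

context scalar_extension_aut
begin

lemma left_ideal_image:
  assumes I: "left_ideal I R"
  shows "left_ideal (tmap A f ` I) R"
proof (rule left_idealI)
  note D = left_idealD[OF I]
  show "tmap A f ` I \<subseteq> carrier R" using D(3) tmap_closed by blast
  show "\<zero>\<^bsub>R\<^esub> \<in> tmap A f ` I" using D(4) by (intro image_eqI[of _ _ "\<zero>\<^bsub>R\<^esub>"]) (simp_all add: zero_R tmap_cls)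
  show "x \<oplus>\<^bsub>R\<^esub> y \<in> tmap A f ` I" if xy: "x \<in> tmap A f ` I" "y \<in> tmap A f ` I" for x y
  proof -
    obtain a b where "a \<in> I" "x = tmap A f a" "b \<in> I" "y = tmap A f b" using xy by blast
    moreover from this have "a \<in> carrier R" "b \<in> carrier R" using D(3) by auto
    ultimately show ?thesis using D(5)[of a b] by (intro image_eqI[of _ _ "a \<oplus>\<^bsub>R\<^esub> b"]) (simp_all add: tmap_add)
  qed
  show "r \<otimes>\<^bsub>R\<^esub> x \<in> tmap A f ` I" if r: "r \<in> carrier R" and x: "x \<in> tmap A f ` I" for r x
  proof -
    interpret i: scalar_extension_aut A field_type g f by (rule inverse)
    obtain a where a: "a \<in> I" "x = tmap A f a" using x by blast
    have "tmap A g r \<in> carrier R" using r by (rule i.tmap_closed)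
    then show ?thesis using D(3) D(2)[of "tmap A g r" a] a r
      by (intro image_eqI[of _ _ "tmap A g r \<otimes>\<^bsub>R\<^esub> a"]) (auto simp: tmap_mult i.tmap_inverse)
  qed
qed

text \<open>The preimage of J is a left ideal, so generators suffice.\<close>

lemma tmap_left_ideal_gen:
  assumes S: "S \<subseteq> carrier R" and J: "left_ideal J R" and sub: "\<And>s. s \<in> S \<Longrightarrow> tmap A f s \<in> J"
    and z: "z \<in> left_ideal_gen R S"
  shows "tmap A f z \<in> J"
proof -
  note D = left_idealD[OF J]
  have "left_ideal {z \<in> carrier R. tmap A f z \<in> J} R"
    by (rule left_idealI) (auto simp: tmap_add tmap_mult tmap_closed D zero_R[symmetric] tmap_cls[of 0, simplified, folded zero_R])
  then have "left_ideal_gen R S \<subseteq> {z \<in> carrier R. tmap A f z \<in> J}"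
    by (rule left_ideal_gen_minimal) (use S sub in auto)
  then show ?thesis using z by blast
qed

end

lemma tmap_comp:
  fixes z :: "('f::field, 'u::ring_1) formal set"
  assumes "scalar_extension_aut A f g" "scalar_extension_aut A f' g'" "z \<in> carrier (tensor_ring A)"
  shows "tmap A (f \<circ> f') z = tmap A f (tmap A f' z)"
proof -
  interpret a: scalar_extension_aut A "TYPE('f)" f g using assms(1) by (simp add: scalar_extension_aut_def scalar_extension_def)
  interpret b: scalar_extension_aut A "TYPE('f)" f' g' using assms(2) by (simp add: scalar_extension_aut_def scalar_extension_def)
  have ab: "scalar_extension_aut A (f \<circ> f') (g' \<circ> g)"
    by unfold_locales (auto simp: a.f_mem b.f_mem a.g_mem b.g_mem a.f_add b.f_add a.f_mult b.f_mult a.f_1 b.f_1 a.gf b.gf a.fg b.fg)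
  interpret ab: scalar_extension_aut A "TYPE('f)" "f \<circ> f'" "g' \<circ> g" using ab by (simp add: scalar_extension_aut_def scalar_extension_def)
  obtain p where "z = tensor_class A p" using assms(3) a.carrier_R by blast
  then show ?thesis
    by (simp only: a.tmap_cls b.tmap_cls ab.tmap_cls) (simp add: push_comp comp_def)
qed

text \<open>What conjugation by exp x needs in order to act on the scalar extension of A: the
  divided powers of x lie in A, and those of \<open>ad_gen x\<close> preserve A, so no denominators
  remain.\<close>

locale exp_step = scalar_extension A field_type
  for A :: "'l::complex_lie_algebra uea set" and field_type :: "'f::field itself" +
  fixes x :: 'l
  assumes nil: "lvs.loc_nilpotent (lie x)"
    and dp: "\<And>k. divided_power (uea_gen x) k \<in> A"
    and dpow: "\<And>i a. a \<in> A \<Longrightarrow> uvs.dpow (ad_gen x) i a \<in> A"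
begin

abbreviation "\<Phi> \<equiv> uvs.dexp (ad_gen x)"
abbreviation "p k \<equiv> divided_power (uea_gen x) k"

lemma neg_1_power_mem: "(-1) ^ k \<in> A"
  by (induction k) (auto simp: subring_setD[OF A])

lemma exp_step_uminus: "exp_step A (- x)"
proof unfold_locales
  show "lvs.loc_nilpotent (lie (- x))"
    using lvs.loc_nilpotent_neg[OF nil] by (simp add: lie_uminus_left[abs_def])
  show "divided_power (uea_gen (- x)) k \<in> A" for k
    unfolding uea_gen_uminus divided_power_uminus by (intro subring_setD(5)[OF A] neg_1_power_mem dp)
  show "uvs.dpow (ad_gen (- x)) i a \<in> A" if "a \<in> A" for i a
  proof -
    have "ad_gen (- x) = (\<lambda>u. - ad_gen x u)"
      by (simp add: ad_gen_def uea_gen_uminus fun_eq_iff)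
    then have "uvs.dpow (ad_gen (- x)) i a = (-1) ^ i * uvs.dpow (ad_gen x) i a"
      using uvs.dpow_neg[OF lin_ad_gen, of x i a] by (simp add: uea_const_neg_1_power)
    then show ?thesis using subring_setD(5)[OF A neg_1_power_mem dpow[OF that]] by simp
  qed
qed

lemma \<Phi>_mem: "a \<in> A \<Longrightarrow> \<Phi> a \<in> A"
  unfolding uvs.dexp_def by (intro subring_setD(8)[OF A] dpow)

lemma scalar_extension_aut_exp: "scalar_extension_aut A \<Phi> (uvs.dexp (ad_gen (- x)))"
proof -
  interpret m: exp_step A field_type "- x" using exp_step_uminus by (simp add: exp_step_def scalar_extension_def)
  note e = uea_extD[OF uea_ext_dexp[OF nil]]
  show ?thesis
    by unfold_locales (auto simp: e \<Phi>_mem m.\<Phi>_mem dexp_ad_gen_inverse[OF nil])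
qed

sublocale aut: scalar_extension_aut A field_type \<Phi> "uvs.dexp (ad_gen (- x))"
  using scalar_extension_aut_exp by (simp add: scalar_extension_aut_def scalar_extension_def)

definition E :: "nat \<Rightarrow> ('f, 'l uea) formal set" where
  "E N = t 1 (\<Sum>k<N. p k)"

lemma sum_p_mem: "(\<Sum>k\<in>B. p k) \<in> A"
  by (intro subring_setD(8)[OF A] dp)

lemma E_closed [simp]: "E N \<in> carrier R"
  unfolding E_def by (intro t_closed sum_p_mem)

text \<open>All large k are demanded, not one: in positive characteristic a divided power may kill
  the generator of the cyclic module without the later ones doing so.\<close>

definition locally_nilpotent_mod :: "('f, 'l uea) formal set set \<Rightarrow> bool" where
  "locally_nilpotent_mod I \<longleftrightarrow> (\<exists>N. \<forall>k\<ge>N. t 1 (p k) \<in> I)"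

text \<open>The rule exp x * r = \<Phi> r * exp x, modulo I. On the left the truncation must be long
  compared with the nilpotency of \<open>ad_gen x\<close> on r, so M0 depends on r; on the right the
  same N serves all r because what is cut off lies in I.\<close>

lemma E_commutation:
  assumes I: "left_ideal I R" and N: "\<And>k. k \<ge> N \<Longrightarrow> t 1 (p k) \<in> I" and r: "r \<in> carrier R"
  shows "\<exists>M0. \<forall>M\<ge>M0. E M \<otimes>\<^bsub>R\<^esub> r \<ominus>\<^bsub>R\<^esub> tmap A \<Phi> r \<otimes>\<^bsub>R\<^esub> E N \<in> I"
  using r
proof (induction r rule: tensor_induct)
  case (tensor c u)
  note D = left_idealD[OF I]
  obtain J where J: "\<And>i. i \<ge> J \<Longrightarrow> (ad_gen x ^^ i) u = 0"
    using uvs.loc_nilpotentE[OF loc_nilpotent_ad_gen[OF nil]] by blast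
  have "E M \<otimes>\<^bsub>R\<^esub> t c u \<ominus>\<^bsub>R\<^esub> tmap A \<Phi> (t c u) \<otimes>\<^bsub>R\<^esub> E N \<in> I" if M: "M \<ge> J + N" for M
  proof -
    define s where "s = (\<Sum>i<J. uvs.dpow (ad_gen x) i u * (\<Sum>j\<in>{N..<M - i}. p j))"
    have mem: "\<Phi> u * (\<Sum>k<N. p k) \<in> A" "(\<Sum>k<M. p k) * u \<in> A"
      using tensor by (intro subring_setD(5)[OF A] \<Phi>_mem sum_p_mem; simp)+
    have summand: "uvs.dpow (ad_gen x) i u * (\<Sum>j\<in>{N..<M - i}. p j) \<in> A \<and>
        t c (uvs.dpow (ad_gen x) i u * (\<Sum>j\<in>{N..<M - i}. p j)) \<in> I" for i
    proof
      show "uvs.dpow (ad_gen x) i u * (\<Sum>j\<in>{N..<M - i}. p j) \<in> A"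
        by (intro subring_setD(5)[OF A] dpow tensor sum_p_mem)
      have "t 1 (\<Sum>j\<in>{N..<M - i}. p j) \<in> I"
        by (rule t_sum_mem[OF D(1)]) (auto simp: dp N)
      then have "t c (uvs.dpow (ad_gen x) i u) \<otimes>\<^bsub>R\<^esub> t 1 (\<Sum>j\<in>{N..<M - i}. p j) \<in> I"
        using dpow[OF tensor] by (intro D(2)) auto
      then show "t c (uvs.dpow (ad_gen x) i u * (\<Sum>j\<in>{N..<M - i}. p j)) \<in> I"
        by (simp add: t_mult dpow[OF tensor] sum_p_mem)
    qed
    have "t c s \<in> I" unfolding s_def by (rule t_sum_mem[OF D(1)]) (rule summand)
    moreover have "(\<Sum>k<M. p k) * u = \<Phi> u * (\<Sum>k<N. p k) + s"
      unfolding s_def by (rule divided_power_sum_commutation) (use J M in \<open>auto simp: uvs.dpow_0_iff\<close>)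
    then have "s = (\<Sum>k<M. p k) * u - \<Phi> u * (\<Sum>k<N. p k)" by simp
    then have "t c s = E M \<otimes>\<^bsub>R\<^esub> t c u \<ominus>\<^bsub>R\<^esub> tmap A \<Phi> (t c u) \<otimes>\<^bsub>R\<^esub> E N"
      unfolding E_def by (simp add: t_diff mem aut.tmap_tensor t_mult \<Phi>_mem tensor sum_p_mem)
    ultimately show ?thesis by simp
  qed
  then show ?case by blast
next
  case (add y z)
  note D = left_idealD[OF I]
  from add obtain M1 M2 where M: "\<And>M. M \<ge> M1 \<Longrightarrow> E M \<otimes>\<^bsub>R\<^esub> y \<ominus>\<^bsub>R\<^esub> tmap A \<Phi> y \<otimes>\<^bsub>R\<^esub> E N \<in> I"
    "\<And>M. M \<ge> M2 \<Longrightarrow> E M \<otimes>\<^bsub>R\<^esub> z \<ominus>\<^bsub>R\<^esub> tmap A \<Phi> z \<otimes>\<^bsub>R\<^esub> E N \<in> I" by blast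
  have "E M \<otimes>\<^bsub>R\<^esub> (y \<oplus>\<^bsub>R\<^esub> z) \<ominus>\<^bsub>R\<^esub> tmap A \<Phi> (y \<oplus>\<^bsub>R\<^esub> z) \<otimes>\<^bsub>R\<^esub> E N \<in> I" if m: "M \<ge> max M1 M2" for M
  proof -
    have c: "tmap A \<Phi> y \<in> carrier R" "tmap A \<Phi> z \<in> carrier R" using add aut.tmap_closed by auto
    have "E M \<otimes>\<^bsub>R\<^esub> (y \<oplus>\<^bsub>R\<^esub> z) \<ominus>\<^bsub>R\<^esub> tmap A \<Phi> (y \<oplus>\<^bsub>R\<^esub> z) \<otimes>\<^bsub>R\<^esub> E N =
        (E M \<otimes>\<^bsub>R\<^esub> y \<ominus>\<^bsub>R\<^esub> tmap A \<Phi> y \<otimes>\<^bsub>R\<^esub> E N) \<oplus>\<^bsub>R\<^esub> (E M \<otimes>\<^bsub>R\<^esub> z \<ominus>\<^bsub>R\<^esub> tmap A \<Phi> z \<otimes>\<^bsub>R\<^esub> E N)"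
      using add c by (simp add: aut.tmap_add a_minus_def r_distr l_distr minus_add a_ac)
    then show ?thesis using D(5)[OF M] m by simp
  qed
  then show ?case by blast
qed

text \<open>For s in I the product E M * s lies in I, and modulo I it is \<Phi> s * E N. So right
  multiplication by E N takes \<Phi> I into I.\<close>

lemma tmap_mult_E:
  assumes I: "left_ideal I R" and N: "\<And>k. k \<ge> N \<Longrightarrow> t 1 (p k) \<in> I" and s: "s \<in> I"
  shows "tmap A \<Phi> s \<otimes>\<^bsub>R\<^esub> E N \<in> I"
proof -
  note D = left_idealD[OF I]
  have sR: "s \<in> carrier R" using s D(3) by blast
  obtain M where M: "E M \<otimes>\<^bsub>R\<^esub> s \<ominus>\<^bsub>R\<^esub> tmap A \<Phi> s \<otimes>\<^bsub>R\<^esub> E N \<in> I" using E_commutation[OF I N sR] by blast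
  have "E M \<otimes>\<^bsub>R\<^esub> s \<ominus>\<^bsub>R\<^esub> (E M \<otimes>\<^bsub>R\<^esub> s \<ominus>\<^bsub>R\<^esub> tmap A \<Phi> s \<otimes>\<^bsub>R\<^esub> E N) \<in> I"
    by (intro D(7) D(2) M s) simp
  also have "E M \<otimes>\<^bsub>R\<^esub> s \<ominus>\<^bsub>R\<^esub> (E M \<otimes>\<^bsub>R\<^esub> s \<ominus>\<^bsub>R\<^esub> tmap A \<Phi> s \<otimes>\<^bsub>R\<^esub> E N) = tmap A \<Phi> s \<otimes>\<^bsub>R\<^esub> E N"
    using sR aut.tmap_closed[OF sR] by (simp add: minus_minus_cancel)
  finally show ?thesis .
qed

text \<open>A divided power is the difference of two consecutive truncations, and modulo I both take
  r to \<Phi> r * E N. Thus nilpotency on the generator spreads to the whole cyclic module.\<close>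

lemma locally_nilpotent_action:
  assumes I: "left_ideal I R" and n: "locally_nilpotent_mod I" and r: "r \<in> carrier R"
  shows "\<exists>K. \<forall>k\<ge>K. t 1 (p k) \<otimes>\<^bsub>R\<^esub> r \<in> I"
proof -
  note D = left_idealD[OF I]
  obtain N where N: "\<And>k. k \<ge> N \<Longrightarrow> t 1 (p k) \<in> I" using n by (auto simp: locally_nilpotent_mod_def)
  obtain M0 where M: "\<And>M. M \<ge> M0 \<Longrightarrow> E M \<otimes>\<^bsub>R\<^esub> r \<ominus>\<^bsub>R\<^esub> tmap A \<Phi> r \<otimes>\<^bsub>R\<^esub> E N \<in> I" using E_commutation[OF I N r] by blast
  have "t 1 (p k) \<otimes>\<^bsub>R\<^esub> r \<in> I" if k: "k \<ge> M0" for k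
  proof -
    let ?w = "tmap A \<Phi> r \<otimes>\<^bsub>R\<^esub> E N"
    have w: "?w \<in> carrier R" using aut.tmap_closed[OF r] by simp
    have pR: "t 1 (p k) \<in> carrier R" by (simp add: dp)
    have "E (Suc k) = t 1 (p k) \<oplus>\<^bsub>R\<^esub> E k"
      unfolding E_def by (simp add: t_add_right sum_p_mem dp a_comm)
    then have "t 1 (p k) \<otimes>\<^bsub>R\<^esub> r = (E (Suc k) \<otimes>\<^bsub>R\<^esub> r \<ominus>\<^bsub>R\<^esub> ?w) \<ominus>\<^bsub>R\<^esub> (E k \<otimes>\<^bsub>R\<^esub> r \<ominus>\<^bsub>R\<^esub> ?w)"
      using r w pR by (simp add: l_distr add_minus_minus)
    then show ?thesis using D(7)[OF M[of "Suc k"] M[of k]] k by simp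
  qed
  then show ?thesis by blast
qed

end

text \<open>The isomorphism is induced by right multiplication by the truncated exponential of \<open>- x\<close>,
  with inverse right multiplication by that of \<open>x\<close>.\<close>

lemma exp_step_twist:
  fixes I :: "('f::field, 'l::complex_lie_algebra uea) formal set set"
  assumes x: "exp_step A x" and I: "left_ideal I (tensor_ring A)"
    and n: "exp_step.locally_nilpotent_mod A x I"
  defines "J \<equiv> tmap A (uvs.dexp (ad_gen x)) ` I"
  shows "left_ideal J (tensor_ring A)"
    and "lmodule_isomorphic (tensor_ring A) (quotient_lmodule (tensor_ring A) I) (quotient_lmodule (tensor_ring A) J)"
    and "\<And>y. exp_step A y \<Longrightarrow> exp_step.locally_nilpotent_mod A y I \<Longrightarrow> exp_step.locally_nilpotent_mod A y J"
proof -
  interpret x: exp_step A "TYPE('f)" x using x by (simp add: exp_step_def scalar_extension_def)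
  interpret m: exp_step A "TYPE('f)" "- x" using x.exp_step_uminus by (simp add: exp_step_def scalar_extension_def)
  show J: "left_ideal J (tensor_ring A)" unfolding J_def by (rule x.aut.left_ideal_image[OF I])
  note DI = x.left_idealD[OF I] and DJ = x.left_idealD[OF J]
  obtain N0 where N0: "\<And>k. k \<ge> N0 \<Longrightarrow> tensor A 1 (divided_power (uea_gen x) k) \<in> I"
    using n by (auto simp: x.locally_nilpotent_mod_def)
  \<comment> \<open>\<open>divided_power_sum_inverse\<close> needs a positive truncation.\<close>
  define N where "N = Suc N0"
  have NI: "tensor A 1 (divided_power (uea_gen x) k) \<in> I" if "k \<ge> N" for k using N0 that by (simp add: N_def)
  \<comment> \<open>Conjugation by exp x fixes x, so the divided powers of x that lie in I lie in J
    as well.\<close>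
  have fix_x: "uvs.dexp (ad_gen x) (divided_power (uea_gen x) k) = divided_power (uea_gen x) k" for k
  proof -
    note e = uea_ext_dexp[OF x.nil]
    have "lvs.dexp (lie x) x = x" using lvs.dexp_eq[OF lin_lie, of 1 x x] by (simp add: lie_self)
    then show ?thesis by (simp add: uea_ext_divided_power[OF e] uea_extD(4)[OF e])
  qed
  have NJ: "tensor A 1 (divided_power (uea_gen x) k) \<in> J" if "k \<ge> N" for k
    unfolding J_def using NI[OF that] by (rule image_eqI[rotated]) (simp add: x.aut.tmap_tensor fix_x)
  have NJ': "tensor A 1 (divided_power (uea_gen (- x)) k) \<in> J" if "k \<ge> N" for k
  proof -
    have "tensor A 1 ((-1) ^ k) \<otimes>\<^bsub>tensor_ring A\<^esub> tensor A 1 (divided_power (uea_gen x) k) \<in> J"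
      by (intro DJ(2) NJ that x.t_closed x.neg_1_power_mem)
    then show ?thesis by (simp add: x.t_mult x.neg_1_power_mem x.dp uea_gen_uminus divided_power_uminus)
  qed
  let ?e = "x.E N" and ?d = "m.E N"
  have Je: "z \<otimes>\<^bsub>tensor_ring A\<^esub> ?e \<in> I" if "z \<in> J" for z
    using that x.tmap_mult_E[OF I NI] unfolding J_def by blast
  \<comment> \<open>This is \<open>tmap_mult_E\<close> for -x and the ideal J: conjugation by exp
    (-x) takes \<Phi> z back to z.\<close>
  have Id: "z \<otimes>\<^bsub>tensor_ring A\<^esub> ?d \<in> J" if z: "z \<in> I" for z
  proof -
    have zR: "z \<in> carrier (tensor_ring A)" using z DI(3) by blast
    have "tmap A (uvs.dexp (ad_gen x)) z \<in> J" using z by (simp add: J_def)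
    from m.tmap_mult_E[OF J NJ' this] show ?thesis by (simp add: x.aut.tmap_inverse[OF zR])
  qed
  have inv: "exp_step.E A (- x) N \<otimes>\<^bsub>tensor_ring A\<^esub> exp_step.E A x N \<ominus>\<^bsub>tensor_ring A\<^esub> \<one>\<^bsub>tensor_ring A\<^esub> \<in> K"
    if x: "exp_step A x" and m: "exp_step A (- x)" and K: "left_ideal K (tensor_ring A)"
      and NK: "\<And>k. k \<ge> N \<Longrightarrow> tensor A 1 (divided_power (uea_gen x) k) \<in> K" for x and K :: "('f, 'l uea) formal set set"
  proof -
    interpret xx: exp_step A "TYPE('f)" x using x by (simp add: exp_step_def scalar_extension_def)
    interpret mm: exp_step A "TYPE('f)" "- x" using m by (simp add: exp_step_def scalar_extension_def)
    note A = subring_setD[OF x.A]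
    obtain c :: "nat \<Rightarrow> int" where c: "(\<Sum>k<N. divided_power (- uea_gen x) k) * (\<Sum>k<N. divided_power (uea_gen x) k) =
        1 + (\<Sum>k\<in>{N..<2 * N}. of_int (c k) * divided_power (uea_gen x) k)"
      using divided_power_sum_inverse[of N "uea_gen x"] by (auto simp: N_def)
    let ?s = "\<Sum>k\<in>{N..<2 * N}. of_int (c k) * divided_power (uea_gen x) k"
    have sA: "?s \<in> A" by (intro A xx.dp)
    have s1: "(\<Sum>k<N. divided_power (- uea_gen x) k) \<in> A"
      using mm.sum_p_mem[of "{..<N}"] unfolding uea_gen_uminus .
    have "tensor A 1 ?s \<in> K"
    proof (rule x.t_sum_mem[OF x.left_idealD(1)[OF K]])
      fix k assume k: "k \<in> {N..<2 * N}"
      have "tensor A 1 (of_int (c k)) \<otimes>\<^bsub>tensor_ring A\<^esub> tensor A 1 (divided_power (uea_gen x) k) \<in> K"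
        using k by (intro x.left_idealD(2)[OF K] NK x.t_closed A) auto
      then show "of_int (c k) * divided_power (uea_gen x) k \<in> A \<and> tensor A 1 (of_int (c k) * divided_power (uea_gen x) k) \<in> K"
        by (simp add: x.t_mult A xx.dp)
    qed
    moreover have "exp_step.E A (- x) N \<otimes>\<^bsub>tensor_ring A\<^esub> exp_step.E A x N = tensor A (1 * 1 :: 'f) (1 + ?s)"
      unfolding xx.E_def mm.E_def c[symmetric] uea_gen_uminus
      by (rule x.t_mult[OF s1 xx.sum_p_mem])
    moreover have "tensor A (1 * 1 :: 'f) (1 + ?s) \<ominus>\<^bsub>tensor_ring A\<^esub> \<one>\<^bsub>tensor_ring A\<^esub> = tensor A 1 ?s"
      using x.t_diff[of "1 + ?s" 1 1] A(6)[OF A(1) sA] A(1) by (simp add: x.one_R)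
    ultimately show ?thesis by simp
  qed
  have de: "?d \<otimes>\<^bsub>tensor_ring A\<^esub> ?e \<ominus>\<^bsub>tensor_ring A\<^esub> \<one>\<^bsub>tensor_ring A\<^esub> \<in> I"
    by (rule inv[OF x x.exp_step_uminus I NI])
  have ed: "?e \<otimes>\<^bsub>tensor_ring A\<^esub> ?d \<ominus>\<^bsub>tensor_ring A\<^esub> \<one>\<^bsub>tensor_ring A\<^esub> \<in> J"
    using inv[OF x.exp_step_uminus _ J NJ'] x by simp
  show "lmodule_isomorphic (tensor_ring A) (quotient_lmodule (tensor_ring A) I) (quotient_lmodule (tensor_ring A) J)"
    by (rule x.lmodule_isomorphic_mult_right[OF I J m.E_closed Id x.E_closed Je de ed])
  \<comment> \<open>For large k the divided power of y times e lies in I, as y acts locally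
    nilpotently on U / I. A further factor d leads into J, and e times d is 1 modulo J.\<close>
  show "exp_step.locally_nilpotent_mod A y J" if y: "exp_step A y" and ny: "exp_step.locally_nilpotent_mod A y I" for y
  proof -
    interpret y: exp_step A "TYPE('f)" y using y by (simp add: exp_step_def scalar_extension_def)
    obtain K where K: "\<And>k. k \<ge> K \<Longrightarrow> tensor A 1 (divided_power (uea_gen y) k) \<otimes>\<^bsub>tensor_ring A\<^esub> ?e \<in> I"
      using y.locally_nilpotent_action[OF I ny x.E_closed] by blast
    have "tensor A 1 (divided_power (uea_gen y) k) \<in> J" if k: "k \<ge> K" for k
    proof -
      let ?z = "tensor A (1 :: 'f) (divided_power (uea_gen y) k)"
      have z: "?z \<in> carrier (tensor_ring A)" by (simp add: y.dp)
      have 1: "?z \<otimes>\<^bsub>tensor_ring A\<^esub> ?e \<otimes>\<^bsub>tensor_ring A\<^esub> ?d \<in> J" by (rule Id[OF K[OF k]])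
      have 2: "?z \<otimes>\<^bsub>tensor_ring A\<^esub> (?e \<otimes>\<^bsub>tensor_ring A\<^esub> ?d \<ominus>\<^bsub>tensor_ring A\<^esub> \<one>\<^bsub>tensor_ring A\<^esub>) \<in> J" by (rule DJ(2)[OF z ed])
      have "?z \<otimes>\<^bsub>tensor_ring A\<^esub> ?e \<otimes>\<^bsub>tensor_ring A\<^esub> ?d \<ominus>\<^bsub>tensor_ring A\<^esub>
          ?z \<otimes>\<^bsub>tensor_ring A\<^esub> (?e \<otimes>\<^bsub>tensor_ring A\<^esub> ?d \<ominus>\<^bsub>tensor_ring A\<^esub> \<one>\<^bsub>tensor_ring A\<^esub>) = ?z"
        using z x.E_closed[of N] m.E_closed[of N]
        by (simp add: a_minus_def x.r_distr x.minus_add x.m_assoc x.r_minus x.a_assoc[symmetric] x.r_neg)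
      then show ?thesis using DJ(7)[OF 1 2] by simp
    qed
    then show ?thesis by (auto simp: y.locally_nilpotent_mod_def)
  qed
qed


section \<open>Twisting the hyperalgebra\<close>

text \<open>The map \<eta> on loops is determined by \<theta> coefficient by coefficient. Keeping it
  hidden lets a word of exponentials be described by its effect on the finite-dimensional algebra
  alone.\<close>

definition loop_ext :: "('g::complex_lie_algebra \<Rightarrow> 'g) \<Rightarrow> ('g loop uea \<Rightarrow> 'g loop uea) \<Rightarrow> bool" where
  "loop_ext \<theta> \<Phi> \<longleftrightarrow> (\<exists>\<eta>. uea_ext \<eta> \<Phi> \<and> (\<forall>f r. Poly_Mapping.lookup (\<eta> f) r = \<theta> (Poly_Mapping.lookup f r)))"

lemma loop_ext_id: "loop_ext id id"
  unfolding loop_ext_def by (rule exI[of _ id]) (simp add: uea_ext_id)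

lemma loop_ext_comp:
  assumes "loop_ext \<theta> \<Phi>" "loop_ext \<theta>' \<Phi>'"
  shows "loop_ext (\<theta> \<circ> \<theta>') (\<Phi> \<circ> \<Phi>')"
proof -
  obtain \<eta> \<eta>' where "uea_ext \<eta> \<Phi>" "\<And>f r. Poly_Mapping.lookup (\<eta> f) r = \<theta> (Poly_Mapping.lookup f r)"
    "uea_ext \<eta>' \<Phi>'" "\<And>f r. Poly_Mapping.lookup (\<eta>' f) r = \<theta>' (Poly_Mapping.lookup f r)"
    using assms unfolding loop_ext_def by metis
  then show ?thesis
    unfolding loop_ext_def by (intro exI[of _ "\<eta> \<circ> \<eta>'"]) (simp add: uea_ext_comp)
qed

lemma loop_ext_dexp:
  fixes x :: "'g::complex_lie_algebra"
  assumes "lvs.loc_nilpotent (lie x)"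
  shows "loop_ext (lvs.dexp (lie x)) (uvs.dexp (ad_gen (Poly_Mapping.single 0 x)))"
  unfolding loop_ext_def
  using uea_ext_dexp[OF loc_nilpotent_lie_single[OF assms]] lookup_dexp_lie_single[OF assms] by blast

lemma loop_ext_single:
  assumes e: "loop_ext \<theta> \<Phi>" and 0: "\<theta> 0 = 0"
  shows "\<Phi> (uea_gen (Poly_Mapping.single r y)) = uea_gen (Poly_Mapping.single r (\<theta> y))"
proof -
  obtain \<eta> where n: "uea_ext \<eta> \<Phi>" "\<And>f r. Poly_Mapping.lookup (\<eta> f) r = \<theta> (Poly_Mapping.lookup f r)"
    using e unfolding loop_ext_def by blast
  have "\<eta> (Poly_Mapping.single r y) = Poly_Mapping.single r (\<theta> y)"
    by (rule poly_mapping_eqI) (simp add: n(2) lookup_single when_def 0)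
  then show ?thesis using uea_extD(4)[OF n(1)] by simp
qed

lemma loop_ext_uea_ext: "loop_ext \<theta> \<Phi> \<Longrightarrow> \<exists>\<eta>. uea_ext \<eta> \<Phi>"
  unfolding loop_ext_def by blast

lemma loop_ext_current:
  assumes e: "loop_ext \<theta> \<Phi>" and 0: "\<theta> 0 = 0" and S: "\<theta> ` S \<subseteq> T"
  shows "u \<in> uea_sub (current S) \<Longrightarrow> \<Phi> u \<in> uea_sub (current T)"
    and "u \<in> uea_sub (current_pos S) \<Longrightarrow> \<Phi> u \<in> uea_sub (current_pos T)"
    and "u \<in> uea_sub (constants S) \<Longrightarrow> \<Phi> u \<in> uea_sub (constants T)"
proof -
  obtain \<eta> where n: "uea_ext \<eta> \<Phi>" "\<And>f r. Poly_Mapping.lookup (\<eta> f) r = \<theta> (Poly_Mapping.lookup f r)"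
    using e unfolding loop_ext_def by blast
  have c: "\<eta> ` current S \<subseteq> current T" "\<eta> ` current_pos S \<subseteq> current_pos T"
    using S by (auto simp: current_def current_pos_def n(2) 0)
  have "\<eta> (Poly_Mapping.single 0 h) = Poly_Mapping.single 0 (\<theta> h)" for h
    by (rule poly_mapping_eqI) (simp add: n(2) lookup_single when_def 0)
  then have c': "\<eta> ` constants S \<subseteq> constants T" using S by (auto simp: constants_def)
  show "u \<in> uea_sub (current S) \<Longrightarrow> \<Phi> u \<in> uea_sub (current T)"
    "u \<in> uea_sub (current_pos S) \<Longrightarrow> \<Phi> u \<in> uea_sub (current_pos T)"
    "u \<in> uea_sub (constants S) \<Longrightarrow> \<Phi> u \<in> uea_sub (constants T)"
    by (rule subsetD[OF uea_sub_mono[OF c(1)]] subsetD[OF uea_sub_mono[OF c(2)]] subsetD[OF uea_sub_mono[OF c']],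
        erule uea_ext_uea_sub[OF n(1)])+
qed

lemma formal_counit_superset:
  assumes "finite S" "Poly_Mapping.keys p \<subseteq> S"
  shows "formal_counit p = (\<Sum>a\<in>S. of_int (Poly_Mapping.lookup p a) * fst a * of_int (to_int (counit (snd a))))"
  unfolding formal_counit_def by (intro sum.mono_neutral_left) (use assms in \<open>auto simp: in_keys_iff\<close>)

lemma formal_counit_add: "formal_counit (p + q) = formal_counit p + formal_counit q"
proof -
  let ?S = "Poly_Mapping.keys p \<union> Poly_Mapping.keys q"
  have "Poly_Mapping.keys (p + q) \<subseteq> ?S" by (rule keys_add)
  then show ?thesis
    by (subst (1 2 3) formal_counit_superset[where S = ?S]) (auto simp: lookup_add distrib_right sum.distrib)
qed

lemma formal_counit_single: "formal_counit (Poly_Mapping.single k n) = of_int n * fst k * of_int (to_int (counit (snd k)))"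
  by (subst formal_counit_superset[where S = "{k}"]) auto

lemma formal_counit_push:
  assumes "\<And>u. counit (f u) = counit u"
  shows "formal_counit (push f p) = formal_counit p"
  by (induction p rule: poly_mapping_add_induct)
    (simp_all add: push_single push_add formal_counit_single formal_counit_add assms formal_counit_def[of 0])

lemma to_int_of_int [simp]: "to_int (of_int n) = n"
  by (simp add: to_int_def)

context chevalley
begin

abbreviation "up x \<equiv> Poly_Mapping.single (0::int) (x :: 'g)"
abbreviation "BB \<equiv> int_form_sub H X (current UNIV)"

text \<open>Closed under negation, so that the inverse of a word in exponentials is again such a
  word.\<close>

definition elementary :: "'g set" where
  "elementary = {x. \<exists>\<gamma>\<in>signed_simple. x = X \<gamma> \<or> x = - X \<gamma>}"

lemma elementary_uminus: "x \<in> elementary \<Longrightarrow> - x \<in> elementary"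
  by (auto simp: elementary_def)

lemma elementary_nilpotent: "x \<in> elementary \<Longrightarrow> lvs.loc_nilpotent (lie x)"
  unfolding elementary_def using loc_nilpotent_X loc_nilpotent_uminus_X signed_simple_root by blast

lemma elementary_divided_power:
  assumes "x \<in> elementary"
  shows "divided_power (uea_gen (up x)) k \<in> BB"
proof -
  obtain \<gamma> where g: "\<gamma> \<in> R" "x = X \<gamma> \<or> x = - X \<gamma>"
    using assms signed_simple_root by (auto simp: elementary_def simp del: Un_iff)
  have i: "divided_power (uea_gen (up (X \<gamma>))) k \<in> int_form H X" by (rule int_form.gen[OF g(1)])
  have "divided_power (uea_gen (up x)) k \<in> int_form H X"
    using g(2)
  proof
    assume "x = - X \<gamma>"
    then have "divided_power (uea_gen (up x)) k = (-1) ^ k * divided_power (uea_gen (up (X \<gamma>))) k"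
      by (simp add: single_uminus uea_gen_uminus divided_power_uminus)
    then show ?thesis using int_form.mult[OF int_form_neg_1_power i] by simp
  qed (use i in simp)
  moreover have "divided_power (uea_gen (up x)) k \<in> uea_sub (current UNIV)"
    by (intro uea_sub_divided_power uea_sub.gen) (simp add: current_def lookup_single when_def)
  ultimately show ?thesis by (simp add: int_form_sub_def)
qed

lemma exp_step_elementary:
  assumes "x \<in> elementary"
  shows "exp_step BB (up x)"
proof unfold_locales
  show "subring_set BB" by (rule subring_set_int_form)
  show "lvs.loc_nilpotent (lie (up x))" by (rule loc_nilpotent_lie_single[OF elementary_nilpotent[OF assms]])
  show dp: "divided_power (uea_gen (up x)) k \<in> BB" for k by (rule elementary_divided_power[OF assms])
  show "uvs.dpow (ad_gen (up x)) i a \<in> BB" if "a \<in> BB" for i a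
    using that dp dpow_ad_gen_int_form[of "up x" H X a i] dpow_ad_gen_uea_sub[of "up x" "current UNIV" a i]
    by (auto simp: int_form_sub_def current_def lookup_single when_def)
qed

section \<open>Words in exponentials and the twists they induce\<close>

definition exp_word :: "'g list \<Rightarrow> 'g \<Rightarrow> 'g" where
  "exp_word xs = foldr (\<lambda>x \<theta>. lvs.dexp (lie x) \<circ> \<theta>) xs id"

definition uea_word :: "'g list \<Rightarrow> 'g loop uea \<Rightarrow> 'g loop uea" where
  "uea_word xs = foldr (\<lambda>x \<Phi>. uvs.dexp (ad_gen (up x)) \<circ> \<Phi>) xs id"

definition inv_word :: "'g list \<Rightarrow> 'g list" where
  "inv_word xs = rev (map uminus xs)"

lemma word_simps [simp]:
  "exp_word [] = id" "exp_word (x # xs) = lvs.dexp (lie x) \<circ> exp_word xs"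
  "uea_word [] = id" "uea_word (x # xs) = uvs.dexp (ad_gen (up x)) \<circ> uea_word xs"
  by (simp_all add: exp_word_def uea_word_def)

lemma word_append:
  "exp_word (xs @ ys) = exp_word xs \<circ> exp_word ys" "uea_word (xs @ ys) = uea_word xs \<circ> uea_word ys"
  by (induction xs) (simp_all add: comp_assoc)

lemma inv_word_elementary: "set xs \<subseteq> elementary \<Longrightarrow> set (inv_word xs) \<subseteq> elementary"
  using elementary_uminus by (auto simp: inv_word_def)

lemma inv_word_inv_word: "inv_word (inv_word xs) = xs"
  by (simp add: inv_word_def rev_map comp_def)

lemma exp_word_inverse: "set xs \<subseteq> elementary \<Longrightarrow> exp_word (inv_word xs) (exp_word xs y) = y"
  by (induction xs) (auto simp: inv_word_def word_append dexp_lie_inverse elementary_nilpotent)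

lemma uea_word_inverse: "set xs \<subseteq> elementary \<Longrightarrow> uea_word (inv_word xs) (uea_word xs u) = u"
  by (induction xs)
    (auto simp: inv_word_def word_append single_uminus dexp_ad_gen_inverse[OF loc_nilpotent_lie_single] elementary_nilpotent)

lemma exp_word_lie_aut: "set xs \<subseteq> elementary \<Longrightarrow> lie_aut (exp_word xs)"
  by (induction xs) (auto intro: lie_aut_id lie_aut_comp lie_aut_dexp elementary_nilpotent)

lemma loop_ext_word: "set xs \<subseteq> elementary \<Longrightarrow> loop_ext (exp_word xs) (uea_word xs)"
  by (induction xs) (auto intro!: loop_ext_id loop_ext_comp loop_ext_dexp elementary_nilpotent)

lemma uea_word_int_form:
  assumes "set xs \<subseteq> elementary" "u \<in> int_form H X"
  shows "uea_word xs u \<in> int_form H X"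
  using assms
  by (induction xs)
    (use elementary_divided_power in \<open>auto intro!: dexp_ad_gen_int_form simp: int_form_sub_def\<close>)

lemma uea_word_int_form_sub:
  assumes xs: "set xs \<subseteq> elementary" and S: "exp_word xs ` S \<subseteq> T"
  shows "u \<in> int_form_sub H X (current S) \<Longrightarrow> uea_word xs u \<in> int_form_sub H X (current T)"
    and "u \<in> int_form_sub H X (current_pos S) \<Longrightarrow> uea_word xs u \<in> int_form_sub H X (current_pos T)"
    and "u \<in> int_form_sub H X (constants S) \<Longrightarrow> uea_word xs u \<in> int_form_sub H X (constants T)"
  using loop_ext_current[OF loop_ext_word[OF xs] lie_autD(4)[OF exp_word_lie_aut[OF xs]] S] uea_word_int_form[OF xs]
  unfolding int_form_sub_def by blast+

lemma scalar_extension_aut_word: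
  assumes xs: "set xs \<subseteq> elementary"
    and A: "subring_set A" "\<And>u. u \<in> A \<Longrightarrow> uea_word xs u \<in> A" "\<And>u. u \<in> A \<Longrightarrow> uea_word (inv_word xs) u \<in> A"
  shows "scalar_extension_aut A (uea_word xs) (uea_word (inv_word xs))"
proof -
  obtain \<eta> where "uea_ext \<eta> (uea_word xs)" using loop_ext_uea_ext[OF loop_ext_word[OF xs]] by blast
  note e = uea_extD[OF this]
  show ?thesis
    by unfold_locales
      (use A e uea_word_inverse[OF xs] uea_word_inverse[OF inv_word_elementary[OF xs]] in \<open>auto simp: inv_word_inv_word\<close>)
qed

lemma scalar_extension_aut_BB:
  "set xs \<subseteq> elementary \<Longrightarrow> scalar_extension_aut BB (uea_word xs) (uea_word (inv_word xs))"
  using uea_word_int_form_sub(1)[of _ UNIV UNIV] inv_word_elementary[of xs]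
  by (intro scalar_extension_aut_word subring_set_int_form) auto

text \<open>The next letter needs local nilpotency modulo the ideal already twisted. It is therefore
  part of the induction, for every elementary element, since any of them may be the next
  letter.\<close>

lemma word_twist:
  fixes I :: "('f::field, 'g) hyp set"
  assumes xs: "set xs \<subseteq> elementary" and I: "left_ideal I (tensor_ring BB)"
    and n: "\<And>x. x \<in> elementary \<Longrightarrow> exp_step.locally_nilpotent_mod BB (up x) I"
  shows "left_ideal (tmap BB (uea_word xs) ` I) (tensor_ring BB) \<and>
    lmodule_isomorphic (tensor_ring BB) (quotient_lmodule (tensor_ring BB) I) (quotient_lmodule (tensor_ring BB) (tmap BB (uea_word xs) ` I)) \<and>
    (\<forall>x\<in>elementary. exp_step.locally_nilpotent_mod BB (up x) (tmap BB (uea_word xs) ` I))"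
  using xs
proof (induction xs)
  case Nil
  interpret e: scalar_extension BB "TYPE('f)" by unfold_locales (rule subring_set_int_form)
  interpret f: scalar_extension_aut BB "TYPE('f)" id id
    by unfold_locales simp_all
  have "tmap BB id z = z" if z: "z \<in> I" for z
  proof -
    obtain p where "z = e.cls p"
      using subsetD[OF e.left_idealD(3)[OF I] z] unfolding e.carrier_R by (rule imageE)
    then show ?thesis using f.tmap_cls[of p] push_ident[of p] by (simp add: id_def)
  qed
  then have eq: "tmap BB (uea_word []) ` I = I" by simp
  show ?case unfolding eq using I n lmodule_isomorphic_refl by blast
next
  case (Cons x xs)
  let ?R = "tensor_ring BB :: ('f, 'g) hyp ring"
  let ?J = "tmap BB (uea_word xs) ` I"
  have x: "x \<in> elementary" and xs: "set xs \<subseteq> elementary" using Cons.prems by auto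
  have J: "left_ideal ?J ?R" and iso: "lmodule_isomorphic ?R (quotient_lmodule ?R I) (quotient_lmodule ?R ?J)"
    and nJ: "\<And>x. x \<in> elementary \<Longrightarrow> exp_step.locally_nilpotent_mod BB (up x) ?J"
    using Cons.IH[OF xs] by auto
  note tw = exp_step_twist[OF exp_step_elementary[OF x] J nJ[OF x]]
  interpret e: scalar_extension BB "TYPE('f)" by unfold_locales (rule subring_set_int_form)
  have "tmap BB (uea_word (x # xs)) z = tmap BB (uvs.dexp (ad_gen (up x))) (tmap BB (uea_word xs) z)" if "z \<in> I" for z
  proof -
    have "scalar_extension_aut BB (uea_word [x]) (uea_word (inv_word [x]))"
      by (rule scalar_extension_aut_BB) (use x in simp)
    then show ?thesis
      using tmap_comp[OF _ scalar_extension_aut_BB[OF xs], of "uea_word [x]" "uea_word (inv_word [x])" z] e.left_idealD(3)[OF I] that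
      by auto
  qed
  then have eq: "tmap BB (uea_word (x # xs)) ` I = tmap BB (uvs.dexp (ad_gen (up x))) ` ?J"
    by (simp add: image_image cong: image_cong)
  show ?case
    unfolding eq using tw(1) lmodule_isomorphic_trans[OF iso tw(2)] tw(3)[OF exp_step_elementary nJ] by blast
qed

definition letters :: "('g \<Rightarrow> complex) list \<Rightarrow> 'g list" where
  "letters as = concat (map (\<lambda>a. [X a, - X (- a), X a]) as)"

lemma letters_elementary: "set as \<subseteq> \<Delta> \<Longrightarrow> set (letters as) \<subseteq> elementary"
  unfolding letters_def elementary_def by (induction as) auto

lemma exp_word_letters: "exp_word (letters as) = word_aut as"
  by (induction as) (simp_all add: letters_def word_append weyl_aut_def comp_assoc)

lemma word_aut_append: "word_aut (as @ bs) = word_aut as \<circ> word_aut bs"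
  by (induction as) (simp_all add: comp_assoc)

text \<open>On H each \<open>weyl_aut\<close> is its own inverse, so reversing the word suffices
  there; on the whole algebra the inverse is given by \<open>inv_word\<close>.\<close>

lemma word_aut_rev: "set as \<subseteq> \<Delta> \<Longrightarrow> h \<in> H \<Longrightarrow> word_aut as (word_aut (rev as) h) = h"
  by (induction as arbitrary: h) (simp_all add: word_aut_append weyl_aut_H_in weyl_aut_weyl_aut_H simple_root)

subsection \<open>Images of the generators\<close>

lemma int_form_sub_mono: "S \<subseteq> T \<Longrightarrow> int_form_sub H X S \<subseteq> int_form_sub H X T"
  using uea_sub_mono by (auto simp: int_form_sub_def)

lemma augmentation_image:
  assumes S: "S \<subseteq> current UNIV"
  shows "tensor_incl BB ` (augmentation_ideal H X S :: ('f::field, 'g) hyp set) =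
    {tensor_class BB p | p. p \<in> formals (int_form_sub H X S) \<and> formal_counit p = 0}"
  unfolding augmentation_ideal_def
  using tensor_incl_class[OF subring_set_int_form subring_set_int_form int_form_sub_mono[OF S]] by (force simp: image_iff)

lemma augmentation_carrier:
  assumes S: "S \<subseteq> current UNIV"
  shows "tensor_incl BB ` (augmentation_ideal H X S :: ('f::field, 'g) hyp set) \<subseteq> carrier (tensor_ring BB)"
proof -
  interpret e: scalar_extension BB "TYPE('f)" by unfold_locales (rule subring_set_int_form)
  show ?thesis
    unfolding augmentation_image[OF S] e.carrier_R using int_form_sub_mono[OF S] by blast
qed

text \<open>An algebra map that extends a map of Lie algebras preserves the counit, hence its
  kernel.\<close>

lemma augmentation_twist:
  fixes z :: "('f::field, 'g) hyp"
  assumes xs: "set xs \<subseteq> elementary" and S: "S \<subseteq> current UNIV" "T \<subseteq> current UNIV"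
    and m: "\<And>u. u \<in> int_form_sub H X S \<Longrightarrow> uea_word xs u \<in> int_form_sub H X T"
    and z: "z \<in> tensor_incl BB ` augmentation_ideal H X S"
  shows "tmap BB (uea_word xs) z \<in> tensor_incl BB ` augmentation_ideal H X T"
proof -
  interpret e: scalar_extension_aut BB "TYPE('f)" "uea_word xs" "uea_word (inv_word xs)"
    using scalar_extension_aut_BB[OF xs] by (simp add: scalar_extension_aut_def scalar_extension_def)
  obtain p where p: "z = e.cls p" "p \<in> formals (int_form_sub H X S)" "formal_counit p = 0"
    using z unfolding augmentation_image[OF S(1)] by blast
  obtain \<eta> where e: "uea_ext \<eta> (uea_word xs)" using loop_ext_uea_ext[OF loop_ext_word[OF xs]] by blast
  have "push (uea_word xs) p \<in> formals (int_form_sub H X T)"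
  proof -
    from p(2) have "Poly_Mapping.keys p \<subseteq> UNIV \<times> int_form_sub H X S" by simp
    then show ?thesis
      by (induction p rule: formal_induct)
        (auto simp: push_diff push_single formals_closed m simp del: mem_Collect_eq)
  qed
  moreover have "formal_counit (push (uea_word xs) p) = 0"
    by (simp only: formal_counit_push[OF uea_ext_counit[OF e]] p(3))
  ultimately show ?thesis unfolding augmentation_image[OF S(2)] p(1) e.tmap_cls by blast
qed

lemma root_power_carrier:
  assumes "\<beta> \<in> R"
  shows "divided_power (uea_gen (Poly_Mapping.single (int s) (X \<beta>))) k \<in> BB"
    and "(root_power H X \<beta> s k :: ('f::field, 'g) hyp) \<in> carrier (tensor_ring BB)"
proof -
  interpret e: scalar_extension BB "TYPE('f)" by unfold_locales (rule subring_set_int_form)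
  show "divided_power (uea_gen (Poly_Mapping.single (int s) (X \<beta>))) k \<in> BB"
    unfolding int_form_sub_def
    by (intro IntI int_form.gen assms uea_sub_divided_power uea_sub.gen) (simp add: current_def lookup_single when_def)
  then show "(root_power H X \<beta> s k :: ('f, 'g) hyp) \<in> carrier (tensor_ring BB)"
    unfolding root_power_def by (rule e.t_closed)
qed

text \<open>A sign on the root vector becomes a factor (-1)^k in the ring, which a left ideal
  absorbs.\<close>

lemma root_power_twist:
  fixes J :: "('f::field, 'g) hyp set"
  assumes xs: "set xs \<subseteq> elementary" and J: "left_ideal J (tensor_ring BB)" and b: "\<beta>' \<in> R"
    and s: "c \<in> {1, -1}" "exp_word xs (X \<beta>) = c *\<^sub>C X \<beta>'"
    and mem: "root_power H X \<beta>' s k \<in> J"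
  shows "tmap BB (uea_word xs) (root_power H X \<beta> s k) \<in> J"
proof -
  interpret e: scalar_extension_aut BB "TYPE('f)" "uea_word xs" "uea_word (inv_word xs)"
    using scalar_extension_aut_BB[OF xs] by (simp add: scalar_extension_aut_def scalar_extension_def)
  obtain \<eta> where e: "uea_ext \<eta> (uea_word xs)" using loop_ext_uea_ext[OF loop_ext_word[OF xs]] by blast
  let ?g = "\<lambda>y. uea_gen (Poly_Mapping.single (int s) y)"
  have "tmap BB (uea_word xs) (root_power H X \<beta> s k) = e.t 1 (divided_power (?g (exp_word xs (X \<beta>))) k)"
    unfolding root_power_def e.tmap_tensor uea_ext_divided_power[OF e]
      loop_ext_single[OF loop_ext_word[OF xs] lie_autD(4)[OF exp_word_lie_aut[OF xs]]] ..
  also have "\<dots> \<in> J"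
  proof (cases "c = 1")
    case True
    then show ?thesis using mem s by (simp add: root_power_def scaleC_one)
  next
    case False
    then have "exp_word xs (X \<beta>) = - X \<beta>'" using s by (simp add: cvs.scale_minus_left scaleC_one)
    then have "divided_power (?g (exp_word xs (X \<beta>))) k = (-1) ^ k * divided_power (?g (X \<beta>')) k"
      by (simp add: single_uminus uea_gen_uminus divided_power_uminus)
    moreover have n: "(-1) ^ k \<in> BB"
      by (induction k) (auto simp: subring_setD[OF subring_set_int_form])
    then have "e.t 1 ((-1) ^ k) \<otimes>\<^bsub>e.R\<^esub> root_power H X \<beta>' s k \<in> J"
      using e.left_idealD(2)[OF J e.t_closed mem] by blast
    ultimately show ?thesis
      using n root_power_carrier(1)[OF b] by (simp add: root_power_def e.t_mult)
  qed
  finally show ?thesis .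
qed

abbreviation "HH \<equiv> int_form_sub H X (constants H)"
abbreviation "coroot_binomial \<alpha> k \<equiv> uea_binomial (uea_gen (up (hh \<alpha>))) k"

lemma constants_subset: "constants H \<subseteq> current UNIV"
  by (auto simp: constants_def current_def lookup_single when_def)

lemma weight_relations_carrier:
  "(weight_relations H \<Delta> X \<mu> :: ('f::field, 'g) hyp set) \<subseteq> carrier (tensor_ring BB)"
proof
  fix z :: "('f, 'g) hyp"
  interpret e: scalar_extension BB "TYPE('f)" by unfold_locales (rule subring_set_int_form)
  interpret c: scalar_extension HH "TYPE('f)" by unfold_locales (rule subring_set_int_form)
  assume "z \<in> weight_relations H \<Delta> X \<mu>"
  then obtain h and \<chi> :: "('f, 'g) hyp \<Rightarrow> 'f" where h: "h \<in> carrier c.R" "z = tensor_incl BB h \<ominus>\<^bsub>e.R\<^esub> e.t (\<chi> h) 1"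
    unfolding weight_relations_def Let_def hyperalgebra_def by blast
  from h(1) obtain p where p: "h = c.cls p" "p \<in> formals HH" unfolding c.carrier_R by blast
  have "tensor_incl BB h = e.cls p"
    unfolding p(1) by (rule tensor_incl_class[OF subring_set_int_form subring_set_int_form int_form_sub_mono[OF constants_subset]])
  moreover have "p \<in> formals BB" using p(2) int_form_sub_mono[OF constants_subset] by auto
  ultimately show "z \<in> carrier (tensor_ring BB)"
    unfolding h(2) using e.minus_closed[OF e.cls_closed e.t_closed[OF subring_setD(1)[OF subring_set_int_form]]] by simp
qed

lemma weight_hom_sum:
  fixes \<chi> :: "('f::field, 'g) hyp \<Rightarrow> 'f"
  assumes w: "weight_hom H \<Delta> X \<mu> \<chi>" and u: "\<And>i. i \<in> B \<Longrightarrow> u i \<in> HH"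
  shows "\<chi> (tensor HH 1 (\<Sum>i\<in>B. of_int (c i) * u i)) = (\<Sum>i\<in>B. of_int (c i) * \<chi> (tensor HH 1 (u i)))"
proof -
  interpret e: scalar_extension HH "TYPE('f)" by unfold_locales (rule subring_set_int_form)
  note A = subring_setD[OF e.A]
  have add: "\<chi> (x \<oplus>\<^bsub>e.R\<^esub> y) = \<chi> x + \<chi> y" and mult: "\<chi> (x \<otimes>\<^bsub>e.R\<^esub> y) = \<chi> x * \<chi> y"
    if "x \<in> carrier e.R" "y \<in> carrier e.R" for x y
    using w that unfolding weight_hom_def hyperalgebra_def Let_def by blast+
  have const: "\<chi> (e.t c 1) = c" for c
    using w unfolding weight_hom_def Let_def by blast
  have "\<chi> (\<zero>\<^bsub>e.R\<^esub> \<oplus>\<^bsub>e.R\<^esub> \<zero>\<^bsub>e.R\<^esub>) = \<chi> \<zero>\<^bsub>e.R\<^esub> + \<chi> \<zero>\<^bsub>e.R\<^esub>" by (rule add) simp_all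
  then have zero: "\<chi> \<zero>\<^bsub>e.R\<^esub> = 0" unfolding e.l_zero[OF e.zero_closed] by (metis add_cancel_right_right)
  have scale: "\<chi> (e.t 1 (of_int n * v)) = of_int n * \<chi> (e.t 1 v)" if v: "v \<in> HH" for n v
  proof -
    have "e.t 1 (of_int n * v) = e.t (of_int n) 1 \<otimes>\<^bsub>e.R\<^esub> e.t 1 v"
      unfolding e.t_of_int[symmetric] using v A(7) by (simp add: e.t_mult)
    then show ?thesis using mult[of "e.t (of_int n) 1" "e.t 1 v"] v A(1) const by simp
  qed
  show ?thesis
    using u
  proof (induction B rule: infinite_finite_induct)
    case (insert i B)
    have m: "of_int (c i) * u i \<in> HH" "(\<Sum>i\<in>B. of_int (c i) * u i) \<in> HH"
      using insert.prems by (auto intro!: A(5) A(7) A(8))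
    then have "\<chi> (e.t 1 (\<Sum>i\<in>insert i B. of_int (c i) * u i)) =
        \<chi> (e.t 1 (of_int (c i) * u i)) + \<chi> (e.t 1 (\<Sum>i\<in>B. of_int (c i) * u i))"
      using insert.hyps add by (simp add: e.t_add_right)
    then show ?case using insert scale by simp
  qed (simp_all add: e.t_zero zero)
qed

text \<open>A relation for \<mu> comes with a character \<chi>; composed with the inverse twist it
  becomes a character for \<nu> that belongs to the twisted relation. Only its values on binomials
  of simple coroots need an argument, and W says that the inverse twist takes simple coroots to
  negatives of simple coroots, as the two weights require.\<close>

lemma weight_relations_twist:
  fixes z :: "('f::field, 'g) hyp"
  assumes xs: "set xs \<subseteq> elementary" and H: "exp_word xs ` H \<subseteq> H" "exp_word (inv_word xs) ` H \<subseteq> H"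
    and W: "\<And>i. i \<in> \<Delta> \<Longrightarrow> \<exists>j\<in>\<Delta>. exp_word (inv_word xs) (hh i) = - hh j \<and> \<nu> (hh i) = - \<mu> (hh j) \<and> \<mu> (hh j) \<in> \<int>"
    and z: "z \<in> weight_relations H \<Delta> X \<mu>"
  shows "tmap BB (uea_word xs) z \<in> weight_relations H \<Delta> X \<nu>"
proof -
  let ?\<Phi> = "uea_word xs" and ?\<Psi> = "uea_word (inv_word xs)"
  have inv: "set (inv_word xs) \<subseteq> elementary" using inv_word_elementary[OF xs] .
  interpret e: scalar_extension_aut BB "TYPE('f)" ?\<Phi> ?\<Psi>
    using scalar_extension_aut_BB[OF xs] by (simp add: scalar_extension_aut_def scalar_extension_def)
  have "scalar_extension_aut HH ?\<Phi> ?\<Psi>"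
    by (rule scalar_extension_aut_word[OF xs subring_set_int_form])
      (rule uea_word_int_form_sub(3)[OF xs H(1)], assumption, rule uea_word_int_form_sub(3)[OF inv H(2)], assumption)
  then interpret c: scalar_extension_aut HH "TYPE('f)" ?\<Phi> ?\<Psi>
    by (simp add: scalar_extension_aut_def scalar_extension_def)
  interpret d: scalar_extension_aut HH "TYPE('f)" ?\<Psi> ?\<Phi> by (rule c.inverse)
  have B1: "1 \<in> BB" by (rule subring_setD(1)[OF subring_set_int_form])
  have incl: "tensor_incl BB (c.cls p) = e.cls p" for p
    by (rule tensor_incl_class[OF subring_set_int_form subring_set_int_form int_form_sub_mono[OF constants_subset]])
  obtain h and \<chi> :: "('f, 'g) hyp \<Rightarrow> 'f" where h: "h \<in> carrier c.R" "z = tensor_incl BB h \<ominus>\<^bsub>e.R\<^esub> e.t (\<chi> h) 1"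
    and w: "weight_hom H \<Delta> X \<mu> \<chi>"
    using z unfolding weight_relations_def Let_def hyperalgebra_def by blast
  from h(1) obtain p where p: "h = c.cls p" "p \<in> formals HH" unfolding c.carrier_R by blast
  have pB: "p \<in> formals BB" using p(2) int_form_sub_mono[OF constants_subset] by auto
  define \<chi>' where "\<chi>' x = \<chi> (tmap HH ?\<Psi> x)" for x
  have "tmap BB ?\<Phi> z = tmap BB ?\<Phi> (e.cls p) \<ominus>\<^bsub>e.R\<^esub> tmap BB ?\<Phi> (e.t (\<chi> h) 1)"
    unfolding h(2) p(1) incl using e.cls_closed[OF pB] B1 by (intro e.tmap_diff) auto
  also have "\<dots> = e.cls (push ?\<Phi> p) \<ominus>\<^bsub>e.R\<^esub> e.t (\<chi> h) 1"
    unfolding e.tmap_cls e.tmap_tensor e.f_1 ..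
  also have "e.cls (push ?\<Phi> p) = tensor_incl BB (tmap HH ?\<Phi> h)"
    unfolding p(1) c.tmap_cls incl ..
  also have "\<chi> h = \<chi>' (tmap HH ?\<Phi> h)"
    unfolding \<chi>'_def using c.tmap_inverse[OF h(1)] by simp
  finally have eq: "tmap BB ?\<Phi> z = tensor_incl BB (tmap HH ?\<Phi> h) \<ominus>\<^bsub>e.R\<^esub> e.t (\<chi>' (tmap HH ?\<Phi> h)) 1" .
  have add: "\<chi> (x \<oplus>\<^bsub>c.R\<^esub> y) = \<chi> x + \<chi> y" and mult: "\<chi> (x \<otimes>\<^bsub>c.R\<^esub> y) = \<chi> x * \<chi> y"
    if "x \<in> carrier c.R" "y \<in> carrier c.R" for x y
    using w that unfolding weight_hom_def hyperalgebra_def Let_def by blast+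
  have const: "\<chi> (c.t a 1) = a" for a
    using w unfolding weight_hom_def Let_def by blast
  have binom: "\<chi> (c.t 1 (coroot_binomial \<alpha> k)) = of_int (to_int (\<mu> (hh \<alpha>) gchoose k))" if "\<alpha> \<in> \<Delta>" for \<alpha> k
    using w that unfolding weight_hom_def Let_def by blast
  have binom': "\<chi>' (c.t 1 (coroot_binomial i k)) = of_int (to_int (\<nu> (hh i) gchoose k))" if i: "i \<in> \<Delta>" for i k
  proof -
    obtain j where j: "j \<in> \<Delta>" "exp_word (inv_word xs) (hh i) = - hh j" "\<nu> (hh i) = - \<mu> (hh j)" "\<mu> (hh j) \<in> \<int>"
      using W[OF i] by blast
    obtain n where n: "\<mu> (hh j) = of_int n" using j(4) by (rule Ints_cases)
    obtain \<eta> where ue: "uea_ext \<eta> ?\<Psi>" using loop_ext_uea_ext[OF loop_ext_word[OF inv]] by blast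
    have "?\<Psi> (coroot_binomial i k) = uea_binomial (- uea_gen (up (hh j))) k"
      unfolding uea_ext_binomial[OF ue] loop_ext_single[OF loop_ext_word[OF inv] lie_autD(4)[OF exp_word_lie_aut[OF inv]]] j(2)
      by (simp add: single_uminus uea_gen_uminus)
    then have "\<chi>' (c.t 1 (coroot_binomial i k)) = \<chi> (c.t 1 (\<Sum>m\<le>k. of_int (neg_binomial_coeff k m) * coroot_binomial j m))"
      unfolding \<chi>'_def d.tmap_tensor by (simp add: uea_binomial_uminus)
    also have "\<dots> = (\<Sum>m\<le>k. of_int (neg_binomial_coeff k m) * \<chi> (c.t 1 (coroot_binomial j m)))"
      by (rule weight_hom_sum[OF w int_form_sub_binomial[OF simple_root[OF j(1)]]])
    also have "\<dots> = (\<Sum>m\<le>k. of_int (neg_binomial_coeff k m) * of_int (zchoose n m))"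
      by (simp add: binom[OF j(1)] n of_int_zchoose[symmetric])
    also have "\<dots> = of_int (\<Sum>m\<le>k. neg_binomial_coeff k m * zchoose n m)"
      by simp
    \<comment> \<open>The number \<nu> (hh i) = -n obeys the same expansion as the negated coroot,
      so the character takes the required value.\<close>
    also have "\<nu> (hh i) gchoose k = of_int (\<Sum>m\<le>k. neg_binomial_coeff k m * zchoose n m)"
      by (simp add: j(3) n gchoose_uminus of_int_zchoose)
    then have "of_int (\<Sum>m\<le>k. neg_binomial_coeff k m * zchoose n m) = (of_int (to_int (\<nu> (hh i) gchoose k)) :: 'f)"
      by (simp only: to_int_of_int)
    finally show ?thesis .
  qed
  have "weight_hom H \<Delta> X \<nu> \<chi>'"
    unfolding weight_hom_def Let_def hyperalgebra_def
  proof (intro conjI ballI allI)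
    show "\<chi>' (x \<oplus>\<^bsub>c.R\<^esub> y) = \<chi>' x + \<chi>' y" "\<chi>' (x \<otimes>\<^bsub>c.R\<^esub> y) = \<chi>' x * \<chi>' y"
      if "x \<in> carrier c.R" "y \<in> carrier c.R" for x y
      using that by (simp_all add: \<chi>'_def d.tmap_add d.tmap_mult add mult d.tmap_closed)
    show "\<chi>' (c.t a 1) = a" for a
      unfolding \<chi>'_def d.tmap_tensor d.f_1 by (rule const)
  qed (rule binom')
  then show ?thesis
    unfolding eq weight_relations_def Let_def hyperalgebra_def using c.tmap_closed[OF h(1)] by blast
qed

end

section \<open>The two presentations of the Demazure module\<close>

context chevalley_longest
begin

abbreviation "xs0 \<equiv> letters ws"

lemma xs0: "set xs0 \<subseteq> elementary" "set (inv_word xs0) \<subseteq> elementary"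
  using letters_elementary[OF ws(1)] inv_word_elementary by auto

lemma exp_word_xs0: "exp_word xs0 = word_aut ws"
  by (rule exp_word_letters)

lemma inverse_xs0: "exp_word (inv_word xs0) (word_aut ws y) = y"
  using exp_word_inverse[OF xs0(1)] exp_word_xs0 by simp

lemma xs0_H: "exp_word xs0 ` H \<subseteq> H" "exp_word (inv_word xs0) ` H \<subseteq> H"
proof -
  show "exp_word xs0 ` H \<subseteq> H" unfolding exp_word_xs0 using word_aut_H_in[OF ws(1)] by blast
  show "exp_word (inv_word xs0) ` H \<subseteq> H"
  proof
    fix y assume "y \<in> exp_word (inv_word xs0) ` H"
    then obtain h where h: "h \<in> H" "y = exp_word (inv_word xs0) h" by blast
    then have "y = word_aut (rev ws) h" using inverse_xs0[of "word_aut (rev ws) h"] word_aut_rev[OF ws(1) h(1)] by simp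
    then show "y \<in> H" using word_aut_H_in[of "rev ws" h] h ws(1) by simp
  qed
qed

lemma xs0_X:
  assumes "\<beta> \<in> R"
  shows "\<exists>s\<in>{1, -1}. exp_word xs0 (X \<beta>) = s *\<^sub>C X (w0 \<beta>)"
    and "\<exists>s\<in>{1, -1}. exp_word (inv_word xs0) (X (w0 \<beta>)) = s *\<^sub>C X \<beta>"
proof -
  obtain s where s: "s \<in> {1, -1}" "word_aut ws (X \<beta>) = s *\<^sub>C X (w0 \<beta>)" using word_aut_X[OF ws(1) assms] ws(2) by blast
  then show "\<exists>s\<in>{1, -1}. exp_word xs0 (X \<beta>) = s *\<^sub>C X (w0 \<beta>)" unfolding exp_word_xs0 by blast
  have "s * s = 1" using s(1) by auto
  then have "X (w0 \<beta>) = s *\<^sub>C word_aut ws (X \<beta>)" by (simp add: s(2) scaleC_scaleC scaleC_one)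
  then have "exp_word (inv_word xs0) (X (w0 \<beta>)) = s *\<^sub>C X \<beta>"
    by (simp only: lie_autD(2)[OF exp_word_lie_aut[OF xs0(2)]] inverse_xs0)
  then show "\<exists>s\<in>{1, -1}. exp_word (inv_word xs0) (X (w0 \<beta>)) = s *\<^sub>C X \<beta>" using s(1) by blast
qed

lemma lie_aut_span:
  assumes "lie_aut \<theta>" "\<And>y. y \<in> S \<Longrightarrow> \<theta> y \<in> cvs.span T"
  shows "\<theta> ` cvs.span S \<subseteq> cvs.span T"
proof
  fix y assume "y \<in> \<theta> ` cvs.span S"
  then obtain z where z: "z \<in> cvs.span S" "y = \<theta> z" by blast
  have "\<theta> z \<in> cvs.span T"
    using z(1) by (induction rule: cvs.span_induct_alt)
      (auto simp: lie_autD[OF assms(1)] assms(2) intro!: cvs.span_add cvs.span_scale cvs.span_zero)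
  then show "y \<in> cvs.span T" using z by simp
qed

lemma root_space_multiple:
  assumes "z \<in> root_space H \<beta>" "\<beta> \<in> R"
  obtains c where "z = c *\<^sub>C X \<beta>"
  using root_space_1dim[OF assms(1) root_dual[OF assms(2)] root_nonzero[OF assms(2)]] by (metis cvs.scale_zero_left)

text \<open>For the inverse, a negative root has to be written as w0 \<alpha> with \<alpha>
  positive, which is possible because -w0 permutes the positive roots.\<close>

lemma xs0_nilradical:
  "exp_word xs0 ` nilradical_plus H \<Delta> \<subseteq> nilradical_minus H \<Delta>"
  "exp_word (inv_word xs0) ` nilradical_minus H \<Delta> \<subseteq> nilradical_plus H \<Delta>"
proof -
  show "exp_word xs0 ` nilradical_plus H \<Delta> \<subseteq> nilradical_minus H \<Delta>"
    unfolding nilradical_plus_def nilradical_minus_def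
  proof (rule lie_aut_span[OF exp_word_lie_aut[OF xs0(1)]])
    fix y assume "y \<in> (\<Union>\<alpha>\<in>pos_roots H \<Delta>. root_space H \<alpha>)"
    then obtain \<alpha> where a: "\<alpha> \<in> pos_roots H \<Delta>" "y \<in> root_space H \<alpha>" by blast
    have aR: "\<alpha> \<in> R" using a by (simp add: pos_roots_iff)
    have "exp_word xs0 y \<in> root_space H (- (- w0 \<alpha>))"
      using word_aut_root_space[OF ws(1) root_dual[OF aR] a(2)] ws(2) by (simp add: exp_word_xs0)
    then show "exp_word xs0 y \<in> cvs.span (\<Union>\<alpha>\<in>pos_roots H \<Delta>. root_space H (- \<alpha>))"
      using w0_pos[OF a(1)] by (intro cvs.span_base UN_I)
  qed
  show "exp_word (inv_word xs0) ` nilradical_minus H \<Delta> \<subseteq> nilradical_plus H \<Delta>"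
    unfolding nilradical_plus_def nilradical_minus_def
  proof (rule lie_aut_span[OF exp_word_lie_aut[OF xs0(2)]])
    fix y assume "y \<in> (\<Union>\<alpha>\<in>pos_roots H \<Delta>. root_space H (- \<alpha>))"
    then obtain \<beta> where b: "\<beta> \<in> pos_roots H \<Delta>" "y \<in> root_space H (- \<beta>)" by blast
    have "\<beta> \<in> (\<lambda>\<beta>. - w0 \<beta>) ` pos_roots H \<Delta>" using b(1) w0_pos_image by simp
    then obtain \<alpha> where a: "\<alpha> \<in> pos_roots H \<Delta>" "- \<beta> = w0 \<alpha>" by auto
    have aR: "\<alpha> \<in> R" using a by (simp add: pos_roots_iff)
    obtain c where c: "y = c *\<^sub>C X (w0 \<alpha>)" using root_space_multiple[of y "w0 \<alpha>"] b(2) a(2) w0_root[OF aR] by auto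
    obtain s where "exp_word (inv_word xs0) (X (w0 \<alpha>)) = s *\<^sub>C X \<alpha>" using xs0_X(2)[OF aR] by blast
    then have "exp_word (inv_word xs0) y = c *\<^sub>C s *\<^sub>C X \<alpha>"
      by (simp add: c lie_autD(2)[OF exp_word_lie_aut[OF xs0(2)]])
    also have "\<dots> \<in> cvs.span (\<Union>\<alpha>\<in>pos_roots H \<Delta>. root_space H \<alpha>)"
      using a(1) X_root_space[OF aR] by (intro cvs.span_scale cvs.span_base UN_I)
    finally show "exp_word (inv_word xs0) y \<in> cvs.span (\<Union>\<alpha>\<in>pos_roots H \<Delta>. root_space H \<alpha>)" .
  qed
qed

context
  fixes \<mu> :: "'g \<Rightarrow> complex" and l :: nat
  assumes mu: "\<mu> \<in> dominant_weights H \<Delta> X"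
begin

lemma mu_dual: "\<mu> \<in> dual_space H"
  and mu_simple: "\<delta> \<in> \<Delta> \<Longrightarrow> \<mu> (hh \<delta>) \<in> \<int>"
  using mu by (auto simp: dominant_weights_def intro: subsetD[OF Nats_subset_Ints])

text \<open>The weight and the coroot are moved by the same word, so their pairing is unchanged; the
  sign comes from the coroot of the negative root.\<close>

lemma w0_mu_hh:
  assumes "\<beta> \<in> R"
  shows "w0 \<mu> (hh (- w0 \<beta>)) = - \<mu> (hh \<beta>)"
proof -
  have "w0 \<mu> (hh (w0 \<beta>)) = rp ws \<mu> (word_aut ws (hh \<beta>))"
    using word_aut_hh[OF ws(1) assms] ws(2) by simp
  also have "\<dots> = \<mu> (hh \<beta>)" by (rule rp_apply[OF ws(1) mu_dual hh_in_H[OF assms]])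
  finally show ?thesis
    using dual_uminus[of "w0 \<mu>" "hh (w0 \<beta>)"] rp_dual[OF ws(1) mu_dual] ws(2) hh_in_H[OF w0_root[OF assms]]
    by (simp add: hh_uminus)
qed

text \<open>Pairings agree up to sign by \<open>w0_mu_hh\<close>, and -w0 preserves root lengths.
  \<open>to_int\<close> rounds down and so respects the sign only on integers, whence the appeal to
  \<open>hh_int\<close>.\<close>

lemma w0_bound:
  assumes a: "\<alpha> \<in> pos_roots H \<Delta>"
  shows "- to_int (w0 \<mu> (hh (- w0 \<alpha>))) - int s * int l * r_check H \<Delta> X (- w0 \<alpha>) =
    to_int (\<mu> (hh \<alpha>)) - int s * int l * r_check H \<Delta> X \<alpha>"
proof -
  have aR: "\<alpha> \<in> R" using a by (simp add: pos_roots_iff)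
  obtain n where n: "\<mu> (hh \<alpha>) = of_int n" using hh_int[OF mu_dual mu_simple a] by (rule Ints_cases)
  have "w0 \<mu> (hh (- w0 \<alpha>)) = of_int (- n)" using w0_mu_hh[OF aR] n by simp
  then have "to_int (w0 \<mu> (hh (- w0 \<alpha>))) = - n" by (simp only: to_int_of_int)
  then show ?thesis by (simp add: n r_check_w0[OF aR])
qed

abbreviation "powers \<equiv> {root_power H X (- \<alpha>) s k | \<alpha> s k. \<alpha> \<in> pos_roots H \<Delta> \<and>
  int k > max 0 (to_int (\<mu> (hh \<alpha>)) - int s * int l * r_check H \<Delta> X \<alpha>)}"

abbreviation "powers_minus \<equiv> {root_power H X \<alpha> s k | \<alpha> s k. \<alpha> \<in> pos_roots H \<Delta> \<and>
  int k > max 0 (- to_int (w0 \<mu> (hh \<alpha>)) - int s * int l * r_check H \<Delta> X \<alpha>)}"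

abbreviation "gens \<equiv> tensor_incl BB ` augmentation_ideal H X (current (nilradical_plus H \<Delta>)) \<union>
  tensor_incl BB ` augmentation_ideal H X (current_pos H) \<union> weight_relations H \<Delta> X \<mu> \<union> powers"

abbreviation "gens_minus \<equiv> weight_relations H \<Delta> X (w0 \<mu>) \<union>
  tensor_incl BB ` augmentation_ideal H X (current_pos H) \<union>
  tensor_incl BB ` augmentation_ideal H X (current (nilradical_minus H \<Delta>)) \<union> powers_minus"

lemma demazure_ideal_eq: "demazure_ideal H \<Delta> X l \<mu> = left_ideal_gen (tensor_ring BB) gens"
  by (simp only: demazure_ideal_def Let_def hyperalgebra_def)

lemma demazure_ideal_minus_eq: "demazure_ideal_minus H \<Delta> X w0 l \<mu> = left_ideal_gen (tensor_ring BB) gens_minus"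
  by (simp only: demazure_ideal_minus_def Let_def hyperalgebra_def)

lemma current_subset: "current S \<subseteq> current UNIV" "current_pos S \<subseteq> current UNIV"
  by (auto simp: current_def current_pos_def)

lemma gens_carrier:
  "(gens :: ('f::field, 'g) hyp set) \<subseteq> carrier (tensor_ring BB)"
  "(gens_minus :: ('f::field, 'g) hyp set) \<subseteq> carrier (tensor_ring BB)"
proof -
  have "(powers :: ('f, 'g) hyp set) \<subseteq> carrier (tensor_ring BB)" "(powers_minus :: ('f, 'g) hyp set) \<subseteq> carrier (tensor_ring BB)"
    using root_power_carrier(2) uminus_root by (auto simp: pos_roots_iff)
  then show "(gens :: ('f, 'g) hyp set) \<subseteq> carrier (tensor_ring BB)" "(gens_minus :: ('f, 'g) hyp set) \<subseteq> carrier (tensor_ring BB)"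
    by - (intro Un_least augmentation_carrier[OF current_subset(1)] augmentation_carrier[OF current_subset(2)]
        weight_relations_carrier; assumption)+
qed

lemma tmap_gens:
  fixes z :: "('f::field, 'g) hyp"
  assumes z: "z \<in> gens" and J: "left_ideal J (tensor_ring BB)" "gens_minus \<subseteq> J"
  shows "tmap BB (uea_word xs0) z \<in> J"
proof -
  note s = current_subset
  have c1: "tmap BB (uea_word xs0) z \<in> J"
    if "z \<in> tensor_incl BB ` augmentation_ideal H X (current (nilradical_plus H \<Delta>))"
    using augmentation_twist[OF xs0(1) s(1) s(1) uea_word_int_form_sub(1)[OF xs0(1) xs0_nilradical(1)] that] J(2) by blast
  have c2: "tmap BB (uea_word xs0) z \<in> J"
    if "z \<in> tensor_incl BB ` augmentation_ideal H X (current_pos H)"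
    using augmentation_twist[OF xs0(1) s(2) s(2) uea_word_int_form_sub(2)[OF xs0(1) xs0_H(1)] that] J(2) by blast
  have c3: "tmap BB (uea_word xs0) z \<in> J" if "z \<in> weight_relations H \<Delta> X \<mu>"
  proof -
    have "tmap BB (uea_word xs0) z \<in> weight_relations H \<Delta> X (w0 \<mu>)"
    proof (rule weight_relations_twist[OF xs0(1) xs0_H _ that])
      fix i assume "i \<in> \<Delta>"
      \<comment> \<open>As -w0 permutes the simple roots, the coroot of i is minus the image of the
        coroot of j.\<close>
      then obtain j where j: "j \<in> \<Delta>" "i = - w0 j" using w0_simple_image by blast
      have jR: "j \<in> R" by (rule simple_root[OF j(1)])
      have "hh i = - word_aut ws (hh j)" using word_aut_hh[OF ws(1) jR] ws(2) by (simp add: j(2) hh_uminus)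
      then have "exp_word (inv_word xs0) (hh i) = - hh j"
        by (simp add: lie_autD(5)[OF exp_word_lie_aut[OF xs0(2)]] inverse_xs0)
      then show "\<exists>j\<in>\<Delta>. exp_word (inv_word xs0) (hh i) = - hh j \<and> w0 \<mu> (hh i) = - \<mu> (hh j) \<and> \<mu> (hh j) \<in> \<int>"
        using w0_mu_hh[OF jR] mu_simple[OF j(1)] j by blast
    qed
    then show ?thesis using J(2) by blast
  qed
  have c4: "tmap BB (uea_word xs0) z \<in> J" if "z \<in> powers"
  proof -
    from that obtain \<alpha> s k where a: "z = root_power H X (- \<alpha>) s k" "\<alpha> \<in> pos_roots H \<Delta>"
      "int k > max 0 (to_int (\<mu> (hh \<alpha>)) - int s * int l * r_check H \<Delta> X \<alpha>)" by blast
    have aR: "\<alpha> \<in> R" using a by (simp add: pos_roots_iff)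
    have "int k > max 0 (- to_int (w0 \<mu> (hh (- w0 \<alpha>))) - int s * int l * r_check H \<Delta> X (- w0 \<alpha>))"
      using a(3) unfolding w0_bound[OF a(2)] .
    then have mem: "root_power H X (- w0 \<alpha>) s k \<in> J" using w0_pos[OF a(2)] J(2) by blast
    obtain c where "c \<in> {1, -1}" "exp_word xs0 (X (- \<alpha>)) = c *\<^sub>C X (- w0 \<alpha>)"
      using xs0_X(1)[OF uminus_root[OF aR]] unfolding w0_uminus by blast
    from root_power_twist[OF xs0(1) J(1) uminus_root[OF w0_root[OF aR]] this mem] show ?thesis unfolding a(1) .
  qed
  show ?thesis using z by (elim UnE) (erule c1 c2 c3 c4)+
qed

lemma tmap_gens_minus:
  fixes z :: "('f::field, 'g) hyp"
  assumes z: "z \<in> gens_minus" and J: "left_ideal J (tensor_ring BB)" "gens \<subseteq> J"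
  shows "tmap BB (uea_word (inv_word xs0)) z \<in> J"
proof -
  note s = current_subset
  have c1: "tmap BB (uea_word (inv_word xs0)) z \<in> J"
    if "z \<in> tensor_incl BB ` augmentation_ideal H X (current (nilradical_minus H \<Delta>))"
    using augmentation_twist[OF xs0(2) s(1) s(1) uea_word_int_form_sub(1)[OF xs0(2) xs0_nilradical(2)] that] J(2) by blast
  have c2: "tmap BB (uea_word (inv_word xs0)) z \<in> J"
    if "z \<in> tensor_incl BB ` augmentation_ideal H X (current_pos H)"
    using augmentation_twist[OF xs0(2) s(2) s(2) uea_word_int_form_sub(2)[OF xs0(2) xs0_H(2)] that] J(2) by blast
  have c3: "tmap BB (uea_word (inv_word xs0)) z \<in> J" if "z \<in> weight_relations H \<Delta> X (w0 \<mu>)"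
  proof -
    have "tmap BB (uea_word (inv_word xs0)) z \<in> weight_relations H \<Delta> X \<mu>"
    proof (rule weight_relations_twist[OF xs0(2) xs0_H(2) _ _ that], unfold inv_word_inv_word, rule xs0_H(1))
      fix i assume i: "i \<in> \<Delta>"
      have iR: "i \<in> R" by (rule simple_root[OF i])
      have j: "- w0 i \<in> \<Delta>" using i w0_simple_image by blast
      have "exp_word xs0 (hh i) = - hh (- w0 i)"
        using word_aut_hh[OF ws(1) iR] ws(2) by (simp add: exp_word_xs0 hh_uminus)
      moreover have "\<mu> (hh i) = - w0 \<mu> (hh (- w0 i))" "w0 \<mu> (hh (- w0 i)) \<in> \<int>"
        using w0_mu_hh[OF iR] mu_simple[OF i] by simp_all
      ultimately show "\<exists>j\<in>\<Delta>. exp_word xs0 (hh i) = - hh j \<and> \<mu> (hh i) = - w0 \<mu> (hh j) \<and> w0 \<mu> (hh j) \<in> \<int>"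
        using j by blast
    qed
    then show ?thesis using J(2) by blast
  qed
  have c4: "tmap BB (uea_word (inv_word xs0)) z \<in> J" if "z \<in> powers_minus"
  proof -
    from that obtain \<beta> s k where b: "z = root_power H X \<beta> s k" "\<beta> \<in> pos_roots H \<Delta>"
      "int k > max 0 (- to_int (w0 \<mu> (hh \<beta>)) - int s * int l * r_check H \<Delta> X \<beta>)" by blast
    have "\<beta> \<in> (\<lambda>\<beta>. - w0 \<beta>) ` pos_roots H \<Delta>" using b(2) w0_pos_image by simp
    then obtain \<alpha> where a: "\<alpha> \<in> pos_roots H \<Delta>" "\<beta> = - w0 \<alpha>" by blast
    have aR: "\<alpha> \<in> R" using a by (simp add: pos_roots_iff)
    have "int k > max 0 (to_int (\<mu> (hh \<alpha>)) - int s * int l * r_check H \<Delta> X \<alpha>)"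
      using b(3) unfolding a(2) w0_bound[OF a(1)] .
    then have mem: "root_power H X (- \<alpha>) s k \<in> J" using a(1) J(2) by blast
    obtain c where "c \<in> {1, -1}" "exp_word (inv_word xs0) (X (- w0 \<alpha>)) = c *\<^sub>C X (- \<alpha>)"
      using xs0_X(2)[OF uminus_root[OF aR]] unfolding w0_uminus by blast
    from root_power_twist[OF xs0(2) J(1) uminus_root[OF aR] this mem] show ?thesis unfolding b(1) a(2) .
  qed
  show ?thesis using z by (elim UnE) (erule c1 c2 c3 c4)+
qed

text \<open>Both inclusions reduce to generators: the twist maps those of one ideal into the other
  ideal, and the inverse twist maps those of the other back.\<close>

lemma tmap_demazure_ideal:
  "tmap BB (uea_word xs0) ` (demazure_ideal H \<Delta> X l \<mu> :: ('f::field, 'g) hyp set) = demazure_ideal_minus H \<Delta> X w0 l \<mu>"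
proof -
  interpret e: scalar_extension_aut BB "TYPE('f)" "uea_word xs0" "uea_word (inv_word xs0)"
    using scalar_extension_aut_BB[OF xs0(1)] by (simp add: scalar_extension_aut_def scalar_extension_def)
  interpret i: scalar_extension_aut BB "TYPE('f)" "uea_word (inv_word xs0)" "uea_word xs0" by (rule e.inverse)
  let ?I = "left_ideal_gen e.R gens" and ?J = "left_ideal_gen e.R gens_minus"
  have I: "left_ideal ?I e.R" and J: "left_ideal ?J e.R"
    by (intro e.left_ideal_gen gens_carrier)+
  have "tmap BB (uea_word xs0) z \<in> ?J" if "z \<in> ?I" for z
    by (rule e.tmap_left_ideal_gen[OF gens_carrier(1) J tmap_gens[OF _ J e.left_ideal_gen_subset] that])
  moreover have "z \<in> tmap BB (uea_word xs0) ` ?I" if z: "z \<in> ?J" for z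
  proof -
    have zR: "z \<in> carrier e.R" using e.left_idealD(3)[OF J] z by blast
    have "tmap BB (uea_word (inv_word xs0)) z \<in> ?I"
      by (rule i.tmap_left_ideal_gen[OF gens_carrier(2) I tmap_gens_minus[OF _ I e.left_ideal_gen_subset] z])
    then show ?thesis by (subst i.tmap_inverse[OF zR, symmetric]) (rule imageI)
  qed
  ultimately show ?thesis unfolding demazure_ideal_eq demazure_ideal_minus_eq by blast
qed

text \<open>For a simple root the divided powers from 1 on have counit zero, so they lie in the
  augmentation ideal of the positive part. For the negative of \<delta> the relations with s = 0
  give all k > \<mu> (hh \<delta>). Every letter of the word is such a root vector up to
  sign.\<close>

lemma demazure_ideal_nilpotent:
  assumes x: "x \<in> elementary"
  shows "exp_step.locally_nilpotent_mod BB (up x) (demazure_ideal H \<Delta> X l \<mu> :: ('f::field, 'g) hyp set)"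
proof -
  interpret e: scalar_extension BB "TYPE('f)" by unfold_locales (rule subring_set_int_form)
  let ?I = "demazure_ideal H \<Delta> X l \<mu> :: ('f, 'g) hyp set"
  have I: "left_ideal ?I e.R" unfolding demazure_ideal_eq by (intro e.left_ideal_gen gens_carrier)
  have gens: "gens \<subseteq> ?I" unfolding demazure_ideal_eq by (rule e.left_ideal_gen_subset)
  obtain \<gamma> where g: "\<gamma> \<in> signed_simple" "x = X \<gamma> \<or> x = - X \<gamma>" using x unfolding elementary_def by blast
  have gR: "\<gamma> \<in> R" by (rule signed_simple_root[OF g(1)])
  let ?p = "\<lambda>y k. divided_power (uea_gen (up y)) k"
  have "\<exists>N. \<forall>k\<ge>N. e.t 1 (?p (X \<gamma>) k) \<in> ?I"
  proof (cases "\<gamma> \<in> \<Delta>")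
    case True
    have "e.t 1 (?p (X \<gamma>) k) \<in> ?I" if k: "k \<ge> 1" for k
    proof -
      have "X \<gamma> \<in> nilradical_plus H \<Delta>"
        unfolding nilradical_plus_def by (rule cvs.span_base) (use simple_pos[OF True] X_root_space[OF gR] in blast)
      then have "up (X \<gamma>) \<in> current (nilradical_plus H \<Delta>)"
        by (auto simp: current_def lookup_single when_def nilradical_plus_def intro: cvs.span_zero)
      then have "?p (X \<gamma>) k \<in> int_form_sub H X (current (nilradical_plus H \<Delta>))"
        unfolding int_form_sub_def by (intro IntI int_form.gen gR uea_sub_divided_power uea_sub.gen)
      then have "Poly_Mapping.single (1 :: 'f, ?p (X \<gamma>) k) 1 \<in> formals (int_form_sub H X (current (nilradical_plus H \<Delta>)))"
        by (rule formals_closed(5))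
      moreover have "formal_counit (Poly_Mapping.single (1 :: 'f, ?p (X \<gamma>) k) 1) = 0"
        using k by (simp add: formal_counit_single counit_divided_power to_int_def)
      ultimately have "e.t 1 (?p (X \<gamma>) k) \<in> tensor_incl BB ` augmentation_ideal H X (current (nilradical_plus H \<Delta>))"
        unfolding augmentation_image[OF current_subset(1)] tensor_def by blast
      then show ?thesis using gens by blast
    qed
    then show ?thesis by blast
  next
    case False
    then obtain \<delta> where d: "\<delta> \<in> \<Delta>" "\<gamma> = - \<delta>" using g(1) by blast
    \<comment> \<open>\<open>Suc\<close> because the relations require k strictly above the
      bound.\<close>
    let ?N = "Suc (nat (max 0 (to_int (\<mu> (hh \<delta>)))))"
    have "e.t 1 (?p (X \<gamma>) k) \<in> ?I" if k: "k \<ge> ?N" for k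
    proof -
      have "int k > max 0 (to_int (\<mu> (hh \<delta>)) - int 0 * int l * r_check H \<Delta> X \<delta>)" using k by auto
      then have "root_power H X (- \<delta>) 0 k \<in> ?I" using simple_pos[OF d(1)] gens by blast
      then show ?thesis by (simp add: root_power_def d(2))
    qed
    then show ?thesis by blast
  qed
  then obtain N where N: "\<And>k. k \<ge> N \<Longrightarrow> e.t 1 (?p (X \<gamma>) k) \<in> ?I" by blast
  have "e.t 1 (?p x k) \<in> ?I" if k: "k \<ge> N" for k
    using g(2)
  proof
    assume "x = - X \<gamma>"
    then have "?p x k = (-1) ^ k * ?p (X \<gamma>) k"
      by (simp add: single_uminus uea_gen_uminus divided_power_uminus)
    moreover have n: "(-1) ^ k \<in> BB"
      by (induction k) (auto simp: subring_setD[OF subring_set_int_form])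
    moreover have "e.t 1 ((-1) ^ k) \<otimes>\<^bsub>e.R\<^esub> e.t 1 (?p (X \<gamma>) k) \<in> ?I"
      by (rule e.left_idealD(2)[OF I e.t_closed[OF n] N[OF k]])
    moreover have "?p (X \<gamma>) k \<in> BB" using root_power_carrier(1)[OF gR, of 0 k] by simp
    ultimately show ?thesis by (simp add: e.t_mult)
  qed (use N k in simp)
  then show ?thesis
    unfolding exp_step.locally_nilpotent_mod_def[OF exp_step_elementary[OF x]] by blast
qed

lemma demazure_isomorphic:
  "lmodule_isomorphic (hyperalgebra H X (current UNIV) :: ('f::field, 'g) hyp ring)
     (demazure_module H \<Delta> X l \<mu>)
     (quotient_lmodule (hyperalgebra H X (current UNIV)) (demazure_ideal_minus H \<Delta> X w0 l \<mu>))"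
proof -
  interpret e: scalar_extension BB "TYPE('f)" by unfold_locales (rule subring_set_int_form)
  have "left_ideal (demazure_ideal H \<Delta> X l \<mu>) e.R"
    unfolding demazure_ideal_eq by (intro e.left_ideal_gen gens_carrier)
  from word_twist[OF xs0(1) this demazure_ideal_nilpotent] show ?thesis
    unfolding demazure_module_def hyperalgebra_def tmap_demazure_ideal by blast
qed

end

end

theorem corollary3p5p6:
  fixes H :: "'g::complex_lie_algebra set"
    and \<Delta> :: "('g \<Rightarrow> complex) set"
    and X :: "('g \<Rightarrow> complex) \<Rightarrow> 'g"
    and w0 :: "('g \<Rightarrow> complex) \<Rightarrow> ('g \<Rightarrow> complex)"
    and l :: nat
    and \<mu> :: "'g \<Rightarrow> complex"
  assumes "finite_dimensional_lie TYPE('g)"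
    and "simple_lie TYPE('g)"
    and "cartan_subalgebra H"
    and "simple_roots H \<Delta>"
    and "chevalley_basis H \<Delta> X"
    and "longest_element \<Delta> X w0"
    and "\<mu> \<in> dominant_weights H \<Delta> X"
    and "type_G2 \<Delta> X \<Longrightarrow> CHAR('f::alg_closed_field) = 0 \<or> CHAR('f) \<ge> 5"
  shows "lmodule_isomorphic (hyperalgebra H X (current UNIV) :: ('f, 'g) hyp ring)
           (demazure_module H \<Delta> X l \<mu>)
           (quotient_lmodule (hyperalgebra H X (current UNIV)) (demazure_ideal_minus H \<Delta> X w0 l \<mu>))"
proof -
  interpret chevalley H \<Delta> X
    using assms(1-5) by unfold_locales
  obtain ws where "set ws \<subseteq> \<Delta>" "reflection_product X ws = w0" "\<And>\<gamma>. \<gamma> \<in> \<Delta> \<Longrightarrow> w0 \<gamma> \<notin> pos_roots H \<Delta>"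
    using longest_element_word[OF assms(6)] by metis
  then interpret chevalley_longest H \<Delta> X w0 ws
    by unfold_locales
  show ?thesis
    by (rule demazure_isomorphic[OF assms(7)])
qed

end
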